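(* For all $d\in\mathbb N$ and $\ell\in\{0,\ldots,d\}$ such that $d-\ell$ is even, $$ \mathbb E f_\ell(\mathcal Z_d)=\pi^{d-\ell}\binom d\ell[x^{d-\ell}]\Big(\frac{x}{\sin x}\Big)^{d+1}, $$ where $[x^m]g$ is the coefficient of $x^m$ in the Taylor expansion of $g$ at $0$.
   Context: Consider a Poisson process on the space of affine hyperplanes in $\mathbb R^d$ whose intensity measure is a positive multiple of the (up to constants unique) measure on affine hyperplanes invariant under rotations and translations. Its hyperplanes dissect $\mathbb R^d$ into polytopes (the homogeneous and isotropic Poisson hyperplane tessellation); $\mathcal Z_d$ denotes the almost surely unique cell containing the origin (the Poisson zero cell). $f_\ell(P)$ is the number of $\ell$-dimensional faces of a polytope $P$, with $f_d(P)=1$. *)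

theory Defs
  imports "HOL-Analysis.Analysis" "HOL-Probability.Probability"
    "HOL-Computational_Algebra.Formal_Power_Series"
begin

text \<open>Parametrisation of hyperplanes: a point x \<noteq> 0 of the euclidean space
  encodes the hyperplane {y. y \<bullet> x = x \<bullet> x}, i.e. the hyperplane with unit
  normal u = x / norm x at distance t = norm x from the origin. Every hyperplane
  not through the origin has exactly one such code.\<close>

definition hyp :: "'a::euclidean_space \<Rightarrow> 'a set" where
  "hyp x = {y. y \<bullet> x = x \<bullet> x}"

definition halfspace0 :: "'a::euclidean_space \<Rightarrow> 'a set" where
  "halfspace0 x = {y. y \<bullet> x \<le> x \<bullet> x}"

text \<open>The motion-invariant measure on hyperplanes, dt d\<sigma>(u), transported to codes
  (polar coordinates x = t u), times the intensity gamma: density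
  gamma * norm x powr (1 - d) with respect to Lebesgue measure.\<close>

definition hyp_intensity :: "real \<Rightarrow> 'a::euclidean_space measure" where
  "hyp_intensity \<gamma> =
     density lborel (\<lambda>x::'a. ennreal (\<gamma> * norm x powr (1 - real DIM('a))))"

definition poisson_process :: "'w measure \<Rightarrow> ('w \<Rightarrow> 'a::euclidean_space set) \<Rightarrow> 'a measure \<Rightarrow> bool" where
  "poisson_process M \<Phi> L \<longleftrightarrow>
     prob_space M \<and>
     (\<forall>\<omega>\<in>space M. \<forall>R. finite (\<Phi> \<omega> \<inter> cball 0 R)) \<and>
     (\<forall>B. B \<in> sets borel \<and> bounded B \<longrightarrow>
        (\<lambda>\<omega>. card (\<Phi> \<omega> \<inter> B)) \<in> measurable M (count_space UNIV) \<and>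
        (\<forall>k::nat. measure M {\<omega>\<in>space M. card (\<Phi> \<omega> \<inter> B) = k}
                  = measure L B ^ k / fact k * exp (- measure L B))) \<and>
     (\<forall>(I::nat set) B. finite I \<and> disjoint_family_on B I \<and>
        (\<forall>i\<in>I. B i \<in> sets borel \<and> bounded (B i)) \<longrightarrow>
        prob_space.indep_vars M (\<lambda>_. count_space UNIV) (\<lambda>i \<omega>. card (\<Phi> \<omega> \<inter> B i)) I)"

definition zero_cell :: "'a::euclidean_space set \<Rightarrow> 'a set" where
  "zero_cell S = (\<Inter>x\<in>S. halfspace0 x)"

definition num_faces :: "nat \<Rightarrow> 'a::euclidean_space set \<Rightarrow> nat" where
  "num_faces l P = card {F. F face_of P \<and> aff_dim F = int l}"

end

theory Submission imports Defs "HOL-Complex_Analysis.Complex_Analysis" "HOL-Real_Asymp.Real_Asymp"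
begin

text \<open>Almost surely the zero cell Z is a simple polytope, and a generic linear functional u attains
  its maximum over every face of Z at a unique vertex. A vertex is the intersection of d hyperplanes
  of the process; it is the highest point of the face obtained by dropping l of them iff u has positive
  coordinates with respect to those l normals. Hence \<open>l! (d - l)! f\<^sub>l(Z)\<close> counts the ordered d-tuples of
  hyperplanes whose intersection point v is not separated from the origin by the process and for which
  l given coordinates of u are positive. By Mecke's formula its expectation is an integral over d-tuples
  of hyperplanes with weight \<open>exp (- \<kappa> |v|)\<close>, the probability that nothing separates v from the origin.

  Normals and u may be taken Gaussian. After u and the normals are integrated out, the sign conditions
  decouple, and up to a factor that does not depend on l there remains
  \<open>\<pi> ^ (d - l)\<close> times the integral of \<open>(\<pi>/2 + \<i> arsinh s) ^ l / sqrt (1 + s\<^sup>2) ^ (d + 2)\<close> over the real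
  line. With \<open>s = sinh t\<close> this is the integral of \<open>z ^ l / sin z ^ (d + 1)\<close> along \<open>Re z = \<pi>/2\<close>. For even
  \<open>d - l\<close> the integrand is odd, so the integral is half of a closed contour integral around the pole at 0
  and equals \<open>\<pi>\<close> times the coefficient of \<open>x ^ (d - l)\<close> in \<open>(x / sin x) ^ (d + 1)\<close>. The unknown factor
  drops out by comparison with l = d, where Z is the only face.\<close>

section \<open>Lebesgue measure on vectors and matrices\<close>

text \<open>The obstacle is the dependence between the sign conditions: they concern the coordinates
  of u in a random basis. With \<open>u = G m\<close> they become \<open>m $ i * a $ i > 0\<close>,
  where a holds the offsets, and so they see only the directions of m and a. Radial profiles can
  therefore be exchanged for Gaussian ones at the price of a factor that does not involve the set of
  imposed signs. The remaining coupling is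
  \<open>exp (- (m \<bullet> a)\<^sup>2 / (2 * r\<^sup>2))\<close>. Mixed over r it becomes a
  multiple of \<open>exp (- \<bar>m \<bullet> a\<bar>)\<close>, up to a constant the Fourier
  transform of \<open>1 / (1 + s\<^sup>2)\<close>, and for fixed s the phase of
  \<open>s * (m \<bullet> a)\<close> is a product over the coordinates. A coordinate with imposed
  sign contributes \<open>\<pi>/2 + \<i> arsinh s\<close>, a free one \<open>\<pi>\<close>, each
  times \<open>2 / sqrt (1 + s\<^sup>2)\<close>. This is the origin of
  \<open>\<pi> ^ (d - l)\<close>; the exponent d + 2 counts d such roots and the Fourier weight. On
  the probabilistic side only the counts in bounded Borel sets and their independence are given, so
  Mecke's formula has to be built up from products of disjoint sets.\<close>

text \<open>Such a map only relabels coordinates, so boxes go to boxes with the same side lengths.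
  It serves to turn vectors of pairs into pairs of vectors and to pass from an arbitrary Euclidean
  space to \<open>real^'n\<close>.\<close>

lemma lborel_distr_basis_bij:
  fixes T :: "'b::euclidean_space \<Rightarrow> 'c::euclidean_space"
  assumes lin: "linear T" and bij: "bij_betw T Basis Basis"
  shows "distr lborel borel T = lborel"
proof (rule lborel_eqI[symmetric])
  have T_expand: "T x = (\<Sum>b\<in>Basis. (x \<bullet> b) *\<^sub>R T b)" for x
    by (subst euclidean_representation[of x, symmetric])
       (simp add: linear_sum[OF lin] linear_scale[OF lin])
  have inner: "T x \<bullet> T b = x \<bullet> b" if "b \<in> Basis" for x b
  proof -
    have "T x \<bullet> T b = (\<Sum>c\<in>Basis. (x \<bullet> c) * (T c \<bullet> T b))"
      by (subst T_expand) (simp add: inner_sum_left)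
    also have "\<dots> = (\<Sum>c\<in>Basis. if c = b then x \<bullet> c else 0)"
    proof (intro sum.cong refl)
      fix c :: 'b assume "c \<in> Basis"
      moreover have "T c \<in> Basis" "T b \<in> Basis" "T c = T b \<longleftrightarrow> c = b"
        using bij that \<open>c \<in> Basis\<close> by (auto simp: bij_betw_def inj_on_eq_iff)
      ultimately show "(x \<bullet> c) * (T c \<bullet> T b) = (if c = b then x \<bullet> c else 0)"
        by (simp add: inner_Basis)
    qed
    finally show ?thesis using that by simp
  qed
  have T_meas [measurable]: "T \<in> borel_measurable borel"
    by (intro borel_measurable_continuous_onI linear_continuous_on)
       (use lin linear_conv_bounded_linear in blast)
  fix l u :: 'c
  assume le: "\<And>b. b \<in> Basis \<Longrightarrow> l \<bullet> b \<le> u \<bullet> b"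
  \<comment> \<open>\<open>S\<close> is the adjoint of \<open>T\<close>, hence its inverse; it
    carries the corners of the box back.\<close>
  define S where "S c = (\<Sum>b\<in>Basis. (c \<bullet> T b) *\<^sub>R b)" for c
  have S: "S c \<bullet> b = c \<bullet> T b" if "b \<in> Basis" for c b
    using that by (simp add: S_def inner_sum_left inner_Basis if_distrib cong: if_cong)
  have TB: "T b \<in> Basis" if "b \<in> Basis" for b using bij that by (auto simp: bij_betw_def)
  have "T -` box l u = box (S l) (S u)"
  proof -
    have "T x \<in> box l u \<longleftrightarrow> (\<forall>b\<in>Basis. l \<bullet> T b < T x \<bullet> T b \<and> T x \<bullet> T b < u \<bullet> T b)" for x
      using bij unfolding mem_box bij_betw_def by (metis imageE imageI)
    then show ?thesis by (auto simp: mem_box inner S)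
  qed
  then have "emeasure (distr lborel borel T) (box l u) = emeasure lborel (box (S l) (S u))"
    by (subst emeasure_distr) auto
  also have "\<dots> = (\<Prod>b\<in>Basis. (S u - S l) \<bullet> b)"
    using le TB by (subst emeasure_lborel_box) (auto simp: S)
  also have "(\<Prod>b\<in>Basis. (S u - S l) \<bullet> b) = (\<Prod>b\<in>Basis. (u - l) \<bullet> T b)"
    by (intro prod.cong) (auto simp: inner_diff_left S)
  also have "\<dots> = (\<Prod>b\<in>Basis. (u - l) \<bullet> b)"
    by (rule prod.reindex_bij_betw[OF bij])
  finally show "emeasure (distr lborel borel T) (box l u) = (\<Prod>b\<in>Basis. (u - l) \<bullet> b)" .
qed simp

lemma measurable_vec_lambda [measurable]:
  assumes "\<And>i. (\<lambda>x. f x i) \<in> borel_measurable M"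
  shows "(\<lambda>x. (\<chi> i. f x i) :: 'b::euclidean_space^'n) \<in> borel_measurable M"
proof (subst borel_measurable_euclidean_space, intro ballI)
  fix v :: "'b^'n" assume "v \<in> Basis"
  then obtain i b where "v = axis i b" by (auto simp: Basis_vec_def)
  then show "(\<lambda>x. (\<chi> i. f x i) \<bullet> v) \<in> borel_measurable M"
    using assms[of i] by (simp add: inner_axis)
qed

lemma measurable_vec_nth' [measurable (raw)]:
  fixes f :: "'a \<Rightarrow> 'b::euclidean_space^'n"
  assumes "f \<in> borel_measurable M"
  shows "(\<lambda>x. f x $ i) \<in> borel_measurable M"
  by (rule borel_measurable_continuous_on[OF _ assms]) (intro continuous_intros)

lemma mem_box_vec:
  fixes x :: "'b::euclidean_space^'n"
  shows "x \<in> box l u \<longleftrightarrow> (\<forall>i. x $ i \<in> box (l $ i) (u $ i))"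
  by (auto simp: mem_box Basis_vec_def inner_axis)

lemma prod_Basis_vec:
  fixes x :: "'b::euclidean_space^'n"
  shows "(\<Prod>b\<in>Basis. x \<bullet> b) = (\<Prod>i\<in>UNIV. \<Prod>b\<in>Basis. x $ i \<bullet> b)"
proof -
  have "(Basis :: ('b^'n) set) = (\<lambda>(i, b). axis i b) ` (UNIV \<times> Basis)"
    by (auto simp: Basis_vec_def)
  moreover have "inj_on (\<lambda>(i, b). axis i b :: 'b^'n) (UNIV \<times> Basis)"
    by (auto simp: inj_on_def axis_eq_axis)
  ultimately have "(\<Prod>b\<in>Basis. x \<bullet> b) = (\<Prod>(i, b)\<in>UNIV \<times> Basis. x \<bullet> axis i b)"
    by (subst prod.reindex_cong[where l = "\<lambda>(i, b). axis i b"]) auto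
  then show ?thesis by (simp add: prod.cartesian_product inner_axis)
qed

text \<open>The bridge from vectors to product measures: through it, integrals of products over the
  components of a vector factorise.\<close>

lemma lborel_vec_eq_PiM:
  "(lborel :: ('b::euclidean_space^'n) measure) =
     distr (PiM UNIV (\<lambda>_. lborel)) borel (\<lambda>f. \<chi> i. f i)"
proof (rule lborel_eqI)
  interpret product_sigma_finite "\<lambda>_::'n. lborel :: 'b measure" by standard
  fix l u :: "'b^'n"
  assume le: "\<And>b. b \<in> Basis \<Longrightarrow> l \<bullet> b \<le> u \<bullet> b"
  have le': "l $ i \<bullet> b \<le> u $ i \<bullet> b" if "b \<in> Basis" for i b
    using le[of "axis i b"] that by (auto simp: inner_axis Basis_vec_def)
  have "(\<lambda>f. \<chi> i. f i) -` box l u \<inter> space (PiM UNIV (\<lambda>_::'n. lborel :: 'b measure))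
      = Pi\<^sub>E UNIV (\<lambda>i. box (l $ i) (u $ i))"
    by (simp add: set_eq_iff mem_box_vec space_PiM PiE_UNIV_domain Pi_iff)
  then have "emeasure (distr (PiM UNIV (\<lambda>_. lborel)) borel (\<lambda>f. \<chi> i. f i)) (box l u)
      = emeasure (PiM UNIV (\<lambda>_::'n. lborel :: 'b measure)) (Pi\<^sub>E UNIV (\<lambda>i. box (l $ i) (u $ i)))"
    by (subst emeasure_distr) auto
  also have "\<dots> = (\<Prod>i\<in>UNIV. ennreal (\<Prod>b\<in>Basis. (u $ i - l $ i) \<bullet> b))"
    using le' by (subst emeasure_PiM) (simp_all add: inner_diff_left)
  also have "\<dots> = ennreal (\<Prod>b\<in>Basis. (u - l) \<bullet> b)"
    using le' by (subst prod_ennreal)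
      (auto simp: prod_Basis_vec[of "u - l"] inner_diff_left[of "u $ i" "l $ i" for i] intro!: prod_nonneg)
  finally show "emeasure (distr (PiM UNIV (\<lambda>_. lborel)) borel (\<lambda>f. \<chi> i. f i)) (box l u)
      = ennreal (\<Prod>b\<in>Basis. (u - l) \<bullet> b)" .
qed simp

lemma nn_integral_lborel_vec_prod:
  fixes F :: "'n::finite \<Rightarrow> 'b::euclidean_space \<Rightarrow> ennreal"
  assumes [measurable]: "\<And>i. F i \<in> borel_measurable borel"
  shows "(\<integral>\<^sup>+x. (\<Prod>i\<in>UNIV. F i (x $ i)) \<partial>lborel) = (\<Prod>i\<in>UNIV. \<integral>\<^sup>+y. F i y \<partial>lborel)"
proof -
  interpret product_sigma_finite "\<lambda>_::'n. lborel :: 'b measure" by standard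
  show ?thesis
    by (subst lborel_vec_eq_PiM, subst nn_integral_distr)
       (auto intro!: product_nn_integral_prod)
qed

lemma lborel_matrix_vector_mult:
  fixes A :: "real^'n::{finite,wellorder}^'n::_"
  assumes "det A \<noteq> 0"
  shows "lborel = density (distr lborel borel ((*v) A)) (\<lambda>_. ennreal \<bar>det A\<bar>)"
proof (rule lborel_eqI)
  have [measurable]: "(*v) A \<in> borel_measurable borel"
    by (intro borel_measurable_continuous_onI linear_continuous_on) simp
  fix l u :: "(real, 'n) vec"
  assume le: "\<And>b. b \<in> Basis \<Longrightarrow> l \<bullet> b \<le> u \<bullet> b"
  define S where "S = (*v) A -` box l u"
  obtain A' where "A ** A' = mat 1" "A' ** A = mat 1"
    using assms by (auto simp: invertible_det_nz[symmetric] invertible_def)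
  then have inv: "A' *v (A *v x) = x" "A *v (A' *v x) = x" for x
    by (simp_all add: matrix_vector_mul_assoc)
  have S_eq: "S = (*v) A' ` box l u"
  proof (intro equalityI subsetI)
    fix x assume "x \<in> S"
    then show "x \<in> (*v) A' ` box l u"
      unfolding S_def by (metis inv(1) imageI vimageD)
  qed (auto simp: S_def inv)
  have box: "(*v) A ` S = box l u"
    unfolding S_eq by (simp add: image_image inv)
  have S_lmeas: "S \<in> lmeasurable"
    unfolding S_eq by (intro measurable_linear_image lmeasurable_box) auto
  have S_borel: "S \<in> sets borel"
    unfolding S_def by (rule measurable_sets_borel[of _ borel]) auto
  have "\<bar>det A\<bar> * measure lebesgue S = measure lebesgue (box l u)"
    using measure_linear_image[OF matrix_vector_mul_linear[of A] S_lmeas] by (simp add: box)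
  moreover have "emeasure lborel S = ennreal (measure lebesgue S)"
    using emeasure_eq_measure2[OF S_lmeas] S_borel by (simp add: emeasure_completion)
  moreover have "emeasure lborel (box l u) = ennreal (measure lebesgue (box l u))"
    using emeasure_eq_measure2[of "box l u" lebesgue] lmeasurable_box[of l u]
    by (simp add: emeasure_completion del: emeasure_lborel_box)
  ultimately have "ennreal \<bar>det A\<bar> * emeasure lborel S = emeasure lborel (box l u)"
    by (simp add: ennreal_mult[symmetric])
  then show "emeasure (density (distr lborel borel ((*v) A)) (\<lambda>_. ennreal \<bar>det A\<bar>)) (box l u)
      = ennreal (prod ((\<bullet>) (u - l)) Basis)"
    using le by (simp add: emeasure_density nn_integral_cmult emeasure_distr S_def[symmetric])
qed simp

lemma nn_integral_matrix_vector_mult: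
  fixes A :: "real^'n::{finite,wellorder}^'n::_"
  assumes "det A \<noteq> 0" and [measurable]: "f \<in> borel_measurable borel"
  shows "(\<integral>\<^sup>+x. f x \<partial>lborel) = ennreal \<bar>det A\<bar> * (\<integral>\<^sup>+x. f (A *v x) \<partial>lborel)"
proof -
  have [measurable]: "(*v) A \<in> borel_measurable borel"
    by (intro borel_measurable_continuous_onI linear_continuous_on) simp
  show ?thesis
    by (subst lborel_matrix_vector_mult[OF assms(1)])
       (simp add: nn_integral_density nn_integral_distr nn_integral_cmult)
qed

lemma measurable_matrix_mult_right [measurable]:
  "(\<lambda>G. G ** (C :: real^'n^'n)) \<in> borel_measurable borel"
  unfolding matrix_matrix_mult_def by measurable

text \<open>Right multiplication by \<open>C\<close> acts on every row of \<open>G\<close>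
  separately, as multiplication by \<open>transpose C\<close>; the determinant therefore enters once
  per row.\<close>

lemma nn_integral_matrix_matrix_mult:
  fixes C :: "real^'n::{finite,wellorder}^'n::_" and f :: "real^'n::_^'n::_ \<Rightarrow> ennreal"
  assumes C: "det C \<noteq> 0" and [measurable]: "f \<in> borel_measurable borel"
  shows "(\<integral>\<^sup>+G. f G \<partial>lborel) = ennreal (\<bar>det C\<bar> ^ CARD('n)) * (\<integral>\<^sup>+G. f (G ** C) \<partial>lborel)"
proof -
  have row: "(G ** C) $ i = transpose C *v (G $ i)" for G :: "real^'n::_^'n::_" and i
    by (simp add: matrix_matrix_mult_def matrix_vector_mult_def transpose_def vec_eq_iff mult.commute)
  have [measurable]: "(*v) (transpose C) \<in> borel_measurable borel"
    by (intro borel_measurable_continuous_onI linear_continuous_on) simp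
  have eq: "(lborel :: ((real, 'n) vec, 'n) vec measure) = density (distr lborel borel (\<lambda>G. G ** C)) (\<lambda>_. ennreal (\<bar>det C\<bar> ^ CARD('n)))"
  proof (rule lborel_eqI)
    fix l u :: "((real, 'n) vec, 'n) vec"
    assume le: "\<And>b. b \<in> Basis \<Longrightarrow> l \<bullet> b \<le> u \<bullet> b"
    have "ennreal (\<bar>det C\<bar> ^ CARD('n)) * emeasure lborel ((\<lambda>G. G ** C) -` box l u)
       = (\<Prod>i\<in>(UNIV::'n set). ennreal \<bar>det C\<bar>) * (\<integral>\<^sup>+G. indicator (box l u) (G ** C) \<partial>lborel)"
    proof -
      have "(\<integral>\<^sup>+G. indicator (box l u) (G ** C) \<partial>lborel) = (\<integral>\<^sup>+G. indicator ((\<lambda>G. G ** C) -` box l u) G \<partial>lborel)"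
        by (simp add: indicator_vimage)
      also have "\<dots> = emeasure lborel ((\<lambda>G. G ** C) -` box l u)"
        by (rule nn_integral_indicator) (simp add: measurable_sets_borel[OF measurable_matrix_mult_right])
      finally show ?thesis by (simp add: ennreal_power)
    qed
    also have "(\<lambda>G. indicator (box l u) (G ** C) :: ennreal) =
        (\<lambda>G. \<Prod>i\<in>UNIV. indicator (box (l $ i) (u $ i)) (transpose C *v (G $ i)))"
      by (auto simp: fun_eq_iff mem_box_vec row indicator_def)
    also have "(\<integral>\<^sup>+G. (\<Prod>i\<in>UNIV. indicator (box (l $ i) (u $ i)) (transpose C *v (G $ i))) \<partial>lborel)
        = (\<Prod>i\<in>UNIV. \<integral>\<^sup>+y. indicator (box (l $ i) (u $ i)) (transpose C *v y) \<partial>lborel)"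
      by (rule nn_integral_lborel_vec_prod) measurable
    also have "(\<Prod>i\<in>(UNIV::'n set). ennreal \<bar>det C\<bar>) * \<dots> =
        (\<Prod>i\<in>UNIV. ennreal \<bar>det C\<bar> * (\<integral>\<^sup>+y. indicator (box (l $ i) (u $ i)) (transpose C *v y) \<partial>lborel))"
      by (simp add: prod.distrib)
    also have "\<dots> = (\<Prod>i\<in>UNIV. \<integral>\<^sup>+y. indicator (box (l $ i) (u $ i)) y \<partial>lborel)"
      using C nn_integral_matrix_vector_mult[of "transpose C" "indicator (box (l $ i) (u $ i))" for i]
      by simp
    also have "\<dots> = (\<integral>\<^sup>+G. (\<Prod>i\<in>UNIV. indicator (box (l $ i) (u $ i)) (G $ i)) \<partial>lborel)"
      by (rule nn_integral_lborel_vec_prod[symmetric]) measurable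
    also have "(\<lambda>G. \<Prod>i\<in>UNIV. indicator (box (l $ i) (u $ i)) (G $ i) :: ennreal) = indicator (box l u)"
      by (auto simp: fun_eq_iff mem_box_vec indicator_def)
    also have "(\<integral>\<^sup>+G. indicator (box l u) G \<partial>lborel) = ennreal (prod ((\<bullet>) (u - l)) Basis)"
      using le by simp
    finally show "emeasure (density (distr lborel borel (\<lambda>G. G ** C)) (\<lambda>_. ennreal (\<bar>det C\<bar> ^ CARD('n)))) (box l u)
      = ennreal (prod ((\<bullet>) (u - l)) Basis)"
      by (simp add: emeasure_density nn_integral_cmult emeasure_distr)
  qed simp
  show ?thesis
    by (subst eq) (simp add: nn_integral_density nn_integral_distr nn_integral_cmult)
qed

lemma nn_integral_lborel_scaleR:
  fixes f :: "'b::euclidean_space \<Rightarrow> ennreal"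
  assumes "c > 0" and [measurable]: "f \<in> borel_measurable borel"
  shows "(\<integral>\<^sup>+x. f x \<partial>lborel) = ennreal (c ^ DIM('b)) * (\<integral>\<^sup>+x. f (c *\<^sub>R x) \<partial>lborel)"
  using assms(1)
  by (subst lborel_affine[of c 0])
     (simp_all add: nn_integral_density nn_integral_distr nn_integral_cmult)

text \<open>Polar coordinates without a surface measure: the direction is that of a point g with an
  arbitrary radial weight k.\<close>

lemma nn_integral_polar:
  fixes f :: "'b::euclidean_space \<Rightarrow> ennreal" and k :: "real \<Rightarrow> ennreal"
  assumes [measurable]: "f \<in> borel_measurable borel" "k \<in> borel_measurable borel"
  shows "(\<integral>\<^sup>+g. k (norm g) * (\<integral>\<^sup>+r. f (r *\<^sub>R (g /\<^sub>R norm g)) * ennreal (r ^ (DIM('b) - 1)) * indicator {0<..} r \<partial>lborel) \<partial>lborel)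
    = (\<integral>\<^sup>+t. k (1 / t) * ennreal (1 / t ^ (DIM('b) + 1)) * indicator {0<..} t \<partial>lborel) * (\<integral>\<^sup>+x. f x \<partial>lborel)"
proof -
  let ?d = "DIM('b)"
  have d: "?d > 0" by simp
  have "(\<integral>\<^sup>+g. k (norm g) * (\<integral>\<^sup>+r. f (r *\<^sub>R (g /\<^sub>R norm g)) * ennreal (r ^ (?d - 1)) * indicator {0<..} r \<partial>lborel) \<partial>lborel)
    = (\<integral>\<^sup>+g. (\<integral>\<^sup>+t. k (norm g) * (f (t *\<^sub>R g) * ennreal (t ^ (?d - 1) * norm g ^ ?d) * indicator {0<..} t) \<partial>lborel) \<partial>lborel)"
  proof (rule nn_integral_cong_AE, rule AE_mp[OF AE_lborel_singleton[of 0]], intro AE_I2 impI)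
    fix g :: 'b assume g: "g \<noteq> 0"
    have "(\<integral>\<^sup>+r. f (r *\<^sub>R (g /\<^sub>R norm g)) * ennreal (r ^ (?d - 1)) * indicator {0<..} r \<partial>lborel)
      = ennreal (norm g) * (\<integral>\<^sup>+t. f ((norm g * t) *\<^sub>R (g /\<^sub>R norm g)) * ennreal ((norm g * t) ^ (?d - 1)) * indicator {0<..} (norm g * t) \<partial>lborel)"
      using g by (subst nn_integral_real_affine[where c = "norm g" and t = 0]) auto
    also have "\<dots> = (\<integral>\<^sup>+t. ennreal (norm g) * (f ((norm g * t) *\<^sub>R (g /\<^sub>R norm g)) * ennreal ((norm g * t) ^ (?d - 1)) * indicator {0<..} (norm g * t)) \<partial>lborel)"
      by (subst nn_integral_cmult) auto
    also have "\<dots> = (\<integral>\<^sup>+t. f (t *\<^sub>R g) * ennreal (t ^ (?d - 1) * norm g ^ ?d) * indicator {0<..} t \<partial>lborel)"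
    proof (intro nn_integral_cong)
      fix t :: real
      have "ennreal (norm g) * ennreal ((norm g * t) ^ (?d - 1)) = ennreal (t ^ (?d - 1) * norm g ^ ?d)" if "t > 0"
        using that d by (subst ennreal_mult[symmetric])
          (auto simp: power_mult_distrib mult_ac power_eq_if[of "norm g" ?d])
      then show "ennreal (norm g) * (f ((norm g * t) *\<^sub>R (g /\<^sub>R norm g)) * ennreal ((norm g * t) ^ (?d - 1)) * indicator {0<..} (norm g * t))
        = f (t *\<^sub>R g) * ennreal (t ^ (?d - 1) * norm g ^ ?d) * indicator {0<..} t"
        using g by (cases "t > 0") (auto simp: zero_less_mult_iff mult_ac, metis mult.left_commute)
    qed
    finally show "k (norm g) * (\<integral>\<^sup>+r. f (r *\<^sub>R (g /\<^sub>R norm g)) * ennreal (r ^ (?d - 1)) * indicator {0<..} r \<partial>lborel)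
      = (\<integral>\<^sup>+t. k (norm g) * (f (t *\<^sub>R g) * ennreal (t ^ (?d - 1) * norm g ^ ?d) * indicator {0<..} t) \<partial>lborel)"
      by (simp add: nn_integral_cmult)
  qed
  also have "\<dots> = (\<integral>\<^sup>+t. (\<integral>\<^sup>+g. k (norm g) * (f (t *\<^sub>R g) * ennreal (t ^ (?d - 1) * norm g ^ ?d) * indicator {0<..} t) \<partial>lborel) \<partial>lborel)"
    by (rule lborel_pair.Fubini') measurable
  \<comment> \<open>Substituting \<open>g = x / t\<close> moves the argument of f to x and leaves
    the ratio \<open>norm x / t\<close> in k. Rescaling t by \<open>norm x\<close> afterwards
    separates the two integrals.\<close>
  also have "\<dots> = (\<integral>\<^sup>+t. (\<integral>\<^sup>+x. k (norm x / t) * f x * ennreal (norm x ^ ?d / t ^ (?d + 1)) * indicator {0<..} t \<partial>lborel) \<partial>lborel)"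
  proof (rule nn_integral_cong)
    fix t :: real
    show "(\<integral>\<^sup>+g. k (norm g) * (f (t *\<^sub>R g) * ennreal (t ^ (?d - 1) * norm g ^ ?d) * indicator {0<..} t) \<partial>lborel)
      = (\<integral>\<^sup>+x. k (norm x / t) * f x * ennreal (norm x ^ ?d / t ^ (?d + 1)) * indicator {0<..} t \<partial>lborel)"
    proof (cases "t > 0")
      case True
      have *: "t ^ ?d * ((t * n) ^ ?d / t ^ (?d + 1)) = t ^ (?d - 1) * n ^ ?d" for n :: real
        using True d by (auto simp: power_mult_distrib field_simps power_eq_if[of t ?d])
      have "(\<integral>\<^sup>+x. k (norm x / t) * f x * ennreal (norm x ^ ?d / t ^ (?d + 1)) * indicator {0<..} t \<partial>lborel)
        = (\<integral>\<^sup>+x. ennreal (t ^ ?d) * (k (norm (t *\<^sub>R x) / t) * f (t *\<^sub>R x) * ennreal (norm (t *\<^sub>R x) ^ ?d / t ^ (?d + 1))) \<partial>lborel)"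
        using True by (subst nn_integral_lborel_scaleR[OF True]) (auto simp: nn_integral_cmult)
      also have "\<dots> = (\<integral>\<^sup>+g. k (norm g) * (f (t *\<^sub>R g) * ennreal (t ^ (?d - 1) * norm g ^ ?d) * indicator {0<..} t) \<partial>lborel)"
      proof (intro nn_integral_cong)
        fix x :: 'b
        have "ennreal (t ^ ?d) * ennreal ((t * norm x) ^ ?d / t ^ (?d + 1)) = ennreal (t ^ (?d - 1) * norm x ^ ?d)"
          using True *[of "norm x"] by (subst ennreal_mult[symmetric]) auto
        then show "ennreal (t ^ ?d) * (k (norm (t *\<^sub>R x) / t) * f (t *\<^sub>R x) * ennreal (norm (t *\<^sub>R x) ^ ?d / t ^ (?d + 1)))
          = k (norm x) * (f (t *\<^sub>R x) * ennreal (t ^ (?d - 1) * norm x ^ ?d) * indicator {0<..} t)"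
          using True by (simp add: mult_ac)
      qed
      finally show ?thesis ..
    qed auto
  qed
  also have "\<dots> = (\<integral>\<^sup>+x. (\<integral>\<^sup>+t. k (norm x / t) * f x * ennreal (norm x ^ ?d / t ^ (?d + 1)) * indicator {0<..} t \<partial>lborel) \<partial>lborel)"
    by (rule lborel_pair.Fubini') measurable
  also have "\<dots> = (\<integral>\<^sup>+x. f x * (\<integral>\<^sup>+t. k (1 / t) * ennreal (1 / t ^ (?d + 1)) * indicator {0<..} t \<partial>lborel) \<partial>lborel)"
  proof (rule nn_integral_cong_AE, rule AE_mp[OF AE_lborel_singleton[of 0]], intro AE_I2 impI)
    fix x :: 'b assume x: "x \<noteq> 0"
    have "(\<integral>\<^sup>+t. k (norm x / t) * f x * ennreal (norm x ^ ?d / t ^ (?d + 1)) * indicator {0<..} t \<partial>lborel)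
      = (\<integral>\<^sup>+t. ennreal (norm x) * (k (norm x / (norm x * t)) * f x * ennreal (norm x ^ ?d / (norm x * t) ^ (?d + 1)) * indicator {0<..} (norm x * t)) \<partial>lborel)"
      using x by (subst nn_integral_real_affine[where c = "norm x" and t = 0]) (auto simp: nn_integral_cmult)
    also have "\<dots> = (\<integral>\<^sup>+t. f x * (k (1 / t) * ennreal (1 / t ^ (?d + 1)) * indicator {0<..} t) \<partial>lborel)"
    proof (intro nn_integral_cong)
      fix t :: real
      have "ennreal (norm x) * ennreal (norm x ^ ?d / (norm x * t) ^ (?d + 1)) = ennreal (1 / t ^ (?d + 1))" if "t > 0"
        using that x by (subst ennreal_mult[symmetric]) (auto simp: power_mult_distrib field_simps)
      then show "ennreal (norm x) * (k (norm x / (norm x * t)) * f x * ennreal (norm x ^ ?d / (norm x * t) ^ (?d + 1)) * indicator {0<..} (norm x * t))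
        = f x * (k (1 / t) * ennreal (1 / t ^ (?d + 1)) * indicator {0<..} t)"
        using x by (cases "t > 0") (auto simp: zero_less_mult_iff mult_ac, metis mult.left_commute)
    qed
    finally show "(\<integral>\<^sup>+t. k (norm x / t) * f x * ennreal (norm x ^ ?d / t ^ (?d + 1)) * indicator {0<..} t \<partial>lborel)
      = f x * (\<integral>\<^sup>+t. k (1 / t) * ennreal (1 / t ^ (?d + 1)) * indicator {0<..} t \<partial>lborel)"
      by (simp add: nn_integral_cmult)
  qed
  finally show ?thesis
    by (simp add: nn_integral_multc mult.commute)
qed

section \<open>A contour integral\<close>

text \<open>The sine series has subdegree 1, so it divides \<open>fps_X\<close> and the quotient of
  the theorem is a genuine one.\<close>

lemma fps_X_div_sin_mult:
  "(fps_X / fps_sin (1::'a::{field_char_0})) * fps_sin 1 = fps_X"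
proof -
  have nth1: "fps_sin (1::'a) $ 1 = 1" by (simp add: fps_sin_def)
  then have "fps_sin (1::'a) \<noteq> 0" by (metis fps_zero_nth zero_neq_one)
  moreover have "subdegree (fps_sin (1::'a)) = 1"
    by (rule subdegreeI) (use nth1 in \<open>auto simp: fps_sin_def\<close>)
  ultimately show ?thesis
    by (intro dvd_div_mult_self) (simp add: fps_dvd_iff)
qed

text \<open>Residues live over the complex numbers, the theorem over the reals. The coefficientwise
  embedding is multiplicative, so it respects the quotient, which is characterised by
  \<open>fps_X_div_sin_mult\<close>.\<close>

lemma fps_X_div_sin_power_of_real:
  "((fps_X / fps_sin (1::complex)) ^ m) $ k = of_real (((fps_X / fps_sin (1::real)) ^ m) $ k)"
proof -
  define h :: "real fps \<Rightarrow> complex fps" where "h F = Abs_fps (\<lambda>n. of_real (F $ n))" for F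
  have h_mult: "h (F * G) = h F * h G" for F G
    by (simp add: h_def fps_eq_iff fps_mult_nth)
  have h_power: "h (F ^ m) = h F ^ m" for F m
  proof (induction m)
    case 0
    show ?case by (simp add: h_def fps_eq_iff)
  qed (simp add: h_mult)
  have h_sin: "h (fps_sin 1) = fps_sin 1"
    by (simp add: h_def fps_eq_iff fps_sin_def)
  have h_X: "h fps_X = fps_X"
    by (simp add: h_def fps_eq_iff fps_X_def)
  have nz: "fps_sin (1::complex) \<noteq> 0"
    using fps_X_div_sin_mult[where 'a = complex] by auto
  have "h (fps_X / fps_sin 1) * fps_sin 1 = fps_X"
    by (metis fps_X_div_sin_mult h_mult h_sin h_X)
  then have "h (fps_X / fps_sin 1) = fps_X / fps_sin 1"
    using fps_X_div_sin_mult[where 'a = complex] nz by (metis mult_right_cancel)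
  then show ?thesis
    using h_power[of "fps_X / fps_sin 1" m] by (metis h_def fps_nth_Abs_fps)
qed

lemma sin_nonzero_strip:
  assumes "\<bar>Re z\<bar> < pi" "z \<noteq> 0"
  shows "sin z \<noteq> 0"
proof
  assume "sin z = 0"
  then obtain n :: int where z: "z = of_real (n * pi)" by (auto simp: sin_eq_0)
  with assms(1) have "\<bar>of_int n :: real\<bar> * pi < 1 * pi" by (simp add: abs_mult)
  then have "\<bar>of_int n :: real\<bar> < 1" by (simp only: mult_less_cancel_right pi_gt_zero) auto
  with z assms(2) show False by simp
qed

text \<open>Away from 0 the function equals \<open>(z / sin z) ^ (d + 1) / z ^ Suc (d - l)\<close>,
  so its residue is a Taylor coefficient of the first factor.\<close>

lemma residue_power_div_sin:
  assumes "l \<le> d"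
  shows "residue (\<lambda>z. z ^ l / sin z ^ (d + 1)) 0 = ((fps_X / fps_sin 1) ^ (d + 1)) $ (d - l)"
proof -
  define g where "g z = (if z = 0 then 1 else z / sin z)" for z :: complex
  have nth1: "fps_sin (1::complex) $ 1 = 1" by (simp add: fps_sin_def)
  have sub: "subdegree (fps_sin (1::complex)) = 1"
    by (rule subdegreeI) (use nth1 in \<open>auto simp: fps_sin_def\<close>)
  have "g has_fps_expansion (fps_X / fps_sin 1)"
    unfolding g_def using nth1 sub has_fps_expansion_sin[of 1]
    by (intro has_fps_expansion_divide) (auto intro!: has_fps_expansion_fps_X)
  then have "(\<lambda>z. g z ^ (d + 1)) has_fps_expansion (fps_X / fps_sin 1) ^ (d + 1)"
    by (rule has_fps_expansion_power)
  then have "residue (\<lambda>z. g z ^ (d + 1) / z ^ Suc (d - l)) 0 = ((fps_X / fps_sin 1) ^ (d + 1)) $ (d - l)"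
    by (rule residue_fps_expansion_over_power_at_0)
  moreover have "residue (\<lambda>z. g z ^ (d + 1) / z ^ Suc (d - l)) 0 = residue (\<lambda>z. z ^ l / sin z ^ (d + 1)) 0"
  proof (rule residue_cong)
    have "\<forall>\<^sub>F z in at (0::complex). z \<noteq> 0" by (simp add: eventually_at_filter)
    then show "\<forall>\<^sub>F z in at 0. g z ^ (d + 1) / z ^ Suc (d - l) = z ^ l / sin z ^ (d + 1)"
    proof eventually_elim
      case (elim z)
      have "z ^ (d + 1) = z ^ l * z ^ Suc (d - l)"
        using assms by (simp add: power_add[symmetric] del: power_Suc)
      with elim show ?case by (simp add: g_def power_divide)
    qed
  qed simp
  ultimately show ?thesis by simp
qed

text \<open>The integrand \<open>z ^ l / sin z ^ (d + 1)\<close> is odd, so the two vertical sides of the rectangle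
  over \<open>[- pi / 2, pi / 2]\<close> contribute equally, and the only pole inside is 0.\<close>

lemma integral_strip_tendsto:
  assumes "l \<le> d" "even (d - l)"
  shows "((\<lambda>N. integral {-N..N} (\<lambda>t. Complex (pi / 2) t ^ l / of_real (cosh t) ^ (d + 1))) \<longlongrightarrow>
     of_real (pi * ((fps_X / fps_sin 1) ^ (d + 1)) $ (d - l))) at_top"
proof -
  define f where "f z = z ^ l / sin z ^ (d + 1)" for z :: complex
  \<comment> \<open>In this strip the sine vanishes only at 0, and the closed contour fits inside
    it.\<close>
  define S where "S = {z. \<bar>Re z\<bar> < pi}"
  have S_open: "open S"
    unfolding S_def by (intro open_Collect_less continuous_intros)
  have S_eq: "S = {z. - pi < Re z} \<inter> {z. Re z < pi}" by (auto simp: S_def)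
  have S_conv: "convex S"
    unfolding S_eq by (intro convex_Int convex_halfspace_Re_gt convex_halfspace_Re_lt)
  have hol: "f holomorphic_on S - {0}"
    unfolding f_def S_def by (intro holomorphic_intros) (auto simp: sin_nonzero_strip)
  then have cont: "continuous_on (S - {0}) f" by (rule holomorphic_on_imp_continuous_on)
  have odd: "f (- z) = - f z" for z
  proof -
    have "odd (l + (d + 1))" using assms by presburger
    then have "(- z) ^ l / (- sin z) ^ (d + 1) = - (z ^ l / sin z ^ (d + 1))"
      by (cases "even l") (auto simp: uminus_power_if)
    then show ?thesis by (simp add: f_def)
  qed
  define I where "I N = integral {-N..N} (\<lambda>t. f (Complex (pi / 2) t))" for N
  define H where "H N = contour_integral (linepath (Complex (-pi/2) (-N)) (Complex (pi/2) (-N))) f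
      + contour_integral (linepath (Complex (pi/2) N) (Complex (-pi/2) N)) f" for N
  have f_eq: "f (Complex (pi / 2) t) = Complex (pi / 2) t ^ l / of_real (cosh t) ^ (d + 1)" for t
  proof -
    have "sin (Complex (pi / 2) t) = of_real (cosh t)"
      by (simp add: complex_eq_iff Re_sin Im_sin cosh_def)
    then show ?thesis by (simp add: f_def)
  qed
  have key: "2 * \<i> * I N + H N = 2 * pi * \<i> * residue f 0"
    and bound: "norm (H N) \<le> 2 * pi * ((pi / 2 + N) ^ l / sinh N ^ (d + 1))" if N: "N > 0" for N
  proof -
    let ?a1 = "Complex (-pi/2) (-N)" and ?a2 = "Complex (pi/2) (-N)"
      and ?a3 = "Complex (pi/2) N" and ?a4 = "Complex (-pi/2) N"
    have pi2: "\<bar>x\<bar> < pi" if "- (pi / 2) \<le> x" "x \<le> pi / 2" for x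
      using that pi_gt_zero by linarith
    have seg: "closed_segment ?a1 ?a2 \<subseteq> S - {0}" "closed_segment ?a2 ?a3 \<subseteq> S - {0}"
      "closed_segment ?a3 ?a4 \<subseteq> S - {0}" "closed_segment ?a4 ?a1 \<subseteq> S - {0}"
      using N by (auto intro!: pi2 simp: S_def closed_segment_same_Re closed_segment_same_Im closed_segment_eq_real_ivl)
        (use pi_gt_zero in linarith)
    have int: "f contour_integrable_on linepath a b" if "closed_segment a b \<subseteq> S - {0}" for a b
      using that cont by (intro contour_integrable_continuous_linepath) (rule continuous_on_subset)
    have rect: "rectpath ?a1 ?a3 = linepath ?a1 ?a2 +++ linepath ?a2 ?a3 +++ linepath ?a3 ?a4 +++ linepath ?a4 ?a1"
      by (simp add: rectpath_def Let_def)
    have "contour_integral (rectpath ?a1 ?a3) f =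
        contour_integral (linepath ?a1 ?a2) f + contour_integral (linepath ?a2 ?a3) f
      + contour_integral (linepath ?a3 ?a4) f + contour_integral (linepath ?a4 ?a1) f"
      unfolding rect using int seg by (simp add: contour_integrable_joinI)
    moreover have "contour_integral (linepath ?a2 ?a3) f = \<i> * I N"
      using N unfolding I_def by (subst contour_integral_linepath_same_Re[of _ "pi/2"]) auto
    moreover have "contour_integral (linepath ?a4 ?a1) f = \<i> * I N"
    proof -
      have "contour_integral (linepath ?a4 ?a1) f = - contour_integral (linepath ?a1 ?a4) f"
        using seg cont by (intro contour_integral_reverse_linepath) (rule continuous_on_subset)
      also have "contour_integral (linepath ?a1 ?a4) f = \<i> * integral {-N..N} (\<lambda>t. f (Complex (- pi / 2) t))"
        using N by (subst contour_integral_linepath_same_Re[of _ "-pi/2"]) auto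
      also have "(\<lambda>t. f (Complex (- pi / 2) t)) = (\<lambda>t. - f (Complex (pi / 2) (- t)))"
        by (subst odd[symmetric]) (simp add: complex_eq_iff fun_eq_iff uminus_complex.code)
      also have "integral {-N..N} (\<lambda>t. - f (Complex (pi / 2) (- t))) = - I N"
        unfolding I_def integral_neg
        using Henstock_Kurzweil_Integration.integral_reflect_real[of N "-N" "\<lambda>t. f (Complex (pi / 2) t)"] by simp
      finally show ?thesis by simp
    qed
    ultimately have rectI: "contour_integral (rectpath ?a1 ?a3) f = 2 * \<i> * I N + H N"
      by (simp add: H_def)
    have "contour_integral (rectpath ?a1 ?a3) f = complex_of_real (2 * pi) * \<i> *
        (\<Sum>p\<in>{0}. winding_number (rectpath ?a1 ?a3) p * residue f p)"
    proof (rule Residue_theorem[OF S_open convex_connected[OF S_conv]])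
      show "path_image (rectpath ?a1 ?a3) \<subseteq> S - {0}"
        unfolding rect using seg by (simp add: path_image_join)
      show "\<forall>z. z \<notin> S \<longrightarrow> winding_number (rectpath ?a1 ?a3) z = 0"
      proof (intro allI impI)
        fix z assume "z \<notin> S"
        then have "z \<notin> cbox ?a1 ?a3" using pi2[of "Re z"] by (auto simp: S_def in_cbox_complex_iff)
        then show "winding_number (rectpath ?a1 ?a3) z = 0"
          using N by (intro winding_number_rectpath_outside) auto
      qed
    qed (use hol in auto)
    also have "(\<Sum>p\<in>{0}. winding_number (rectpath ?a1 ?a3) p * residue f p) = residue f 0"
      using N by (subst sum.insert) (auto intro!: winding_number_rectpath simp: in_box_complex_iff)
    finally show "2 * \<i> * I N + H N = 2 * pi * \<i> * residue f 0"
      using rectI by simp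
    \<comment> \<open>On the horizontal sides the square of the modulus of \<open>sin z\<close> is
      \<open>sin\<^sup>2 (Re z) + sinh\<^sup>2 N\<close>, so the integrand decays
      exponentially.\<close>
    have fb: "norm (f z) \<le> (pi / 2 + N) ^ l / sinh N ^ (d + 1)" if "\<bar>Re z\<bar> \<le> pi / 2" "\<bar>Im z\<bar> = N" for z
    proof -
      have "norm z \<le> pi / 2 + N" using cmod_le[of z] that by linarith
      moreover have "norm (sin z) \<ge> sinh N"
      proof -
        have "(sinh N)\<^sup>2 \<le> (norm (sin z))\<^sup>2"
        proof -
          have "(norm (sin z))\<^sup>2 = (sin (Re z))\<^sup>2 + (sinh (Im z))\<^sup>2"
          proof -
            have R: "Re (sin z) = sin (Re z) * cosh (Im z)" "Im (sin z) = cos (Re z) * sinh (Im z)"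
              by (simp_all add: Re_sin Im_sin cosh_def sinh_def)
            have "(sin (Re z) * cosh (Im z))\<^sup>2 + (cos (Re z) * sinh (Im z))\<^sup>2
              = (sin (Re z))\<^sup>2 * (1 + (sinh (Im z))\<^sup>2) + (1 - (sin (Re z))\<^sup>2) * (sinh (Im z))\<^sup>2"
              by (simp add: power_mult_distrib cosh_square_eq cos_squared_eq)
            then show ?thesis by (simp add: cmod_power2 R algebra_simps)
          qed
          moreover have "(sinh (Im z))\<^sup>2 = (sinh N)\<^sup>2"
            using that(2) by (cases "Im z \<ge> 0") (auto simp: abs_if)
          ultimately show ?thesis by simp
        qed
        then show ?thesis by (rule power2_le_imp_le) simp
      qed
      ultimately show ?thesis
        using N unfolding f_def norm_divide norm_power
        by (intro frac_le power_mono zero_less_power zero_le_power) (auto simp: add_nonneg_nonneg)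
    qed
    have [simp]: "\<not> pi \<le> 0" using pi_gt_zero by linarith
    have B0: "0 \<le> (pi / 2 + N) ^ l / sinh N ^ (d + 1)" using N by simp
    have "norm (contour_integral (linepath ?a1 ?a2) f) \<le> (pi / 2 + N) ^ l / sinh N ^ (d + 1) * norm (?a2 - ?a1)"
      using seg int N fb B0 by (intro contour_integral_bound_linepath)
        (auto simp: closed_segment_same_Im closed_segment_eq_real_ivl)
    moreover have "norm (contour_integral (linepath ?a3 ?a4) f) \<le> (pi / 2 + N) ^ l / sinh N ^ (d + 1) * norm (?a4 - ?a3)"
      using seg int N fb B0 by (intro contour_integral_bound_linepath)
        (auto simp: closed_segment_same_Im closed_segment_eq_real_ivl)
    moreover have "norm (?a2 - ?a1) = pi" "norm (?a4 - ?a3) = pi"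
      by (simp_all add: cmod_def)
    ultimately have "norm (contour_integral (linepath ?a1 ?a2) f) + norm (contour_integral (linepath ?a3 ?a4) f)
        \<le> (pi / 2 + N) ^ l / sinh N ^ (d + 1) * pi + (pi / 2 + N) ^ l / sinh N ^ (d + 1) * pi"
      by (simp only: add_mono)
    also have "\<dots> = 2 * pi * ((pi / 2 + N) ^ l / sinh N ^ (d + 1))" by simp
    finally show "norm (H N) \<le> 2 * pi * ((pi / 2 + N) ^ l / sinh N ^ (d + 1))"
      unfolding H_def by (rule order.trans[OF norm_triangle_ineq])
  qed
  have "((\<lambda>N. 2 * pi * ((pi / 2 + N) ^ l / sinh N ^ (d + 1))) \<longlongrightarrow> 0) at_top"
  proof -
    have "((\<lambda>N. (pi / 2 + N) / sinh N) \<longlongrightarrow> 0) at_top" "((\<lambda>N. 1 / sinh N :: real) \<longlongrightarrow> 0) at_top"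
      unfolding sinh_field_def by real_asymp+
    \<comment> \<open>Of the d + 1 factors \<open>1 / sinh N\<close>, l are paired with the factors
      of the numerator; because of \<open>l \<le> d\<close> at least one further factor remains and
      forces the limit 0.\<close>
    then have "((\<lambda>N. 2 * pi * (((pi / 2 + N) / sinh N) ^ l * (1 / sinh N) ^ (d + 1 - l))) \<longlongrightarrow> 2 * pi * (0 ^ l * 0 ^ (d + 1 - l))) at_top"
      by (intro tendsto_intros)
    moreover have "((pi / 2 + N) / sinh N) ^ l * (1 / sinh N) ^ (d + 1 - l) = (pi / 2 + N) ^ l / sinh N ^ (d + 1)" for N :: real
    proof -
      have "sinh N ^ (d + 1) = sinh N ^ l * sinh N ^ (d + 1 - l)"
        using assms by (simp add: power_add[symmetric])
      then show ?thesis by (simp add: power_divide)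
    qed
    ultimately show ?thesis using assms by (simp add: power_0_left)
  qed
  then have "(H \<longlongrightarrow> 0) at_top"
    by (rule Lim_null_comparison[rotated]) (rule eventually_mono[OF eventually_gt_at_top[of 0] bound])
  then have "((\<lambda>N. (2 * pi * \<i> * residue f 0 - H N) / (2 * \<i>)) \<longlongrightarrow> (2 * pi * \<i> * residue f 0 - 0) / (2 * \<i>)) at_top"
    by (intro tendsto_intros) auto
  moreover have "\<forall>\<^sub>F N in at_top. (2 * pi * \<i> * residue f 0 - H N) / (2 * \<i>) = I N"
    using eventually_gt_at_top[of 0]
  proof eventually_elim
    case (elim N)
    then show ?case using key[of N] by (simp add: field_simps)
  qed
  ultimately have "(I \<longlongrightarrow> (2 * pi * \<i> * residue f 0 - 0) / (2 * \<i>)) at_top"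
    by (rule Lim_transform_eventually)
  moreover have "(2 * pi * \<i> * residue f 0 - 0) / (2 * \<i>) = pi * residue f 0"
    by (simp add: field_simps)
  ultimately have "(I \<longlongrightarrow> pi * residue f 0) at_top"
    by (simp only:)
  moreover have "pi * residue f 0 = of_real (pi * ((fps_X / fps_sin 1) ^ (d + 1)) $ (d - l))"
    using residue_power_div_sin[OF assms(1)] fps_X_div_sin_power_of_real[of "d + 1" "d - l"]
    by (simp add: f_def[abs_def])
  ultimately show ?thesis by (simp add: I_def[abs_def] f_eq)
qed

section \<open>Gaussian integrals over quadrants\<close>

lemma nn_integral_exp_neg_square:
  "(\<integral>\<^sup>+x. ennreal (exp (- x\<^sup>2 / 2)) \<partial>lborel) = ennreal (sqrt (2 * pi))"
proof -
  have "(\<integral>\<^sup>+x. ennreal (exp (- x\<^sup>2 / 2)) \<partial>lborel)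
      = (\<integral>\<^sup>+x. ennreal (sqrt (2 * pi)) * ennreal (normal_density 0 1 x) \<partial>lborel)"
    by (intro nn_integral_cong) (simp add: normal_density_def ennreal_mult[symmetric])
  also have "\<dots> = ennreal (sqrt (2 * pi)) * (\<integral>\<^sup>+x. ennreal (normal_density 0 1 x) \<partial>lborel)"
    by (rule nn_integral_cmult) simp
  also have "(\<integral>\<^sup>+x. ennreal (normal_density 0 1 x) \<partial>lborel) = 1"
    by (subst nn_integral_eq_integral) auto
  finally show ?thesis by simp
qed

lemma integrable_exp_neg_square: "integrable lborel (\<lambda>x::real. exp (- x\<^sup>2 / 2))"
proof (rule integrableI_nonneg)
  show "(\<integral>\<^sup>+x. ennreal (exp (- x\<^sup>2 / 2)) \<partial>lborel) < \<infinity>"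
    unfolding nn_integral_exp_neg_square by simp
qed auto

text \<open>An explicit antiderivative works for complex z as well. The modulus of the integrand is
  the real integrand with \<open>Re z\<close> in place of z, which settles integrability.\<close>

lemma LBINT_mult_exp_neg_square:
  fixes z :: complex
  assumes z: "Re z > 0"
  shows "set_integrable lborel {0<..} (\<lambda>m. of_real m * exp (- (of_real (m\<^sup>2) * z) / 2))"
    and "(LBINT m:{0<..}. of_real m * exp (- (of_real (m\<^sup>2) * z) / 2)) = 1 / z"
proof -
  define c where "c = Re z"
  have c: "c > 0" using z by (simp add: c_def)
  have ei: "einterval 0 \<infinity> = {0<..}" by (auto simp: einterval_def zero_ereal_def)
  have int_real: "set_integrable lborel (einterval 0 \<infinity>) (\<lambda>m. m * exp (- (m\<^sup>2 * c) / 2))"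
  proof (rule interval_integral_FTC_nonneg)
    show "DERIV (\<lambda>m. - exp (- (m\<^sup>2 * c) / 2) / c) x :> x * exp (- (x\<^sup>2 * c) / 2)" for x
      using c by (auto intro!: derivative_eq_intros simp: field_simps)
    show "(((\<lambda>m. - exp (- (m\<^sup>2 * c) / 2) / c) \<circ> real_of_ereal) \<longlongrightarrow> - 1 / c) (at_right 0)"
      unfolding o_def zero_ereal_def
      by (subst at_right_ereal, subst filterlim_filtermap) (use c in \<open>auto intro!: tendsto_eq_intros\<close>)
    show "(((\<lambda>m. - exp (- (m\<^sup>2 * c) / 2) / c) \<circ> real_of_ereal) \<longlongrightarrow> 0) (at_left \<infinity>)"
      unfolding o_def using c
      by (subst at_left_PInf, subst filterlim_filtermap, simp) real_asymp
  qed (auto simp: ei)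
  have "norm (of_real m * exp (- (of_real (m\<^sup>2) * z) / 2)) = m * exp (- (m\<^sup>2 * c) / 2)" if "m > 0" for m
    using that by (simp add: norm_mult c_def)
  then show int: "set_integrable lborel {0<..} (\<lambda>m. of_real m * exp (- (of_real (m\<^sup>2) * z) / 2))"
    unfolding set_integrable_def
    by (intro Bochner_Integration.integrable_bound[OF int_real[unfolded ei set_integrable_def]])
       (auto simp: indicator_def intro!: AE_I2)
  have "(LBINT m=0..\<infinity>. of_real m * exp (- (of_real (m\<^sup>2) * z) / 2)) = 0 - (- 1 / z)"
  proof (rule interval_integral_FTC_integrable)
    show "((\<lambda>m. - exp (- (of_real (m\<^sup>2) * z) / 2) / z) has_vector_derivative
        of_real x * exp (- (of_real (x\<^sup>2) * z) / 2)) (at x)" for x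
    proof -
      have "((\<lambda>w. - exp (- (w\<^sup>2 * z) / 2) / z) has_field_derivative
          of_real x * exp (- (of_real (x\<^sup>2) * z) / 2)) (at (of_real x))"
        using z by (auto intro!: derivative_eq_intros simp: field_simps)
      from has_vector_derivative_real_field[OF this] show ?thesis by (simp add: o_def)
    qed
    show "(((\<lambda>m. - exp (- (of_real (m\<^sup>2) * z) / 2) / z) \<circ> real_of_ereal) \<longlongrightarrow> - 1 / z) (at_right 0)"
      unfolding o_def zero_ereal_def
      by (subst at_right_ereal, subst filterlim_filtermap) (use z in \<open>auto intro!: tendsto_eq_intros\<close>)
    have "((\<lambda>m::real. exp (- (m\<^sup>2 * c) / 2)) \<longlongrightarrow> 0) at_top"
      using c by real_asymp
    then have "((\<lambda>m::real. exp (- (m\<^sup>2 * c) / 2) / norm z) \<longlongrightarrow> 0) at_top"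
      by (rule tendsto_divide_zero)
    then have "((\<lambda>m. - exp (- (of_real (m\<^sup>2) * z) / 2) / z) \<longlongrightarrow> 0) at_top"
      by (rule Lim_null_comparison[rotated]) (simp add: norm_divide c_def)
    then show "(((\<lambda>m. - exp (- (of_real (m\<^sup>2) * z) / 2) / z) \<circ> real_of_ereal) \<longlongrightarrow> 0) (at_left \<infinity>)"
      unfolding o_def
      by (subst at_left_PInf, subst filterlim_filtermap, simp)
  qed (use int in \<open>auto simp: ei intro!: continuous_intros\<close>)
  then show "(LBINT m:{0<..}. of_real m * exp (- (of_real (m\<^sup>2) * z) / 2)) = 1 / z"
    by (simp add: interval_lebesgue_integral_def ei)
qed

text \<open>The quadratic factors over purely imaginary roots, so partial fractions give a
  difference of two complex logarithms; the larger root is \<i> times \<open>exp (arsinh s)\<close>,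
  whence the arsinh.\<close>

lemma LBINT_inverse_quadratic:
  fixes s :: real
  shows "set_integrable lborel {0<..} (\<lambda>t. 1 / (1 + of_real (t\<^sup>2) - 2 * \<i> * of_real s * of_real t))"
    and "(LBINT t:{0<..}. 1 / (1 + of_real (t\<^sup>2) - 2 * \<i> * of_real s * of_real t))
      = (pi / 2 + \<i> * of_real (arsinh s)) / of_real (sqrt (1 + s\<^sup>2))"
proof -
  let ?g = "\<lambda>t::real. 1 / (1 + of_real (t\<^sup>2) - 2 * \<i> * of_real s * of_real t) :: complex"
  define c where "c = sqrt (1 + s\<^sup>2)"
  have c2: "c\<^sup>2 = 1 + s\<^sup>2" and c0: "c > 0" by (simp_all add: c_def add_pos_nonneg)
  have cs: "\<bar>s\<bar> < c" unfolding c_def by (rule real_less_rsqrt) simp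
  have ei: "einterval 0 \<infinity> = {0<..}" by (auto simp: einterval_def zero_ereal_def)
  have int_real: "set_integrable lborel (einterval 0 \<infinity>) (\<lambda>t. 1 / (1 + t\<^sup>2))"
  proof (rule interval_integral_FTC_nonneg)
    show "DERIV arctan x :> 1 / (1 + x\<^sup>2)" for x
      by (auto intro!: derivative_eq_intros simp: field_simps)
    show "((arctan \<circ> real_of_ereal) \<longlongrightarrow> arctan 0) (at_right 0)"
      unfolding o_def zero_ereal_def
      by (subst at_right_ereal, subst filterlim_filtermap, simp) (auto intro!: tendsto_eq_intros)
    show "((arctan \<circ> real_of_ereal) \<longlongrightarrow> pi / 2) (at_left \<infinity>)"
      unfolding o_def
      by (subst at_left_PInf, subst filterlim_filtermap, simp) (rule tendsto_arctan_at_top)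
    show "isCont (\<lambda>t. 1 / (1 + t\<^sup>2)) x" for x :: real
      by (intro continuous_intros) (metis add_pos_nonneg less_numeral_extra(1) less_numeral_extra(3) zero_le_power2)
  qed (auto simp: ei)
  have "norm (?g t) \<le> 1 / (1 + t\<^sup>2)" for t
  proof -
    have "1 + t\<^sup>2 \<le> norm (1 + of_real (t\<^sup>2) - 2 * \<i> * of_real s * of_real t)"
      using abs_Re_le_cmod[of "1 + of_real (t\<^sup>2) - 2 * \<i> * of_real s * of_real t"] by simp
    then show ?thesis unfolding norm_divide
      by (intro frac_le) (auto simp: add_pos_nonneg)
  qed
  then show int: "set_integrable lborel {0<..} ?g"
    unfolding set_integrable_def
    by (intro Bochner_Integration.integrable_bound[OF int_real[unfolded ei set_integrable_def]])
       (auto simp: indicator_def add_nonneg_nonneg intro!: AE_I2)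
  \<comment> \<open>The roots of the quadratic are \<open>\<i> * p\<close> and
    \<open>\<i> * q\<close>, with \<open>p + q = 2 * s\<close> and \<open>p * q = -1\<close>. Being
    nonzero, p and q keep both logarithms off the branch cut for every real t.\<close>
  define p q where "p = s + c" and "q = s - c"
  have pq: "p > 0" "q < 0" using cs by (auto simp: p_def q_def)
  define F where "F t = (Ln (of_real t - \<i> * of_real p) - Ln (of_real t - \<i> * of_real q)) / (2 * \<i> * of_real c)" for t :: real
  have nn: "of_real t - \<i> * of_real x \<notin> \<real>\<^sub>\<le>\<^sub>0" if "x \<noteq> 0" for t x :: real
    using that by (auto simp: complex_nonpos_Reals_iff)
  have "(LBINT t=0..\<infinity>. ?g t) = 0 - F 0"
  proof (rule interval_integral_FTC_integrable)
    show "(F has_vector_derivative ?g x) (at x)" for x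
    proof -
      let ?u = "of_real x - \<i> * of_real p" and ?v = "of_real x - \<i> * of_real q"
      have nz: "?u \<noteq> 0" "?v \<noteq> 0" using pq by (auto simp: complex_eq_iff)
      have "((\<lambda>w. Ln (w - \<i> * of_real y)) has_field_derivative 1 / (of_real x - \<i> * of_real y)) (at (of_real x))"
        if "y \<noteq> 0" for y :: real
        using nn[OF that, of x] by (auto intro!: derivative_eq_intros simp: divide_inverse)
      then have "((\<lambda>w. (Ln (w - \<i> * of_real p) - Ln (w - \<i> * of_real q)) / (2 * \<i> * of_real c))
          has_field_derivative (1 / ?u - 1 / ?v) / (2 * \<i> * of_real c)) (at (of_real x))"
        using pq by (intro DERIV_cdivide DERIV_diff) auto
      moreover have "(1 / ?u - 1 / ?v) / (2 * \<i> * of_real c) = ?g x"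
      proof -
        have "?u * ?v = 1 + of_real (x\<^sup>2) - 2 * \<i> * of_real s * of_real x"
          using c2 by (simp add: p_def q_def complex_eq_iff algebra_simps power2_eq_square)
        moreover have "?v - ?u = 2 * \<i> * of_real c"
          by (simp add: p_def q_def algebra_simps)
        moreover have "1 / ?u - 1 / ?v = (?v - ?u) / (?u * ?v)"
          using nz by (simp add: diff_frac_eq)
        ultimately show ?thesis using c0 by simp
      qed
      ultimately have "((\<lambda>w. (Ln (w - \<i> * of_real p) - Ln (w - \<i> * of_real q)) / (2 * \<i> * of_real c))
          has_field_derivative ?g x) (at (of_real x))" by simp
      from has_vector_derivative_real_field[OF this] show ?thesis
        by (simp add: F_def[abs_def])
    qed
    have nz: "1 + of_real (t\<^sup>2) - 2 * \<i> * of_real s * of_real t \<noteq> 0" for t :: real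
    proof
      assume "1 + of_real (t\<^sup>2) - 2 * \<i> * of_real s * of_real t = (0::complex)"
      then have "1 + t\<^sup>2 = 0" by (simp add: complex_eq_iff)
      then show False by (metis add_pos_nonneg less_numeral_extra(1) less_numeral_extra(3) zero_le_power2)
    qed
    show "isCont ?g x" for x using nz by (intro continuous_intros) 
    have "continuous (at 0) F" unfolding F_def
      using nn[of p 0] nn[of q 0] pq c0 by (intro continuous_intros) auto
    then have "(F \<longlongrightarrow> F 0) (at_right 0)"
      by (auto simp: isCont_def intro: tendsto_within_subset)
    then show "((F \<circ> real_of_ereal) \<longlongrightarrow> F 0) (at_right 0)"
      unfolding o_def zero_ereal_def
      by (subst at_right_ereal, subst filterlim_filtermap) simp
    \<comment> \<open>Dividing both arguments by t splits off \<open>ln t\<close>, which cancels in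
      the difference; the quotients tend to 1.\<close>
    have *: "((\<lambda>t::real. Ln (1 - \<i> * of_real x * of_real (1 / t))) \<longlongrightarrow> Ln (1 - \<i> * of_real x * of_real 0)) at_top" for x
    proof -
      have "((\<lambda>t::real. 1 / t) \<longlongrightarrow> 0) at_top" by real_asymp
      then show ?thesis by (intro tendsto_intros) auto
    qed
    have "((\<lambda>t::real. (Ln (1 - \<i> * of_real p * of_real (1 / t)) - Ln (1 - \<i> * of_real q * of_real (1 / t))) / (2 * \<i> * of_real c))
        \<longlongrightarrow> (Ln (1 - \<i> * of_real p * of_real 0) - Ln (1 - \<i> * of_real q * of_real 0)) / (2 * \<i> * of_real c)) at_top"
      using c0 by (intro tendsto_intros *) auto
    moreover have "\<forall>\<^sub>F t in at_top. (Ln (1 - \<i> * of_real p * of_real (1 / t)) - Ln (1 - \<i> * of_real q * of_real (1 / t))) / (2 * \<i> * of_real c) = F t"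
      using eventually_gt_at_top[of 0]
    proof eventually_elim
      case (elim t)
      have "Ln (of_real t - \<i> * of_real x) = of_real (ln t) + Ln (1 - \<i> * of_real x * of_real (1 / t))" for x
      proof -
        have "of_real t - \<i> * of_real x = of_real t * (1 - \<i> * of_real x * of_real (1 / t))"
          using elim by (simp add: field_simps)
        moreover have "1 - \<i> * of_real x * of_real (1 / t) \<noteq> (0::complex)"
          by (simp add: complex_eq_iff)
        ultimately show ?thesis using elim by (simp add: Ln_times_of_real Ln_of_real)
      qed
      then show ?case by (simp add: F_def)
    qed
    ultimately show "((F \<circ> real_of_ereal) \<longlongrightarrow> 0) (at_left \<infinity>)"
      unfolding o_def
      by (subst at_left_PInf, subst filterlim_filtermap) (simp add: tendsto_cong)
  qed (use int in \<open>auto simp: ei\<close>)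
  \<comment> \<open>At 0 the arguments are \<open>- \<i> * p\<close> and \<open>- \<i> * q\<close>,
    on opposite halves of the imaginary axis: the logarithms of the moduli differ by
    \<open>2 * arsinh s\<close>, since \<open>p * (- q) = 1\<close>, and the angles differ by
    \<open>- pi\<close>.\<close>
  also have "0 - F 0 = (pi / 2 + \<i> * of_real (arsinh s)) / of_real c"
  proof -
    have "ln p = arsinh s" by (simp add: p_def c_def arsinh_real_def add.commute)
    moreover have "p * (- q) = 1" using c2 by (simp add: p_def q_def algebra_simps power2_eq_square)
    then have "ln (- q) = - ln p" using pq by (metis ln_mult_pos ln_one add_eq_0_iff neg_0_less_iff_less)
    moreover have "Ln (- (\<i> * of_real p)) = of_real (ln p) - \<i> * of_real pi / 2"
      using pq(1) Ln_times_of_real[of p "- \<i>"] by (simp add: mult.commute Ln_of_real)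
    moreover have "Ln (- (\<i> * of_real q)) = of_real (ln (- q)) + \<i> * of_real pi / 2"
      using pq(2) Ln_times_of_real[of "- q" "\<i>"] Ln_of_real[of "- q"] by (simp add: mult.commute)
    ultimately have "F 0 = (of_real (arsinh s) - \<i> * of_real pi / 2 - (of_real (- arsinh s) + \<i> * of_real pi / 2)) / (2 * \<i> * of_real c)"
      by (simp add: F_def)
    also have "\<dots> = - ((pi / 2 + \<i> * of_real (arsinh s)) / of_real c)"
      using c0 by (simp add: field_simps)
    finally show ?thesis by simp
  qed
  finally show "(LBINT t:{0<..}. ?g t) = (pi / 2 + \<i> * of_real (arsinh s)) / of_real (sqrt (1 + s\<^sup>2))"
    by (simp add: interval_lebesgue_integral_def ei c_def)
qed

text \<open>The common dominating function for exchanging the integrals over r and s: it is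
  nonnegative, and its integral over r is the integrable Cauchy weight.\<close>

lemma
  fixes s :: real
  shows integrable_mult_exp_quadratic: "integrable (lborel \<Otimes>\<^sub>M lborel) (\<lambda>(r::real, s::real). indicator {0<..} r * (r * exp (- (r\<^sup>2 * (1 + s\<^sup>2)) / 2)))"
  (is "integrable _ (\<lambda>(r, s). ?h r s)")
  and integral_mult_exp_quadratic:
  "(LBINT r. indicator {0<..} r * (r * exp (- (r\<^sup>2 * (1 + s\<^sup>2)) / 2))) = 1 / (1 + s\<^sup>2)"
proof -
  have c: "1 + s\<^sup>2 > 0" for s :: real by (simp add: add_pos_nonneg)
  have cplx: "(\<lambda>r. indicator {0<..} r *\<^sub>R (of_real r * exp (- (of_real (r\<^sup>2) * of_real (1 + s\<^sup>2)) / 2)))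
      = (\<lambda>r. complex_of_real (?h r s))" for s
    by (auto simp: fun_eq_iff indicator_def simp flip: exp_of_real)
  have int: "integrable lborel (\<lambda>r. ?h r s)" for s
    using LBINT_mult_exp_neg_square(1)[of "of_real (1 + s\<^sup>2)"] c[of s]
    unfolding set_integrable_def cplx complex_of_real_integrable_eq by simp
  have val: "(LBINT r. ?h r s) = 1 / (1 + s\<^sup>2)" for s
  proof -
    have "complex_of_real (LBINT r. ?h r s) = of_real (1 / (1 + s\<^sup>2))"
      using LBINT_mult_exp_neg_square(2)[of "of_real (1 + s\<^sup>2)"] c[of s]
      unfolding set_lebesgue_integral_def cplx integral_complex_of_real by simp
    then show ?thesis by (simp only: of_real_eq_iff)
  qed
  then show "(LBINT r. ?h r s) = 1 / (1 + s\<^sup>2)" .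
  have nonneg: "0 \<le> ?h r s" for r s by (auto simp: indicator_def)
  have nn: "(\<integral>\<^sup>+r. ennreal (?h r s) \<partial>lborel) = ennreal (1 / (1 + s\<^sup>2))" for s
    using nn_integral_eq_integral[OF int[of s] AE_I2[OF nonneg]] by (simp only: val)
  have ei: "einterval (-\<infinity>) \<infinity> = UNIV" by (auto simp: einterval_def)
  have "set_integrable lborel (einterval (-\<infinity>) \<infinity>) (\<lambda>t. 1 / (1 + t\<^sup>2))"
  proof (rule interval_integral_FTC_nonneg)
    show "DERIV arctan x :> 1 / (1 + x\<^sup>2)" for x
      by (auto intro!: derivative_eq_intros simp: field_simps)
    show "((arctan \<circ> real_of_ereal) \<longlongrightarrow> - (pi / 2)) (at_right (-\<infinity>))"
      unfolding o_def
      by (subst at_right_MInf, subst filterlim_filtermap, simp) (rule tendsto_arctan_at_bot)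
    show "((arctan \<circ> real_of_ereal) \<longlongrightarrow> pi / 2) (at_left \<infinity>)"
      unfolding o_def
      by (subst at_left_PInf, subst filterlim_filtermap, simp) (rule tendsto_arctan_at_top)
    show "isCont (\<lambda>t. 1 / (1 + t\<^sup>2)) x" for x :: real
      using c[of x] by (intro continuous_intros) auto
  qed (auto simp: add_nonneg_nonneg)
  then have "integrable lborel (\<lambda>s::real. 1 / (1 + s\<^sup>2))"
    by (simp add: ei set_integrable_def)
  then have fin: "(\<integral>\<^sup>+s. ennreal (1 / (1 + s\<^sup>2)) \<partial>lborel) < \<infinity>"
    by (subst nn_integral_eq_integral) (auto simp: add_nonneg_nonneg)
  show "integrable (lborel \<Otimes>\<^sub>M lborel) (\<lambda>(r, s). ?h r s)"
  proof (rule integrableI_nonneg)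
    have "(\<integral>\<^sup>+x. ennreal (case x of (r, s) \<Rightarrow> ?h r s) \<partial>(lborel \<Otimes>\<^sub>M lborel))
        = (\<integral>\<^sup>+s. \<integral>\<^sup>+r. ennreal (?h r s) \<partial>lborel \<partial>lborel)"
      by (subst lborel_pair.nn_integral_snd[symmetric]) (auto simp: case_prod_beta)
    also have "\<dots> < \<infinity>" using fin by (simp only: nn)
    finally show "(\<integral>\<^sup>+x. ennreal (case x of (r, s) \<Rightarrow> ?h r s) \<partial>(lborel \<Otimes>\<^sub>M lborel)) < \<infinity>" .
  qed (use nonneg in auto)
qed

lemma integrable_inverse_one_plus_square: "integrable lborel (\<lambda>s::real. 1 / (1 + s\<^sup>2))"
  using lborel_pair.integrable_snd[OF integrable_mult_exp_quadratic]
  by (simp only: integral_mult_exp_quadratic)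

lemma integrable_exp_neg_square_prod:
  "integrable lborel (\<lambda>x::real \<times> real. exp (- ((fst x)\<^sup>2 + (snd x)\<^sup>2) / 2))"
proof -
  have "integrable (lborel \<Otimes>\<^sub>M lborel) (\<lambda>(x::real, y::real). exp (- x\<^sup>2 / 2) * exp (- y\<^sup>2 / 2))"
    using integrable_exp_neg_square
    by (intro lborel_pair.Fubini_integrable) (auto simp: abs_mult)
  moreover have "exp (- x\<^sup>2 / 2) * exp (- y\<^sup>2 / 2) = exp (- (x\<^sup>2 + y\<^sup>2) / 2)" for x y :: real
    by (simp add: exp_add[symmetric] add_divide_distrib[symmetric])
  ultimately show ?thesis by (simp only: lborel_prod case_prod_unfold)
qed

lemma lborel_integral_uminus:
  fixes f :: "'b::euclidean_space \<Rightarrow> 'c::{banach, second_countable_topology}"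
  assumes [measurable]: "f \<in> borel_measurable borel"
  shows "(\<integral>x. f (- x) \<partial>lborel) = (\<integral>x. f x \<partial>lborel)"
proof -
  have "lborel = distr lborel borel (uminus :: 'b \<Rightarrow> 'b)"
    using lborel_affine[of "-1" "0::'b"] by (simp add: density_1 one_ennreal_def[symmetric])
  then have "(\<integral>x. f x \<partial>lborel) = (\<integral>x. f x \<partial>(distr lborel borel uminus))" by simp
  also have "\<dots> = (\<integral>x. f (- x) \<partial>lborel)" by (rule integral_distr) auto
  finally show ?thesis ..
qed

section \<open>Gaussian integrals with a bilinear phase\<close>

text \<open>The contribution of a single coordinate pair: its Gaussian weight and its share of the
  phase of \<open>s * (m \<bullet> a)\<close>.\<close>

definition quad_gauss :: "real \<Rightarrow> real \<times> real \<Rightarrow> complex" where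
  "quad_gauss s x = of_real (exp (- ((fst x)\<^sup>2 + (snd x)\<^sup>2) / 2)) * cis (s * (fst x * snd x))"

lemma measurable_cis [measurable]: "cis \<in> borel_measurable borel"
  by (intro borel_measurable_continuous_onI continuous_intros)

lemma measurable_quad_gauss [measurable]: "quad_gauss s \<in> borel_measurable borel"
  unfolding quad_gauss_def[abs_def] borel_prod[symmetric] by measurable

lemma norm_quad_gauss: "norm (quad_gauss s x) = exp (- ((fst x)\<^sup>2 + (snd x)\<^sup>2) / 2)"
  by (simp add: quad_gauss_def norm_mult)

lemma integrable_quad_gauss: "integrable lborel (quad_gauss s)"
  by (rule Bochner_Integration.integrable_bound[OF integrable_exp_neg_square_prod])
     (auto simp: norm_quad_gauss)

lemma integrable_indicator_quad_gauss:
  assumes [measurable]: "A \<in> sets borel"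
  shows "integrable lborel (\<lambda>x. indicator A x *\<^sub>R quad_gauss s x)"
  by (rule Bochner_Integration.integrable_bound[OF integrable_quad_gauss[of s]])
     (auto simp: indicator_def)

text \<open>With \<open>a = t m\<close> the integral over a quadrant becomes that of
  \<open>1 / (1 + t\<^sup>2 - 2 \<i> s t)\<close>.\<close>

lemma integral_quad_gauss_quadrant:
  "(\<integral>x. indicator ({0<..} \<times> {0<..}) x *\<^sub>R quad_gauss s x \<partial>lborel)
    = (pi / 2 + \<i> * of_real (arsinh s)) / of_real (sqrt (1 + s\<^sup>2))"
proof -
  define h where "h m t = indicator {0<..} m *\<^sub>R (indicator {0<..} t *\<^sub>R
     (of_real m * exp (- (of_real (m\<^sup>2) * (1 + of_real (t\<^sup>2) - 2 * \<i> * of_real s * of_real t)) / 2)))" for m t :: real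
  let ?f = "\<lambda>x. indicator ({0<..} \<times> {0<..}) x *\<^sub>R quad_gauss s x"
  have [measurable]: "{0<..} \<times> {0<..} \<in> sets (borel :: (real \<times> real) measure)"
    by (intro borel_open open_Times) auto
  have "(\<integral>x. ?f x \<partial>lborel) = (LBINT m. LBINT a. ?f (m, a))"
    using lborel_pair.integral_fst'[of ?f] integrable_indicator_quad_gauss[of "{0<..} \<times> {0<..}" s]
    by (simp add: lborel_prod)
  also have "\<dots> = (LBINT m. LBINT t. h m t)"
  proof (rule Bochner_Integration.integral_cong[OF refl])
    fix m :: real
    show "(LBINT a. ?f (m, a)) = (LBINT t. h m t)"
    proof (cases "m > 0")
      case True
      have "(LBINT a. ?f (m, a)) = m *\<^sub>R (LBINT t. ?f (m, m * t))"
        using True by (subst lborel_integral_real_affine[where c = m and t = 0]) auto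
      also have "\<dots> = (LBINT t. m *\<^sub>R ?f (m, m * t))"
        by (simp only: integral_scaleR_right)
      also have "\<dots> = (LBINT t. h m t)"
      proof (rule Bochner_Integration.integral_cong[OF refl])
        fix t :: real
        have "of_real (exp (- (m\<^sup>2 + (m * t)\<^sup>2) / 2)) * cis (s * (m * (m * t)))
          = exp (- (of_real (m\<^sup>2) * (1 + of_real (t\<^sup>2) - 2 * \<i> * of_real s * of_real t)) / 2)"
          unfolding cis_conv_exp exp_of_real[symmetric] exp_add[symmetric]
          by (rule arg_cong[where f = exp]) (simp add: field_simps power2_eq_square)
        then show "m *\<^sub>R ?f (m, m * t) = h m t"
          using True by (auto simp: h_def quad_gauss_def indicator_def zero_less_mult_iff scaleR_conv_of_real)
      qed
      finally show ?thesis .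
    qed (simp add: h_def)
  qed
  also have "\<dots> = (LBINT t. LBINT m. h m t)"
  proof (rule lborel_pair.Fubini_integral[symmetric])
    \<comment> \<open>The phase has modulus 1, so \<open>h\<close> is dominated by the real kernel
      of \<open>integrable_mult_exp_quadratic\<close>.\<close>
    show "integrable (lborel \<Otimes>\<^sub>M lborel) (\<lambda>(m, t). h m t)"
    proof (rule Bochner_Integration.integrable_bound[OF integrable_mult_exp_quadratic])
      show "(\<lambda>(m, t). h m t) \<in> borel_measurable (lborel \<Otimes>\<^sub>M lborel)"
        unfolding h_def by measurable
    qed (auto simp: h_def indicator_def norm_mult)
  qed
  also have "\<dots> = (LBINT t:{0<..}. 1 / (1 + of_real (t\<^sup>2) - 2 * \<i> * of_real s * of_real t))"
    unfolding set_lebesgue_integral_def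
  proof (rule Bochner_Integration.integral_cong[OF refl])
    fix t :: real
    have "(LBINT m. h m t) = (LBINT m. indicator {0<..} t *\<^sub>R (indicator {0<..} m *\<^sub>R (of_real m * exp (- (of_real (m\<^sup>2) * (1 + of_real (t\<^sup>2) - 2 * \<i> * of_real s * of_real t)) / 2))))"
      by (simp add: h_def mult_ac)
    also have "\<dots> = indicator {0<..} t *\<^sub>R (LBINT m:{0<..}. of_real m * exp (- (of_real (m\<^sup>2) * (1 + of_real (t\<^sup>2) - 2 * \<i> * of_real s * of_real t)) / 2))"
      by (simp only: set_lebesgue_integral_def integral_scaleR_right)
    also have "\<dots> = indicator {0<..} t *\<^sub>R (1 / (1 + of_real (t\<^sup>2) - 2 * \<i> * of_real s * of_real t))"
      by (subst LBINT_mult_exp_neg_square(2)) (auto simp: add_pos_nonneg)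
    finally show "(LBINT m. h m t) = indicator {0<..} t *\<^sub>R (1 / (1 + of_real (t\<^sup>2) - 2 * \<i> * of_real s * of_real t))" .
  qed
  finally show ?thesis unfolding LBINT_inverse_quadratic(2) .
qed

text \<open>The domain is the union of the first and the third quadrant, which contribute equally
  because the integrand is invariant under \<open>x \<mapsto> - x\<close>.\<close>

lemma integral_quad_gauss_pos:
  "(\<integral>x. indicator {x. fst x * snd x > 0} x *\<^sub>R quad_gauss s x \<partial>lborel)
    = 2 * (pi / 2 + \<i> * of_real (arsinh s)) / of_real (sqrt (1 + s\<^sup>2))"
proof -
  let ?Q = "{0<..} \<times> {0<..} :: (real \<times> real) set"
  have [measurable]: "?Q \<in> sets borel" by (intro borel_open open_Times) auto
  have [measurable]: "uminus -` ?Q \<in> sets borel"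
    by (rule measurable_sets_borel[of _ borel]) auto
  have split: "indicator {x. fst x * snd x > 0} x *\<^sub>R quad_gauss s x
      = indicator ?Q x *\<^sub>R quad_gauss s x + indicator (uminus -` ?Q) x *\<^sub>R quad_gauss s x" for x
    by (cases x) (auto simp: indicator_def zero_less_mult_iff)
  have meas: "(\<lambda>x. indicator ?Q x *\<^sub>R quad_gauss s x) \<in> borel_measurable borel" by measurable
  have refl: "(\<integral>x. indicator (uminus -` ?Q) x *\<^sub>R quad_gauss s x \<partial>lborel) = (\<integral>x. indicator ?Q x *\<^sub>R quad_gauss s x \<partial>lborel)"
    using lborel_integral_uminus[OF meas]
    by (simp add: quad_gauss_def indicator_vimage)
  show ?thesis
    unfolding split
    by (subst Bochner_Integration.integral_add)
       (auto intro!: integrable_indicator_quad_gauss simp: refl integral_quad_gauss_quadrant)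
qed

lemma lborel_integral_reflect_fst:
  fixes f :: "real \<times> real \<Rightarrow> complex"
  assumes "integrable lborel f"
  shows "(\<integral>x. f (- fst x, snd x) \<partial>lborel) = (\<integral>x. f x \<partial>lborel)"
proof -
  have [measurable]: "f \<in> borel_measurable borel" using assms by auto
  have "lborel = distr lborel borel (\<lambda>x::real \<times> real. (- fst x, snd x))"
  proof (rule lborel_eqI)
    fix l u :: "real \<times> real"
    assume le: "\<And>b. b \<in> Basis \<Longrightarrow> l \<bullet> b \<le> u \<bullet> b"
    have [measurable]: "(\<lambda>x::real \<times> real. (- fst x, snd x)) \<in> borel_measurable borel"
      by (intro borel_measurable_continuous_onI continuous_intros)
    have "(\<lambda>x. (- fst x, snd x)) -` box l u = box (- fst u, snd l) (- fst l, snd u)"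
      by (auto simp: box_def Basis_prod_def inner_prod_def)
    then show "emeasure (distr lborel borel (\<lambda>x. (- fst x, snd x))) (box l u) = ennreal (prod ((\<bullet>) (u - l)) Basis)"
      using le[of "(1, 0)"] le[of "(0, 1)"] by (subst emeasure_distr)
        (auto simp: emeasure_lborel_box_eq Basis_prod_def prod.union_disjoint inner_prod_def)
  qed simp
  then have "(\<integral>x. f x \<partial>lborel) = (\<integral>x. f x \<partial>(distr lborel borel (\<lambda>x::real \<times> real. (- fst x, snd x))))" by simp
  also have "\<dots> = (\<integral>x. f (- fst x, snd x) \<partial>lborel)"
    by (rule integral_distr) (auto intro!: borel_measurable_continuous_onI continuous_intros)
  finally show ?thesis ..
qed

text \<open>Reflecting the first coordinate exchanges the two signs of the product and turns s into
  - s. As arsinh is odd, its two contributions cancel and only \<pi> survives: this is the factor of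
  a coordinate without sign condition.\<close>

lemma integral_quad_gauss:
  "(\<integral>x. quad_gauss s x \<partial>lborel) = 2 * of_real pi / of_real (sqrt (1 + s\<^sup>2))"
proof -
  let ?P = "{x. fst x * snd x > (0::real)}" and ?N = "{x. fst x * snd x < (0::real)}"
  have [measurable]: "?P \<in> sets borel" "?N \<in> sets borel"
    by (intro borel_open open_Collect_less continuous_intros)+
  have "AE x in lborel \<Otimes>\<^sub>M lborel. fst x * snd x \<noteq> (0::real)"
  proof (rule lborel_pair.AE_pair_measure)
    show "{x \<in> space (lborel \<Otimes>\<^sub>M lborel). fst x * snd x \<noteq> (0::real)} \<in> sets (lborel \<Otimes>\<^sub>M lborel)"
      by measurable
    show "AE x in lborel. AE y in lborel. fst (x, y) * snd (x, y) \<noteq> (0::real)"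
      using AE_lborel_singleton[of 0]
    proof eventually_elim
      case (elim x)
      show ?case using AE_lborel_singleton[of 0] by eventually_elim (use elim in simp)
    qed
  qed
  then have AE: "AE x in lborel. fst x * snd x \<noteq> (0::real)" by (simp only: lborel_prod)
  have "(\<integral>x. quad_gauss s x \<partial>lborel) = (\<integral>x. indicator ?P x *\<^sub>R quad_gauss s x + indicator ?N x *\<^sub>R quad_gauss s x \<partial>lborel)"
  proof (rule Bochner_Integration.integral_cong_AE)
    show "AE x in lborel. quad_gauss s x = indicator ?P x *\<^sub>R quad_gauss s x + indicator ?N x *\<^sub>R quad_gauss s x"
      using AE
    proof eventually_elim
      case (elim x)
      then show ?case by (cases "fst x * snd x > 0") (simp_all add: indicator_def)
    qed
  qed simp_all
  also have "\<dots> = (\<integral>x. indicator ?P x *\<^sub>R quad_gauss s x \<partial>lborel) + (\<integral>x. indicator ?N x *\<^sub>R quad_gauss s x \<partial>lborel)"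
    by (rule Bochner_Integration.integral_add) (auto intro!: integrable_indicator_quad_gauss)
  also have "(\<integral>x. indicator ?N x *\<^sub>R quad_gauss s x \<partial>lborel) = (\<integral>x. indicator ?P x *\<^sub>R quad_gauss (- s) x \<partial>lborel)"
  proof -
    have "indicator ?P (- fst x, snd x) *\<^sub>R quad_gauss (- s) (- fst x, snd x) = indicator ?N x *\<^sub>R quad_gauss s x" for x
      by (simp add: quad_gauss_def indicator_def)
    then show ?thesis
      using lborel_integral_reflect_fst[OF integrable_indicator_quad_gauss[of ?P "- s"]] by simp
  qed
  finally show ?thesis
    by (simp add: integral_quad_gauss_pos arsinh_minus_real add_divide_distrib[symmetric] diff_divide_distrib[symmetric])
qed

text \<open>This is \<open>sqrt (pi / 2) * exp (- \<bar>X\<bar>)\<close>, kept as a Fourier integral because the integration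
  over s is carried out last.\<close>

definition stable_kernel :: "real \<Rightarrow> real" where
  "stable_kernel X = (1 / sqrt (2 * pi)) * (LBINT s. cos (s * X) / (1 + s\<^sup>2))"

text \<open>A rescaled real part of the characteristic function of the standard normal law.\<close>

lemma integral_cos_exp_neg_square:
  assumes r: "r > 0"
  shows "(LBINT s. cos (s * X) * exp (- (s\<^sup>2 * r\<^sup>2) / 2)) = sqrt (2 * pi) / r * exp (- X\<^sup>2 / (2 * r\<^sup>2))"
proof -
  have "(CLINT y|std_normal_distribution. iexp (X / r * y)) = complex_of_real (exp (- (X / r)\<^sup>2 / 2))"
    using fun_cong[OF char_std_normal_distribution, of "X / r"] by (simp add: char_def)
  then have "(LBINT y. normal_density 0 1 y *\<^sub>R iexp (X / r * y)) = complex_of_real (exp (- (X / r)\<^sup>2 / 2))"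
    by (subst (asm) integral_density) auto
  then have "Re (LBINT y. normal_density 0 1 y *\<^sub>R iexp (X / r * y)) = exp (- (X / r)\<^sup>2 / 2)"
    by (simp only: Re_complex_of_real)
  moreover have "integrable lborel (\<lambda>y. normal_density 0 1 y *\<^sub>R iexp (X / r * y))"
    by (rule Bochner_Integration.integrable_bound[of _ "normal_density 0 1"]) auto
  ultimately have n: "(LBINT y. normal_density 0 1 y * cos (X / r * y)) = exp (- (X / r)\<^sup>2 / 2)"
    by (subst (asm) integral_Re[symmetric]) (auto simp: Re_exp)
  have "(LBINT s. cos (s * X) * exp (- (s\<^sup>2 * r\<^sup>2) / 2)) = (1 / r) *\<^sub>R (LBINT y. cos (y / r * X) * exp (- ((y / r)\<^sup>2 * r\<^sup>2) / 2))"
    using r by (subst lborel_integral_real_affine[where c = "1 / r" and t = 0]) auto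
  also have "\<dots> = (1 / r) * (LBINT y. sqrt (2 * pi) * (normal_density 0 1 y * cos (X / r * y)))"
    using r by (simp add: normal_density_def power_divide mult_ac)
  also have "\<dots> = sqrt (2 * pi) / r * exp (- (X / r)\<^sup>2 / 2)"
    by (simp only: integral_mult_right_zero n) simp
  finally show ?thesis by (simp add: power_divide mult.commute)
qed

text \<open>One double integral in r and s is evaluated in both orders: over s first, the Gaussian
  Fourier transform produces \<open>exp (- X\<^sup>2 / (2 * r\<^sup>2))\<close>; over r first, the
  Cauchy weight of \<open>stable_kernel\<close> appears.\<close>

lemma
  shows stable_kernel_nonneg: "0 \<le> stable_kernel X"
    and nn_integral_stable_kernel: "(\<integral>\<^sup>+r. ennreal (exp (- r\<^sup>2 / 2 - X\<^sup>2 / (2 * r\<^sup>2))) * indicator {0<..} r \<partial>lborel) = ennreal (stable_kernel X)"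
proof -
  define w where "w r s = indicator {0<..} r * (r * exp (- (r\<^sup>2 * (1 + s\<^sup>2)) / 2)) * cos (s * X)" for r s :: real
  have int: "integrable (lborel \<Otimes>\<^sub>M lborel) (\<lambda>(r, s). w r s)"
  proof (rule Bochner_Integration.integrable_bound[OF integrable_mult_exp_quadratic])
    show "(\<lambda>(r, s). w r s) \<in> borel_measurable (lborel \<Otimes>\<^sub>M lborel)"
      unfolding w_def by measurable
  qed (auto simp: w_def indicator_def abs_mult intro!: mult_left_le)
  have "(LBINT s. w r s) = sqrt (2 * pi) * (exp (- r\<^sup>2 / 2 - X\<^sup>2 / (2 * r\<^sup>2)) * indicator {0<..} r)" for r
  proof (cases "r > 0")
    case True
    have "w r s = (r * exp (- r\<^sup>2 / 2)) * (cos (s * X) * exp (- (s\<^sup>2 * r\<^sup>2) / 2))" for s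
    proof -
      have "exp (- (r\<^sup>2 * (1 + s\<^sup>2)) / 2) = exp (- r\<^sup>2 / 2) * exp (- (s\<^sup>2 * r\<^sup>2) / 2)"
        by (simp add: exp_add[symmetric] field_simps)
      then show ?thesis using True by (simp add: w_def)
    qed
    then have "(LBINT s. w r s) = (r * exp (- r\<^sup>2 / 2)) * (sqrt (2 * pi) / r * exp (- X\<^sup>2 / (2 * r\<^sup>2)))"
      by (simp only: integral_mult_right_zero integral_cos_exp_neg_square[OF True])
    also have "\<dots> = sqrt (2 * pi) * (exp (- r\<^sup>2 / 2) * exp (- X\<^sup>2 / (2 * r\<^sup>2)))"
      using True by simp
    also have "exp (- r\<^sup>2 / 2) * exp (- X\<^sup>2 / (2 * r\<^sup>2)) = exp (- r\<^sup>2 / 2 - X\<^sup>2 / (2 * r\<^sup>2))"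
      by (simp add: exp_add[symmetric])
    finally show ?thesis using True by simp
  qed (simp add: w_def)
  note inner = this
  have "integrable lborel (\<lambda>r. 1 / sqrt (2 * pi) * (LBINT s. w r s))"
    using lborel_pair.integrable_fst[OF int] by (rule integrable_mult_right)
  moreover have "1 / sqrt (2 * pi) * (sqrt (2 * pi) * x) = x" for x by simp
  ultimately have int_r: "integrable lborel (\<lambda>r. exp (- r\<^sup>2 / 2 - X\<^sup>2 / (2 * r\<^sup>2)) * indicator {0<..} r)"
    by (simp only: inner)
  have "(LBINT r. LBINT s. w r s) = (LBINT s. LBINT r. w r s)"
    using lborel_pair.Fubini_integral[OF int] ..
  also have "\<dots> = (LBINT s. cos (s * X) / (1 + s\<^sup>2))"
    unfolding w_def integral_mult_left_zero integral_mult_exp_quadratic by simp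
  finally have "sqrt (2 * pi) * (LBINT r. exp (- r\<^sup>2 / 2 - X\<^sup>2 / (2 * r\<^sup>2)) * indicator {0<..} r) = (LBINT s. cos (s * X) / (1 + s\<^sup>2))"
    unfolding inner by simp
  then have "(LBINT r. exp (- r\<^sup>2 / 2 - X\<^sup>2 / (2 * r\<^sup>2)) * indicator {0<..} r) = stable_kernel X"
    by (simp add: stable_kernel_def field_simps)
  then show "0 \<le> stable_kernel X"
    by (rule subst) (auto intro!: integral_nonneg_AE)
  moreover note \<open>(LBINT r. exp (- r\<^sup>2 / 2 - X\<^sup>2 / (2 * r\<^sup>2)) * indicator {0<..} r) = stable_kernel X\<close>
  moreover have "(\<integral>\<^sup>+r. ennreal (exp (- r\<^sup>2 / 2 - X\<^sup>2 / (2 * r\<^sup>2))) * indicator {0<..} r \<partial>lborel)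
      = (\<integral>\<^sup>+r. ennreal (exp (- r\<^sup>2 / 2 - X\<^sup>2 / (2 * r\<^sup>2)) * indicator {0<..} r) \<partial>lborel)"
    by (intro nn_integral_cong) (auto simp: indicator_def)
  ultimately show "(\<integral>\<^sup>+r. ennreal (exp (- r\<^sup>2 / 2 - X\<^sup>2 / (2 * r\<^sup>2))) * indicator {0<..} r \<partial>lborel) = ennreal (stable_kernel X)"
    using nn_integral_eq_integral[OF int_r] by simp
qed

section \<open>Products over coordinate pairs and the integral over s\<close>

lemma
  fixes F :: "'n::finite \<Rightarrow> 'b::euclidean_space \<Rightarrow> 'c::{real_normed_field, banach, second_countable_topology}"
  assumes F: "\<And>i. integrable lborel (F i)"
  shows integrable_lborel_vec_prod: "integrable lborel (\<lambda>x. \<Prod>i\<in>UNIV. F i (x $ i))"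
    and integral_lborel_vec_prod: "(\<integral>x. (\<Prod>i\<in>UNIV. F i (x $ i)) \<partial>lborel) = (\<Prod>i\<in>UNIV. \<integral>y. F i y \<partial>lborel)"
proof -
  interpret product_sigma_finite "\<lambda>_::'n. lborel :: 'b measure" by standard
  have [measurable]: "F i \<in> borel_measurable borel" for i using F[of i] by auto
  have [measurable]: "(\<lambda>f. \<chi> i. f i) \<in> PiM UNIV (\<lambda>_::'n. lborel :: 'b measure) \<rightarrow>\<^sub>M borel"
    by measurable
  show "integrable lborel (\<lambda>x. \<Prod>i\<in>UNIV. F i (x $ i))"
    by (subst lborel_vec_eq_PiM, subst integrable_distr_eq)
       (auto intro!: product_integrable_prod F)
  show "(\<integral>x. (\<Prod>i\<in>UNIV. F i (x $ i)) \<partial>lborel) = (\<Prod>i\<in>UNIV. \<integral>y. F i y \<partial>lborel)"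
    by (subst lborel_vec_eq_PiM, subst integral_distr)
       (auto intro!: product_integral_prod F)
qed

text \<open>The exponent d + 2 collects one root from each of the d coordinates and two from the
  weight \<open>1 / (1 + s\<^sup>2)\<close> in \<open>stable_kernel\<close>.\<close>

definition arsinh_integrand :: "nat \<Rightarrow> nat \<Rightarrow> real \<Rightarrow> complex" where
  "arsinh_integrand l d s = (pi / 2 + \<i> * of_real (arsinh s)) ^ l / of_real (sqrt (1 + s\<^sup>2)) ^ (d + 2)"

lemma measurable_arsinh [measurable]: "arsinh \<in> borel_measurable (borel :: real measure)"
  by (intro borel_measurable_continuous_onI continuous_intros)

text \<open>No growth estimate for arsinh is made: by \<open>integral_quad_gauss_pos\<close> the
  base divided by one root is half an integral whose integrand is bounded by a fixed Gaussian, hence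
  bounded uniformly in s. The two roots left over give an integrable weight.\<close>

lemma integrable_arsinh_integrand:
  assumes "l \<le> d"
  shows "integrable lborel (arsinh_integrand l d)"
proof (rule Bochner_Integration.integrable_bound)
  define C where "C = (LBINT x. norm (quad_gauss 0 x))"
  have C: "norm (2 * (pi / 2 + \<i> * of_real (arsinh s)) / of_real (sqrt (1 + s\<^sup>2))) \<le> C" for s
  proof -
    have meas: "{x::real\<times>real. fst x * snd x > 0} \<in> sets borel"
      by (intro borel_open open_Collect_less continuous_intros)
    have "norm (\<integral>x. indicator {x. fst x * snd x > 0} x *\<^sub>R quad_gauss s x \<partial>lborel) \<le> C"
      unfolding C_def
      by (rule Bochner_Integration.integral_norm_bound_integral[OF integrable_indicator_quad_gauss[OF meas]
            integrable_norm[OF integrable_quad_gauss]])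
         (auto simp: norm_quad_gauss indicator_def)
    then show ?thesis by (simp only: integral_quad_gauss_pos)
  qed
  have C0: "0 \<le> C" unfolding C_def by (rule integral_nonneg_AE) auto
  show "integrable lborel (\<lambda>s::real. (C / 2) ^ l * (1 / (1 + s\<^sup>2)))"
    by (intro integrable_mult_right integrable_inverse_one_plus_square)
  show "AE s in lborel. norm (arsinh_integrand l d s) \<le> norm ((C / 2) ^ l * (1 / (1 + s\<^sup>2)))"
  proof (intro AE_I2)
    fix s :: real
    define c where "c = sqrt (1 + s\<^sup>2)"
    have c: "c \<ge> 1" by (simp add: c_def)
    have c2: "c ^ 2 = 1 + s\<^sup>2" by (simp add: c_def add_nonneg_nonneg)
    let ?z = "pi / 2 + \<i> * of_real (arsinh s)"
    have z: "norm ?z / c \<le> C / 2"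
    proof -
      have "norm (2 * ?z / of_real c) = 2 * (norm ?z / c)"
        unfolding norm_divide norm_mult norm_numeral norm_of_real using c by simp
      then show ?thesis using C[of s] unfolding c_def[symmetric] by linarith
    qed
    have "norm (arsinh_integrand l d s) = norm ?z ^ l / c ^ (d + 2)"
      unfolding arsinh_integrand_def c_def[symmetric] norm_divide norm_power using c by simp
    \<comment> \<open>As \<open>c \<ge> 1\<close> and \<open>l \<le> d\<close>, dropping surplus
      roots only enlarges the quotient; l of the remaining ones are paired with the l factors of the
      numerator.\<close>
    also have "\<dots> \<le> norm ?z ^ l / c ^ (l + 2)"
      using c assms by (intro divide_left_mono power_increasing mult_pos_pos) auto
    also have "\<dots> = (norm ?z / c) ^ l * (1 / (1 + s\<^sup>2))"
      using c2 by (simp add: power_add power_divide power2_eq_square)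
    also have "\<dots> \<le> (C / 2) ^ l * (1 / (1 + s\<^sup>2))"
      using z c by (intro mult_right_mono power_mono) (auto simp: add_nonneg_nonneg)
    finally show "norm (arsinh_integrand l d s) \<le> norm ((C / 2) ^ l * (1 / (1 + s\<^sup>2)))"
      using C0 by (simp add: add_nonneg_nonneg)
  qed
  show "arsinh_integrand l d \<in> borel_measurable lborel"
    unfolding arsinh_integrand_def[abs_def] by measurable
qed

text \<open>The windows \<open>{- sinh N..sinh N}\<close> correspond under \<open>s = sinh t\<close>
  to the vertical segments of the contour, so dominated convergence identifies the integral with the
  limit in \<open>integral_strip_tendsto\<close>.\<close>

lemma integral_arsinh_integrand:
  assumes "l \<le> d" "even (d - l)"
  shows "(\<integral>s. arsinh_integrand l d s \<partial>lborel) = of_real (pi * ((fps_X / fps_sin 1) ^ (d + 1)) $ (d - l))"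
proof -
  let ?f = "arsinh_integrand l d"
  have int: "integrable lborel ?f" by (rule integrable_arsinh_integrand[OF assms(1)])
  have cont: "continuous_on A ?f" for A
    unfolding arsinh_integrand_def
    by (intro continuous_intros) (auto simp: add_pos_nonneg[THEN less_imp_neq, symmetric])
  have lim: "((\<lambda>N. \<integral>s. indicator {-sinh N..sinh N} s *\<^sub>R ?f s \<partial>lborel) \<longlongrightarrow> (\<integral>s. ?f s \<partial>lborel)) at_top"
  proof (rule integral_dominated_convergence_at_top[where w = "\<lambda>s. norm (?f s)"])
    have sinh_top: "filterlim (sinh :: real \<Rightarrow> real) at_top at_top"
      unfolding sinh_field_def by real_asymp
    show "AE s in lborel. ((\<lambda>N. indicator {-sinh N..sinh N} s *\<^sub>R ?f s) \<longlongrightarrow> ?f s) at_top"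
    proof (intro AE_I2 tendsto_eventually)
      fix s :: real
      have "\<forall>\<^sub>F N in at_top. \<bar>s\<bar> \<le> sinh N"
        using sinh_top by (simp add: filterlim_at_top)
      then show "\<forall>\<^sub>F N in at_top. indicator {-sinh N..sinh N} s *\<^sub>R ?f s = ?f s"
        by eventually_elim (auto simp: indicator_def)
    qed
    show "\<forall>\<^sub>F N in at_top. AE s in lborel. norm (indicator {-sinh N..sinh N} s *\<^sub>R ?f s) \<le> norm (?f s)"
      by (intro always_eventually allI AE_I2) (auto simp: indicator_def)
  qed (use int in auto)
  have "(\<integral>s. indicator {-sinh N..sinh N} s *\<^sub>R ?f s \<partial>lborel)
      = integral {-N..N} (\<lambda>t. Complex (pi / 2) t ^ l / of_real (cosh t) ^ (d + 1))" if N: "N > 0" for N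
  proof -
    have "set_integrable lborel {-sinh N..sinh N} ?f"
      by (rule borel_integrable_atLeastAtMost') (rule cont)
    then have "(\<integral>s. indicator {-sinh N..sinh N} s *\<^sub>R ?f s \<partial>lborel) = integral {sinh (- N)..sinh N} ?f"
      using set_borel_integral_eq_integral(2) by (fastforce simp: set_lebesgue_integral_def)
    also have "((\<lambda>t. cosh t *\<^sub>R ?f (sinh t)) has_integral \<dots>) {-N..N}"
      using N by (intro has_integral_substitution[where c = "sinh (- N)" and d = "sinh N"] cont)
        (auto intro!: derivative_eq_intros simp del: sinh_minus)
    then have "integral {sinh (- N)..sinh N} ?f = integral {-N..N} (\<lambda>t. cosh t *\<^sub>R ?f (sinh t))"
      by (rule integral_unique[symmetric])
    \<comment> \<open>The factor \<open>cosh t\<close> of the substitution cancels one of the d + 2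
      roots, which leaves the exponent d + 1 of the contour integral.\<close>
    also have "(\<lambda>t. cosh t *\<^sub>R ?f (sinh t)) = (\<lambda>t. Complex (pi / 2) t ^ l / of_real (cosh t) ^ (d + 1))"
    proof
      fix t :: real
      have "sqrt (1 + (sinh t)\<^sup>2) = cosh t"
        by (rule real_sqrt_unique) (simp_all add: cosh_square_eq add.commute)
      moreover have "pi / 2 + \<i> * of_real t = Complex (pi / 2) t" by (simp add: complex_eq_iff)
      ultimately show "cosh t *\<^sub>R ?f (sinh t) = Complex (pi / 2) t ^ l / of_real (cosh t) ^ (d + 1)"
        by (simp add: arsinh_integrand_def scaleR_conv_of_real arsinh_sinh_real)
    qed
    finally show ?thesis .
  qed
  then have "\<forall>\<^sub>F N in at_top. integral {-N..N} (\<lambda>t. Complex (pi / 2) t ^ l / of_real (cosh t) ^ (d + 1))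
      = (\<integral>s. indicator {-sinh N..sinh N} s *\<^sub>R ?f s \<partial>lborel)"
    by (intro eventually_mono[OF eventually_gt_at_top[of 0]]) (rule sym)
  from tendsto_unique[OF _ lim Lim_transform_eventually[OF integral_strip_tendsto[OF assms] this]]
  show ?thesis by simp
qed

lemma prod_cis: "finite I \<Longrightarrow> (\<Prod>i\<in>I. cis (f i)) = cis (\<Sum>i\<in>I. f i)"
  by (induction I rule: finite_induct) (auto simp: cis_mult)

lemma measurable_stable_kernel [measurable]: "stable_kernel \<in> borel_measurable borel"
  unfolding stable_kernel_def by measurable

text \<open>With the Fourier form of \<open>stable_kernel\<close> inserted and s integrated last,
  the integral for fixed s is a product over the coordinates: \<open>integral_quad_gauss_pos\<close>
  for indices in \<open>J\<close>, \<open>integral_quad_gauss\<close> for the others. Real parts are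
  taken because the cosine is the real part of \<open>cis\<close>.\<close>

lemma nn_integral_gauss_signs:
  fixes J :: "'n::finite set"
  shows "(\<integral>\<^sup>+x. ennreal (\<Prod>i\<in>UNIV. exp (- ((fst (x $ i))\<^sup>2 + (snd (x $ i))\<^sup>2) / 2))
        * indicator {x. \<forall>i\<in>J. fst (x $ i) * snd (x $ i) > 0} x
        * ennreal (stable_kernel (\<Sum>i\<in>UNIV. fst (x $ i) * snd (x $ i))) \<partial>(lborel :: ((real\<times>real)^'n) measure))
    = ennreal (2 ^ CARD('n) / sqrt (2 * pi) * (pi ^ (CARD('n) - card J) * Re (\<integral>s. arsinh_integrand (card J) CARD('n) s \<partial>lborel)))"
    (is "?lhs = _")
proof -
  let ?n = "CARD('n)"
  define X where "X x = (\<Sum>i\<in>UNIV. fst (x $ i) * snd (x $ i))" for x :: "(real\<times>real)^'n"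
  define P where "P = {y::real\<times>real. fst y * snd y > 0}"
  have [measurable]: "P \<in> sets borel"
    unfolding P_def by (intro borel_open open_Collect_less continuous_intros)
  define e where "e i y = indicator (if i \<in> J then P else UNIV) y * exp (- ((fst y)\<^sup>2 + (snd y)\<^sup>2) / 2)" for i y
  define g where "g x = (\<Prod>i\<in>UNIV. e i (x $ i))" for x :: "(real\<times>real)^'n"
  have [measurable]: "(fst :: real \<times> real \<Rightarrow> real) \<in> borel_measurable borel" "(snd :: real \<times> real \<Rightarrow> real) \<in> borel_measurable borel"
    by (intro borel_measurable_continuous_onI continuous_intros)+
  have [measurable]: "X \<in> borel_measurable borel" unfolding X_def[abs_def] by measurable
  have [measurable]: "e i \<in> borel_measurable borel" for i
    unfolding e_def by (cases "i \<in> J"; simp)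
  have e_int: "integrable lborel (e i)" for i
    by (rule Bochner_Integration.integrable_bound[OF integrable_exp_neg_square_prod])
       (auto simp: e_def indicator_def)
  have g_int: "integrable lborel g"
    unfolding g_def by (rule integrable_lborel_vec_prod) (rule e_int)
  have g_nonneg: "0 \<le> g x" for x unfolding g_def by (intro prod_nonneg) (auto simp: e_def)
  have [measurable]: "g \<in> borel_measurable borel" using g_int by auto
  define h where "h s x = (\<Prod>i\<in>UNIV. indicator (if i \<in> J then P else UNIV) (x $ i) *\<^sub>R quad_gauss s (x $ i))" for s x
  have h_eq: "h s x = of_real (g x) * cis (s * X x)" for s x
    by (simp add: h_def g_def e_def X_def quad_gauss_def prod.distrib scaleR_conv_of_real
        prod_cis sum_distrib_left mult.assoc)
  \<comment> \<open>The factor \<open>1 + s\<^sup>2\<close> is displayed separately because the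
    Fourier weight divides it away in \<open>k_s\<close>.\<close>
  have h_integral: "(\<integral>x. h s x \<partial>lborel) = of_real (2 ^ ?n * pi ^ (?n - card J) * (1 + s\<^sup>2)) * arsinh_integrand (card J) ?n s" for s
  proof -
    define c where "c = sqrt (1 + s\<^sup>2)"
    have c: "c > 0" "c ^ 2 = 1 + s\<^sup>2" by (simp_all add: c_def add_pos_nonneg add_nonneg_nonneg)
    let ?z = "pi / 2 + \<i> * of_real (arsinh s)"
    have "(\<integral>x. h s x \<partial>lborel) = (\<Prod>i\<in>UNIV. \<integral>y. indicator (if i \<in> J then P else UNIV) y *\<^sub>R quad_gauss s y \<partial>lborel)"
      unfolding h_def by (rule integral_lborel_vec_prod) (auto intro!: integrable_indicator_quad_gauss integrable_quad_gauss)
    also have "\<dots> = (\<Prod>i\<in>UNIV. if i \<in> J then 2 * ?z / of_real c else 2 * of_real pi / of_real c)"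
      using integral_quad_gauss_pos[of s] integral_quad_gauss[of s]
      by (intro prod.cong refl) (simp add: c_def P_def)
    also have "\<dots> = (2 * ?z / of_real c) ^ card J * (2 * of_real pi / of_real c) ^ (?n - card J)"
      by (simp add: prod.If_cases Compl_eq_Diff_UNIV card_Diff_subset)
    also have "\<dots> = 2 ^ (card J + (?n - card J)) * of_real pi ^ (?n - card J) * ?z ^ card J / of_real c ^ (card J + (?n - card J))"
    proof -
      have "(2 * z / w) ^ a * (2 * p / w) ^ b = 2 ^ (a + b) * p ^ b * z ^ a / w ^ (a + b)" for z w p :: complex and a b
        by (simp add: power_divide power_mult_distrib power_add)
      then show ?thesis .
    qed
    also have "card J + (?n - card J) = ?n"
      by (simp add: card_mono)
    also have "2 ^ ?n * of_real pi ^ (?n - card J) * ?z ^ card J / of_real c ^ ?n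
      = 2 ^ ?n * of_real pi ^ (?n - card J) * of_real (c ^ 2) * (?z ^ card J / of_real c ^ (?n + 2))"
      using c(1) by (simp add: power_add field_simps power2_eq_square)
    finally show ?thesis
      by (simp add: arsinh_integrand_def c_def[symmetric] c(2))
  qed
  define k where "k x s = g x * (cos (s * X x) / (1 + s\<^sup>2))" for x s
  have k_int: "integrable (lborel \<Otimes>\<^sub>M lborel) (\<lambda>(x, s). k x s)"
  proof (rule Bochner_Integration.integrable_bound)
    show "integrable (lborel \<Otimes>\<^sub>M lborel) (\<lambda>(x, s). g x * (1 / (1 + s\<^sup>2)))"
    proof (rule lborel_pair.Fubini_integrable)
      have "integrable lborel (\<lambda>x. g x * (LBINT s. 1 / (1 + s\<^sup>2)))"
        using g_int by (rule integrable_mult_left)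
      moreover have "norm (case (x, y) of (x, s) \<Rightarrow> g x * (1 / (1 + s\<^sup>2))) = g x * (1 / (1 + y\<^sup>2))" for x y
        using g_nonneg by (simp add: abs_mult add_nonneg_nonneg)
      ultimately show "integrable lborel (\<lambda>x. LBINT y. norm (case (x, y) of (x, s) \<Rightarrow> g x * (1 / (1 + s\<^sup>2))))"
        by (simp only: integral_mult_right_zero)
    qed (use integrable_inverse_one_plus_square in \<open>auto intro!: AE_I2 integrable_mult_right simp del: times_divide_eq_right\<close>)
    show "(\<lambda>(x, s). k x s) \<in> borel_measurable (lborel \<Otimes>\<^sub>M lborel)"
      unfolding k_def by measurable
    show "AE p in lborel \<Otimes>\<^sub>M lborel. norm (case p of (x, s) \<Rightarrow> k x s) \<le> norm (case p of (x, s) \<Rightarrow> g x * (1 / (1 + s\<^sup>2)))"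
      using g_nonneg by (auto simp: k_def abs_mult add_nonneg_nonneg intro!: AE_I2 divide_right_mono mult_left_le)
  qed
  have k_x: "(LBINT s. k x s) = sqrt (2 * pi) * (g x * stable_kernel (X x))" for x
    unfolding k_def stable_kernel_def integral_mult_right_zero by simp
  have k_s: "(LBINT x. k x s) = 2 ^ ?n * pi ^ (?n - card J) * Re (arsinh_integrand (card J) ?n s)" for s
  proof -
    have "integrable lborel (h s)"
      unfolding h_def by (rule integrable_lborel_vec_prod) (auto intro!: integrable_indicator_quad_gauss integrable_quad_gauss)
    then have "(LBINT x. Re (h s x)) = Re (\<integral>x. h s x \<partial>lborel)" by (rule integral_Re)
    moreover have "(LBINT x. k x s) = (LBINT x. Re (h s x) / (1 + s\<^sup>2))"
      by (rule Bochner_Integration.integral_cong) (simp_all add: h_eq k_def)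
    ultimately have "(LBINT x. k x s) = Re (\<integral>x. h s x \<partial>lborel) / (1 + s\<^sup>2)"
      by (simp only: integral_divide_zero)
    moreover have "1 + s\<^sup>2 \<noteq> 0" by (metis add_pos_nonneg less_numeral_extra(1) less_numeral_extra(3) zero_le_power2)
    then have "Re (of_real (a * b * (1 + s\<^sup>2)) * z) / (1 + s\<^sup>2) = a * b * Re z" for a b z
      by (simp only: times_complex.sel Re_complex_of_real Im_complex_of_real) simp
    ultimately show ?thesis by (simp only: h_integral)
  qed
  have "(LBINT x. LBINT s. k x s) = (LBINT s. LBINT x. k x s)"
    using lborel_pair.Fubini_integral[OF k_int] ..
  then have "sqrt (2 * pi) * (LBINT x. g x * stable_kernel (X x))
      = 2 ^ ?n * pi ^ (?n - card J) * Re (\<integral>s. arsinh_integrand (card J) ?n s \<partial>lborel)"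
    unfolding k_x k_s
    by (simp add: integral_Re integrable_arsinh_integrand card_mono)
  then have val: "(LBINT x. g x * stable_kernel (X x)) = 2 ^ ?n / sqrt (2 * pi) * (pi ^ (?n - card J) * Re (\<integral>s. arsinh_integrand (card J) ?n s \<partial>lborel))"
    by (simp add: field_simps)
  have "integrable lborel (\<lambda>x. 1 / sqrt (2 * pi) * (LBINT s. k x s))"
    using lborel_pair.integrable_fst[OF k_int] by (rule integrable_mult_right)
  then have int: "integrable lborel (\<lambda>x. g x * stable_kernel (X x))"
    unfolding k_x by simp
  have "?lhs = (\<integral>\<^sup>+x. ennreal (g x * stable_kernel (X x)) \<partial>lborel)"
  proof (rule nn_integral_cong)
    fix x :: "(real\<times>real)^'n"
    have "g x = (\<Prod>i\<in>UNIV. exp (- ((fst (x $ i))\<^sup>2 + (snd (x $ i))\<^sup>2) / 2)) * indicator {x. \<forall>i\<in>J. fst (x $ i) * snd (x $ i) > 0} x"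
    proof -
      have "(\<Prod>i\<in>UNIV. indicator (if i \<in> J then P else UNIV) (x $ i)) = (indicator {x. \<forall>i\<in>J. fst (x $ i) * snd (x $ i) > 0} x :: real)"
      proof (cases "\<forall>i\<in>J. fst (x $ i) * snd (x $ i) > 0")
        case True
        then have "(\<Prod>i\<in>UNIV. indicator (if i \<in> J then P else UNIV) (x $ i)) = (\<Prod>i\<in>(UNIV :: 'n set). 1 :: real)"
          by (intro prod.cong) (auto simp: P_def)
        with True show ?thesis by simp
      next
        case False
        then obtain i where "i \<in> J" "x $ i \<notin> P" by (auto simp: P_def)
        then have "(\<Prod>i\<in>UNIV. indicator (if i \<in> J then P else UNIV) (x $ i)) = (0 :: real)"
          by (intro prod_zero finite bexI[of _ i]) simp_all
        with False show ?thesis by simp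
      qed
      then show ?thesis unfolding g_def e_def prod.distrib by (simp add: mult.commute)
    qed
    then show "ennreal (\<Prod>i\<in>UNIV. exp (- ((fst (x $ i))\<^sup>2 + (snd (x $ i))\<^sup>2) / 2))
        * indicator {x. \<forall>i\<in>J. fst (x $ i) * snd (x $ i) > 0} x
        * ennreal (stable_kernel (\<Sum>i\<in>UNIV. fst (x $ i) * snd (x $ i))) = ennreal (g x * stable_kernel (X x))"
      by (auto simp: X_def ennreal_mult prod_nonneg stable_kernel_nonneg indicator_def)
  qed
  also have "\<dots> = ennreal (LBINT x. g x * stable_kernel (X x))"
    using int by (rule nn_integral_eq_integral) (simp add: g_nonneg stable_kernel_nonneg)
  finally show ?thesis unfolding val .
qed

section \<open>Hyperplanes with Gaussian normals\<close>

lemma power_mult_exp_neg_square_bounded: "\<exists>C. \<forall>r\<ge>0::real. r ^ k * exp (- r\<^sup>2 / 2) \<le> C"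
proof -
  have "((\<lambda>r::real. r ^ k * exp (- r\<^sup>2 / 2)) \<longlongrightarrow> 0) at_top"
    by real_asymp
  then have "\<forall>\<^sub>F r::real in at_top. r ^ k * exp (- r\<^sup>2 / 2) < 1"
    by (rule order_tendstoD) simp
  then obtain R where R: "\<And>r::real. r \<ge> R \<Longrightarrow> r ^ k * exp (- r\<^sup>2 / 2) < 1"
    by (auto simp: eventually_at_top_linorder)
  have "r ^ k * exp (- r\<^sup>2 / 2) \<le> max 1 (\<bar>R\<bar> ^ k)" if "r \<ge> 0" for r :: real
  proof (cases "r \<ge> R")
    case True
    then show ?thesis using R[of r] by simp
  next
    case False
    then have "r ^ k * exp (- r\<^sup>2 / 2) \<le> \<bar>R\<bar> ^ k * 1"
      using that by (intro mult_mono power_mono) auto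
    then show ?thesis by simp
  qed
  then show ?thesis by blast
qed

text \<open>The constant in \<open>nn_integral_polar\<close> for the radial weight
  \<open>r ^ j * exp (- r\<^sup>2 / 2)\<close>. Only its being positive and finite matters, since it
  drops out of the final comparison.\<close>

definition polar_const :: "nat \<Rightarrow> nat \<Rightarrow> ennreal" where
  "polar_const d j = (\<integral>\<^sup>+t. ennreal ((1 / t) ^ j * exp (- (1 / t)\<^sup>2 / 2)) * ennreal (1 / t ^ (d + 1)) * indicator {0<..} t \<partial>lborel)"

lemma polar_const:
  assumes "d \<ge> 1"
  shows "polar_const d j \<noteq> 0" "polar_const d j \<noteq> \<top>"
proof -
  obtain C1 where C1: "\<And>r::real. r \<ge> 0 \<Longrightarrow> r ^ (j + (d + 1)) * exp (- r\<^sup>2 / 2) \<le> C1"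
    using power_mult_exp_neg_square_bounded by blast
  obtain C2 where C2: "\<And>r::real. r \<ge> 0 \<Longrightarrow> r ^ (j + (d - 1)) * exp (- r\<^sup>2 / 2) \<le> C2"
    using power_mult_exp_neg_square_bounded by blast
  \<comment> \<open>In terms of \<open>r = 1 / t\<close>, multiplication by
    \<open>1 + t\<^sup>2\<close> produces the powers j + d + 1 and j + d - 1 of r; \<open>C1\<close>
    and \<open>C2\<close> bound them against the Gaussian factor.\<close>
  define C where "C = C1 + C2"
  have C: "(1 / t) ^ j * exp (- (1 / t)\<^sup>2 / 2) * (1 / t ^ (d + 1)) \<le> C * (1 / (1 + t\<^sup>2))" if t: "t > 0" for t :: real
  proof -
    define r where "r = 1 / t"
    have r: "r > 0" using t by (simp add: r_def)
    have "(1 / t) ^ j * exp (- (1 / t)\<^sup>2 / 2) * (1 / t ^ (d + 1)) * (1 + t\<^sup>2) = r ^ (j + (d + 1)) * exp (- r\<^sup>2 / 2) * (1 + t\<^sup>2)"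
      by (simp add: r_def power_add power_one_over)
    also have "\<dots> = r ^ (j + (d + 1)) * exp (- r\<^sup>2 / 2) + r ^ (j + (d - 1)) * exp (- r\<^sup>2 / 2) * (r * t)\<^sup>2"
      using assms by (cases d) (simp_all add: algebra_simps power_add power2_eq_square)
    also have "\<dots> \<le> C"
      using C1[of r] C2[of r] r t by (simp add: C_def r_def)
    finally show ?thesis
      using add_pos_nonneg[of 1 "t\<^sup>2"] by (simp add: pos_le_divide_eq)
  qed
  have "polar_const d j \<le> (\<integral>\<^sup>+t. ennreal (norm (C * (1 / (1 + t\<^sup>2)))) \<partial>lborel)"
    unfolding polar_const_def
  proof (rule nn_integral_mono)
    fix t :: real
    show "ennreal ((1 / t) ^ j * exp (- (1 / t)\<^sup>2 / 2)) * ennreal (1 / t ^ (d + 1)) * indicator {0<..} t \<le> ennreal (norm (C * (1 / (1 + t\<^sup>2))))"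
    proof (cases "t > 0")
      case True
      then have "ennreal ((1 / t) ^ j * exp (- (1 / t)\<^sup>2 / 2)) * ennreal (1 / t ^ (d + 1)) * indicator {0<..} t
        = ennreal ((1 / t) ^ j * exp (- (1 / t)\<^sup>2 / 2) * (1 / t ^ (d + 1)))"
        by (subst ennreal_mult) auto
      also have "\<dots> \<le> ennreal (norm (C * (1 / (1 + t\<^sup>2))))"
        using C[OF True] unfolding real_norm_def by (intro ennreal_leI) linarith
      finally show ?thesis .
    qed simp
  qed
  also have "\<dots> < \<top>"
  proof -
    have "integrable lborel (\<lambda>t::real. C * (1 / (1 + t\<^sup>2)))"
      by (intro integrable_mult_right integrable_inverse_one_plus_square)
    then show ?thesis by (simp only: integrable_iff_bounded infinity_ennreal_def)
  qed
  finally show "polar_const d j \<noteq> \<top>" by simp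
  show "polar_const d j \<noteq> 0"
  proof
    assume "polar_const d j = 0"
    then have "AE t in lborel. ennreal ((1 / t) ^ j * exp (- (1 / t)\<^sup>2 / 2)) * ennreal (1 / t ^ (d + 1)) * indicator {0<..} (t::real) = 0"
      unfolding polar_const_def by (subst (asm) nn_integral_0_iff_AE) auto
    then have "AE t in lborel. \<not> (t::real) > 0"
      by (rule AE_mp) (auto intro!: AE_I2 simp: indicator_def ennreal_mult[symmetric] split: if_splits)
    then have "AE t in lborel. t \<notin> {0<..1::real}"
      by (rule AE_mp) (auto intro!: AE_I2)
    then have "{0<..1::real} \<in> null_sets lborel"
      by (subst AE_iff_null_sets) auto
    then show False by (simp add: null_sets_def)
  qed
qed

text \<open>For \<open>F\<close> homogeneous of degree 0 the radial and the angular integral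
  separate. Hence a radial profile \<open>H\<close> can be replaced by a Gaussian at the cost of a
  factor that does not depend on \<open>F\<close>, in particular not on sign conditions encoded in
  it.\<close>

lemma nn_integral_radial:
  fixes F :: "'b::euclidean_space \<Rightarrow> ennreal" and H :: "real \<Rightarrow> ennreal"
  assumes [measurable]: "F \<in> borel_measurable borel" "H \<in> borel_measurable borel"
    and hom: "\<And>t x. t > 0 \<Longrightarrow> F (t *\<^sub>R x) = F x"
  shows "polar_const DIM('b) 0 * (\<integral>\<^sup>+x. H (norm x) * F x \<partial>lborel)
    = (\<integral>\<^sup>+r. H r * ennreal (r ^ (DIM('b) - 1)) * indicator {0<..} r \<partial>lborel) * (\<integral>\<^sup>+x. ennreal (exp (- (norm x)\<^sup>2 / 2)) * F x \<partial>lborel)"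
proof -
  let ?d = "DIM('b)"
  have "polar_const ?d 0 * (\<integral>\<^sup>+x. H (norm x) * F x \<partial>lborel)
    = (\<integral>\<^sup>+g. ennreal (exp (- (norm g)\<^sup>2 / 2)) * (\<integral>\<^sup>+r. (H (norm (r *\<^sub>R (g /\<^sub>R norm g))) * F (r *\<^sub>R (g /\<^sub>R norm g))) * ennreal (r ^ (?d - 1)) * indicator {0<..} r \<partial>lborel) \<partial>(lborel :: 'b measure))"
    using nn_integral_polar[of "\<lambda>x::'b. H (norm x) * F x" "\<lambda>t. ennreal (exp (- t\<^sup>2 / 2))"]
    by (simp add: polar_const_def)
  also have "\<dots> = (\<integral>\<^sup>+g. ennreal (exp (- (norm g)\<^sup>2 / 2)) * (F g * (\<integral>\<^sup>+r. H r * ennreal (r ^ (?d - 1)) * indicator {0<..} r \<partial>lborel)) \<partial>(lborel :: 'b measure))"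
  proof (rule nn_integral_cong_AE, rule AE_mp[OF AE_lborel_singleton[of 0]], intro AE_I2 impI)
    fix g :: 'b assume g: "g \<noteq> 0"
    have "(\<integral>\<^sup>+r. (H (norm (r *\<^sub>R (g /\<^sub>R norm g))) * F (r *\<^sub>R (g /\<^sub>R norm g))) * ennreal (r ^ (?d - 1)) * indicator {0<..} r \<partial>lborel)
      = (\<integral>\<^sup>+r. F g * (H r * ennreal (r ^ (?d - 1)) * indicator {0<..} r) \<partial>lborel)"
    proof (rule nn_integral_cong)
      fix r :: real
      have "F (r *\<^sub>R (g /\<^sub>R norm g)) = F g" if "r > 0"
        using that g hom[of "r / norm g" g] by (simp add: divide_inverse)
      then show "(H (norm (r *\<^sub>R (g /\<^sub>R norm g))) * F (r *\<^sub>R (g /\<^sub>R norm g))) * ennreal (r ^ (?d - 1)) * indicator {0<..} r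
        = F g * (H r * ennreal (r ^ (?d - 1)) * indicator {0<..} r)"
        using g by (cases "r > 0") (auto simp: mult_ac)
    qed
    then show "ennreal (exp (- (norm g)\<^sup>2 / 2)) * (\<integral>\<^sup>+r. (H (norm (r *\<^sub>R (g /\<^sub>R norm g))) * F (r *\<^sub>R (g /\<^sub>R norm g))) * ennreal (r ^ (?d - 1)) * indicator {0<..} r \<partial>lborel)
      = ennreal (exp (- (norm g)\<^sup>2 / 2)) * (F g * (\<integral>\<^sup>+r. H r * ennreal (r ^ (?d - 1)) * indicator {0<..} r \<partial>lborel))"
      by (simp add: nn_integral_cmult)
  qed
  also have "\<dots> = (\<integral>\<^sup>+r. H r * ennreal (r ^ (?d - 1)) * indicator {0<..} r \<partial>lborel) * (\<integral>\<^sup>+x. ennreal (exp (- (norm x)\<^sup>2 / 2)) * F x \<partial>lborel)"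
    by (subst nn_integral_cmult[symmetric]) (auto intro!: nn_integral_cong simp: mult_ac)
  finally show ?thesis .
qed

text \<open>The foot of the perpendicular from the origin to \<open>{y. y \<bullet> g = a}\<close>,
  that is, the code of this hyperplane for a normal g of any nonzero length. For g = 0 the value is
  0.\<close>

definition hyp_code :: "('b::euclidean_space) \<times> real \<Rightarrow> 'b" where
  "hyp_code y = (snd y / (norm (fst y))\<^sup>2) *\<^sub>R fst y"

lemma measurable_hyp_code [measurable]: "hyp_code \<in> borel_measurable borel"
  unfolding hyp_code_def[abs_def] borel_prod[symmetric] by measurable

text \<open>A Gaussian normal vector g and a uniform offset a describe the invariant measure on
  hyperplanes via \<open>{y. y \<bullet> g = a}\<close>.\<close>

lemma nn_integral_hyp_intensity:
  fixes f :: "'b::euclidean_space \<Rightarrow> ennreal"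
  assumes [measurable]: "f \<in> borel_measurable borel" and \<gamma>: "\<gamma> > 0"
  shows "2 * polar_const DIM('b) 1 * (\<integral>\<^sup>+x. f x \<partial>hyp_intensity \<gamma>)
    = ennreal \<gamma> * (\<integral>\<^sup>+y. ennreal (exp (- (norm (fst y))\<^sup>2 / 2)) * f (hyp_code y) \<partial>lborel)"
proof -
  let ?d = "DIM('b)"
  have "2 * polar_const ?d 1 * (\<integral>\<^sup>+x. f x \<partial>hyp_intensity \<gamma>)
    = ennreal \<gamma> * (2 * (polar_const ?d 1 * (\<integral>\<^sup>+x. f x * ennreal (norm x powr (1 - real ?d)) \<partial>lborel)))"
  proof -
    have "(\<integral>\<^sup>+x. f x \<partial>hyp_intensity \<gamma>) = (\<integral>\<^sup>+x. ennreal \<gamma> * (f x * ennreal (norm x powr (1 - real ?d))) \<partial>lborel)"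
      unfolding hyp_intensity_def using \<gamma>
      by (subst nn_integral_density) (auto simp: ennreal_mult mult_ac intro!: nn_integral_cong)
    also have "\<dots> = ennreal \<gamma> * (\<integral>\<^sup>+x. f x * ennreal (norm x powr (1 - real ?d)) \<partial>lborel)"
      by (rule nn_integral_cmult) measurable
    finally show ?thesis by (simp add: mult_ac)
  qed
  \<comment> \<open>The extra factor \<open>norm g\<close> in the weight, and with it the index 1,
    pays for the change from the distance r to the offset \<open>a = r * norm g\<close>.\<close>
  also have "polar_const ?d 1 * (\<integral>\<^sup>+x. f x * ennreal (norm x powr (1 - real ?d)) \<partial>lborel)
    = (\<integral>\<^sup>+g. ennreal (norm g * exp (- (norm g)\<^sup>2 / 2)) * (\<integral>\<^sup>+r. (f (r *\<^sub>R (g /\<^sub>R norm g)) * ennreal (norm (r *\<^sub>R (g /\<^sub>R norm g)) powr (1 - real ?d))) * ennreal (r ^ (?d - 1)) * indicator {0<..} r \<partial>lborel) \<partial>(lborel :: 'b measure))"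
    using nn_integral_polar[of "\<lambda>x::'b. f x * ennreal (norm x powr (1 - real ?d))" "\<lambda>t. ennreal (t * exp (- t\<^sup>2 / 2))"]
    by (simp add: polar_const_def)
  also have "\<dots> = (\<integral>\<^sup>+g. ennreal (exp (- (norm g)\<^sup>2 / 2)) * (\<integral>\<^sup>+a. f (hyp_code (g, a)) * indicator {0<..} a \<partial>lborel) \<partial>(lborel :: 'b measure))"
  proof (rule nn_integral_cong_AE, rule AE_mp[OF AE_lborel_singleton[of 0]], intro AE_I2 impI)
    fix g :: 'b assume g: "g \<noteq> 0"
    have "(\<integral>\<^sup>+r. (f (r *\<^sub>R (g /\<^sub>R norm g)) * ennreal (norm (r *\<^sub>R (g /\<^sub>R norm g)) powr (1 - real ?d))) * ennreal (r ^ (?d - 1)) * indicator {0<..} r \<partial>lborel)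
      = (\<integral>\<^sup>+r. f (r *\<^sub>R (g /\<^sub>R norm g)) * indicator {0<..} r \<partial>lborel)"
    proof (rule nn_integral_cong)
      fix r :: real
      have "ennreal (norm (r *\<^sub>R (g /\<^sub>R norm g)) powr (1 - real ?d)) * ennreal (r ^ (?d - 1)) = 1" if "r > 0"
      proof -
        have "norm (r *\<^sub>R (g /\<^sub>R norm g)) = r" using that g by simp
        then show ?thesis using that
          by (subst ennreal_mult[symmetric])
             (simp_all add: powr_realpow[symmetric] powr_add[symmetric] of_nat_diff Suc_leI del: norm_scaleR)
      qed
      then show "(f (r *\<^sub>R (g /\<^sub>R norm g)) * ennreal (norm (r *\<^sub>R (g /\<^sub>R norm g)) powr (1 - real ?d))) * ennreal (r ^ (?d - 1)) * indicator {0<..} r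
        = f (r *\<^sub>R (g /\<^sub>R norm g)) * indicator {0<..} r"
        by (cases "r > 0") (simp_all add: mult.assoc)
    qed
    also have "\<dots> = ennreal (1 / norm g) * (\<integral>\<^sup>+a. f ((a / norm g) *\<^sub>R (g /\<^sub>R norm g)) * indicator {0<..} (a / norm g) \<partial>lborel)"
      using g by (subst nn_integral_real_affine[where c = "1 / norm g" and t = 0]) auto
    also have "\<dots> = ennreal (1 / norm g) * (\<integral>\<^sup>+a. f (hyp_code (g, a)) * indicator {0<..} a \<partial>lborel)"
      using g by (intro arg_cong2[where f = "(*)"] nn_integral_cong refl)
        (auto simp: hyp_code_def indicator_def power2_eq_square zero_less_mult_iff divide_inverse mult_ac)
    finally show "ennreal (norm g * exp (- (norm g)\<^sup>2 / 2)) * (\<integral>\<^sup>+r. (f (r *\<^sub>R (g /\<^sub>R norm g)) * ennreal (norm (r *\<^sub>R (g /\<^sub>R norm g)) powr (1 - real ?d))) * ennreal (r ^ (?d - 1)) * indicator {0<..} r \<partial>lborel)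
      = ennreal (exp (- (norm g)\<^sup>2 / 2)) * (\<integral>\<^sup>+a. f (hyp_code (g, a)) * indicator {0<..} a \<partial>lborel)"
      using g by (simp add: mult.assoc[symmetric] ennreal_mult[symmetric])
  qed
  \<comment> \<open>The pairs (g, a) and (- g, - a) describe the same hyperplane, so offsets of both
    signs count it twice.\<close>
  also have "2 * \<dots> = (\<integral>\<^sup>+g. ennreal (exp (- (norm g)\<^sup>2 / 2)) * (\<integral>\<^sup>+a. f (hyp_code (g, a)) \<partial>lborel) \<partial>(lborel :: 'b measure))"
  proof -
    let ?I = "\<lambda>g a. ennreal (exp (- (norm g)\<^sup>2 / 2)) * (f (hyp_code (g :: 'b, a)) * indicator {0<..} a)"
    have [measurable]: "(\<lambda>x. f (hyp_code x)) \<in> borel_measurable (lborel \<Otimes>\<^sub>M lborel)"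
      by (simp add: lborel_prod)
    have code_neg: "hyp_code (- g, - a) = hyp_code (g, a)" for g :: 'b and a by (simp add: hyp_code_def)
    have lborel_neg: "(\<integral>\<^sup>+x. h (- x) \<partial>lborel) = (\<integral>\<^sup>+x. h x \<partial>lborel)" if [measurable]: "h \<in> borel_measurable borel"
      for h :: "'c::euclidean_space \<Rightarrow> ennreal"
      by (subst (2) lborel_affine[of "-1" 0]) (simp_all add: nn_integral_density nn_integral_distr density_1)
    have half: "(\<integral>\<^sup>+a. f (hyp_code (g, a)) \<partial>lborel) = (\<integral>\<^sup>+a. f (hyp_code (g, a)) * indicator {0<..} a \<partial>lborel) + (\<integral>\<^sup>+a. f (hyp_code (- g, a)) * indicator {0<..} a \<partial>lborel)" for g :: 'b
    proof -
      have [measurable]: "(\<lambda>a. f (hyp_code (g, a))) \<in> borel_measurable borel" for g :: 'b by (simp add: hyp_code_def)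
      have "(\<integral>\<^sup>+a. f (hyp_code (g, a)) \<partial>lborel) = (\<integral>\<^sup>+a. f (hyp_code (g, a)) * indicator {0<..} a + f (hyp_code (g, a)) * indicator {..<0} a \<partial>lborel)"
        by (rule nn_integral_cong_AE, rule AE_mp[OF AE_lborel_singleton[of 0]]) (auto intro!: AE_I2 simp: indicator_def)
      also have "\<dots> = (\<integral>\<^sup>+a. f (hyp_code (g, a)) * indicator {0<..} a \<partial>lborel) + (\<integral>\<^sup>+a. f (hyp_code (g, a)) * indicator {..<0} a \<partial>lborel)"
        by (rule nn_integral_add) measurable
      also have "(\<integral>\<^sup>+a. f (hyp_code (g, a)) * indicator {..<0} a \<partial>lborel) = (\<integral>\<^sup>+a. f (hyp_code (g, - a)) * indicator {..<0} (- a) \<partial>lborel)"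
        by (rule lborel_neg[symmetric]) measurable
      also have "\<dots> = (\<integral>\<^sup>+a. f (hyp_code (- g, a)) * indicator {0<..} a \<partial>lborel)"
        using code_neg[of "- g"] by (intro nn_integral_cong) (auto simp: indicator_def)
      finally show ?thesis .
    qed
    define K where "K g = ennreal (exp (- (norm g)\<^sup>2 / 2)) * (\<integral>\<^sup>+a. f (hyp_code (g, a)) * indicator {0<..} a \<partial>lborel)" for g :: 'b
    have [measurable]: "K \<in> borel_measurable borel" unfolding K_def[abs_def] by measurable
    have "(\<integral>\<^sup>+g. ennreal (exp (- (norm g)\<^sup>2 / 2)) * (\<integral>\<^sup>+a. f (hyp_code (g, a)) \<partial>lborel) \<partial>(lborel :: 'b measure))
        = (\<integral>\<^sup>+g. K g + K (- g) \<partial>lborel)"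
      by (simp only: half K_def distrib_left norm_minus_cancel)
    also have "\<dots> = 2 * (\<integral>\<^sup>+g. K g \<partial>lborel)"
      by (subst nn_integral_add) (auto simp: lborel_neg mult_2)
    finally show ?thesis by (simp only: K_def)
  qed
  also have "\<dots> = (\<integral>\<^sup>+y. ennreal (exp (- (norm (fst y))\<^sup>2 / 2)) * f (hyp_code y) \<partial>lborel)"
  proof -
    have [measurable]: "(\<lambda>x. f (hyp_code x)) \<in> borel_measurable (lborel \<Otimes>\<^sub>M lborel)"
      by (simp add: lborel_prod)
    have "(\<integral>\<^sup>+y. ennreal (exp (- (norm (fst y))\<^sup>2 / 2)) * f (hyp_code y) \<partial>(lborel \<Otimes>\<^sub>M lborel))
      = (\<integral>\<^sup>+g. \<integral>\<^sup>+a. ennreal (exp (- (norm g)\<^sup>2 / 2)) * f (hyp_code (g, a)) \<partial>lborel \<partial>(lborel :: 'b measure))"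
      by (subst lborel.nn_integral_fst[symmetric]) auto
    also have "\<dots> = (\<integral>\<^sup>+g. ennreal (exp (- (norm g)\<^sup>2 / 2)) * (\<integral>\<^sup>+a. f (hyp_code (g, a)) \<partial>lborel) \<partial>(lborel :: 'b measure))"
      by (intro nn_integral_cong nn_integral_cmult) (simp add: hyp_code_def)
    finally show ?thesis by (simp only: lborel_prod)
  qed
  finally show ?thesis .
qed

section \<open>Random simplices\<close>

text \<open>Cramer's rule makes the solution of a linear system a measurable function of its data.\<close>

definition sol :: "real^'n^'n \<Rightarrow> real^'n \<Rightarrow> real^'n" where
  "sol A b = (\<chi> k. det (\<chi> i j. if j = k then b $ i else A $ i $ j) / det A)"

lemma sol_iff: "det A \<noteq> 0 \<Longrightarrow> A *v x = b \<longleftrightarrow> x = sol A b"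
  unfolding sol_def by (rule cramer)

lemma mult_sol: "det A \<noteq> 0 \<Longrightarrow> A *v sol A b = b"
  by (simp add: sol_iff)

lemma measurable_det [measurable (raw)]:
  fixes A :: "'a \<Rightarrow> real^'n^'n"
  assumes [measurable]: "A \<in> borel_measurable M"
  shows "(\<lambda>x. det (A x)) \<in> borel_measurable M"
  unfolding det_def by measurable

lemma measurable_sol [measurable (raw)]:
  fixes A :: "'a \<Rightarrow> real^'n^'n" and b :: "'a \<Rightarrow> real^'n"
  assumes [measurable]: "A \<in> borel_measurable M" "b \<in> borel_measurable M"
  shows "(\<lambda>x. sol (A x) (b x)) \<in> borel_measurable M"
proof -
  have [measurable]: "(\<lambda>x. \<chi> i j. if j = k then b x $ i else A x $ i $ j) \<in> borel_measurable M" for k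
    by (intro measurable_vec_lambda) (auto intro: measurable_vec_nth')
  show ?thesis unfolding sol_def by measurable
qed

lemma measurable_transpose [measurable (raw)]:
  fixes A :: "'a \<Rightarrow> real^'n^'m"
  assumes [measurable]: "A \<in> borel_measurable M"
  shows "(\<lambda>x. transpose (A x)) \<in> borel_measurable M"
  unfolding transpose_def by measurable

lemma measurable_matrix_vector [measurable (raw)]:
  fixes A :: "'a \<Rightarrow> real^'n^'m" and b :: "'a \<Rightarrow> real^'n"
  assumes [measurable]: "A \<in> borel_measurable M" "b \<in> borel_measurable M"
  shows "(\<lambda>x. A x *v b x) \<in> borel_measurable M"
  unfolding matrix_vector_mult_def by measurable

section \<open>Sign conditions on Gaussian pairs\<close>

text \<open>A code is its normal times a factor with the sign of the offset. Positivity of a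
  coordinate of u with respect to the codes thus means that the coordinate m with respect to the
  normals and the offset a have equal signs; see \<open>tuple_coords_code_tuple\<close>.\<close>

definition sign_set :: "'n set \<Rightarrow> ((real^'n) \<times> (real^'n)) set" where
  "sign_set J = {(m, a). \<forall>i\<in>J. m $ i * a $ i > 0}"

lemma measurable_sign_set [measurable]:
  fixes J :: "'n::finite set"
  shows "sign_set J \<in> sets borel"
proof -
  have "sign_set J = (\<Inter>i\<in>J. {x. 0 < fst x $ i * snd x $ i})"
    by (auto simp: sign_set_def)
  then show ?thesis
    by (simp only:) (intro borel_open open_INT ballI open_Collect_less continuous_intros; simp)
qed

lemma sign_set_scale1: "t > 0 \<Longrightarrow> (t *\<^sub>R m, a) \<in> sign_set J \<longleftrightarrow> (m, a) \<in> sign_set J"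
  by (simp add: sign_set_def zero_less_mult_iff mult_less_0_iff)

lemma sign_set_scale2: "t > 0 \<Longrightarrow> (m, t *\<^sub>R a) \<in> sign_set J \<longleftrightarrow> (m, a) \<in> sign_set J"
  by (simp add: sign_set_def zero_less_mult_iff mult_less_0_iff)

lemma norm_vec_squared: "(norm x)\<^sup>2 = (\<Sum>i\<in>UNIV. (norm (x $ i))\<^sup>2)" for x :: "'b::real_normed_vector^'n"
  by (simp add: norm_vec_def L2_set_def sum_nonneg)

text \<open>The pair of vectors (m, a) is regrouped into a vector of coordinate pairs by a map that
  permutes the standard bases.\<close>

lemma nn_integral_gauss_pair_signs:
  fixes J :: "'n::finite set"
  shows "(\<integral>\<^sup>+m. \<integral>\<^sup>+a. ennreal (exp (- ((norm m)\<^sup>2 + (norm a)\<^sup>2) / 2)) * indicator (sign_set J) (m, a)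
        * ennreal (stable_kernel (m \<bullet> a)) \<partial>lborel \<partial>(lborel :: (real^'n) measure))
    = ennreal (2 ^ CARD('n) / sqrt (2 * pi) * (pi ^ (CARD('n) - card J) * Re (\<integral>s. arsinh_integrand (card J) CARD('n) s \<partial>lborel)))"
proof -
  let ?T = "\<lambda>x::(real\<times>real)^'n. (\<chi> i. fst (x $ i), \<chi> i. snd (x $ i))"
  define f where "f = (\<lambda>(m::real^'n, a::real^'n). ennreal (exp (- ((norm m)\<^sup>2 + (norm a)\<^sup>2) / 2)) * indicator (sign_set J) (m, a)
        * ennreal (stable_kernel (m \<bullet> a)))"
  have f_pair [measurable]: "f \<in> borel_measurable (lborel \<Otimes>\<^sub>M lborel)"
  proof -
    have [measurable]: "sign_set J \<in> sets (lborel \<Otimes>\<^sub>M lborel)"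
      by (simp only: lborel_prod sets_lborel measurable_sign_set)
    have [measurable]: "(\<lambda>x. indicator (sign_set J) (fst x, snd x) :: ennreal) \<in> borel_measurable (lborel \<Otimes>\<^sub>M lborel)"
      by simp
    show ?thesis unfolding f_def case_prod_unfold by measurable
  qed
  then have f_borel [measurable]: "f \<in> borel_measurable borel" by (simp add: lborel_prod)
  have lin: "linear ?T"
    by (rule linearI) (auto simp: vec_eq_iff)
  have bij: "bij_betw ?T Basis Basis"
  proof (rule bij_betwI)
    let ?S = "\<lambda>p::(real^'n) \<times> (real^'n). (\<chi> i. (fst p $ i, snd p $ i))"
    have "?T (axis i (1, 0)) = (axis i 1, 0)" "?T (axis i (0, 1)) = (0, axis i 1)" for i
      by (simp_all add: vec_eq_iff axis_def)
    then show "?T \<in> Basis \<rightarrow> Basis"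
      by (auto simp: Basis_vec_def Basis_prod_def simp del: Pair_inject)
    have "?S (axis i 1, 0) = axis i (1, 0)" "?S (0, axis i 1) = axis i (0, 1)" for i
      by (simp_all add: vec_eq_iff axis_def zero_prod_def)
    then show "?S \<in> Basis \<rightarrow> Basis"
      by (auto simp: Basis_vec_def Basis_prod_def simp del: Pair_inject)
  qed (auto simp: vec_eq_iff prod_eq_iff)
  have [measurable]: "?T \<in> borel_measurable borel"
    by (intro borel_measurable_continuous_onI linear_continuous_on) (use lin linear_conv_bounded_linear in blast)
  have "(\<integral>\<^sup>+m. \<integral>\<^sup>+a. f (m, a) \<partial>lborel \<partial>lborel) = (\<integral>\<^sup>+y. f y \<partial>(lborel \<Otimes>\<^sub>M lborel))"
    by (rule lborel.nn_integral_fst) (rule f_pair)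
  also have "\<dots> = (\<integral>\<^sup>+y. f y \<partial>(distr lborel borel ?T))"
    by (simp only: lborel_prod lborel_distr_basis_bij[OF lin bij])
  also have "\<dots> = (\<integral>\<^sup>+x. f (?T x) \<partial>lborel)"
    by (rule nn_integral_distr) measurable
  also have "\<dots> = (\<integral>\<^sup>+x. ennreal (\<Prod>i\<in>UNIV. exp (- ((fst (x $ i))\<^sup>2 + (snd (x $ i))\<^sup>2) / 2))
        * indicator {x. \<forall>i\<in>J. fst (x $ i) * snd (x $ i) > 0} x
        * ennreal (stable_kernel (\<Sum>i\<in>UNIV. fst (x $ i) * snd (x $ i))) \<partial>lborel)"
    by (intro nn_integral_cong)
       (auto simp: f_def sign_set_def indicator_def norm_vec_squared inner_vec_def exp_sum[symmetric]
          sum.distrib[symmetric] sum_negf[symmetric] sum_divide_distrib intro!: arg_cong2[where f = "(*)"])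
  finally show ?thesis
    unfolding nn_integral_gauss_signs f_def by simp
qed

definition gauss_moment :: "nat \<Rightarrow> ennreal" where
  "gauss_moment d = (\<integral>\<^sup>+r. ennreal (r ^ d * exp (- r\<^sup>2 / 2)) * indicator {0<..} r \<partial>lborel)"

lemma gauss_moment_nonzero: "gauss_moment d \<noteq> 0"
proof
  assume "gauss_moment d = 0"
  then have "AE r in lborel. ennreal (r ^ d * exp (- r\<^sup>2 / 2)) * indicator {0<..} (r::real) = 0"
    unfolding gauss_moment_def by (subst (asm) nn_integral_0_iff_AE) auto
  then have "AE r in lborel. r \<notin> {0<..1::real}"
    by (rule AE_mp) (auto intro!: AE_I2 simp: indicator_def not_less zero_less_power split: if_splits)
  then have "{0<..1::real} \<in> null_sets lborel"
    by (subst AE_iff_null_sets) auto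
  then show False by (simp add: null_sets_def)
qed

lemma gauss_moment_finite: "gauss_moment d \<noteq> \<top>"
proof -
  have "gauss_moment d \<le> (\<integral>\<^sup>+r. ennreal (sqrt (2 * pi)) * ennreal (norm (normal_density 0 1 r * r ^ d)) \<partial>lborel)"
    unfolding gauss_moment_def
    by (intro nn_integral_mono)
       (auto simp: indicator_def normal_density_def ennreal_mult[symmetric] abs_mult)
  also have "\<dots> = ennreal (sqrt (2 * pi)) * (\<integral>\<^sup>+r. ennreal (norm (normal_density 0 1 r * r ^ d)) \<partial>lborel)"
    by (rule nn_integral_cmult) measurable
  also have "\<dots> < \<top>"
    using integrable_std_normal_moment[of d]
    by (simp add: integrable_iff_bounded ennreal_mult_less_top)
  finally show ?thesis by simp
qed

text \<open>Writes a negative power of \<open>A\<close> as a mixture of exponentials in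
  \<open>A\<close>. With \<open>A = 1 + (norm m)\<^sup>2\<close> this makes m conditionally
  Gaussian.\<close>

lemma gauss_moment_scale:
  assumes A: "A > 0"
  shows "gauss_moment d * ennreal (1 / sqrt A ^ (d + 1)) = (\<integral>\<^sup>+r. ennreal (r ^ d * exp (- (r\<^sup>2 * A) / 2)) * indicator {0<..} r \<partial>lborel)"
proof -
  define c where "c = sqrt A"
  have c: "c > 0" "c ^ 2 = A" using A by (simp_all add: c_def)
  have "gauss_moment d * ennreal (1 / c ^ (d + 1)) = (\<integral>\<^sup>+r. ennreal (r ^ d * exp (- r\<^sup>2 / 2)) * indicator {0<..} r \<partial>lborel) * ennreal (1 / c ^ (d + 1))"
    by (simp only: gauss_moment_def)
  also have "\<dots> = ennreal c * (\<integral>\<^sup>+r. ennreal ((c * r) ^ d * exp (- (c * r)\<^sup>2 / 2)) * indicator {0<..} (c * r) \<partial>lborel) * ennreal (1 / c ^ (d + 1))"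
    using c by (subst nn_integral_real_affine[where c = c and t = 0]) auto
  also have "\<dots> = (\<integral>\<^sup>+r. ennreal (c * (1 / c ^ (d + 1))) * (ennreal ((c * r) ^ d * exp (- (c * r)\<^sup>2 / 2)) * indicator {0<..} (c * r)) \<partial>lborel)"
  proof -
    have "ennreal (c * (1 / c ^ (d + 1))) = ennreal c * ennreal (1 / c ^ (d + 1))"
      by (rule ennreal_mult) (use c in auto)
    then show ?thesis
      by (subst nn_integral_cmult) (simp_all only: mult_ac, measurable)
  qed
  also have "\<dots> = (\<integral>\<^sup>+r. ennreal (r ^ d * exp (- (r\<^sup>2 * A) / 2)) * indicator {0<..} r \<partial>lborel)"
  proof (rule nn_integral_cong)
    fix r :: real
    have "c * (1 / c ^ (d + 1)) * ((c * r) ^ d * exp (- (c * r)\<^sup>2 / 2)) = r ^ d * exp (- (r\<^sup>2 * A) / 2)"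
      using c by (simp add: power_mult_distrib mult.commute)
    then show "ennreal (c * (1 / c ^ (d + 1))) * (ennreal ((c * r) ^ d * exp (- (c * r)\<^sup>2 / 2)) * indicator {0<..} (c * r))
      = ennreal (r ^ d * exp (- (r\<^sup>2 * A) / 2)) * indicator {0<..} r"
      using c by (cases "r > 0") (auto simp: zero_less_mult_iff ennreal_mult[symmetric])
  qed
  finally show ?thesis by (simp only: c_def)
qed

lemma measurable_indicator_sign_set [measurable (raw)]:
  fixes f g :: "'a \<Rightarrow> real^'n"
  assumes [measurable]: "f \<in> borel_measurable M" "g \<in> borel_measurable M"
  shows "(\<lambda>x. indicator (sign_set J) (f x, g x) :: ennreal) \<in> borel_measurable M"
proof -
  have "(\<lambda>x. (f x, g x)) \<in> borel_measurable M" by measurable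
  then show ?thesis
    by (rule measurable_compose) (intro borel_measurable_indicator measurable_sign_set)
qed

text \<open>Up to a constant the weight of m is the multivariate Cauchy density, a scale mixture of
  Gaussians. Rescaling m by the mixing variable r keeps the signs and divides the cross term by
  \<open>r\<^sup>2\<close>; the integral over r is then \<open>stable_kernel\<close>.\<close>

lemma nn_integral_signs_cauchy:
  fixes J :: "'n::finite set"
  shows "gauss_moment CARD('n) * (\<integral>\<^sup>+m. ennreal (1 / sqrt (1 + (norm m)\<^sup>2) ^ (CARD('n) + 1)) *
      (\<integral>\<^sup>+a. ennreal (exp (- ((norm a)\<^sup>2 + (m \<bullet> a)\<^sup>2) / 2)) * indicator (sign_set J) (m, a) \<partial>lborel) \<partial>(lborel :: (real^'n) measure))
    = ennreal (2 ^ CARD('n) / sqrt (2 * pi) * (pi ^ (CARD('n) - card J) * Re (\<integral>s. arsinh_integrand (card J) CARD('n) s \<partial>lborel)))"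
proof -
  let ?n = "CARD('n)"
  define I where "I m = (\<integral>\<^sup>+a. ennreal (exp (- ((norm a)\<^sup>2 + (m \<bullet> a)\<^sup>2) / 2)) * indicator (sign_set J) (m, a) \<partial>lborel)" for m :: "real^'n"
  have [measurable]: "I \<in> borel_measurable borel"
    unfolding I_def[abs_def] by measurable
  define K where "K r m a = ennreal (exp (- r\<^sup>2 / 2 - (m \<bullet> a)\<^sup>2 / (2 * r\<^sup>2))) * indicator {0<..} r *
     (ennreal (exp (- ((norm m)\<^sup>2 + (norm a)\<^sup>2) / 2)) * indicator (sign_set J) (m, a))" for r :: real and m a :: "real^'n"
  have "gauss_moment ?n * (\<integral>\<^sup>+m. ennreal (1 / sqrt (1 + (norm m)\<^sup>2) ^ (?n + 1)) * I m \<partial>lborel)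
     = (\<integral>\<^sup>+m. gauss_moment ?n * ennreal (1 / sqrt (1 + (norm m)\<^sup>2) ^ (?n + 1)) * I m \<partial>lborel)"
    by (subst nn_integral_cmult[symmetric]) (auto simp: mult.assoc)
  also have "\<dots> = (\<integral>\<^sup>+m. \<integral>\<^sup>+r. ennreal (r ^ ?n * exp (- (r\<^sup>2 * (1 + (norm m)\<^sup>2)) / 2)) * indicator {0<..} r * I m \<partial>lborel \<partial>lborel)"
    by (intro nn_integral_cong, subst gauss_moment_scale) (auto simp: add_pos_nonneg nn_integral_multc)
  also have "\<dots> = (\<integral>\<^sup>+r. \<integral>\<^sup>+m. ennreal (r ^ ?n * exp (- (r\<^sup>2 * (1 + (norm m)\<^sup>2)) / 2)) * indicator {0<..} r * I m \<partial>lborel \<partial>lborel)"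
    by (rule lborel_pair.Fubini') measurable
  also have "\<dots> = (\<integral>\<^sup>+r. \<integral>\<^sup>+m. \<integral>\<^sup>+a. K r m a \<partial>lborel \<partial>lborel \<partial>lborel)"
  proof (rule nn_integral_cong)
    fix r :: real
    show "(\<integral>\<^sup>+m. ennreal (r ^ ?n * exp (- (r\<^sup>2 * (1 + (norm m)\<^sup>2)) / 2)) * indicator {0<..} r * I m \<partial>lborel)
      = (\<integral>\<^sup>+m. \<integral>\<^sup>+a. K r m a \<partial>lborel \<partial>lborel)"
    proof (cases "r > 0")
      case True
      \<comment> \<open>The factor \<open>r ^ CARD('n)\<close> on the left is the Jacobian of
        \<open>m \<mapsto> r *\<^sub>R m\<close>, which is why the moment of order d was
        chosen.\<close>
      have I_scale: "(\<integral>\<^sup>+a. K r (r *\<^sub>R m) a \<partial>lborel) = ennreal (exp (- (r\<^sup>2 * (1 + (norm m)\<^sup>2)) / 2)) * I m" for m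
      proof -
        have "K r (r *\<^sub>R m) a = ennreal (exp (- (r\<^sup>2 * (1 + (norm m)\<^sup>2)) / 2)) * (ennreal (exp (- ((norm a)\<^sup>2 + (m \<bullet> a)\<^sup>2) / 2)) * indicator (sign_set J) (m, a))" for a
        proof -
          have "exp (- r\<^sup>2 / 2 - (r *\<^sub>R m \<bullet> a)\<^sup>2 / (2 * r\<^sup>2)) * exp (- ((norm (r *\<^sub>R m))\<^sup>2 + (norm a)\<^sup>2) / 2)
            = exp (- (r\<^sup>2 * (1 + (norm m)\<^sup>2)) / 2) * exp (- ((norm a)\<^sup>2 + (m \<bullet> a)\<^sup>2) / 2)"
            unfolding exp_add[symmetric] using True
            by (intro arg_cong[where f = exp]) (simp add: field_simps power_mult_distrib)
          then show ?thesis using True sign_set_scale1[OF True, of m a J]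
            by (simp add: K_def indicator_def ennreal_mult[symmetric] del: mult_exp_exp)
        qed
        then show ?thesis by (simp add: I_def nn_integral_cmult)
      qed
      have "(\<integral>\<^sup>+m. \<integral>\<^sup>+a. K r m a \<partial>lborel \<partial>lborel) = ennreal (r ^ ?n) * (\<integral>\<^sup>+m. \<integral>\<^sup>+a. K r (r *\<^sub>R m) a \<partial>lborel \<partial>lborel)"
        using nn_integral_lborel_scaleR[OF True, of "\<lambda>m. \<integral>\<^sup>+a. K r m a \<partial>lborel"] by (simp add: K_def)
      also have "\<dots> = (\<integral>\<^sup>+m. ennreal (r ^ ?n) * (ennreal (exp (- (r\<^sup>2 * (1 + (norm m)\<^sup>2)) / 2)) * I m) \<partial>lborel)"
        by (subst nn_integral_cmult) (auto simp: I_scale)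
      finally show ?thesis using True by (simp add: ennreal_mult mult.assoc)
    qed (simp add: K_def)
  qed
  also have "\<dots> = (\<integral>\<^sup>+m. \<integral>\<^sup>+r. \<integral>\<^sup>+a. K r m a \<partial>lborel \<partial>lborel \<partial>lborel)"
    by (rule lborel_pair.Fubini') (unfold K_def, measurable)
  also have "\<dots> = (\<integral>\<^sup>+m. \<integral>\<^sup>+a. \<integral>\<^sup>+r. K r m a \<partial>lborel \<partial>lborel \<partial>lborel)"
    by (rule nn_integral_cong, rule lborel_pair.Fubini') (unfold K_def, measurable)
  also have "\<dots> = (\<integral>\<^sup>+m. \<integral>\<^sup>+a. ennreal (exp (- ((norm m)\<^sup>2 + (norm a)\<^sup>2) / 2)) * indicator (sign_set J) (m, a)
        * ennreal (stable_kernel (m \<bullet> a)) \<partial>lborel \<partial>(lborel :: (real^'n) measure))"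
  proof (intro nn_integral_cong)
    fix m a :: "real^'n"
    have "(\<integral>\<^sup>+r. K r m a \<partial>lborel) = ennreal (stable_kernel (m \<bullet> a)) *
        (ennreal (exp (- ((norm m)\<^sup>2 + (norm a)\<^sup>2) / 2)) * indicator (sign_set J) (m, a))"
      unfolding K_def nn_integral_stable_kernel[symmetric] by (rule nn_integral_multc) measurable
    then show "(\<integral>\<^sup>+r. K r m a \<partial>lborel) = ennreal (exp (- ((norm m)\<^sup>2 + (norm a)\<^sup>2) / 2)) * indicator (sign_set J) (m, a)
        * ennreal (stable_kernel (m \<bullet> a))" by (simp only: mult.commute)
  qed
  finally show ?thesis
    unfolding nn_integral_gauss_pair_signs I_def .
qed

text \<open>Rotate m onto a coordinate axis and stretch that axis by
  \<open>sqrt (1 + (norm m)\<^sup>2)\<close>: the squared length grows exactly by the squared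
  component along m, scaled by the length of m.\<close>

lemma exists_rank_one_square_root:
  fixes m :: "real^'n"
  obtains B :: "real^'n^'n" where "\<bar>det B\<bar> = sqrt (1 + (norm m)\<^sup>2)"
    "\<And>x. (norm (transpose B *v x))\<^sup>2 = (norm x)\<^sup>2 + (m \<bullet> x)\<^sup>2"
proof -
  \<comment> \<open>Any index serves as the axis.\<close>
  define k :: 'n where "k = undefined"
  obtain f :: "real^'n \<Rightarrow> real^'n" where f: "orthogonal_transformation f" "f m = axis k (norm m)"
    using orthogonal_transformation_exists[of m "axis k (norm m)"] by (auto simp: norm_eq_sqrt_inner[of "axis k _"] inner_axis_axis)
  define R where "R = matrix f"
  have R: "orthogonal_matrix R" "R *v x = f x" for x
    using f orthogonal_transformation_matrix[of f] by (auto simp: R_def matrix_works orthogonal_transformation_linear)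
  define D :: "real^'n^'n" where "D = (\<chi> i j. if i = j then if i = k then sqrt (1 + (norm m)\<^sup>2) else 1 else 0)"
  have "det D = (\<Prod>i\<in>UNIV. D $ i $ i)" by (rule det_diagonal) (simp add: D_def)
  also have "\<dots> = sqrt (1 + (norm m)\<^sup>2)" by (simp add: D_def prod.delta)
  finally have det_D: "det D = sqrt (1 + (norm m)\<^sup>2)" .
  have D_norm: "(norm (D *v y))\<^sup>2 = (norm y)\<^sup>2 + (norm m)\<^sup>2 * (y $ k)\<^sup>2" for y
  proof -
    have "D *v y = (\<chi> i. (if i = k then sqrt (1 + (norm m)\<^sup>2) else 1) * y $ i)"
      by (simp add: D_def matrix_vector_mult_def vec_eq_iff if_distrib[of "\<lambda>x. x * _"] cong: if_cong)
    then have "(norm (D *v y))\<^sup>2 = (\<Sum>i\<in>UNIV. (y $ i)\<^sup>2 + (if i = k then (norm m)\<^sup>2 * (y $ i)\<^sup>2 else 0))"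
      by (subst norm_vec_squared[of "D *v y"]) (auto simp: power_mult_distrib algebra_simps add_nonneg_nonneg intro!: sum.cong)
    then show ?thesis by (simp add: sum.distrib norm_vec_squared[of y])
  qed
  define B where "B = transpose R ** D"
  have "\<bar>det B\<bar> = sqrt (1 + (norm m)\<^sup>2)"
    using det_orthogonal_matrix[OF R(1)] by (auto simp: B_def det_mul det_D abs_mult)
  moreover have "(norm (transpose B *v x))\<^sup>2 = (norm x)\<^sup>2 + (m \<bullet> x)\<^sup>2" for x
  proof -
    have "transpose B *v x = D *v (R *v x)"
    proof -
      have "transpose D = D" by (auto simp: transpose_def D_def vec_eq_iff)
      then show ?thesis by (simp add: B_def matrix_transpose_mul matrix_vector_mul_assoc)
    qed
    moreover have "m \<bullet> x = norm m * (R *v x) $ k"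
    proof -
      have "m \<bullet> x = f m \<bullet> f x" using f(1) by (simp add: orthogonal_transformation_def)
      then show ?thesis by (simp add: f(2) R(2) inner_axis' mult.commute)
    qed
    ultimately show ?thesis
      using f(1) by (simp add: D_norm R(2) orthogonal_transformation_norm power_mult_distrib)
  qed
  ultimately show ?thesis using that by blast
qed

lemma ennreal_eq_divide_mult:
  fixes a b c k :: ennreal
  assumes "c * a = k * b" "c \<noteq> 0" "c \<noteq> \<top>"
  shows "a = k / c * b"
proof -
  have "a = a * c / c" using assms by (simp add: mult_divide_eq_ennreal)
  also have "a * c = k * b" using assms(1) by (simp add: mult.commute)
  finally show ?thesis by (simp add: divide_ennreal_def mult_ac)
qed

section \<open>Gaussian matrices weighted by their intersection point\<close>

text \<open>The columns of \<open>G\<close> are normals, b holds the offsets, and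
  \<open>sol (transpose G) b\<close> is the common point of the hyperplanes. The factor
  \<open>\<bar>det G\<bar>\<close> is the Jacobian of \<open>u = G m\<close>.\<close>

definition det_integral :: "real \<Rightarrow> real^'n \<Rightarrow> ennreal" where
  "det_integral \<kappa> b = (\<integral>\<^sup>+G. ennreal (\<bar>det G\<bar> * exp (- (norm G)\<^sup>2 / 2 - \<kappa> * norm (sol (transpose G) b)))
      * indicator {G. det G \<noteq> 0} G \<partial>(lborel :: (real^'n^'n) measure))"

lemma measurable_det_integral [measurable]: "det_integral \<kappa> \<in> borel_measurable borel"
  unfolding det_integral_def[abs_def] by measurable

text \<open>Mixing the equations by \<open>transpose C\<close> on both sides does not move the
  common point of the hyperplanes.\<close>

lemma sol_transpose_mult:
  assumes "det G \<noteq> 0" "det C \<noteq> 0"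
  shows "sol (transpose (G ** C)) (transpose C *v b) = sol (transpose G) b"
proof (rule sol_iff[THEN iffD1, symmetric])
  show "det (transpose (G ** C)) \<noteq> 0" using assms by (simp add: det_mul)
  have "transpose G *v sol (transpose G) b = b" using assms by (intro mult_sol) simp
  then show "transpose (G ** C) *v sol (transpose G) b = transpose C *v b"
    by (simp add: matrix_transpose_mul matrix_vector_mul_assoc[symmetric] del: transpose_matrix_vector)
qed

text \<open>Substituting \<open>G ** C\<close> gives one power of the determinant for each of the
  rows and one more from the factor \<open>\<bar>det (G ** C)\<bar>\<close> of the
  integrand.\<close>

lemma det_integral_transform:
  fixes C :: "real^'n::{finite,wellorder}^'n::_"
  assumes C: "det C \<noteq> 0"
  shows "det_integral \<kappa> (transpose C *v b) = ennreal (\<bar>det C\<bar> ^ (CARD('n) + 1)) *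
    (\<integral>\<^sup>+G. ennreal (\<bar>det G\<bar> * exp (- (norm (G ** C))\<^sup>2 / 2 - \<kappa> * norm (sol (transpose G) b)))
      * indicator {G. det G \<noteq> 0} G \<partial>lborel)"
proof -
  have "det_integral \<kappa> (transpose C *v b) = ennreal (\<bar>det C\<bar> ^ CARD('n)) *
    (\<integral>\<^sup>+G. ennreal (\<bar>det (G ** C)\<bar> * exp (- (norm (G ** C))\<^sup>2 / 2 - \<kappa> * norm (sol (transpose (G ** C)) (transpose C *v b))))
      * indicator {G. det G \<noteq> 0} (G ** C) \<partial>lborel)"
    unfolding det_integral_def by (rule nn_integral_matrix_matrix_mult[OF C]) measurable
  also have "(\<integral>\<^sup>+G. ennreal (\<bar>det (G ** C)\<bar> * exp (- (norm (G ** C))\<^sup>2 / 2 - \<kappa> * norm (sol (transpose (G ** C)) (transpose C *v b))))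
      * indicator {G. det G \<noteq> 0} (G ** C) \<partial>lborel)
    = (\<integral>\<^sup>+G. ennreal \<bar>det C\<bar> * (ennreal (\<bar>det G\<bar> * exp (- (norm (G ** C))\<^sup>2 / 2 - \<kappa> * norm (sol (transpose G) b)))
      * indicator {G. det G \<noteq> 0} G) \<partial>lborel)"
  proof (rule nn_integral_cong)
    fix G :: "((real, 'n) vec, 'n) vec"
    show "ennreal (\<bar>det (G ** C)\<bar> * exp (- (norm (G ** C))\<^sup>2 / 2 - \<kappa> * norm (sol (transpose (G ** C)) (transpose C *v b))))
      * indicator {G. det G \<noteq> 0} (G ** C) = ennreal \<bar>det C\<bar> * (ennreal (\<bar>det G\<bar> * exp (- (norm (G ** C))\<^sup>2 / 2 - \<kappa> * norm (sol (transpose G) b)))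
      * indicator {G. det G \<noteq> 0} G)"
      using C by (cases "det G = 0")
        (simp_all add: det_mul sol_transpose_mult abs_mult ennreal_mult[symmetric] mult_ac del: transpose_matrix_vector)
  qed
  also have "\<dots> = ennreal \<bar>det C\<bar> * (\<integral>\<^sup>+G. ennreal (\<bar>det G\<bar> * exp (- (norm (G ** C))\<^sup>2 / 2 - \<kappa> * norm (sol (transpose G) b)))
      * indicator {G. det G \<noteq> 0} G \<partial>lborel)"
    by (rule nn_integral_cmult) measurable
  finally show ?thesis by (simp add: ennreal_mult mult_ac)
qed

lemma norm_matrix_mult_squared:
  fixes G :: "real^'n^'m" and C :: "real^'k^'n"
  shows "(norm (G ** C))\<^sup>2 = (\<Sum>i\<in>UNIV. (norm (transpose C *v (G $ i)))\<^sup>2)"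
proof -
  have "(G ** C) $ i = transpose C *v (G $ i)" for i
    by (simp add: matrix_matrix_mult_def matrix_vector_mult_def transpose_def vec_eq_iff mult.commute)
  then show ?thesis by (simp add: norm_vec_squared[of "G ** C"])
qed

text \<open>Apply \<open>det_integral_transform\<close> with an orthogonal \<open>C\<close> taking
  one offset vector to the other: it preserves the norm of \<open>G\<close> and has determinant of
  modulus 1.\<close>

lemma det_integral_radial:
  fixes b b' :: "real^'n::{finite,wellorder}"
  assumes "norm b = norm b'"
  shows "det_integral \<kappa> b = det_integral \<kappa> b'"
proof -
  obtain f where f: "orthogonal_transformation f" "f b = b'"
    using orthogonal_transformation_exists[OF assms] by blast
  define C where "C = transpose (matrix f)"
  have orth: "orthogonal_matrix (matrix f)" using f orthogonal_transformation_matrix by blast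
  have Cb: "transpose C *v x = f x" for x
    using f by (simp add: C_def matrix_works orthogonal_transformation_linear)
  have det: "\<bar>det C\<bar> = 1" using det_orthogonal_matrix[OF orth] by (auto simp: C_def)
  have norm: "(norm (G ** C))\<^sup>2 = (norm G)\<^sup>2" for G :: "((real, 'n) vec, 'n) vec"
    using f(1) by (simp add: norm_matrix_mult_squared Cb orthogonal_transformation_norm norm_vec_squared[of G] del: transpose_matrix_vector)
  have "det_integral \<kappa> b' = det_integral \<kappa> (transpose C *v b)" by (simp only: Cb f(2))
  also have "\<dots> = det_integral \<kappa> b"
    using det by (subst det_integral_transform) (auto simp: norm det_integral_def)
  finally show ?thesis ..
qed

text \<open>After \<open>u = G m\<close> the quadratic form \<open>|G|\<^sup>2 + |G m|\<^sup>2\<close> is absorbed into G by a square root of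
  \<open>1 + m m\<^sup>T\<close>; what is left depends on a only through a norm.\<close>

lemma nn_integral_random_simplex:
  fixes \<kappa> :: real
  obtains K :: ennreal where
    "\<And>J::'n::{finite,wellorder} set.
      (\<integral>\<^sup>+u. \<integral>\<^sup>+a. \<integral>\<^sup>+G. ennreal (exp (- (norm u)\<^sup>2 / 2 - (norm G)\<^sup>2 / 2 - \<kappa> * norm (sol (transpose G) a)))
         * indicator {G. det G \<noteq> 0} G * indicator (sign_set J) (sol G u, a)
         \<partial>(lborel :: ((real,'n) vec, 'n) vec measure) \<partial>lborel \<partial>(lborel :: (real, 'n) vec measure))
      = K * ennreal (pi ^ (CARD('n) - card J) * Re (\<integral>s. arsinh_integrand (card J) CARD('n) s \<partial>lborel))"
proof -
  let ?n = "CARD('n)"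
  define e where "e = (axis undefined 1 :: (real, 'n) vec)"
  define h where "h t = det_integral \<kappa> (t *\<^sub>R e)" for t
  have h: "det_integral \<kappa> b = h (norm b)" for b :: "(real, 'n) vec"
    unfolding h_def using det_integral_radial[of b "norm b *\<^sub>R e" \<kappa>] by (simp add: e_def norm_eq_sqrt_inner[of "axis _ _"] inner_axis_axis)
  have [measurable]: "h \<in> borel_measurable borel"
    unfolding h_def[abs_def] by measurable
  define K1 where "K1 = (\<integral>\<^sup>+r. h r * ennreal (r ^ (?n - 1)) * indicator {0<..} r \<partial>lborel)"
  define K where "K = K1 / polar_const ?n 0 * (ennreal (2 ^ ?n / sqrt (2 * pi)) / gauss_moment ?n)"
  have n1: "?n \<ge> 1" by (simp add: Suc_leI)
  show ?thesis
  proof (rule that[of K])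
    fix J :: "'n set"
    define w where "w u a G = ennreal (exp (- (norm u)\<^sup>2 / 2 - (norm G)\<^sup>2 / 2 - \<kappa> * norm (sol (transpose G) a)))
         * indicator {G. det G \<noteq> 0} G * indicator (sign_set J) (sol G u, a)"
      for u a :: "(real, 'n) vec" and G :: "((real, 'n) vec, 'n) vec"
    define w' where "w' m a G = ennreal (\<bar>det G\<bar> * exp (- ((norm G)\<^sup>2 + (norm (G *v m))\<^sup>2) / 2 - \<kappa> * norm (sol (transpose G) a)))
         * indicator {G. det G \<noteq> 0} G" for m a :: "(real, 'n) vec" and G :: "((real, 'n) vec, 'n) vec"
    have "(\<integral>\<^sup>+u. \<integral>\<^sup>+a. \<integral>\<^sup>+G. w u a G \<partial>lborel \<partial>lborel \<partial>lborel) = (\<integral>\<^sup>+a. \<integral>\<^sup>+u. \<integral>\<^sup>+G. w u a G \<partial>lborel \<partial>lborel \<partial>lborel)"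
      by (rule lborel_pair.Fubini') (unfold w_def, measurable)
    also have "\<dots> = (\<integral>\<^sup>+a. \<integral>\<^sup>+G. \<integral>\<^sup>+u. w u a G \<partial>lborel \<partial>lborel \<partial>lborel)"
      by (rule nn_integral_cong, rule lborel_pair.Fubini') (unfold w_def, measurable)
    also have "\<dots> = (\<integral>\<^sup>+a. \<integral>\<^sup>+G. \<integral>\<^sup>+m. w' m a G * indicator (sign_set J) (m, a) \<partial>lborel \<partial>lborel \<partial>lborel)"
    proof (rule nn_integral_cong, rule nn_integral_cong)
      fix a :: "(real, 'n) vec" and G :: "((real, 'n) vec, 'n) vec"
      show "(\<integral>\<^sup>+u. w u a G \<partial>lborel) = (\<integral>\<^sup>+m. w' m a G * indicator (sign_set J) (m, a) \<partial>lborel)"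
      proof (cases "det G = 0")
        case False
        have "(\<integral>\<^sup>+u. w u a G \<partial>lborel) = ennreal \<bar>det G\<bar> * (\<integral>\<^sup>+m. w (G *v m) a G \<partial>lborel)"
          by (rule nn_integral_matrix_vector_mult[OF False]) (unfold w_def, measurable)
        also have "\<dots> = (\<integral>\<^sup>+m. ennreal \<bar>det G\<bar> * w (G *v m) a G \<partial>lborel)"
          by (rule nn_integral_cmult[symmetric]) (unfold w_def, measurable)
        also have "\<dots> = (\<integral>\<^sup>+m. w' m a G * indicator (sign_set J) (m, a) \<partial>lborel)"
        proof (rule nn_integral_cong)
          fix m :: "(real, 'n) vec"
          have "sol G (G *v m) = m" using False by (metis sol_iff)
          moreover have ex: "- (norm (G *v m))\<^sup>2 / 2 - (norm G)\<^sup>2 / 2 = - ((norm G)\<^sup>2 + (norm (G *v m))\<^sup>2) / 2"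
            by (simp add: field_simps)
          ultimately show "ennreal \<bar>det G\<bar> * w (G *v m) a G = w' m a G * indicator (sign_set J) (m, a)"
            using False unfolding w_def w'_def ex by (simp add: ennreal_mult mult.assoc)
        qed
        finally show ?thesis .
      qed (simp add: w_def w'_def)
    qed
    also have "\<dots> = (\<integral>\<^sup>+a. \<integral>\<^sup>+m. \<integral>\<^sup>+G. w' m a G * indicator (sign_set J) (m, a) \<partial>lborel \<partial>lborel \<partial>lborel)"
      by (rule nn_integral_cong, rule lborel_pair.Fubini') (unfold w'_def, measurable)
    also have "\<dots> = (\<integral>\<^sup>+m. \<integral>\<^sup>+a. \<integral>\<^sup>+G. w' m a G * indicator (sign_set J) (m, a) \<partial>lborel \<partial>lborel \<partial>lborel)"
      by (rule lborel_pair.Fubini') (unfold w'_def, measurable)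
    also have "\<dots> = (\<integral>\<^sup>+m. K1 / polar_const ?n 0 * (ennreal (1 / sqrt (1 + (norm m)\<^sup>2) ^ (?n + 1)) *
      (\<integral>\<^sup>+a. ennreal (exp (- ((norm a)\<^sup>2 + (m \<bullet> a)\<^sup>2) / 2)) * indicator (sign_set J) (m, a) \<partial>lborel)) \<partial>lborel)"
    proof (rule nn_integral_cong)
      fix m :: "(real, 'n) vec"
      obtain B :: "((real, 'n) vec, 'n) vec" where B: "\<bar>det B\<bar> = sqrt (1 + (norm m)\<^sup>2)"
        "\<And>x. (norm (transpose B *v x))\<^sup>2 = (norm x)\<^sup>2 + (m \<bullet> x)\<^sup>2"
        using exists_rank_one_square_root by blast
      define c where "c = sqrt (1 + (norm m)\<^sup>2)"
      have c: "c > 0" by (simp add: c_def add_pos_nonneg)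
      have det_B: "det B \<noteq> 0" using B(1) c by (auto simp: c_def)
      have inner: "(\<integral>\<^sup>+G. w' m a G \<partial>lborel) = ennreal (1 / c ^ (?n + 1)) * h (norm (transpose B *v a))" for a
      proof -
        have "h (norm (transpose B *v a)) = ennreal (c ^ (?n + 1)) * (\<integral>\<^sup>+G. w' m a G \<partial>lborel)"
        proof -
          have "(norm (G ** B))\<^sup>2 = (norm G)\<^sup>2 + (norm (G *v m))\<^sup>2" for G :: "((real, 'n) vec, 'n) vec"
            unfolding norm_matrix_mult_squared B(2)
            by (simp add: sum.distrib norm_vec_squared[of G] norm_vec_squared[of "G *v m"] matrix_vector_mul_component inner_commute)
          then show ?thesis
            using det_integral_transform[OF det_B, of \<kappa> a] by (simp add: h w'_def B(1) c_def)
        qed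
        moreover have "ennreal (1 / c ^ (?n + 1)) * ennreal (c ^ (?n + 1)) = 1"
          using c by (simp add: ennreal_mult[symmetric])
        ultimately show ?thesis by (simp add: mult.assoc[symmetric])
      qed
      have [measurable]: "(*v) (transpose B) \<in> borel_measurable borel"
        by (intro borel_measurable_continuous_onI linear_continuous_on) simp
      have det_B': "det (transpose B) \<noteq> 0" using det_B by simp
      \<comment> \<open>The sign condition expressed through \<open>x = transpose B *v a\<close>. It
        is homogeneous of degree 0, as \<open>nn_integral_radial\<close> requires.\<close>
      define F where "F x = (indicator (sign_set J) (m, sol (transpose B) x) :: ennreal)" for x
      have F_meas [measurable]: "F \<in> borel_measurable borel" unfolding F_def by measurable
      have F: "F (transpose B *v a) = indicator (sign_set J) (m, a)" for a
        unfolding F_def using sol_iff[OF det_B', of a "transpose B *v a"] by (simp del: transpose_matrix_vector)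
      have F_hom: "F (t *\<^sub>R x) = F x" if "t > 0" for t x
      proof -
        have "sol (transpose B) (t *\<^sub>R x) = t *\<^sub>R sol (transpose B) x"
          using det_B' by (subst eq_commute, subst sol_iff[symmetric]) (simp_all add: matrix_vector_mult_scaleR mult_sol del: transpose_matrix_vector)
        then show ?thesis using that by (simp add: F_def indicator_def sign_set_scale2)
      qed
      have "(\<integral>\<^sup>+a. \<integral>\<^sup>+G. w' m a G * indicator (sign_set J) (m, a) \<partial>lborel \<partial>lborel)
        = (\<integral>\<^sup>+a. ennreal (1 / c ^ (?n + 1)) * (h (norm (transpose B *v a)) * F (transpose B *v a)) \<partial>lborel)"
      proof (rule nn_integral_cong)
        fix a :: "(real, 'n) vec"
        have "(\<integral>\<^sup>+G. w' m a G * indicator (sign_set J) (m, a) \<partial>lborel) = (\<integral>\<^sup>+G. w' m a G \<partial>lborel) * indicator (sign_set J) (m, a)"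
          by (rule nn_integral_multc) (unfold w'_def, measurable)
        then show "(\<integral>\<^sup>+G. w' m a G * indicator (sign_set J) (m, a) \<partial>lborel)
          = ennreal (1 / c ^ (?n + 1)) * (h (norm (transpose B *v a)) * F (transpose B *v a))"
          by (simp only: inner F mult.assoc)
      qed
      also have "\<dots> = ennreal (1 / c ^ (?n + 1)) * (\<integral>\<^sup>+a. h (norm (transpose B *v a)) * F (transpose B *v a) \<partial>lborel)"
        by (rule nn_integral_cmult) measurable
      also have "(\<integral>\<^sup>+a. h (norm (transpose B *v a)) * F (transpose B *v a) \<partial>lborel)
        = K1 / polar_const ?n 0 * (\<integral>\<^sup>+a. ennreal (exp (- (norm (transpose B *v a))\<^sup>2 / 2)) * F (transpose B *v a) \<partial>lborel)"
        (is "?A = _ * ?B")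
      proof -
        \<comment> \<open>Passing from a to \<open>transpose B *v a\<close> costs the same Jacobian
          before and after \<open>h\<close> is exchanged for a Gaussian, so it cancels.\<close>
        have "ennreal \<bar>det B\<bar> * (polar_const ?n 0 * ?A) = polar_const ?n 0 * (\<integral>\<^sup>+x. h (norm x) * F x \<partial>lborel)"
          using nn_integral_matrix_vector_mult[OF det_B', of "\<lambda>x. h (norm x) * F x"] by (simp add: mult_ac)
        also have "\<dots> = K1 * (\<integral>\<^sup>+x. ennreal (exp (- (norm x)\<^sup>2 / 2)) * F x \<partial>lborel)"
          using nn_integral_radial[OF F_meas, of h] F_hom by (simp add: K1_def)
        also have "\<dots> = ennreal \<bar>det B\<bar> * (K1 * ?B)"
          using nn_integral_matrix_vector_mult[OF det_B', of "\<lambda>x. ennreal (exp (- (norm x)\<^sup>2 / 2)) * F x"] by (simp add: mult_ac)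
        finally have "polar_const ?n 0 * ?A = K1 * ?B"
          using det_B by (subst (asm) ennreal_mult_cancel_left) auto
        then show ?thesis
          by (rule ennreal_eq_divide_mult) (use polar_const[OF n1, of 0] in auto)
      qed
      also have "?B = (\<integral>\<^sup>+a. ennreal (exp (- ((norm a)\<^sup>2 + (m \<bullet> a)\<^sup>2) / 2)) * indicator (sign_set J) (m, a) \<partial>lborel)"
        by (simp only: F B(2))
      finally show "(\<integral>\<^sup>+a. \<integral>\<^sup>+G. w' m a G * indicator (sign_set J) (m, a) \<partial>lborel \<partial>lborel) =
         K1 / polar_const ?n 0 * (ennreal (1 / sqrt (1 + (norm m)\<^sup>2) ^ (?n + 1)) *
        (\<integral>\<^sup>+a. ennreal (exp (- ((norm a)\<^sup>2 + (m \<bullet> a)\<^sup>2) / 2)) * indicator (sign_set J) (m, a) \<partial>lborel))"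
        unfolding c_def by (simp only: mult_ac)
    qed
    also have "\<dots> = K1 / polar_const ?n 0 * (\<integral>\<^sup>+m. (ennreal (1 / sqrt (1 + (norm m)\<^sup>2) ^ (?n + 1)) *
      (\<integral>\<^sup>+a. ennreal (exp (- ((norm a)\<^sup>2 + (m \<bullet> a)\<^sup>2) / 2)) * indicator (sign_set J) (m, a) \<partial>lborel)) \<partial>lborel)"
      (is "_ = _ * ?Y")
      by (rule nn_integral_cmult) measurable
    also have "?Y = ennreal (2 ^ ?n / sqrt (2 * pi)) / gauss_moment ?n * ennreal (pi ^ (?n - card J) * Re (\<integral>s. arsinh_integrand (card J) ?n s \<partial>lborel))"
    proof -
      have "gauss_moment ?n * ?Y = ennreal (2 ^ ?n / sqrt (2 * pi)) * ennreal (pi ^ (?n - card J) * Re (\<integral>s. arsinh_integrand (card J) ?n s \<partial>lborel))"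
        unfolding nn_integral_signs_cauchy by (rule ennreal_mult') simp
      then show ?thesis
        by (rule ennreal_eq_divide_mult) (use gauss_moment_finite gauss_moment_nonzero in auto)
    qed
    finally show "(\<integral>\<^sup>+u. \<integral>\<^sup>+a. \<integral>\<^sup>+G. ennreal (exp (- (norm u)\<^sup>2 / 2 - (norm G)\<^sup>2 / 2 - \<kappa> * norm (sol (transpose G) a)))
         * indicator {G. det G \<noteq> 0} G * indicator (sign_set J) (sol G u, a) \<partial>lborel \<partial>lborel \<partial>lborel)
      = K * ennreal (pi ^ (?n - card J) * Re (\<integral>s. arsinh_integrand (card J) ?n s \<partial>lborel))"
      unfolding w_def K_def by (simp only: mult.assoc)
  qed
qed

section \<open>Mecke's formula for Poisson processes\<close>

definition tuples :: "'i set \<Rightarrow> 'a set \<Rightarrow> ('i \<Rightarrow> 'a) set" where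
  "tuples I S = {x \<in> I \<rightarrow>\<^sub>E S. inj_on x I}"

text \<open>The codes of the hyperplanes that separate v from the origin.\<close>

definition void_ball :: "'a::real_inner \<Rightarrow> 'a set" where
  "void_ball v = {x. x \<bullet> x < x \<bullet> v}"

text \<open>Finiteness on bounded sets makes \<open>measure L\<close> agree there with the true
  intensity; the absence of atoms makes the diagonals of the product measure negligible.\<close>

locale poisson_points = prob_space M for M :: "'w measure" +
  fixes \<Phi> :: "'w \<Rightarrow> 'a::euclidean_space set" and L :: "'a measure"
  assumes poisson: "poisson_process M \<Phi> L"
    and sets_L [measurable_cong]: "sets L = sets borel"
    and finite_bounded: "bounded B \<Longrightarrow> B \<in> sets borel \<Longrightarrow> emeasure L B < \<infinity>"
    and diffuse: "emeasure L {x} = 0"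
begin

lemma space_L: "space L = UNIV"
  using sets_eq_imp_space_eq[OF sets_L] by simp

sublocale L: sigma_finite_measure L
proof
  show "\<exists>A. countable A \<and> A \<subseteq> sets L \<and> \<Union>A = space L \<and> (\<forall>a\<in>A. emeasure L a \<noteq> \<infinity>)"
  proof (intro exI conjI ballI)
    show "\<Union>(range (\<lambda>n::nat. cball 0 (real n))) = space L"
      by (auto simp: space_L real_arch_simple)
    fix a assume "a \<in> range (\<lambda>n::nat. cball (0::'a) (real n))"
    then have "emeasure L a < \<infinity>" by (intro finite_bounded) auto
    then show "emeasure L a \<noteq> \<infinity>" by simp
  qed (auto simp: sets_L)
qed

sublocale PL: product_sigma_finite "\<lambda>_::'i. L"
  by standard

lemma finite_points: "\<omega> \<in> space M \<Longrightarrow> bounded B \<Longrightarrow> finite (\<Phi> \<omega> \<inter> B)"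
proof -
  assume \<omega>: "\<omega> \<in> space M" and "bounded B"
  obtain R where "B \<subseteq> cball 0 R"
    using bounded_subset_ballD[OF \<open>bounded B\<close>, of 0] ball_subset_cball by blast
  moreover have "finite (\<Phi> \<omega> \<inter> cball 0 R)" using poisson \<omega> by (auto simp: poisson_process_def)
  ultimately show ?thesis by (elim finite_subset[rotated]) auto
qed

abbreviation points :: "'a set \<Rightarrow> 'w \<Rightarrow> nat" where
  "points B \<omega> \<equiv> card (\<Phi> \<omega> \<inter> B)"

lemma points_measurable: "B \<in> sets borel \<Longrightarrow> bounded B \<Longrightarrow> points B \<in> M \<rightarrow>\<^sub>M count_space UNIV"
  using poisson by (auto simp: poisson_process_def)

lemma points_prob:
  "B \<in> sets borel \<Longrightarrow> bounded B \<Longrightarrow> measure M {\<omega> \<in> space M. points B \<omega> = k} = measure L B ^ k / fact k * exp (- measure L B)"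
  using poisson by (auto simp: poisson_process_def)

lemma points_indep:
  "finite (K :: nat set) \<Longrightarrow> disjoint_family_on B K \<Longrightarrow> (\<And>i. i \<in> K \<Longrightarrow> B i \<in> sets borel \<and> bounded (B i)) \<Longrightarrow>
    indep_vars (\<lambda>_. count_space UNIV) (\<lambda>i. points (B i)) K"
  using poisson by (auto simp: poisson_process_def)

lemma nn_integral_points:
  assumes B: "B \<in> sets borel" "bounded B"
  shows "(\<integral>\<^sup>+\<omega>. of_nat (points B \<omega>) \<partial>M) = emeasure L B"
proof -
  define m where "m = measure L B"
  have m: "m \<ge> 0" by (simp add: m_def)
  have meas [measurable]: "points B \<in> M \<rightarrow>\<^sub>M count_space UNIV" by (rule points_measurable[OF B])
  have expand: "(of_nat (points B \<omega>) :: ennreal) = (\<Sum>k. of_nat k * indicator {\<omega> \<in> space M. points B \<omega> = k} \<omega>)" if "\<omega> \<in> space M" for \<omega>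
  proof -
    have "(\<lambda>k. (of_nat k * indicator {\<omega> \<in> space M. points B \<omega> = k} \<omega> :: ennreal)) = (\<lambda>k. if k = points B \<omega> then of_nat k else 0)"
      using that by (auto simp: indicator_def)
    then show ?thesis using sums_single[of "points B \<omega>" "\<lambda>k. of_nat k :: ennreal"] by (simp add: sums_iff)
  qed
  have "(\<lambda>k. m * (m ^ k / fact k)) sums (m * exp m)"
    using sums_mult[OF exp_converges[of m], of m] by (simp add: scaleR_conv_of_real divide_inverse mult_ac)
  then have "(\<lambda>k. real (Suc k) * (m ^ Suc k / fact (Suc k))) sums (m * exp m)"
    by (simp add: field_simps del: of_nat_Suc)
  then have "(\<lambda>k. real k * (m ^ k / fact k)) sums (m * exp m)"
    by (subst (asm) sums_Suc_iff) simp
  from sums_mult2[OF this, of "exp (- m)"] have sums: "(\<lambda>k. real k * (m ^ k / fact k * exp (- m))) sums m"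
    by (simp add: mult_ac exp_minus)
  have "(\<integral>\<^sup>+\<omega>. of_nat (points B \<omega>) \<partial>M) = (\<integral>\<^sup>+\<omega>. (\<Sum>k. of_nat k * indicator {\<omega> \<in> space M. points B \<omega> = k} \<omega>) \<partial>M)"
    by (intro nn_integral_cong expand)
  also have "\<dots> = (\<Sum>k. \<integral>\<^sup>+\<omega>. of_nat k * indicator {\<omega> \<in> space M. points B \<omega> = k} \<omega> \<partial>M)"
    by (rule nn_integral_suminf) measurable
  also have "\<dots> = (\<Sum>k. ennreal (real k * (m ^ k / fact k * exp (- m))))"
  proof (rule suminf_cong)
    fix k
    have "(\<integral>\<^sup>+\<omega>. of_nat k * indicator {\<omega> \<in> space M. points B \<omega> = k} \<omega> \<partial>M) = of_nat k * emeasure M {\<omega> \<in> space M. points B \<omega> = k}"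
      by (rule nn_integral_cmult_indicator) measurable
    also have "\<dots> = ennreal (real k * (m ^ k / fact k * exp (- m)))"
      using m by (simp add: emeasure_eq_measure points_prob[OF B] m_def[symmetric] ennreal_mult[symmetric] ennreal_of_nat_eq_real_of_nat)
    finally show "(\<integral>\<^sup>+\<omega>. of_nat k * indicator {\<omega> \<in> space M. points B \<omega> = k} \<omega> \<partial>M) = ennreal (real k * (m ^ k / fact k * exp (- m)))" .
  qed
  also have "\<dots> = ennreal m"
    using sums m by (subst suminf_ennreal2) (auto simp: sums_iff)
  also have "\<dots> = emeasure L B"
    using finite_bounded[OF B(2,1)] by (simp add: m_def emeasure_eq_ennreal_measure)
  finally show ?thesis .
qed

lemma void_measurable: "D \<in> sets borel \<Longrightarrow> bounded D \<Longrightarrow> {\<omega> \<in> space M. \<Phi> \<omega> \<inter> D = {}} \<in> sets M"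
proof -
  assume D: "D \<in> sets borel" "bounded D"
  have "{\<omega> \<in> space M. \<Phi> \<omega> \<inter> D = {}} = points D -` {0} \<inter> space M"
    using finite_points D(2) by auto
  then show ?thesis using measurable_sets[OF points_measurable[OF D], of "{0}"] by simp
qed

lemma void_prob:
  assumes D: "D \<in> sets borel" "bounded D"
  shows "emeasure M {\<omega> \<in> space M. \<Phi> \<omega> \<inter> D = {}} = ennreal (exp (- measure L D))"
proof -
  have "{\<omega> \<in> space M. \<Phi> \<omega> \<inter> D = {}} = {\<omega> \<in> space M. points D \<omega> = 0}"
    using finite_points D(2) by auto
  then show ?thesis using points_prob[OF D, of 0] by (simp add: emeasure_eq_measure)
qed

text \<open>The counts in the sets \<open>X i\<close> and in \<open>D\<close> are independent
  because these sets are disjoint. Independence is available for families indexed by naturals, so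
  \<open>I\<close> is enumerated and the last index \<open>card I\<close> is reserved for
  \<open>D\<close>.\<close>

lemma nn_integral_prod_points_void:
  assumes I: "finite I" and disj: "disjoint_family_on X I"
    and X: "\<And>i. i \<in> I \<Longrightarrow> X i \<in> sets borel" "\<And>i. i \<in> I \<Longrightarrow> bounded (X i)" "\<And>i. i \<in> I \<Longrightarrow> X i \<inter> D = {}"
    and D: "D \<in> sets borel" "bounded D"
  shows "(\<integral>\<^sup>+\<omega>. (\<Prod>i\<in>I. of_nat (points (X i) \<omega>)) * indicator {\<omega>. \<Phi> \<omega> \<inter> D = {}} \<omega> \<partial>M)
    = (\<Prod>i\<in>I. emeasure L (X i)) * ennreal (exp (- measure L D))"
proof -
  obtain h where h: "bij_betw h {0..<card I} I" using ex_bij_betw_nat_finite[OF I] by blast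
  let ?k = "card I"
  define B where "B i = (if i < ?k then X (h i) else D)" for i
  define f where "f i n = (if i < ?k then of_nat n else indicator {0} n :: ennreal)" for i n :: nat
  have hI: "h i \<in> I" if "i < ?k" for i using h that by (auto simp: bij_betw_def)
  have h_inj: "h i = h j \<longleftrightarrow> i = j" if "i < ?k" "j < ?k" for i j
    using h that by (auto simp: bij_betw_def inj_on_def)
  have B: "B i \<in> sets borel \<and> bounded (B i)" for i using hI X D by (auto simp: B_def)
  have disjB: "disjoint_family_on B {0..?k}"
    unfolding disjoint_family_on_def
  proof (intro ballI impI)
    fix i j assume ij: "i \<in> {0..?k}" "j \<in> {0..?k}" "i \<noteq> j"
    consider "i < ?k" "j < ?k" | "i < ?k" "\<not> j < ?k" | "\<not> i < ?k" "j < ?k" | "\<not> i < ?k" "\<not> j < ?k" by blast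
    then show "B i \<inter> B j = {}"
    proof cases
      case 1
      then show ?thesis using disjoint_family_onD[OF disj hI hI] h_inj ij(3) by (simp add: B_def)
    next
      case 2
      then show ?thesis using X(3)[OF hI] by (simp add: B_def)
    next
      case 3
      then show ?thesis using X(3)[OF hI] by (simp add: B_def Int_commute)
    qed (use ij in auto)
  qed
  have "indep_vars (\<lambda>_. count_space UNIV) (\<lambda>i. points (B i)) {0..?k}"
    by (rule points_indep) (use disjB B in auto)
  then have indep: "indep_vars (\<lambda>_. borel) (\<lambda>i \<omega>. f i (points (B i) \<omega>)) {0..?k}"
    by (rule indep_vars_compose2) simp
  have eq1: "(\<integral>\<^sup>+\<omega>. (\<Prod>i\<in>{0..?k}. f i (points (B i) \<omega>)) \<partial>M) = (\<Prod>i\<in>{0..?k}. \<integral>\<^sup>+\<omega>. f i (points (B i) \<omega>) \<partial>M)"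
    by (rule indep_vars_nn_integral[OF _ indep]) auto
  have split: "{0..?k} = insert ?k {0..<?k}" by auto
  have reidx: "(\<Prod>i\<in>{0..<?k}. g i) = (\<Prod>i\<in>I. g' i)" if "\<And>i. i < ?k \<Longrightarrow> g i = g' (h i)" for g g' :: "_ \<Rightarrow> ennreal"
    using prod.reindex_bij_betw[OF h, of g'] that by (metis (no_types, lifting) atLeastLessThan_iff prod.cong)
  have prod1: "(\<Prod>i\<in>{0..<?k}. f i (points (B i) \<omega>)) = (\<Prod>i\<in>I. of_nat (points (X i) \<omega>))" for \<omega>
    by (rule reidx) (simp add: f_def B_def)
  have prod2: "(\<Prod>i\<in>{0..<?k}. \<integral>\<^sup>+\<omega>. f i (points (B i) \<omega>) \<partial>M) = (\<Prod>i\<in>I. emeasure L (X i))"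
    by (rule reidx) (simp add: f_def B_def nn_integral_points X hI)
  have last: "f ?k (points (B ?k) \<omega>) = indicator {\<omega>. \<Phi> \<omega> \<inter> D = {}} \<omega>" if "\<omega> \<in> space M" for \<omega>
    using finite_points[OF that D(2)] by (auto simp: f_def B_def indicator_def)
  have "(\<integral>\<^sup>+\<omega>. (\<Prod>i\<in>I. of_nat (points (X i) \<omega>)) * indicator {\<omega>. \<Phi> \<omega> \<inter> D = {}} \<omega> \<partial>M)
    = (\<integral>\<^sup>+\<omega>. (\<Prod>i\<in>{0..?k}. f i (points (B i) \<omega>)) \<partial>M)"
    unfolding split by (intro nn_integral_cong) (simp add: prod1 last mult.commute)
  also have "\<dots> = (\<integral>\<^sup>+\<omega>. f ?k (points (B ?k) \<omega>) \<partial>M) * (\<Prod>i\<in>I. emeasure L (X i))"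
    unfolding eq1 unfolding split by (simp add: prod2)
  also have "(\<integral>\<^sup>+\<omega>. f ?k (points (B ?k) \<omega>) \<partial>M) = (\<integral>\<^sup>+\<omega>. indicator {\<omega> \<in> space M. \<Phi> \<omega> \<inter> D = {}} \<omega> \<partial>M)"
    by (intro nn_integral_cong) (simp add: last indicator_def)
  also have "\<dots> = ennreal (exp (- measure L D))"
    using void_prob[OF D] void_measurable[OF D] by simp
  finally show ?thesis by (simp only: mult.commute)
qed

text \<open>Counting measure instead of \<open>card\<close>: the number is countably additive in
  \<open>A\<close>, and infinite sets get infinity rather than 0.\<close>

definition ntuples :: "'i set \<Rightarrow> ('i \<Rightarrow> 'a) set \<Rightarrow> 'w \<Rightarrow> ennreal" where
  "ntuples I A \<omega> = emeasure (count_space UNIV) (tuples I (\<Phi> \<omega>) \<inter> A)"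

lemma finite_tuples:
  assumes "finite I" "\<omega> \<in> space M" "A \<subseteq> (\<Pi>\<^sub>E i\<in>I. Q i)" "\<And>i. i \<in> I \<Longrightarrow> bounded (Q i)"
  shows "finite (tuples I (\<Phi> \<omega>) \<inter> A)"
proof (rule finite_subset)
  show "tuples I (\<Phi> \<omega>) \<inter> A \<subseteq> (\<Pi>\<^sub>E i\<in>I. \<Phi> \<omega> \<inter> Q i)"
    using assms(3) by (auto simp: tuples_def PiE_iff)
  show "finite (\<Pi>\<^sub>E i\<in>I. \<Phi> \<omega> \<inter> Q i)"
    using assms finite_points by (intro finite_PiE) auto
qed

lemma space_PiM_L: "space (PiM I (\<lambda>_. L)) = (\<Pi>\<^sub>E i\<in>I. UNIV)"
  by (simp add: space_PiM space_L)

text \<open>Mecke's formula for the tuples in \<open>A\<close>, restricted to the event that the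
  fixed set \<open>D\<close> is empty of points. Measurability is part of the predicate because it
  has to pass through the same inductions.\<close>

definition mecke :: "'i set \<Rightarrow> 'a set \<Rightarrow> ('i \<Rightarrow> 'a) set \<Rightarrow> bool" where
  "mecke I D A \<longleftrightarrow> (\<lambda>\<omega>. ntuples I A \<omega> * indicator {\<omega>. \<Phi> \<omega> \<inter> D = {}} \<omega>) \<in> borel_measurable M \<and>
     (\<integral>\<^sup>+\<omega>. ntuples I A \<omega> * indicator {\<omega>. \<Phi> \<omega> \<inter> D = {}} \<omega> \<partial>M)
       = emeasure (PiM I (\<lambda>_. L)) A * ennreal (exp (- measure L D))"

lemma mecke_suminf:
  assumes A: "\<And>n::nat. A n \<in> sets (PiM I (\<lambda>_. L))" "disjoint_family A" and "\<And>n. mecke I D (A n)"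
  shows "mecke I D (\<Union>n. A n)"
proof -
  have "disjoint_family (\<lambda>n. tuples I (\<Phi> \<omega>) \<inter> A n)" for \<omega>
    using A(2) by (auto simp: disjoint_family_on_def)
  then have N: "ntuples I (\<Union>n. A n) \<omega> = (\<Sum>n. ntuples I (A n) \<omega>)" for \<omega>
    unfolding ntuples_def by (subst suminf_emeasure) auto
  then have N': "ntuples I (\<Union>n. A n) \<omega> * indicator {\<omega>. \<Phi> \<omega> \<inter> D = {}} \<omega> = (\<Sum>n. ntuples I (A n) \<omega> * indicator {\<omega>. \<Phi> \<omega> \<inter> D = {}} \<omega>)" for \<omega>
    by simp
  have [measurable]: "(\<lambda>\<omega>. ntuples I (A n) \<omega> * indicator {\<omega>. \<Phi> \<omega> \<inter> D = {}} \<omega>) \<in> borel_measurable M" for n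
    using assms(3)[of n] by (simp add: mecke_def)
  have "(\<integral>\<^sup>+\<omega>. ntuples I (\<Union>n. A n) \<omega> * indicator {\<omega>. \<Phi> \<omega> \<inter> D = {}} \<omega> \<partial>M)
      = (\<Sum>n. \<integral>\<^sup>+\<omega>. ntuples I (A n) \<omega> * indicator {\<omega>. \<Phi> \<omega> \<inter> D = {}} \<omega> \<partial>M)"
    unfolding N' by (rule nn_integral_suminf) measurable
  also have "\<dots> = (\<Sum>n. emeasure (PiM I (\<lambda>_. L)) (A n) * ennreal (exp (- measure L D)))"
    using assms(3) by (simp add: mecke_def)
  also have "\<dots> = emeasure (PiM I (\<lambda>_. L)) (\<Union>n. A n) * ennreal (exp (- measure L D))"
  proof -
    have "(\<Sum>n. emeasure (PiM I (\<lambda>_. L)) (A n)) = emeasure (PiM I (\<lambda>_. L)) (\<Union>n. A n)"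
      using A by (intro suminf_emeasure) auto
    then show ?thesis by (simp only: ennreal_suminf_multc)
  qed
  finally have "(\<integral>\<^sup>+\<omega>. ntuples I (\<Union>n. A n) \<omega> * indicator {\<omega>. \<Phi> \<omega> \<inter> D = {}} \<omega> \<partial>M)
      = emeasure (PiM I (\<lambda>_. L)) (\<Union>n. A n) * ennreal (exp (- measure L D))" .
  moreover have "(\<lambda>\<omega>. ntuples I (\<Union>n. A n) \<omega> * indicator {\<omega>. \<Phi> \<omega> \<inter> D = {}} \<omega>) \<in> borel_measurable M"
    unfolding N' by measurable
  ultimately show ?thesis unfolding mecke_def by simp
qed

text \<open>Inside a product of disjoint sets every tuple is injective, so on boxes the number of
  tuples is a product of independent counts. Boxes are stable under intersection, and the formula
  spreads to the sigma-algebra they generate.\<close>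

lemma mecke_rectangle:
  assumes I: "finite I" and disj: "disjoint_family_on Q I"
    and Q: "\<And>i. i \<in> I \<Longrightarrow> Q i \<in> sets borel" "\<And>i. i \<in> I \<Longrightarrow> bounded (Q i)" "\<And>i. i \<in> I \<Longrightarrow> Q i \<inter> D = {}"
    and D: "D \<in> sets borel" "bounded D"
    and A: "A \<in> sets (PiM I (\<lambda>_. L))"
  shows "mecke I D (A \<inter> (\<Pi>\<^sub>E i\<in>I. Q i))"
proof -
  let ?P = "PiM I (\<lambda>_. L)" and ?Q = "\<Pi>\<^sub>E i\<in>I. Q i"
  let ?v = "\<lambda>\<omega>. indicator {\<omega>. \<Phi> \<omega> \<inter> D = {}} \<omega> :: ennreal"
  have Q_sets: "?Q \<in> sets ?P" using I Q(1) by (intro sets_PiM_I_finite) (auto simp: sets_L)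
  have box: "mecke I D (\<Pi>\<^sub>E i\<in>I. X i \<inter> Q i)" if X: "\<And>i. i \<in> I \<Longrightarrow> X i \<in> sets borel" for X
  proof -
    have N: "ntuples I (\<Pi>\<^sub>E i\<in>I. X i \<inter> Q i) \<omega> = (\<Prod>i\<in>I. of_nat (points (X i \<inter> Q i) \<omega>))" if \<omega>: "\<omega> \<in> space M" for \<omega>
    proof -
      have eq: "tuples I (\<Phi> \<omega>) \<inter> (\<Pi>\<^sub>E i\<in>I. X i \<inter> Q i) = (\<Pi>\<^sub>E i\<in>I. \<Phi> \<omega> \<inter> (X i \<inter> Q i))"
      proof (intro equalityI subsetI)
        fix x assume x: "x \<in> (\<Pi>\<^sub>E i\<in>I. \<Phi> \<omega> \<inter> (X i \<inter> Q i))"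
        have "inj_on x I"
        proof (rule inj_onI)
          fix i j assume ij: "i \<in> I" "j \<in> I" "x i = x j"
          then have "x i \<in> Q i \<inter> Q j" using x by (auto simp: PiE_iff)
          then show "i = j" using disj ij by (auto simp: disjoint_family_on_def)
        qed
        with x show "x \<in> tuples I (\<Phi> \<omega>) \<inter> (\<Pi>\<^sub>E i\<in>I. X i \<inter> Q i)" by (auto simp: tuples_def PiE_iff)
      qed (auto simp: tuples_def PiE_iff)
      have "finite (\<Pi>\<^sub>E i\<in>I. \<Phi> \<omega> \<inter> (X i \<inter> Q i))"
        using I Q(2) finite_points[OF \<omega>] by (intro finite_PiE) (auto intro: bounded_Int)
      then show ?thesis unfolding ntuples_def eq
        using I by (simp add: emeasure_count_space_finite card_PiE)
    qed
    have meas: "(\<lambda>\<omega>. (\<Prod>i\<in>I. of_nat (points (X i \<inter> Q i) \<omega>)) * ?v \<omega>) \<in> borel_measurable M"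
    proof (intro borel_measurable_times_ennreal borel_measurable_prod_ennreal)
      fix i assume "i \<in> I"
      then show "(\<lambda>\<omega>. of_nat (points (X i \<inter> Q i) \<omega>) :: ennreal) \<in> borel_measurable M"
        using X Q by (intro measurable_compose[OF points_measurable]) (auto intro: bounded_Int)
    next
      show "?v \<in> borel_measurable M"
        using void_measurable[OF D] by (subst borel_measurable_indicator_iff) (simp add: Int_def conj_commute)
    qed
    have "emeasure ?P (\<Pi>\<^sub>E i\<in>I. X i \<inter> Q i) = (\<Prod>i\<in>I. emeasure L (X i \<inter> Q i))"
      using I X Q by (intro PL.emeasure_PiM) (auto simp: sets_L)
    moreover have "(\<integral>\<^sup>+\<omega>. (\<Prod>i\<in>I. of_nat (points (X i \<inter> Q i) \<omega>)) * ?v \<omega> \<partial>M)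
       = (\<Prod>i\<in>I. emeasure L (X i \<inter> Q i)) * ennreal (exp (- measure L D))"
    proof (rule nn_integral_prod_points_void[OF I _ _ _ _ D])
      show "disjoint_family_on (\<lambda>i. X i \<inter> Q i) I"
        using disj by (auto simp: disjoint_family_on_def)
      show "X i \<inter> Q i \<in> sets borel" "bounded (X i \<inter> Q i)" "X i \<inter> Q i \<inter> D = {}" if "i \<in> I" for i
        using X[OF that] Q(1,2)[OF that] Q(3)[OF that] by (auto intro: bounded_Int)
    qed
    ultimately show ?thesis
      unfolding mecke_def using meas
      by (simp add: N cong: measurable_cong nn_integral_cong)
  qed
  have Q_mecke: "mecke I D ?Q" using box[of "\<lambda>_. UNIV"] by simp
  have "emeasure ?P ?Q = (\<Prod>i\<in>I. emeasure L (Q i))"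
    using I Q by (intro PL.emeasure_PiM) (auto simp: sets_L)
  also have "\<dots> < \<infinity>"
    using finite_bounded Q by (simp add: ennreal_prod_eq_top less_top[symmetric])
  finally have Q_fin: "emeasure ?P ?Q < \<infinity>" .
  have "A \<in> sigma_sets (\<Pi>\<^sub>E i\<in>I. space L) (prod_algebra I (\<lambda>_. L))"
    using A by (simp add: sets_PiM)
  then show ?thesis
  proof (rule sigma_sets_induct_disjoint[OF Int_stable_prod_algebra prod_algebra_sets_into_space])
    fix A assume "A \<in> prod_algebra I (\<lambda>_. L)"
    then obtain X where X: "A = Pi\<^sub>E I X" "\<And>i. i \<in> I \<Longrightarrow> X i \<in> sets borel"
      using I by (auto simp: prod_algebra_eq_finite sets_L)
    then have "A \<inter> ?Q = (\<Pi>\<^sub>E i\<in>I. X i \<inter> Q i)" by (simp add: PiE_Int)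
    then show "mecke I D (A \<inter> ?Q)" using box X by simp
  next
    show "mecke I D ({} \<inter> ?Q)" by (simp add: mecke_def ntuples_def)
  next
    fix A assume "A \<in> sigma_sets (\<Pi>\<^sub>E i\<in>I. space L) (prod_algebra I (\<lambda>_. L))" and m: "mecke I D (A \<inter> ?Q)"
    then have A_sets: "A \<in> sets ?P" by (simp add: sets_PiM)
    have eq: "((\<Pi>\<^sub>E i\<in>I. space L) - A) \<inter> ?Q = ?Q - A \<inter> ?Q" by (auto simp: space_L)
    \<comment> \<open>Only finitely many tuples lie in \<open>?Q\<close>, so the count for the
      complement is obtained by subtraction.\<close>
    have N: "ntuples I (?Q - A \<inter> ?Q) \<omega> * ?v \<omega> = ntuples I ?Q \<omega> * ?v \<omega> - ntuples I (A \<inter> ?Q) \<omega> * ?v \<omega>" if "\<omega> \<in> space M" for \<omega>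
    proof -
      have fin: "finite (tuples I (\<Phi> \<omega>) \<inter> ?Q)"
        by (rule finite_tuples[where Q = Q]) (use I Q that in auto)
      have "ntuples I (?Q - A \<inter> ?Q) \<omega> = emeasure (count_space UNIV) ((tuples I (\<Phi> \<omega>) \<inter> ?Q) - (tuples I (\<Phi> \<omega>) \<inter> (A \<inter> ?Q)))"
        unfolding ntuples_def by (rule arg_cong[where f = "emeasure _"]) auto
      also have "\<dots> = ntuples I ?Q \<omega> - ntuples I (A \<inter> ?Q) \<omega>"
        unfolding ntuples_def using finite_subset[OF _ fin, of "tuples I (\<Phi> \<omega>) \<inter> (A \<inter> ?Q)"]
        by (intro emeasure_Diff) (auto simp: emeasure_count_space)
      finally show ?thesis by (simp add: indicator_def)
    qed
    have [measurable]: "(\<lambda>\<omega>. ntuples I ?Q \<omega> * ?v \<omega>) \<in> borel_measurable M" "(\<lambda>\<omega>. ntuples I (A \<inter> ?Q) \<omega> * ?v \<omega>) \<in> borel_measurable M"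
      using m Q_mecke by (simp_all add: mecke_def)
    have le: "emeasure ?P (A \<inter> ?Q) \<le> emeasure ?P ?Q" using Q_sets by (intro emeasure_mono) auto
    have "(\<integral>\<^sup>+\<omega>. ntuples I ?Q \<omega> * ?v \<omega> - ntuples I (A \<inter> ?Q) \<omega> * ?v \<omega> \<partial>M)
      = (\<integral>\<^sup>+\<omega>. ntuples I ?Q \<omega> * ?v \<omega> \<partial>M) - (\<integral>\<^sup>+\<omega>. ntuples I (A \<inter> ?Q) \<omega> * ?v \<omega> \<partial>M)"
    proof (rule nn_integral_diff)
      show "(\<integral>\<^sup>+\<omega>. ntuples I (A \<inter> ?Q) \<omega> * ?v \<omega> \<partial>M) \<noteq> \<infinity>"
        using m le Q_fin by (auto simp: mecke_def ennreal_mult_eq_top_iff top_unique)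
      show "AE \<omega> in M. ntuples I (A \<inter> ?Q) \<omega> * ?v \<omega> \<le> ntuples I ?Q \<omega> * ?v \<omega>"
        unfolding ntuples_def by (intro AE_I2 mult_right_mono emeasure_mono) auto
    qed measurable
    also have "\<dots> = emeasure ?P ?Q * ennreal (exp (- measure L D)) - emeasure ?P (A \<inter> ?Q) * ennreal (exp (- measure L D))"
      using m Q_mecke by (simp add: mecke_def)
    also have "\<dots> = (emeasure ?P ?Q - emeasure ?P (A \<inter> ?Q)) * ennreal (exp (- measure L D))"
      using ennreal_right_diff_distrib[of "ennreal (exp (- measure L D))"]
      by (simp only: mult.commute[of _ "ennreal (exp (- measure L D))"]) simp
    also have "emeasure ?P ?Q - emeasure ?P (A \<inter> ?Q) = emeasure ?P (?Q - A \<inter> ?Q)"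
      using Q_fin le A_sets Q_sets by (intro emeasure_Diff[symmetric]) auto
    finally show "mecke I D (((\<Pi>\<^sub>E i\<in>I. space L) - A) \<inter> ?Q)"
      unfolding eq mecke_def by (simp add: N cong: measurable_cong nn_integral_cong)
  next
    fix A :: "nat \<Rightarrow> _"
    assume d: "disjoint_family A" and A: "range A \<subseteq> sigma_sets (\<Pi>\<^sub>E i\<in>I. space L) (prod_algebra I (\<lambda>_. L))"
      and m: "\<And>n. mecke I D (A n \<inter> ?Q)"
    have "mecke I D (\<Union>n. A n \<inter> ?Q)"
    proof (intro mecke_suminf m)
      have "A n \<in> sets ?P" for n using A by (auto simp: sets_PiM)
      then show "A n \<inter> ?Q \<in> sets ?P" for n using Q_sets by (intro sets.Int)
      show "disjoint_family (\<lambda>n. A n \<inter> ?Q)" using d by (auto simp: disjoint_family_on_def)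
    qed
    then show "mecke I D (\<Union>(range A) \<inter> ?Q)" by (simp add: Int_commute)
  qed
qed

end

section \<open>Mecke's formula off the diagonals\<close>

context poisson_points
begin

text \<open>Integrating coordinate i first leaves the \<open>L\<close>-measure of the single point
  \<open>x j\<close>, which is 0.\<close>

lemma diagonal_null:
  assumes I: "finite I" "i \<in> I" "j \<in> I" "i \<noteq> j"
  shows "{x \<in> space (PiM I (\<lambda>_. L)). x i = x j} \<in> null_sets (PiM I (\<lambda>_. L))"
proof -
  define K where "K = I - {i}"
  have K: "I = insert i K" "i \<notin> K" "finite K" "j \<in> K" using I by (auto simp: K_def)
  let ?A = "{x \<in> space (PiM I (\<lambda>_. L)). x i = x j}"
  have A: "?A \<in> sets (PiM I (\<lambda>_. L))"
    using I(2,3) by measurable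
  have "emeasure (PiM I (\<lambda>_. L)) ?A = (\<integral>\<^sup>+x. indicator ?A x \<partial>PiM I (\<lambda>_. L))"
    using A by simp
  also have "\<dots> = (\<integral>\<^sup>+x. \<integral>\<^sup>+y. indicator ?A (x(i := y)) \<partial>L \<partial>PiM K (\<lambda>_. L))"
    unfolding K(1) using K A by (intro PL.product_nn_integral_insert) auto
  also have "\<dots> = (\<integral>\<^sup>+x. \<integral>\<^sup>+y. indicator {x j} y \<partial>L \<partial>PiM K (\<lambda>_. L))"
    using K by (intro nn_integral_cong) (auto simp: indicator_def space_PiM space_L PiE_iff extensional_def)
  also have "\<dots> = 0"
    by (simp add: diffuse sets_L)
  finally show ?thesis using A by (auto simp: null_sets_def)
qed

text \<open>The entries of an injective tuple can be separated by disjoint sets of a countable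
  basis, so countably many rectangles cover all injective tuples in \<open>A\<close>. Made disjoint,
  they add up by \<open>mecke_suminf\<close>. What is missed lies on diagonals: it is null for the
  product measure and contains no injective tuple.\<close>

lemma mecke_off_diagonal:
  assumes I: "finite I" and D: "D \<in> sets borel" "bounded D"
    and A: "A \<in> sets (PiM I (\<lambda>_. L))" and sub: "A \<subseteq> (\<Pi>\<^sub>E i\<in>I. cball 0 R - D)"
  shows "mecke I D A"
proof -
  let ?P = "PiM I (\<lambda>_. L)"
  obtain \<B> :: "'a set set" where \<B>: "countable \<B>" "topological_basis \<B>"
    using ex_countable_basis by blast
  have \<B>_open: "U \<in> \<B> \<Longrightarrow> open U" for U using \<B>(2) by (rule topological_basis_open)
  define \<C> where "\<C> = {U \<in> I \<rightarrow>\<^sub>E \<B>. disjoint_family_on U I}"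
  have \<C>: "countable \<C>"
  proof (rule countable_subset)
    show "countable (I \<rightarrow>\<^sub>E \<B>)" using I \<B>(1) by (intro countable_PiE) auto
  qed (auto simp: \<C>_def)
  define Q where "Q U i = U i \<inter> (cball 0 R - D)" for U :: "'b \<Rightarrow> 'a set" and i
  have Q: "Q U i \<in> sets borel" "bounded (Q U i)" "Q U i \<inter> D = {}" if "U \<in> \<C>" "i \<in> I" for U i
  proof -
    have "U i \<in> \<B>" using that by (auto simp: \<C>_def)
    then show "Q U i \<in> sets borel" using D(1) \<B>_open by (auto simp: Q_def)
    show "bounded (Q U i)" by (rule bounded_subset[of "cball 0 R"]) (auto simp: Q_def)
  qed (auto simp: Q_def)
  have Q_disj: "disjoint_family_on (Q U) I" if "U \<in> \<C>" for U
    using that by (auto simp: \<C>_def disjoint_family_on_def Q_def)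
  define E where "E n = (if \<C> = {} then {} else Pi\<^sub>E I (Q (from_nat_into \<C> n)))" for n
  have E_sets [measurable]: "E n \<in> sets ?P" for n
    using I Q from_nat_into[of \<C> n] by (auto simp: E_def sets_L intro!: sets_PiM_I_finite)
  have cover: "x \<in> (\<Union>n. E n)" if x: "x \<in> A" "inj_on x I" for x
  proof -
    have "\<exists>\<delta>>0. \<forall>i\<in>I. \<forall>j\<in>I. i \<noteq> j \<longrightarrow> \<delta> \<le> dist (x i) (x j)"
    proof (cases "\<exists>i\<in>I. \<exists>j\<in>I. i \<noteq> j")
      case True
      define T where "T = (\<lambda>(i, j). dist (x i) (x j)) ` {(i, j) \<in> I \<times> I. i \<noteq> j}"
      have "finite {(i, j) \<in> I \<times> I. i \<noteq> j}" by (rule finite_subset[OF _ finite_cartesian_product[OF I I]]) auto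
      then have fin: "finite T" unfolding T_def by (rule finite_imageI)
      have "T \<noteq> {}" using True by (auto simp: T_def)
      moreover have "\<forall>t\<in>T. t > 0" using x(2) by (auto simp: T_def inj_on_def)
      ultimately have "Min T > 0" using fin by simp
      moreover have "\<forall>i\<in>I. \<forall>j\<in>I. i \<noteq> j \<longrightarrow> Min T \<le> dist (x i) (x j)"
      proof (intro ballI impI)
        fix i j assume "i \<in> I" "j \<in> I" "i \<noteq> j"
        then have "dist (x i) (x j) \<in> T" unfolding T_def by (intro image_eqI[of _ _ "(i, j)"]) simp_all
        then show "Min T \<le> dist (x i) (x j)" using fin by (intro Min_le)
      qed
      ultimately show ?thesis by blast
    qed (auto intro!: exI[of _ 1])
    then obtain \<delta> where \<delta>: "\<delta> > 0" "\<And>i j. i \<in> I \<Longrightarrow> j \<in> I \<Longrightarrow> i \<noteq> j \<Longrightarrow> \<delta> \<le> dist (x i) (x j)" by blast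
    have "\<exists>U\<in>\<B>. x i \<in> U \<and> U \<subseteq> ball (x i) (\<delta> / 2)" for i
      using topological_basisE[OF \<B>(2), of "ball (x i) (\<delta> / 2)" "x i"] \<delta>(1) by (metis centre_in_ball half_gt_zero open_ball)
    then obtain u where u: "\<And>i. u i \<in> \<B>" "\<And>i. x i \<in> u i" "\<And>i. u i \<subseteq> ball (x i) (\<delta> / 2)" by metis
    have "u i \<inter> u j = {}" if "i \<in> I" "j \<in> I" "i \<noteq> j" for i j
    proof (rule ccontr)
      assume "u i \<inter> u j \<noteq> {}"
      then obtain z where "dist (x i) z < \<delta> / 2" "dist (x j) z < \<delta> / 2" using u(3) by (fastforce simp: subset_iff)
      then have "dist (x i) (x j) < \<delta>" using dist_triangle2[of "x i" "x j" z] by linarith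
      then show False using \<delta>(2)[OF that] by simp
    qed
    then have U: "restrict u I \<in> \<C>" using u(1) by (auto simp: \<C>_def disjoint_family_on_def)
    then obtain n where n: "from_nat_into \<C> n = restrict u I"
      using from_nat_into_surj[OF \<C>] by blast
    have "x \<in> Pi\<^sub>E I (Q (restrict u I))" using x(1) sub u(2) by (auto simp: Q_def PiE_iff subset_iff)
    with U n show ?thesis by (auto simp: E_def intro!: exI[of _ n])
  qed
  define E' where "E' n = A \<inter> disjointed E n" for n
  have "range (disjointed E) \<subseteq> sets ?P"
    by (rule sets.range_disjointed_sets) (use E_sets in auto)
  then have E'_sets: "E' n \<in> sets ?P" for n
    unfolding E'_def using A by auto
  have "mecke I D (E' n)" for n
  proof (cases "\<C> = {}")
    case False
    have "E' n = E' n \<inter> E n" using disjointed_subset[of E n] by (auto simp: E'_def)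
    also have "mecke I D \<dots>"
      using False from_nat_into[OF False, of n] Q Q_disj D E'_sets
      by (simp add: E_def) (intro mecke_rectangle I; simp)
    finally show ?thesis .
  next
    case True
    then show ?thesis by (simp add: E'_def E_def disjointed_def mecke_def ntuples_def)
  qed
  then have "mecke I D (\<Union>n. E' n)"
  proof (intro mecke_suminf E'_sets)
    show "disjoint_family E'"
      using disjoint_family_disjointed[of E] unfolding disjoint_family_on_def E'_def by blast
  qed
  moreover have E': "(\<Union>n. E' n) = A \<inter> (\<Union>n. E n)"
    by (simp add: E'_def UN_disjointed_eq Int_UN_distrib[symmetric] del: Int_UN_distrib)
  moreover have "ntuples I (A \<inter> (\<Union>n. E n)) \<omega> = ntuples I A \<omega>" for \<omega>
    unfolding ntuples_def using cover by (intro arg_cong[where f = "emeasure _"]) (auto simp: tuples_def)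
  moreover have "emeasure ?P (A \<inter> (\<Union>n. E n)) = emeasure ?P A"
  proof -
    let ?N = "\<Union>p\<in>{(i, j) \<in> I \<times> I. i \<noteq> j}. {x \<in> space ?P. x (fst p) = x (snd p)}"
    have "finite {(i, j) \<in> I \<times> I. i \<noteq> j}"
      by (rule finite_subset[OF _ finite_cartesian_product[OF I I]]) auto
    then have N: "?N \<in> null_sets ?P"
      using diagonal_null[OF I] by (intro null_sets_UN') (auto intro: countable_finite)
    have "A - (A \<inter> (\<Union>n. E n)) \<subseteq> ?N"
    proof
      fix x assume x: "x \<in> A - (A \<inter> (\<Union>n. E n))"
      then have "\<not> inj_on x I" using cover by blast
      then obtain i j where "i \<in> I" "j \<in> I" "i \<noteq> j" "x i = x j" by (auto simp: inj_on_def)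
      moreover have "x \<in> space ?P" using x A sets.sets_into_space by blast
      ultimately show "x \<in> ?N" by auto
    qed
    then have "A - (A \<inter> (\<Union>n. E n)) \<in> null_sets ?P"
      using N A by (intro null_sets_subset[OF N]) auto
    then have "emeasure ?P (A - (A - (A \<inter> (\<Union>n. E n)))) = emeasure ?P A"
      using A by (intro emeasure_Diff_null_set) auto
    moreover have "A - (A - (A \<inter> (\<Union>n. E n))) = A \<inter> (\<Union>n. E n)" by auto
    ultimately show ?thesis by simp
  qed
  ultimately show ?thesis by (simp add: mecke_def)
qed

lemma
  assumes I: "finite I" and A: "A \<in> sets (PiM I (\<lambda>_. L))" and sub: "A \<subseteq> (\<Pi>\<^sub>E i\<in>I. cball 0 R)"
  shows measurable_ntuples: "ntuples I A \<in> borel_measurable M"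
    and nn_integral_ntuples: "(\<integral>\<^sup>+\<omega>. ntuples I A \<omega> \<partial>M) = emeasure (PiM I (\<lambda>_. L)) A"
  using mecke_off_diagonal[OF I _ _ A, of "{}" R] sub by (simp_all add: mecke_def)

lemma emeasure_tuples_finite:
  assumes I: "finite I" and sub: "A \<subseteq> (\<Pi>\<^sub>E i\<in>I. cball 0 R)"
  shows "emeasure (PiM I (\<lambda>_. L)) A < \<infinity>"
proof -
  have "emeasure (PiM I (\<lambda>_. L)) A \<le> emeasure (PiM I (\<lambda>_. L)) (\<Pi>\<^sub>E i\<in>I. cball 0 R)"
    using I sub by (intro emeasure_mono) (auto simp: sets_L intro!: sets_PiM_I_finite)
  also have "\<dots> = (\<Prod>i\<in>I. emeasure L (cball 0 R))"
    using I by (intro PL.emeasure_PiM) (auto simp: sets_L)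
  also have "\<dots> < \<infinity>"
    using finite_bounded[of "cball 0 R"] by (simp add: power_eq_top_ennreal less_top[symmetric])
  finally show ?thesis .
qed

text \<open>On bounded pieces of the null set the expected number of tuples is 0, and countably many
  pieces exhaust it. This transfers almost sure statements from the product measure to the
  process.\<close>

lemma AE_no_tuples:
  assumes I: "finite I" and A: "A \<in> null_sets (PiM I (\<lambda>_. L))"
  shows "AE \<omega> in M. tuples I (\<Phi> \<omega>) \<inter> A = {}"
proof -
  define A' where "A' n = A \<inter> (\<Pi>\<^sub>E i\<in>I. cball 0 (real n))" for n
  have A'_sets: "A' n \<in> sets (PiM I (\<lambda>_. L))" for n
    unfolding A'_def using A I by (intro sets.Int sets_PiM_I_finite) (auto simp: sets_L)
  have "AE \<omega> in M. tuples I (\<Phi> \<omega>) \<inter> A' n = {}" for n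
  proof -
    have "(\<integral>\<^sup>+\<omega>. ntuples I (A' n) \<omega> \<partial>M) = emeasure (PiM I (\<lambda>_. L)) (A' n)"
      by (rule nn_integral_ntuples[OF I A'_sets[of n], where R = "real n"]) (auto simp: A'_def)
    also have "\<dots> = 0"
      using A A'_sets[of n] by (metis A'_def Int_lower1 null_setsD1 null_sets_subset)
    finally have "AE \<omega> in M. ntuples I (A' n) \<omega> = 0"
      using measurable_ntuples[OF I A'_sets[of n], where R = "real n"] by (subst (asm) nn_integral_0_iff_AE) (auto simp: A'_def)
    then show ?thesis
      by (rule AE_mp) (auto intro!: AE_I2 simp: ntuples_def emeasure_count_space split: if_splits)
  qed
  then have "AE \<omega> in M. \<forall>n. tuples I (\<Phi> \<omega>) \<inter> A' n = {}" by (simp add: AE_all_countable)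
  then show ?thesis
  proof (rule AE_mp, intro AE_I2 impI)
    fix \<omega> assume none: "\<forall>n. tuples I (\<Phi> \<omega>) \<inter> A' n = {}"
    show "tuples I (\<Phi> \<omega>) \<inter> A = {}"
    proof (rule ccontr)
      assume "tuples I (\<Phi> \<omega>) \<inter> A \<noteq> {}"
      then obtain x where x: "x \<in> tuples I (\<Phi> \<omega>)" "x \<in> A" by blast
      define m where "m = nat \<lceil>\<Sum>i\<in>I. norm (x i)\<rceil>"
      have "norm (x i) \<le> real m" if "i \<in> I" for i
      proof -
        have "norm (x i) \<le> (\<Sum>i\<in>I. norm (x i))" using I that by (intro member_le_sum) auto
        then show ?thesis unfolding m_def by linarith
      qed
      then have "x \<in> A' m" using x by (auto simp: A'_def tuples_def PiE_iff)
      with x(1) none show False by blast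
    qed
  qed
qed

end

section \<open>Void sets that move with the tuple\<close>

lemma void_ball_borel [measurable]: "void_ball (v::'a::euclidean_space) \<in> sets borel"
  unfolding void_ball_def by (intro borel_open open_Collect_less continuous_intros)

text \<open>Geometrically this is the open ball with the segment from 0 to v as a diameter.\<close>

lemma void_ball_bounded: "bounded (void_ball (v::'a::euclidean_space))"
proof (rule bounded_subset[of "cball 0 (norm v)"])
  show "void_ball v \<subseteq> cball 0 (norm v)"
  proof
    fix x assume "x \<in> void_ball v"
    then have "norm x * norm x < norm x * norm v"
      using norm_cauchy_schwarz[of x v] by (simp add: void_ball_def power2_norm_eq_inner[symmetric] power2_eq_square)
    then show "x \<in> cball 0 (norm v)" by (cases "x = 0") (auto simp: mult_less_cancel_left)
  qed
qed simp

text \<open>In \<open>mecke\<close> the void set is fixed. A void ball that depends on the tuple is approximated from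
  inside by the sets \<open>inner_void r c\<close>, with c the centre rounded to a grid so that only countably many occur.\<close>

definition inner_void :: "real \<Rightarrow> 'a::euclidean_space \<Rightarrow> 'a set" where
  "inner_void r c = {x. x \<bullet> x + r * norm x < x \<bullet> c}"

definition grid_round :: "nat \<Rightarrow> 'a::euclidean_space \<Rightarrow> 'a" where
  "grid_round n v = (\<Sum>b\<in>Basis. (of_int \<lfloor>2 ^ n * (v \<bullet> b)\<rfloor> / 2 ^ n) *\<^sub>R b)"

lemma norm_grid_round: "norm (v - grid_round n v) \<le> real DIM('a) / 2 ^ n" for v :: "'a::euclidean_space"
proof -
  have "\<bar>(v - grid_round n v) \<bullet> b\<bar> \<le> 1 / 2 ^ n" if "b \<in> Basis" for b
  proof -
    have "(v - grid_round n v) \<bullet> b = (2 ^ n * (v \<bullet> b) - of_int \<lfloor>2 ^ n * (v \<bullet> b)\<rfloor>) / 2 ^ n"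
      using that by (simp add: grid_round_def inner_diff_left diff_divide_distrib)
    moreover have "\<bar>2 ^ n * (v \<bullet> b) - of_int \<lfloor>2 ^ n * (v \<bullet> b)\<rfloor>\<bar> \<le> 1" by linarith
    ultimately show ?thesis by (simp add: divide_right_mono)
  qed
  then have "(\<Sum>b\<in>Basis. \<bar>(v - grid_round n v) \<bullet> b\<bar>) \<le> (\<Sum>b\<in>(Basis :: 'a set). 1 / 2 ^ n)"
    by (rule sum_mono)
  then show ?thesis using norm_le_l1[of "v - grid_round n v"] by simp
qed

lemma countable_range_grid_round: "countable (range (grid_round n :: 'a::euclidean_space \<Rightarrow> 'a))"
proof -
  let ?g = "\<lambda>k. \<Sum>b\<in>Basis. (of_int (k b) / 2 ^ n) *\<^sub>R (b :: 'a)"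
  have "range (grid_round n) \<subseteq> ?g ` (Basis \<rightarrow>\<^sub>E (UNIV :: int set))"
  proof clarify
    fix v :: 'a
    show "grid_round n v \<in> ?g ` (Basis \<rightarrow>\<^sub>E UNIV)"
      by (rule image_eqI[where x = "\<lambda>b\<in>Basis. \<lfloor>2 ^ n * (v \<bullet> b)\<rfloor>"]) (simp_all add: grid_round_def)
  qed
  moreover have "countable (Basis \<rightarrow>\<^sub>E (UNIV :: int set))" by (rule countable_PiE) auto
  ultimately show ?thesis by (blast intro: countable_subset countable_image)
qed

lemma measurable_grid_round [measurable]: "(grid_round n :: 'a::euclidean_space \<Rightarrow> 'a) \<in> borel_measurable borel"
  unfolding grid_round_def by measurable

text \<open>The margin \<open>r * norm x\<close> outweighs the change of the inner product with x
  caused by rounding v.\<close>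

lemma inner_void_grid_subset:
  "inner_void (real DIM('a) / 2 ^ n) (grid_round n v) \<subseteq> void_ball (v :: 'a::euclidean_space)"
proof
  fix x :: 'a assume x: "x \<in> inner_void (real DIM('a) / 2 ^ n) (grid_round n v)"
  have "x \<bullet> grid_round n v - x \<bullet> v \<le> norm x * norm (v - grid_round n v)"
    using norm_cauchy_schwarz[of x "grid_round n v - v"] by (simp add: inner_diff_right norm_minus_commute)
  also have "\<dots> \<le> norm x * (real DIM('a) / 2 ^ n)"
    using norm_grid_round by (intro mult_left_mono) auto
  finally show "x \<in> void_ball v"
    using x by (simp add: inner_void_def void_ball_def mult.commute)
qed

lemma inner_void_grid_eventually:
  assumes "x \<in> void_ball (v :: 'a::euclidean_space)"
  shows "\<forall>\<^sub>F n in sequentially. x \<in> inner_void (real DIM('a) / 2 ^ n) (grid_round n v)"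
proof -
  \<comment> \<open>Twice the rounding error is needed: once for the margin in
    \<open>inner_void\<close> and once for the displacement of the centre.\<close>
  have "(\<lambda>n. x \<bullet> x + 2 * (real DIM('a) / 2 ^ n) * norm x) \<longlonglongrightarrow> x \<bullet> x + 2 * 0 * norm x"
    by (intro tendsto_intros) real_asymp
  then have "\<forall>\<^sub>F n in sequentially. x \<bullet> x + 2 * (real DIM('a) / 2 ^ n) * norm x < x \<bullet> v"
    using assms by (intro order_tendstoD(2)) (auto simp: void_ball_def)
  then show ?thesis
  proof eventually_elim
    case (elim n)
    have "x \<bullet> v - x \<bullet> grid_round n v \<le> norm x * norm (v - grid_round n v)"
      using norm_cauchy_schwarz[of x "v - grid_round n v"] by (simp add: inner_diff_right)
    also have "\<dots> \<le> norm x * (real DIM('a) / 2 ^ n)"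
      using norm_grid_round by (intro mult_left_mono) auto
    finally have "x \<bullet> v - x \<bullet> grid_round n v \<le> norm x * (real DIM('a) / 2 ^ n)" .
    moreover have "2 * (real DIM('a) / 2 ^ n) * norm x = norm x * (real DIM('a) / 2 ^ n) + norm x * (real DIM('a) / 2 ^ n)"
      by simp
    ultimately have "x \<bullet> x + norm x * (real DIM('a) / 2 ^ n) < x \<bullet> grid_round n v"
      using elim by linarith
    then show ?case by (simp only: inner_void_def mem_Collect_eq mult.commute)
  qed
qed

context poisson_points
begin

text \<open>For fixed n the set \<open>A\<close> is split according to the rounded value c of
  \<open>V\<close>; on each piece the void set \<open>D n c\<close> is constant, so
  \<open>mecke_off_diagonal\<close> applies, because by \<open>out\<close> no entry of the tuple
  lies in the void set. The pieces are summed, and n tends to infinity by dominated convergence on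
  both sides.\<close>

lemma mecke_void:
  assumes I: "finite I" and A: "A \<in> sets (PiM I (\<lambda>_. L))" and sub: "A \<subseteq> (\<Pi>\<^sub>E i\<in>I. cball 0 R)"
    and V [measurable]: "V \<in> PiM I (\<lambda>_. L) \<rightarrow>\<^sub>M borel"
    and out: "\<And>x i. x \<in> A \<Longrightarrow> i \<in> I \<Longrightarrow> x i \<notin> void_ball (V x)"
    and \<kappa>: "\<And>v. measure L (void_ball v) = \<kappa> * norm v"
  shows "(\<lambda>\<omega>. ntuples I {x \<in> A. \<Phi> \<omega> \<inter> void_ball (V x) = {}} \<omega>) \<in> borel_measurable M" (is "?meas")
    and "(\<integral>\<^sup>+\<omega>. ntuples I {x \<in> A. \<Phi> \<omega> \<inter> void_ball (V x) = {}} \<omega> \<partial>M)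
      = (\<integral>\<^sup>+x. indicator A x * ennreal (exp (- \<kappa> * norm (V x))) \<partial>PiM I (\<lambda>_. L))" (is "?int")
proof -
  let ?P = "PiM I (\<lambda>_. L)"
  define D where "D n c = inner_void (real DIM('a) / 2 ^ n) c" for n and c :: 'a
  have D_borel: "D n c \<in> sets borel" for n c
    unfolding D_def inner_void_def by (intro borel_open open_Collect_less continuous_intros)
  have D_sub: "D n (grid_round n v) \<subseteq> void_ball v" for n v
    unfolding D_def by (rule inner_void_grid_subset)
  define C where "C n = range (grid_round n :: 'a \<Rightarrow> 'a)" for n
  have C: "countable (C n)" for n unfolding C_def by (rule countable_range_grid_round)
  have D_bounded: "bounded (D n c)" if c: "c \<in> C n" for n c
  proof -
    obtain v where "c = grid_round n v" using c by (auto simp: C_def)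
    then show ?thesis using bounded_subset[OF void_ball_bounded D_sub] by simp
  qed
  define B where "B n c = {x \<in> A. grid_round n (V x) = c}" for n c
  have B_sets [measurable]: "B n c \<in> sets ?P" for n c
  proof -
    have "B n c = A \<inter> {x \<in> space ?P. grid_round n (V x) = c}"
      using sets.sets_into_space[OF A] by (auto simp: B_def)
    also have "\<dots> \<in> sets ?P" using A by measurable
    finally show ?thesis .
  qed
  have B_mecke: "mecke I (D n c) (B n c)" for n c
  proof (cases "B n c = {}")
    case False
    then have "c \<in> C n" by (auto simp: B_def C_def)
    moreover have "B n c \<subseteq> (\<Pi>\<^sub>E i\<in>I. cball 0 R - D n c)"
    proof
      fix x assume "x \<in> B n c"
      then have x: "x \<in> A" and c: "c = grid_round n (V x)" by (simp_all add: B_def)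
      have "x i \<notin> D n c" if "i \<in> I" for i
        using out[OF x that] D_sub[of n "V x"] unfolding c by blast
      moreover have "x \<in> (\<Pi>\<^sub>E i\<in>I. cball 0 R)" using x sub by blast
      ultimately show "x \<in> (\<Pi>\<^sub>E i\<in>I. cball 0 R - D n c)" by (simp add: PiE_iff)
    qed
    ultimately show ?thesis
      by (intro mecke_off_diagonal[OF I D_borel D_bounded B_sets])
  qed (simp add: mecke_def ntuples_def)
  define T where "T n \<omega> = ntuples I {x \<in> A. \<Phi> \<omega> \<inter> D n (grid_round n (V x)) = {}} \<omega>" for n \<omega>
  let ?v = "\<lambda>n c \<omega>. indicator {\<omega>. \<Phi> \<omega> \<inter> D n c = {}} \<omega> :: ennreal"
  have T_sum: "T n \<omega> = (\<integral>\<^sup>+c. ntuples I (B n c) \<omega> * ?v n c \<omega> \<partial>count_space (C n))" for n \<omega>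
  proof -
    let ?X = "\<lambda>c. tuples I (\<Phi> \<omega>) \<inter> {x \<in> B n c. \<Phi> \<omega> \<inter> D n c = {}}"
    have "tuples I (\<Phi> \<omega>) \<inter> {x \<in> A. \<Phi> \<omega> \<inter> D n (grid_round n (V x)) = {}} = (\<Union>c\<in>C n. ?X c)"
      by (auto simp: B_def C_def)
    then have "T n \<omega> = emeasure (count_space UNIV) (\<Union>c\<in>C n. ?X c)" by (simp add: T_def ntuples_def)
    also have "\<dots> = (\<integral>\<^sup>+c. emeasure (count_space UNIV) (?X c) \<partial>count_space (C n))"
      by (rule emeasure_UN_countable) (auto simp: C disjoint_family_on_def B_def)
    also have "\<dots> = (\<integral>\<^sup>+c. ntuples I (B n c) \<omega> * ?v n c \<omega> \<partial>count_space (C n))"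
      by (intro nn_integral_cong) (auto simp: ntuples_def indicator_def)
    finally show ?thesis .
  qed
  have term_meas: "(\<lambda>\<omega>. ntuples I (B n c) \<omega> * ?v n c \<omega>) \<in> borel_measurable M" for n c
    using B_mecke by (simp add: mecke_def)
  have T_meas [measurable]: "T n \<in> borel_measurable M" for n
  proof -
    interpret sigma_finite_measure "count_space (C n)" by (rule sigma_finite_measure_count_space_countable[OF C])
    have "(\<lambda>p. (\<lambda>c p. ntuples I (B n c) (fst p) * ?v n c (fst p)) (snd p) p) \<in> borel_measurable (M \<Otimes>\<^sub>M count_space (C n))"
      by (rule measurable_compose_countable'[OF measurable_compose[OF measurable_fst term_meas] measurable_snd C])
    then show ?thesis unfolding T_sum[abs_def]
      by (intro borel_measurable_nn_integral) (simp add: case_prod_unfold)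
  qed
  have T_int: "(\<integral>\<^sup>+\<omega>. T n \<omega> \<partial>M) = (\<integral>\<^sup>+x. indicator A x * ennreal (exp (- measure L (D n (grid_round n (V x))))) \<partial>?P)" for n
  proof -
    have "(\<integral>\<^sup>+\<omega>. T n \<omega> \<partial>M) = (\<integral>\<^sup>+c. \<integral>\<^sup>+\<omega>. ntuples I (B n c) \<omega> * ?v n c \<omega> \<partial>M \<partial>count_space (C n))"
      unfolding T_sum by (rule nn_integral_count_space_nn_integral[OF C term_meas])
    also have "\<dots> = (\<integral>\<^sup>+c. \<integral>\<^sup>+x. indicator (B n c) x * ennreal (exp (- measure L (D n c))) \<partial>?P \<partial>count_space (C n))"
      using B_mecke by (intro nn_integral_cong) (simp add: mecke_def nn_integral_multc)
    also have "\<dots> = (\<integral>\<^sup>+x. \<integral>\<^sup>+c. indicator (B n c) x * ennreal (exp (- measure L (D n c))) \<partial>count_space (C n) \<partial>?P)"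
      by (rule nn_integral_count_space_nn_integral[OF C, symmetric]) measurable
    also have "\<dots> = (\<integral>\<^sup>+x. indicator A x * ennreal (exp (- measure L (D n (grid_round n (V x))))) \<partial>?P)"
    proof (intro nn_integral_cong)
      fix x
      have "(\<integral>\<^sup>+c. indicator (B n c) x * ennreal (exp (- measure L (D n c))) \<partial>count_space (C n))
        = (\<integral>\<^sup>+c. (indicator A x * ennreal (exp (- measure L (D n (grid_round n (V x)))))) * indicator {grid_round n (V x)} c \<partial>count_space (C n))"
        by (intro nn_integral_cong) (auto simp: B_def indicator_def)
      also have "\<dots> = indicator A x * ennreal (exp (- measure L (D n (grid_round n (V x)))))"
        by (subst nn_integral_cmult_indicator) (auto simp: C_def)
      finally show "(\<integral>\<^sup>+c. indicator (B n c) x * ennreal (exp (- measure L (D n c))) \<partial>count_space (C n))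
        = indicator A x * ennreal (exp (- measure L (D n (grid_round n (V x)))))" .
    qed
    finally show ?thesis .
  qed
  define T' where "T' \<omega> = ntuples I {x \<in> A. \<Phi> \<omega> \<inter> void_ball (V x) = {}} \<omega>" for \<omega>
  \<comment> \<open>Only finitely many tuples of points lie in \<open>A\<close>, so from some n on
    the inner set is empty of points exactly when the void ball is, for all of them at once.\<close>
  have T_lim: "(\<lambda>n. T n \<omega>) \<longlonglongrightarrow> T' \<omega>" if \<omega>: "\<omega> \<in> space M" for \<omega>
  proof -
    have fin: "finite (tuples I (\<Phi> \<omega>) \<inter> A)"
      by (rule finite_tuples[OF I \<omega> sub]) auto
    have "\<forall>\<^sub>F n in sequentially. \<forall>x\<in>tuples I (\<Phi> \<omega>) \<inter> A. \<Phi> \<omega> \<inter> D n (grid_round n (V x)) = {} \<longleftrightarrow> \<Phi> \<omega> \<inter> void_ball (V x) = {}"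
    proof (intro eventually_ball_finite fin ballI)
      fix x assume "x \<in> tuples I (\<Phi> \<omega>) \<inter> A"
      show "\<forall>\<^sub>F n in sequentially. \<Phi> \<omega> \<inter> D n (grid_round n (V x)) = {} \<longleftrightarrow> \<Phi> \<omega> \<inter> void_ball (V x) = {}"
      proof (cases "\<Phi> \<omega> \<inter> void_ball (V x) = {}")
        case True
        then show ?thesis using D_sub by (auto intro!: always_eventually)
      next
        case False
        then obtain y where y: "y \<in> \<Phi> \<omega>" "y \<in> void_ball (V x)" by blast
        have "\<forall>\<^sub>F n in sequentially. y \<in> D n (grid_round n (V x))"
          unfolding D_def by (rule inner_void_grid_eventually[OF y(2)])
        then show ?thesis by eventually_elim (use y(1) False in auto)
      qed
    qed
    then have "\<forall>\<^sub>F n in sequentially. T n \<omega> = T' \<omega>"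
    proof eventually_elim
      case (elim n)
      then have "tuples I (\<Phi> \<omega>) \<inter> {x \<in> A. \<Phi> \<omega> \<inter> D n (grid_round n (V x)) = {}} = tuples I (\<Phi> \<omega>) \<inter> {x \<in> A. \<Phi> \<omega> \<inter> void_ball (V x) = {}}"
        by blast
      then show ?case by (simp add: T_def T'_def ntuples_def)
    qed
    then show ?thesis by (rule tendsto_eventually)
  qed
  have meas': "T' \<in> borel_measurable M"
  proof (subst measurable_cong)
    show "T' \<omega> = liminf (\<lambda>n. T n \<omega>)" if "\<omega> \<in> space M" for \<omega>
      using lim_imp_Liminf[OF _ T_lim[OF that]] by simp
    show "(\<lambda>\<omega>. liminf (\<lambda>n. T n \<omega>)) \<in> borel_measurable M" by measurable
  qed
  then show ?meas by (simp add: T'_def[abs_def])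
  have fin_A: "(\<integral>\<^sup>+x. indicator A x \<partial>?P) < \<infinity>"
    using emeasure_tuples_finite[OF I sub] A by simp
  have "(\<lambda>n. \<integral>\<^sup>+\<omega>. T n \<omega> \<partial>M) \<longlonglongrightarrow> (\<integral>\<^sup>+\<omega>. T' \<omega> \<partial>M)"
  proof (rule nn_integral_dominated_convergence[where w = "ntuples I A"])
    show "ntuples I A \<in> borel_measurable M" by (rule measurable_ntuples[OF I A sub])
    show "(\<integral>\<^sup>+\<omega>. ntuples I A \<omega> \<partial>M) < \<infinity>"
      using nn_integral_ntuples[OF I A sub] emeasure_tuples_finite[OF I sub] by simp
    show "AE \<omega> in M. T n \<omega> \<le> ntuples I A \<omega>" for n
      unfolding T_def ntuples_def by (intro AE_I2 emeasure_mono) auto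
  qed (use T_lim meas' in auto)
  moreover have "(\<lambda>n. \<integral>\<^sup>+x. indicator A x * ennreal (exp (- measure L (D n (grid_round n (V x))))) \<partial>?P)
    \<longlonglongrightarrow> (\<integral>\<^sup>+x. indicator A x * ennreal (exp (- \<kappa> * norm (V x))) \<partial>?P)"
  proof (rule nn_integral_dominated_convergence[where w = "indicator A"])
    show "(\<lambda>x. indicator A x * ennreal (exp (- measure L (D n (grid_round n (V x)))))) \<in> borel_measurable ?P" for n
    proof -
      have "(\<lambda>x. grid_round n (V x)) \<in> ?P \<rightarrow>\<^sub>M count_space (C n)"
        unfolding measurable_count_space_eq_countable[OF C]
      proof (intro conjI ballI)
        fix c
        have "(\<lambda>x. grid_round n (V x)) -` {c} \<inter> space ?P = {x \<in> space ?P. grid_round n (V x) = c}" by auto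
        also have "\<dots> \<in> sets ?P" by measurable
        finally show "(\<lambda>x. grid_round n (V x)) -` {c} \<inter> space ?P \<in> sets ?P" .
      qed (auto simp: C_def)
      then have "(\<lambda>x. ennreal (exp (- measure L (D n (grid_round n (V x)))))) \<in> borel_measurable ?P"
        by (rule measurable_compose) simp
      then show ?thesis using A by measurable
    qed
    show "AE x in ?P. (\<lambda>n. indicator A x * ennreal (exp (- measure L (D n (grid_round n (V x)))))) \<longlonglongrightarrow> indicator A x * ennreal (exp (- \<kappa> * norm (V x)))"
    proof (intro AE_I2 tendsto_mult_ennreal tendsto_const tendsto_ennrealI tendsto_exp)
      fix x
      have "(\<lambda>n. \<integral>y. indicator (D n (grid_round n (V x))) y \<partial>L) \<longlonglongrightarrow> (\<integral>y. indicator (void_ball (V x)) y \<partial>L :: real)"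
      proof (rule integral_dominated_convergence[where w = "indicator (void_ball (V x))"])
        show "integrable L (indicator (void_ball (V x)) :: 'a \<Rightarrow> real)"
          using finite_bounded[OF void_ball_bounded void_ball_borel]
          by (intro integrable_real_indicator) (auto simp: sets_L)
        show "AE y in L. (\<lambda>n. indicator (D n (grid_round n (V x))) y :: real) \<longlonglongrightarrow> indicator (void_ball (V x)) y"
        proof (intro AE_I2 tendsto_eventually)
          fix y
          show "\<forall>\<^sub>F n in sequentially. indicator (D n (grid_round n (V x))) y = (indicator (void_ball (V x)) y :: real)"
          proof (cases "y \<in> void_ball (V x)")
            case True
            show ?thesis using inner_void_grid_eventually[OF True] True by (auto simp: D_def elim: eventually_mono)
          next
            case False
            then show ?thesis using D_sub by (auto intro!: always_eventually simp: indicator_def)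
          qed
        qed
        show "AE y in L. norm (indicator (D n (grid_round n (V x))) y :: real) \<le> indicator (void_ball (V x)) y" for n
          using D_sub[of n "V x"] by (intro AE_I2) (auto simp: indicator_def)
      qed (use D_borel in \<open>auto simp: measurable_cong_sets[OF sets_L refl]\<close>)
      then have "(\<lambda>n. measure L (D n (grid_round n (V x)))) \<longlonglongrightarrow> \<kappa> * norm (V x)"
        using D_borel by (simp add: \<kappa>[symmetric] space_L)
      then show "(\<lambda>n. - measure L (D n (grid_round n (V x)))) \<longlonglongrightarrow> - \<kappa> * norm (V x)"
        by (simp add: tendsto_minus)
    qed (auto simp: indicator_def)
    show "AE x in ?P. indicator A x * ennreal (exp (- measure L (D n (grid_round n (V x))))) \<le> indicator A x" for n
      by (intro AE_I2) (auto simp: indicator_def ennreal_le_1)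
  qed (use A fin_A in auto)
  ultimately have "(\<integral>\<^sup>+\<omega>. T' \<omega> \<partial>M) = (\<integral>\<^sup>+x. indicator A x * ennreal (exp (- \<kappa> * norm (V x))) \<partial>?P)"
    unfolding T_int by (rule LIMSEQ_unique)
  then show ?int by (simp add: T'_def)
qed

end

section \<open>Faces and their top vertices\<close>

no_notation fps_nth (infixl "$" 75)

definition tuple_matrix :: "('n \<Rightarrow> real^'n) \<Rightarrow> real^'n^'n" where
  "tuple_matrix X = (\<chi> r i. X i $ r)"

definition tuple_coords :: "('n \<Rightarrow> real^'n) \<Rightarrow> real^'n \<Rightarrow> real^'n" where
  "tuple_coords X u = sol (tuple_matrix X) u"

text \<open>The common point of the hyperplanes \<open>hyp (X i)\<close>, provided the points X i
  are linearly independent.\<close>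

definition tuple_vertex :: "('n \<Rightarrow> real^'n) \<Rightarrow> real^'n" where
  "tuple_vertex X = sol (transpose (tuple_matrix X)) (\<chi> i. X i \<bullet> X i)"

lemma tuple_matrix_mult: "tuple_matrix X *v c = (\<Sum>i\<in>UNIV. c $ i *\<^sub>R X i)"
  by (simp add: tuple_matrix_def matrix_vector_mult_def vec_eq_iff mult.commute)

lemma transpose_tuple_matrix_mult: "transpose (tuple_matrix X) *v v = (\<chi> i. X i \<bullet> v)"
  by (simp add: tuple_matrix_def transpose_def matrix_vector_mult_def inner_vec_def vec_eq_iff)

lemma sum_tuple_coords: "det (tuple_matrix X) \<noteq> 0 \<Longrightarrow> (\<Sum>i\<in>UNIV. tuple_coords X u $ i *\<^sub>R X i) = u"
  unfolding tuple_matrix_mult[symmetric] tuple_coords_def by (rule mult_sol)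

lemma tuple_vertex_iff:
  assumes "det (tuple_matrix X) \<noteq> 0"
  shows "(\<forall>i. v \<bullet> X i = X i \<bullet> X i) \<longleftrightarrow> v = tuple_vertex X"
  using sol_iff[of "transpose (tuple_matrix X)" v "\<chi> i. X i \<bullet> X i"] assms
  by (simp add: transpose_tuple_matrix_mult tuple_vertex_def vec_eq_iff inner_commute del: transpose_matrix_vector)

text \<open>Supplies directions with prescribed inner products with the normals: moving along them
  leaves chosen hyperplanes and stays on the others.\<close>

lemma tuple_dual_vector:
  assumes "det (tuple_matrix X) \<noteq> 0"
  obtains w where "\<And>i. w \<bullet> X i = c i"
proof -
  have "transpose (tuple_matrix X) *v sol (transpose (tuple_matrix X)) (\<chi> i. c i) = (\<chi> i. c i)"
    using assms by (intro mult_sol) simp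
  then show ?thesis
    by (intro that[of "sol (transpose (tuple_matrix X)) (\<chi> i. c i)"])
       (simp add: transpose_tuple_matrix_mult vec_eq_iff inner_commute del: transpose_matrix_vector)
qed

lemma tuple_independent:
  assumes "det (tuple_matrix X) \<noteq> 0"
  shows "independent (range X)"
proof -
  have "column i (tuple_matrix X) = X i" for i by (simp add: column_def tuple_matrix_def vec_eq_iff)
  then have "columns (tuple_matrix X) = range X" by (auto simp: columns_def)
  then show ?thesis using det_dependent_columns[of "tuple_matrix X"] assms by (auto simp: dependent_vec_eq)
qed

text \<open>Such an ordering consists of two independent bijections, from \<open>J\<close> onto
  \<open>I - K\<close> and from its complement onto \<open>K\<close>.\<close>

lemma card_bij_betw_split:
  fixes J :: "'n::finite set" and I K :: "'a set"
  assumes "finite I" "card I = CARD('n)" "K \<subseteq> I" "card (I - K) = card J"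
  shows "card {X. inj X \<and> range X = I \<and> X ` (- J) = K} = fact (card J) * fact (CARD('n) - card J)"
proof -
  let ?A = "{f \<in> J \<rightarrow>\<^sub>E (I - K). inj_on f J}" and ?B = "{f \<in> (- J) \<rightarrow>\<^sub>E K. inj_on f (- J)}"
  have cJ: "card (- J) = CARD('n) - card J" by (simp add: Compl_eq_Diff_UNIV card_Diff_subset)
  have JK: "card J \<le> CARD('n)" by (simp add: card_mono)
  have finK: "finite K" using assms finite_subset by blast
  have "card I = card (I - K) + card K" using assms by (metis card_Diff_subset card_mono finK le_add_diff_inverse2)
  then have cK: "card K = CARD('n) - card J" using assms by simp
  have cA: "card ?A = fact (card J)"
    using card_inj_on_subset_funcset[of J "I - K" J] assms by (simp add: fact_prod_rev)
  have cB: "card ?B = fact (CARD('n) - card J)"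
    using card_inj_on_subset_funcset[of "- J" K "- J"] finK cJ cK by (simp add: fact_prod_rev)
  let ?h = "\<lambda>X. (restrict X J, restrict X (- J))"
  have "bij_betw ?h {X. inj X \<and> range X = I \<and> X ` (- J) = K} (?A \<times> ?B)"
  proof (rule bij_betw_byWitness[where f' = "\<lambda>(f, g) i. if i \<in> J then f i else g i"])
    show "\<forall>X\<in>{X. inj X \<and> range X = I \<and> X ` (- J) = K}. (\<lambda>(f, g) i. if i \<in> J then f i else g i) (?h X) = X"
      by (auto simp: fun_eq_iff)
    show "\<forall>p\<in>?A \<times> ?B. ?h ((\<lambda>(f, g) i. if i \<in> J then f i else g i) p) = p"
      by (auto simp: fun_eq_iff restrict_def PiE_def extensional_def)
    show "?h ` {X. inj X \<and> range X = I \<and> X ` (- J) = K} \<subseteq> ?A \<times> ?B"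
    proof (rule image_subsetI)
      fix X assume "X \<in> {X. inj X \<and> range X = I \<and> X ` (- J) = K}"
      then have X: "inj X" "range X = I" "X ` (- J) = K" by auto
      have "X i \<in> I - K" if "i \<in> J" for i
        using that X by (metis ComplD DiffI imageE injD rangeI)
      then show "?h X \<in> ?A \<times> ?B"
        using X by (auto simp: inj_on_def dest: injD)
    qed
    show "(\<lambda>(f, g) i. if i \<in> J then f i else g i) ` (?A \<times> ?B) \<subseteq> {X. inj X \<and> range X = I \<and> X ` (- J) = K}"
    proof (rule image_subsetI)
      fix p assume "p \<in> ?A \<times> ?B"
      then obtain f g where p: "p = (f, g)" and f: "f \<in> J \<rightarrow>\<^sub>E I - K" "inj_on f J" and g: "g \<in> (- J) \<rightarrow>\<^sub>E K" "inj_on g (- J)"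
        by auto
      let ?X = "\<lambda>i. if i \<in> J then f i else g i"
      have "f ` J = I - K"
        using f assms by (intro card_subset_eq) (auto simp: card_image)
      moreover have "g ` (- J) = K"
        using g finK cJ cK by (intro card_subset_eq) (auto simp: card_image)
      moreover have X: "?X ` J = f ` J" "?X ` (- J) = g ` (- J)" by auto
      moreover have "range ?X = ?X ` J \<union> ?X ` (- J)" by blast
      moreover have "inj ?X"
      proof (rule injI)
        fix i j assume eq: "?X i = ?X j"
        have "i \<in> J \<longleftrightarrow> j \<in> J"
          using eq PiE_mem[OF f(1), of i] PiE_mem[OF f(1), of j] PiE_mem[OF g(1), of i] PiE_mem[OF g(1), of j]
          by (cases "i \<in> J"; cases "j \<in> J") auto
        then show "i = j"
          using eq inj_onD[OF f(2), of i j] inj_onD[OF g(2), of i j] by (cases "i \<in> J") auto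
      qed
      ultimately have "inj ?X \<and> range ?X = I \<and> ?X ` (- J) = K" using assms(3) by auto
      then show "(case p of (f, g) \<Rightarrow> \<lambda>i. if i \<in> J then f i else g i) \<in> {X. inj X \<and> range X = I \<and> X ` (- J) = K}"
        by (simp add: p)
    qed
  qed
  then have "card {X. inj X \<and> range X = I \<and> X ` (- J) = K} = card (?A \<times> ?B)"
    by (rule bij_betw_same_card)
  then show ?thesis by (simp only: card_cartesian_product cA cB)
qed

lemma norm_le_if_inner_le: "x \<bullet> x \<le> y \<bullet> x \<Longrightarrow> norm x \<le> norm (y :: real^'n)"
proof -
  assume "x \<bullet> x \<le> y \<bullet> x"
  then have "norm x * norm x \<le> norm y * norm x"
    using norm_cauchy_schwarz[of y x] by (simp add: power2_norm_eq_inner[symmetric] power2_eq_square)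
  then show ?thesis by (cases "x = 0") auto
qed

section \<open>The zero cell of points in general position\<close>

text \<open>\<open>orthants\<close> bounds the cell. \<open>regular\<close> makes any d normals
  independent, \<open>simple\<close> forbids a further hyperplane through their vertex, and
  \<open>generic\<close> keeps u off the spans of d - 1 normals, so that u is not constant along any
  edge.\<close>

locale general_position =
  fixes S :: "(real^'n::finite) set" and u :: "real^'n"
  assumes locally_finite: "\<And>R. finite (S \<inter> cball 0 R)"
    and orthants: "\<And>e :: 'n \<Rightarrow> bool. \<exists>x\<in>S. \<forall>i. if e i then x $ i > 0 else x $ i < 0"
    and regular: "\<And>X. X \<in> tuples UNIV S \<Longrightarrow> det (tuple_matrix X) \<noteq> 0"
    and simple: "\<And>X x. X \<in> tuples UNIV S \<Longrightarrow> x \<in> S \<Longrightarrow> x \<notin> range X \<Longrightarrow> tuple_vertex X \<bullet> x \<noteq> x \<bullet> x"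
    and generic: "\<And>X i. X \<in> tuples UNIV S \<Longrightarrow> tuple_coords X u $ i \<noteq> 0"
begin

abbreviation "Z \<equiv> zero_cell S"

lemma mem_Z: "y \<in> Z \<longleftrightarrow> (\<forall>x\<in>S. y \<bullet> x \<le> x \<bullet> x)"
  by (simp add: zero_cell_def halfspace0_def)

lemma convex_Z: "convex Z"
  unfolding zero_cell_def halfspace0_def
  by (intro convex_INT ballI) (simp add: convex_halfspace_le inner_commute)

lemma closed_Z: "closed Z"
  unfolding zero_cell_def halfspace0_def
  by (intro closed_INT ballI closed_Collect_le continuous_intros)

text \<open>For y in the cell take the point of \<open>S\<close> whose signs match those of y. All
  terms of the inner product are then nonnegative, so each of them obeys the bound that the
  hyperplane imposes on the sum.\<close>

lemma bounded_Z: "bounded Z"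
proof -
  have "\<exists>x. x \<in> S \<and> (\<forall>i. if e i then x $ i > 0 else x $ i < 0)" for e :: "'n \<Rightarrow> bool" using orthants by blast
  then obtain w :: "('n \<Rightarrow> bool) \<Rightarrow> real^'n" where w: "\<And>e. w e \<in> S" "\<And>e i. if e i then w e $ i > 0 else w e $ i < 0" by metis
  define R where "R = (\<Sum>e\<in>UNIV. \<Sum>i\<in>UNIV. (w e \<bullet> w e) / \<bar>w e $ i\<bar>)"
  have "\<bar>y $ i\<bar> \<le> R" if y: "y \<in> Z" for y i
  proof -
    \<comment> \<open>Zero entries of y are treated as negative; their terms vanish anyway.\<close>
    define e where "e i = (y $ i > 0)" for i
    have pos: "0 \<le> y $ i * w e $ i" "\<bar>y $ i\<bar> * \<bar>w e $ i\<bar> = y $ i * w e $ i" for i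
      using w(2)[of e i] by (auto simp: e_def zero_le_mult_iff abs_mult[symmetric] split: if_splits)
    have "\<bar>y $ i\<bar> * \<bar>w e $ i\<bar> \<le> (\<Sum>i\<in>UNIV. y $ i * w e $ i)"
      unfolding pos(2) by (rule member_le_sum) (auto simp: pos)
    also have "\<dots> \<le> w e \<bullet> w e" using y w(1)[of e] by (auto simp: mem_Z inner_vec_def)
    finally have "\<bar>y $ i\<bar> \<le> (w e \<bullet> w e) / \<bar>w e $ i\<bar>"
      using w(2)[of e i] by (subst pos_le_divide_eq) (auto split: if_splits)
    also have "\<dots> \<le> (\<Sum>i\<in>UNIV. (w e \<bullet> w e) / \<bar>w e $ i\<bar>)"
      by (rule member_le_sum) auto
    also have "\<dots> \<le> R" unfolding R_def
      by (rule member_le_sum[of e]) (auto intro!: sum_nonneg)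
    finally show ?thesis .
  qed
  then have "norm y \<le> real CARD('n) * R" if "y \<in> Z" for y
    using norm_le_l1_cart[of y] sum_bounded_above[of UNIV "\<lambda>i. \<bar>y $ i\<bar>" R] that by force
  then show ?thesis unfolding bounded_iff by blast
qed

lemma compact_Z: "compact Z"
  using closed_Z bounded_Z by (simp add: compact_eq_bounded_closed)

definition active :: "real^'n \<Rightarrow> (real^'n) set" where
  "active y = {x \<in> S. y \<bullet> x = x \<bullet> x}"

lemma finite_active: "finite (active y)"
proof (rule finite_subset[OF _ locally_finite[of "norm y"]])
  show "active y \<subseteq> S \<inter> cball 0 (norm y)"
    using norm_le_if_inner_le[of _ y] by (auto simp: active_def)
qed

text \<open>Only the finitely many points of norm at most \<open>norm y + 1\<close> need attention;
  the hyperplane of any other point does not reach the unit ball around y.\<close>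

lemma inactive_neighbourhood:
  assumes "y \<in> Z"
  obtains \<delta> where "\<delta> > 0" "\<And>z x. dist z y < \<delta> \<Longrightarrow> x \<in> S - active y \<Longrightarrow> z \<bullet> x < x \<bullet> x"
proof -
  let ?T = "S \<inter> cball 0 (norm y + 1) - active y"
  let ?U = "\<Inter>x\<in>?T. {z. z \<bullet> x < x \<bullet> x}"
  have "finite ?T" using locally_finite by simp
  then have "open ?U" by (intro open_INT ballI open_Collect_less continuous_intros) auto
  moreover have "y \<in> ?U" using assms by (auto simp: mem_Z active_def order_less_le)
  ultimately obtain e where e: "e > 0" "ball y e \<subseteq> ?U" by (meson open_contains_ball)
  show ?thesis
  proof (rule that[of "min e 1"])
    fix z x assume z: "dist z y < min e 1" and x: "x \<in> S - active y"
    show "z \<bullet> x < x \<bullet> x"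
    proof (cases "norm x \<le> norm y + 1")
      case True
      then have "x \<in> ?T" using x by auto
      moreover have "z \<in> ?U" using z e(2) by (auto simp: dist_commute)
      ultimately show ?thesis by blast
    next
      case False
      have "norm z \<le> norm y + dist z y" using norm_triangle_ineq2[of z y] by (simp add: dist_norm)
      then have "norm z < norm x" using False z by simp
      then show ?thesis using norm_le_if_inner_le[of x z] by (metis not_le)
    qed
  qed (use e in auto)
qed

text \<open>In a small step the inactive inequalities remain strict. Active hyperplanes with
  negative inner product are left towards the inside, those orthogonal to w stay active.\<close>

lemma perturb_in_Z:
  assumes y: "y \<in> Z" and w: "\<And>x. x \<in> active y \<Longrightarrow> w \<bullet> x \<le> 0"
  obtains s where "s > 0" "y + s *\<^sub>R w \<in> Z" "active (y + s *\<^sub>R w) = {x \<in> active y. w \<bullet> x = 0}"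
proof -
  obtain \<delta> where \<delta>: "\<delta> > 0" "\<And>z x. dist z y < \<delta> \<Longrightarrow> x \<in> S - active y \<Longrightarrow> z \<bullet> x < x \<bullet> x"
    using inactive_neighbourhood[OF y] by blast
  \<comment> \<open>The summand 1 keeps the quotient defined and the step strictly inside the
    neighbourhood, also for w = 0.\<close>
  define s where "s = \<delta> / (norm w + 1)"
  have s: "s > 0" using \<delta>(1) by (simp add: s_def add_nonneg_pos)
  have "s * norm w < \<delta>" using \<delta>(1) by (simp add: s_def divide_simps add_nonneg_pos)
  then have "dist (y + s *\<^sub>R w) y < \<delta>" using s by (simp add: dist_norm)
  note inact = \<delta>(2)[OF this]
  have act: "(y + s *\<^sub>R w) \<bullet> x = x \<bullet> x + s * (w \<bullet> x)" if "x \<in> active y" for x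
    using that by (simp add: active_def inner_add_left)
  have "y + s *\<^sub>R w \<in> Z"
    unfolding mem_Z
  proof
    fix x assume x: "x \<in> S"
    show "(y + s *\<^sub>R w) \<bullet> x \<le> x \<bullet> x"
    proof (cases "x \<in> active y")
      case True
      then show ?thesis using act[OF True] w[OF True] s by (simp add: mult_le_0_iff)
    qed (use inact x in force)
  qed
  moreover have "active (y + s *\<^sub>R w) = {x \<in> active y. w \<bullet> x = 0}"
  proof (intro equalityI subsetI)
    fix x assume x: "x \<in> active (y + s *\<^sub>R w)"
    then have "x \<in> active y" using inact[of x] by (force simp: active_def)
    then show "x \<in> {x \<in> active y. w \<bullet> x = 0}" using act x s by (auto simp: active_def)
  qed (use act in \<open>auto simp: active_def\<close>)
  ultimately show ?thesis using that s by blast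
qed

text \<open>The sign patterns with a single positive entry pick out pairwise different
  points.\<close>

lemma many_points: "\<exists>T\<subseteq>S. finite T \<and> card T = CARD('n)"
proof -
  have "\<exists>x. x \<in> S \<and> (\<forall>i. if i = j then x $ i > 0 else x $ i < 0)" for j :: 'n
    using orthants[of "\<lambda>i. i = j"] by blast
  then obtain w :: "'n \<Rightarrow> real^'n" where w: "\<And>j. w j \<in> S" "\<And>j i. if i = j then w j $ i > 0 else w j $ i < 0" by metis
  have "inj w"
  proof (rule injI)
    fix i j assume "w i = w j"
    then show "i = j" using w(2)[of i i] w(2)[of i j] by (auto split: if_splits)
  qed
  then show ?thesis using w(1) by (intro exI[of _ "range w"]) (auto simp: card_image)
qed

lemma tuple_range:
  assumes "T \<subseteq> S" "finite T" "card T = CARD('n)"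
  obtains X :: "'n \<Rightarrow> real^'n" where "X \<in> tuples UNIV S" "range X = T"
proof -
  obtain X :: "'n \<Rightarrow> real^'n" where "bij_betw X UNIV T"
    using finite_same_card_bij[of "UNIV :: 'n set" T] assms by auto
  then show ?thesis using that[of X] assms(1) by (auto simp: tuples_def bij_betw_def)
qed

text \<open>If y lay on more than d hyperplanes, d of them would already determine y as their
  vertex, and any further one would contradict \<open>simple\<close>.\<close>

lemma card_active: "card (active y) \<le> CARD('n)"
proof (rule ccontr)
  assume "\<not> card (active y) \<le> CARD('n)"
  then obtain T where T: "T \<subseteq> active y" "card T = CARD('n)" "finite T"
    by (metis finite_active finite_subset nat_le_linear obtain_subset_with_card_n)
  moreover have "T \<subseteq> S" using T by (auto simp: active_def)
  ultimately obtain X :: "'n \<Rightarrow> real^'n" where X: "X \<in> tuples UNIV S" "range X = T"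
    using tuple_range[of T] by metis
  have "y = tuple_vertex X"
    using X T(1) tuple_vertex_iff[OF regular[OF X(1)], of y] by (auto simp: active_def)
  moreover obtain x where "x \<in> active y" "x \<notin> T"
    using \<open>\<not> card (active y) \<le> CARD('n)\<close> T by (metis card_mono order_refl subsetI)
  ultimately show False using simple[OF X(1), of x] X(2) by (auto simp: active_def)
qed

text \<open>Completes the active normals to a basis, so that dual directions are available also at
  points that are not vertices.\<close>

lemma tuple_containing_active:
  obtains X :: "'n \<Rightarrow> real^'n" where "X \<in> tuples UNIV S" "active y \<subseteq> range X"
proof -
  obtain T where T: "T \<subseteq> S" "finite T" "card T = CARD('n)" using many_points by blast
  have "card T \<le> card (active y \<union> T)" using T finite_active by (intro card_mono) auto
  then obtain B where "active y \<subseteq> B" "B \<subseteq> active y \<union> T" "card B = CARD('n)"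
    using exists_subset_between[OF card_active[of y], of "active y \<union> T"] T finite_active[of y] by auto
  moreover have "B \<subseteq> S" "finite B"
    using calculation T finite_active[of y] by (auto simp: active_def intro: finite_subset)
  ultimately show ?thesis using that tuple_range[of B] by metis
qed

section \<open>Faces as intersections with flats\<close>

definition flat :: "(real^'n) set \<Rightarrow> (real^'n) set" where
  "flat K = {y. \<forall>x\<in>K. y \<bullet> x = x \<bullet> x}"

lemma affine_flat: "affine (flat K)"
  by (auto simp: affine_def flat_def inner_add_left algebra_simps) (metis distrib_right mult_1)

lemma active_flat: "y \<in> flat K \<longleftrightarrow> K \<subseteq> active y" if "K \<subseteq> S"
  using that by (auto simp: flat_def active_def)

lemma active_subset: "active y \<subseteq> S"
  by (auto simp: active_def)

text \<open>An inequality valid on \<open>Z\<close> that is tight inside a segment of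
  \<open>Z\<close> is tight at both ends.\<close>

lemma face_flat: "(Z \<inter> flat K) face_of Z" if "K \<subseteq> S"
  unfolding face_of_def
proof (intro conjI ballI impI)
  show "convex (Z \<inter> flat K)" using convex_Z affine_imp_convex[OF affine_flat] by (rule convex_Int)
  fix a b x assume a: "a \<in> Z" and b: "b \<in> Z" and x: "x \<in> Z \<inter> flat K" and seg: "x \<in> open_segment a b"
  obtain t where t: "0 < t" "t < 1" "x = (1 - t) *\<^sub>R a + t *\<^sub>R b" using seg by (auto simp: in_segment)
  have "a \<bullet> k = k \<bullet> k \<and> b \<bullet> k = k \<bullet> k" if k: "k \<in> K" for k
  proof -
    have le: "a \<bullet> k \<le> k \<bullet> k" "b \<bullet> k \<le> k \<bullet> k" using a b k that \<open>K \<subseteq> S\<close> by (auto simp: mem_Z)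
    have eq: "(1 - t) * (a \<bullet> k) + t * (b \<bullet> k) = k \<bullet> k" using x k by (simp add: flat_def t(3) inner_add_left)
    have "(1 - t) * (k \<bullet> k - a \<bullet> k) + t * (k \<bullet> k - b \<bullet> k) = 0" using eq by (simp add: algebra_simps)
    moreover have "0 \<le> (1 - t) * (k \<bullet> k - a \<bullet> k)" "0 \<le> t * (k \<bullet> k - b \<bullet> k)" using le t by auto
    ultimately have "(1 - t) * (k \<bullet> k - a \<bullet> k) = 0" "t * (k \<bullet> k - b \<bullet> k) = 0" by linarith+
    then show ?thesis using t by auto
  qed
  then show "a \<in> Z \<inter> flat K" "b \<in> Z \<inter> flat K" using a b by (auto simp: flat_def)
qed auto

text \<open>The flat is a translate of the orthogonal complement of the active normals, which are
  independent as part of a regular tuple.\<close>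

lemma aff_dim_flat:
  assumes y: "y \<in> Z"
  shows "aff_dim (flat (active y)) = int (CARD('n) - card (active y))"
proof -
  obtain X :: "'n \<Rightarrow> real^'n" where X: "X \<in> tuples UNIV S" "active y \<subseteq> range X"
    using tuple_containing_active by blast
  have ind: "independent (active y)"
    using tuple_independent[OF regular[OF X(1)]] X(2) by (rule independent_mono)
  let ?W = "{w. \<forall>x\<in>span (active y). orthogonal x w}"
  have "dim ?W + dim (span (active y)) = dim (UNIV :: (real^'n) set)"
    using dim_subspace_orthogonal_to_vectors[OF subspace_span subspace_UNIV, of "active y"] by simp
  then have dimW: "dim ?W = CARD('n) - card (active y)"
    using ind by (simp add: dim_eq_card_independent)
  have W: "?W = {w. \<forall>x\<in>active y. orthogonal x w}"
  proof (intro equalityI subsetI)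
    fix w assume w: "w \<in> {w. \<forall>x\<in>active y. orthogonal x w}"
    have "orthogonal w x" if "x \<in> span (active y)" for x
      by (rule orthogonal_to_span[OF that]) (use w orthogonal_commute in blast)
    then show "w \<in> ?W" using orthogonal_commute by blast
  qed (auto intro: span_base)
  have "flat (active y) = (\<lambda>w. y + w) ` ?W"
  proof (intro equalityI subsetI)
    fix z assume "z \<in> flat (active y)"
    then have "z - y \<in> ?W" unfolding W by (auto simp: flat_def active_def orthogonal_def inner_diff_right inner_commute)
    then show "z \<in> (\<lambda>w. y + w) ` ?W" by (intro image_eqI[of _ _ "z - y"]) auto
  next
    fix z assume "z \<in> (\<lambda>w. y + w) ` ?W"
    then show "z \<in> flat (active y)" unfolding W by (auto simp: flat_def active_def orthogonal_def inner_add_left inner_add_right inner_commute)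
  qed
  then have "aff_dim (flat (active y)) = aff_dim ?W" using aff_dim_translation_eq[of y ?W] by simp
  also have "\<dots> = int (dim ?W)" by (rule aff_dim_subspace) (auto simp: subspace_def orthogonal_clauses)
  finally show ?thesis using dimW by simp
qed

text \<open>Near y only active hyperplanes matter, so the flat stays inside \<open>Z\<close> there
  and the face has the full dimension of the flat.\<close>

lemma aff_dim_face:
  assumes y: "y \<in> Z"
  shows "aff_dim (Z \<inter> flat (active y)) = int (CARD('n) - card (active y))"
proof -
  obtain \<delta> where \<delta>: "\<delta> > 0" "\<And>z x. dist z y < \<delta> \<Longrightarrow> x \<in> S - active y \<Longrightarrow> z \<bullet> x < x \<bullet> x"
    using inactive_neighbourhood[OF y] by blast
  have sub: "flat (active y) \<inter> ball y \<delta> \<subseteq> Z \<inter> flat (active y)"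
  proof
    fix z assume z: "z \<in> flat (active y) \<inter> ball y \<delta>"
    have "z \<bullet> x \<le> x \<bullet> x" if "x \<in> S" for x
      using z \<delta>(2)[of z x] that by (cases "x \<in> active y") (auto simp: flat_def dist_commute)
    with z show "z \<in> Z \<inter> flat (active y)" by (auto simp: mem_Z)
  qed
  have "y \<in> flat (active y)" by (simp add: flat_def active_def)
  then have "aff_dim (flat (active y) \<inter> ball y \<delta>) = aff_dim (flat (active y))"
    using \<delta>(1) by (intro aff_dim_convex_Int_open affine_imp_convex affine_flat) auto
  moreover have "aff_dim (flat (active y) \<inter> ball y \<delta>) \<le> aff_dim (Z \<inter> flat (active y))"
    using sub by (rule aff_dim_subset)
  moreover have "aff_dim (Z \<inter> flat (active y)) \<le> aff_dim (flat (active y))"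
    by (rule aff_dim_subset) auto
  ultimately show ?thesis using aff_dim_flat[OF y] by linarith
qed

text \<open>Take z in the relative interior of F. A segment from a point of F to z can be prolonged
  within F, which forces the inequalities active at z to be tight at that point. Conversely, from a
  point of \<open>Z\<close> on the flat one can step beyond z inside \<open>Z\<close>, so the face
  property at z puts that point into F.\<close>

lemma face_eq_flat:
  assumes F: "F face_of Z" "F \<noteq> {}"
  obtains z where "z \<in> Z" "F = Z \<inter> flat (active z)"
proof -
  have conv: "convex F" using F(1) by (simp add: face_of_imp_convex)
  then obtain z where z: "z \<in> rel_interior F" using F(2) rel_interior_eq_empty by blast
  then have zF: "z \<in> F" using rel_interior_subset by blast
  then have zZ: "z \<in> Z" using F(1) face_of_imp_subset by blast
  have "F = Z \<inter> flat (active z)"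
  proof (intro equalityI subsetI)
    fix x assume x: "x \<in> F"
    then obtain m where m: "m > 1" "(1 - m) *\<^sub>R x + m *\<^sub>R z \<in> F"
      using convex_rel_interior_if[OF conv z] hull_inc[of x F] by blast
    have "x \<bullet> k = k \<bullet> k" if k: "k \<in> active z" for k
    proof -
      have "((1 - m) *\<^sub>R x + m *\<^sub>R z) \<bullet> k \<le> k \<bullet> k" "x \<bullet> k \<le> k \<bullet> k"
        using m(2) x k F(1) face_of_imp_subset active_subset by (fastforce simp: mem_Z)+
      moreover have "z \<bullet> k = k \<bullet> k" using k by (simp add: active_def)
      ultimately have "(m - 1) * (k \<bullet> k - x \<bullet> k) \<le> 0" by (simp add: inner_add_left algebra_simps)
      then show ?thesis using m(1) \<open>x \<bullet> k \<le> k \<bullet> k\<close> by (auto simp: mult_le_0_iff)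
    qed
    then show "x \<in> Z \<inter> flat (active z)" using x F(1) face_of_imp_subset by (auto simp: flat_def)
  next
    fix x assume x: "x \<in> Z \<inter> flat (active z)"
    show "x \<in> F"
    proof (cases "x = z")
      case False
      have "(z - x) \<bullet> k \<le> 0" if "k \<in> active z" for k
        using x that by (auto simp: flat_def active_def inner_diff_left)
      then obtain s where s: "s > 0" "z + s *\<^sub>R (z - x) \<in> Z"
        using perturb_in_Z[OF zZ] by metis
      define x' where "x' = z + s *\<^sub>R (z - x)"
      have "z = (1 - 1 / (1 + s)) *\<^sub>R x + (1 / (1 + s)) *\<^sub>R x'"
      proof -
        have "(1 + s) *\<^sub>R z = s *\<^sub>R x + x'" by (simp add: x'_def algebra_simps)
        then have "(1 / (1 + s)) *\<^sub>R ((1 + s) *\<^sub>R z) = (1 / (1 + s)) *\<^sub>R (s *\<^sub>R x + x')" by simp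
        moreover have "1 - 1 / (1 + s) = s / (1 + s)" using s(1) by (simp add: field_simps)
        ultimately show ?thesis using s(1) by (simp add: scaleR_add_right)
      qed
      moreover have "x \<noteq> x'"
      proof
        assume "x = x'"
        then have "(1 + s) *\<^sub>R (z - x) = 0" by (simp add: x'_def algebra_simps)
        then show False using s(1) False by simp
      qed
      ultimately have "z \<in> open_segment x x'"
        unfolding in_segment using s(1) by (auto intro!: exI[of _ "1 / (1 + s)"])
      then show ?thesis using F(1) zF x s(2) unfolding face_of_def x'_def by blast
    qed (use zF in simp)
  qed
  with zZ show ?thesis using that by blast
qed

lemma active_eq_if_flat_eq:
  assumes "z \<in> Z" "z' \<in> Z" "Z \<inter> flat (active z) = Z \<inter> flat (active z')"
  shows "active z = active z'"
proof -
  have "z \<in> flat (active z)" "z' \<in> flat (active z')" by (auto simp: flat_def active_def)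
  then have "z \<in> flat (active z')" "z' \<in> flat (active z)" using assms by blast+
  then show ?thesis using active_flat[OF active_subset] by blast
qed

text \<open>The linear functional u attains its maximum over the face at a unique vertex, characterised
  by positive coordinates of u with respect to the remaining facet normals.\<close>

lemma top_vertex_exists:
  assumes K: "K \<subseteq> S" and ne: "Z \<inter> flat K \<noteq> {}"
  obtains y where "y \<in> Z \<inter> flat K" "card (active y) = CARD('n)"
    "\<And>X i. X \<in> tuples UNIV S \<Longrightarrow> range X = active y \<Longrightarrow> X i \<notin> K \<Longrightarrow> tuple_coords X u $ i > 0"
proof -
  have "flat K = (\<Inter>x\<in>K. {y. y \<bullet> x = x \<bullet> x})" by (auto simp: flat_def)
  then have "closed (flat K)" by (simp only:) (intro closed_INT ballI closed_Collect_eq continuous_intros)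
  then have "compact (Z \<inter> flat K)" using compact_Z by (rule compact_Int_closed[rotated])
  then obtain y where y: "y \<in> Z \<inter> flat K" "\<And>z. z \<in> Z \<inter> flat K \<Longrightarrow> u \<bullet> z \<le> u \<bullet> y"
    using continuous_attains_sup[OF _ ne continuous_on_inner[OF continuous_on_const[of _ u] continuous_on_id]] by blast
  have Ky: "K \<subseteq> active y" using y(1) active_flat[OF K] by blast
  have u_inner: "u \<bullet> w = (\<Sum>i\<in>UNIV. tuple_coords X u $ i * (w \<bullet> X i))" if "X \<in> tuples UNIV S" for X w
  proof -
    have "u \<bullet> w = (\<Sum>i\<in>UNIV. tuple_coords X u $ i *\<^sub>R X i) \<bullet> w" by (simp only: sum_tuple_coords[OF regular[OF that]])
    then show ?thesis by (simp add: inner_sum_left inner_commute[of w])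
  qed
  have descend: "tuple_coords X u $ i > 0"
    if X: "X \<in> tuples UNIV S" "active y \<subseteq> range X" and i: "X i \<notin> K" for X i
  proof -
    have injX: "inj X" using X by (simp add: tuples_def)
    \<comment> \<open>The direction leaves only the hyperplane of X i, towards the inside.
      Maximality of y makes the coordinate nonnegative, and \<open>generic\<close> makes it
      positive.\<close>
    obtain w where w: "\<And>j. w \<bullet> X j = (if j = i then -1 else 0)"
      using tuple_dual_vector[OF regular[OF X(1)], of "\<lambda>j. if j = i then -1 else 0"] by metis
    have "w \<bullet> x \<le> 0" if "x \<in> active y" for x using that X(2) w by fastforce
    then obtain s where s: "s > 0" "y + s *\<^sub>R w \<in> Z" "active (y + s *\<^sub>R w) = {x \<in> active y. w \<bullet> x = 0}"
      using perturb_in_Z[of y w] y(1) by blast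
    have "w \<bullet> x = 0" if "x \<in> K" for x
    proof -
      obtain j where j: "x = X j" using \<open>x \<in> K\<close> Ky X(2) by (meson imageE subsetD)
      then have "j \<noteq> i" using that i by blast
      then show ?thesis using w j by simp
    qed
    then have "y + s *\<^sub>R w \<in> flat K" using active_flat[OF K] s(3) Ky by blast
    then have "u \<bullet> (y + s *\<^sub>R w) \<le> u \<bullet> y" using y(2) s(2) by blast
    then have "u \<bullet> w \<le> 0" using s(1) by (simp add: inner_add_right mult_le_0_iff)
    moreover have "u \<bullet> w = - tuple_coords X u $ i" using u_inner[OF X(1), of w] w by (simp add: if_distrib sum.delta cong: if_cong)
    ultimately show ?thesis using generic[OF X(1), of i] by linarith
  qed
  have "card (active y) = CARD('n)"
  proof -
    obtain X :: "'n \<Rightarrow> real^'n" where X: "X \<in> tuples UNIV S" "active y \<subseteq> range X"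
      using tuple_containing_active by blast
    have injX: "inj X" using X by (simp add: tuples_def)
    have "X i \<in> active y" for i
    proof (rule ccontr)
      assume i: "X i \<notin> active y"
      then have pos: "tuple_coords X u $ i > 0" using descend[OF X] Ky by blast
      \<comment> \<open>If X i is not active at y, the opposite step is possible as well and raises
        the value of u, against maximality.\<close>
      obtain w where w: "\<And>j. w \<bullet> X j = (if j = i then 1 else 0)"
        using tuple_dual_vector[OF regular[OF X(1)], of "\<lambda>j. if j = i then 1 else 0"] by metis
      have w0: "w \<bullet> x = 0" if "x \<in> active y" for x using that X(2) w i by (metis imageE subsetD)
      then obtain s where s: "s > 0" "y + s *\<^sub>R w \<in> Z" "active (y + s *\<^sub>R w) = {x \<in> active y. w \<bullet> x = 0}"
        using perturb_in_Z[of y w] y(1) by force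
      have "y + s *\<^sub>R w \<in> flat K" using active_flat[OF K] s(3) Ky w0 by blast
      then have "u \<bullet> (y + s *\<^sub>R w) \<le> u \<bullet> y" using y(2) s(2) by blast
      then have "u \<bullet> w \<le> 0" using s(1) by (simp add: inner_add_right mult_le_0_iff)
      moreover have "u \<bullet> w = tuple_coords X u $ i" using u_inner[OF X(1), of w] w by (simp add: if_distrib sum.delta cong: if_cong)
      ultimately show False using pos by simp
    qed
    then have "active y = range X" using X(2) by blast
    then show ?thesis using injX by (simp add: card_image)
  qed
  then show ?thesis using that[OF y(1)] descend by blast
qed

text \<open>Expanding u in the normals, the loss of height from the vertex to z is the sum of
  coordinate times slack of z. No term is negative, and as no coordinate vanishes, the sum is 0 only
  if z lies on all d hyperplanes.\<close>

lemma top_vertex_unique: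
  assumes X: "X \<in> tuples UNIV S" and v: "tuple_vertex X \<in> Z"
    and pos: "\<And>i. X i \<notin> K \<Longrightarrow> tuple_coords X u $ i > 0"
    and z: "z \<in> Z \<inter> flat K"
  shows "u \<bullet> z \<le> u \<bullet> tuple_vertex X" "u \<bullet> z = u \<bullet> tuple_vertex X \<Longrightarrow> z = tuple_vertex X"
proof -
  let ?v = "tuple_vertex X" and ?l = "\<lambda>i. tuple_coords X u $ i"
  have vX: "?v \<bullet> X i = X i \<bullet> X i" for i using tuple_vertex_iff[OF regular[OF X], of ?v] by simp
  have XS: "X i \<in> S" for i using X by (auto simp: tuples_def)
  have "u \<bullet> (?v - z) = (\<Sum>i\<in>UNIV. ?l i *\<^sub>R X i) \<bullet> (?v - z)" by (simp only: sum_tuple_coords[OF regular[OF X]])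
  also have "\<dots> = (\<Sum>i\<in>UNIV. ?l i * (X i \<bullet> X i - z \<bullet> X i))"
    by (simp add: inner_sum_left inner_diff_right inner_commute[of "X _" ?v] inner_commute[of "X _" z] vX
        right_diff_distrib sum_subtractf)
  finally have sum: "u \<bullet> (?v - z) = (\<Sum>i\<in>UNIV. ?l i * (X i \<bullet> X i - z \<bullet> X i))" .
  have nonneg: "0 \<le> ?l i * (X i \<bullet> X i - z \<bullet> X i)" for i
  proof (cases "X i \<in> K")
    case True
    then have "z \<bullet> X i = X i \<bullet> X i" using z by (simp add: flat_def)
    then show ?thesis by simp
  next
    case False
    have "z \<bullet> X i \<le> X i \<bullet> X i" using z XS by (simp add: mem_Z)
    then show ?thesis using pos[OF False] by simp
  qed
  then have "0 \<le> u \<bullet> (?v - z)" unfolding sum by (intro sum_nonneg) auto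
  then show "u \<bullet> z \<le> u \<bullet> ?v" by (simp add: inner_diff_right)
  assume "u \<bullet> z = u \<bullet> ?v"
  then have "(\<Sum>i\<in>UNIV. ?l i * (X i \<bullet> X i - z \<bullet> X i)) = 0" unfolding sum[symmetric] by (simp add: inner_diff_right)
  then have zero: "?l i * (X i \<bullet> X i - z \<bullet> X i) = 0" for i using nonneg by (simp add: sum_nonneg_eq_0_iff)
  have "z \<bullet> X i = X i \<bullet> X i" for i
    using zero[of i] generic[OF X, of i] by simp
  then show "z = ?v" using tuple_vertex_iff[OF regular[OF X], of z] by simp
qed

section \<open>Counting tuples face by face\<close>

abbreviation "top_tuples J \<equiv> {X \<in> tuples UNIV S. S \<inter> void_ball (tuple_vertex X) = {} \<and> (\<forall>i\<in>J. tuple_coords X u $ i > 0)}"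

lemma void_iff_mem_Z: "S \<inter> void_ball v = {} \<longleftrightarrow> v \<in> Z"
  by (auto simp: mem_Z void_ball_def inner_commute not_less)

lemma range_subset_active: "X \<in> tuples UNIV S \<Longrightarrow> range X \<subseteq> active (tuple_vertex X)"
  using tuple_vertex_iff[OF regular, of X "tuple_vertex X"] by (auto simp: active_def tuples_def)

lemma active_tuple_vertex:
  assumes X: "X \<in> tuples UNIV S"
  shows "active (tuple_vertex X) = range X"
proof -
  have "card (range X) = CARD('n)" using X by (simp add: tuples_def card_image)
  then show ?thesis
    using range_subset_active[OF X] card_active[of "tuple_vertex X"] finite_active[of "tuple_vertex X"]
    by (metis card_seteq)
qed

lemma finite_top_tuples: "finite (top_tuples J)"
proof -
  obtain R where R: "\<And>z. z \<in> Z \<Longrightarrow> norm z \<le> R" using bounded_Z by (meson bounded_iff)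
  have "top_tuples J \<subseteq> (UNIV \<rightarrow>\<^sub>E S \<inter> cball 0 R)"
  proof
    fix X assume X: "X \<in> top_tuples J"
    then have v: "tuple_vertex X \<in> Z" and XT: "X \<in> tuples UNIV S" using void_iff_mem_Z by auto
    have "X i \<in> S \<inter> cball 0 R" for i
    proof -
      have "X i \<in> active (tuple_vertex X)" using range_subset_active[OF XT] by blast
      then have "norm (X i) \<le> norm (tuple_vertex X)" "X i \<in> S"
        using norm_le_if_inner_le[of "X i" "tuple_vertex X"] by (auto simp: active_def)
      then show ?thesis using R[OF v] by simp
    qed
    then show "X \<in> (UNIV \<rightarrow>\<^sub>E S \<inter> cball 0 R)" by blast
  qed
  then show ?thesis by (rule finite_subset) (intro finite_PiE locally_finite finite)
qed

text \<open>Starting at the vertex, the hyperplanes indexed by \<open>J\<close> are all left at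
  once; the point reached is active exactly for the remaining ones.\<close>

lemma interior_of_top_tuple_face:
  assumes X: "X \<in> top_tuples J"
  obtains z where "z \<in> Z" "active z = X ` (- J)"
proof -
  have v: "tuple_vertex X \<in> Z" and XT: "X \<in> tuples UNIV S" using X void_iff_mem_Z by auto
  have injX: "inj X" using XT by (simp add: tuples_def)
  obtain w where w: "\<And>j. w \<bullet> X j = (if j \<in> J then -1 else 0)"
    using tuple_dual_vector[OF regular[OF XT], of "\<lambda>j. if j \<in> J then -1 else 0"] by metis
  have "w \<bullet> x \<le> 0" if "x \<in> active (tuple_vertex X)" for x using that w by (auto simp: active_tuple_vertex[OF XT])
  then obtain s where s: "tuple_vertex X + s *\<^sub>R w \<in> Z" "active (tuple_vertex X + s *\<^sub>R w) = {x \<in> active (tuple_vertex X). w \<bullet> x = 0}"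
    using perturb_in_Z[OF v, of w] by blast
  have "{x \<in> active (tuple_vertex X). w \<bullet> x = 0} = X ` (- J)"
    unfolding active_tuple_vertex[OF XT] using w by auto
  then show ?thesis using s that by simp
qed

text \<open>A face determines the set K of hyperplanes containing it, by
  \<open>active_eq_if_flat_eq\<close>, and its top vertex, hence all d hyperplanes of the tuple.
  Only the orderings that send the complement of \<open>J\<close> to K remain to be chosen.\<close>

lemma top_tuples_fibre:
  assumes F: "F face_of Z" "aff_dim F = int (card J)"
  shows "card {X \<in> top_tuples J. Z \<inter> flat (X ` (- J)) = F} = fact (card J) * fact (CARD('n) - card J)"
proof -
  have "F \<noteq> {}" using F(2) by force
  then obtain z where z: "z \<in> Z" "F = Z \<inter> flat (active z)" using face_eq_flat[OF F(1)] by blast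
  define K where "K = active z"
  have KS: "K \<subseteq> S" by (simp add: K_def active_subset)
  have JK: "card J \<le> CARD('n)" by (simp add: card_mono)
  have cK: "card K = CARD('n) - card J"
    using aff_dim_face[OF z(1)] F(2) card_active[of z] z(2) by (simp add: K_def)
  obtain y where y: "y \<in> Z \<inter> flat K" "card (active y) = CARD('n)"
    "\<And>X i. X \<in> tuples UNIV S \<Longrightarrow> range X = active y \<Longrightarrow> X i \<notin> K \<Longrightarrow> tuple_coords X u $ i > 0"
    using top_vertex_exists[OF KS] \<open>F \<noteq> {}\<close> z(2) K_def by metis
  have Ky: "K \<subseteq> active y" using y(1) active_flat[OF KS] by blast
  have vertex: "tuple_vertex X = y" if "X \<in> tuples UNIV S" "range X = active y" for X
    using tuple_vertex_iff[OF regular[OF that(1)], of y] that(2) by (auto simp: active_def)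
  have "{X \<in> top_tuples J. Z \<inter> flat (X ` (- J)) = F} = {X. inj X \<and> range X = active y \<and> X ` (- J) = K}"
  proof (intro equalityI subsetI)
    fix X assume "X \<in> {X \<in> top_tuples J. Z \<inter> flat (X ` (- J)) = F}"
    then have X: "X \<in> top_tuples J" "Z \<inter> flat (X ` (- J)) = F" by auto
    then have XT: "X \<in> tuples UNIV S" and v: "tuple_vertex X \<in> Z" using void_iff_mem_Z by auto
    obtain z' where z': "z' \<in> Z" "active z' = X ` (- J)" using interior_of_top_tuple_face[OF X(1)] .
    have XK: "X ` (- J) = K"
      using active_eq_if_flat_eq[OF z'(1) z(1)] X(2) z(2) z'(2) by (simp add: K_def)
    have pos: "tuple_coords X u $ i > 0" if "X i \<notin> K" for i using that XK X(1) by blast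
    have vF: "tuple_vertex X \<in> Z \<inter> flat K"
      using v active_flat[OF KS] range_subset_active[OF XT] XK by blast
    obtain Y :: "'n \<Rightarrow> real^'n" where Y: "Y \<in> tuples UNIV S" "range Y = active y"
      by (rule tuple_range[OF active_subset finite_active y(2)])
    have "u \<bullet> tuple_vertex X \<le> u \<bullet> y"
      using top_vertex_unique(1)[OF Y(1) _ y(3)[OF Y] vF] vertex[OF Y] y(1) by simp
    moreover have "u \<bullet> y \<le> u \<bullet> tuple_vertex X"
      by (rule top_vertex_unique(1)[OF XT v pos y(1)])
    ultimately have "y = tuple_vertex X"
      using top_vertex_unique(2)[OF XT v pos y(1)] by simp
    then show "X \<in> {X. inj X \<and> range X = active y \<and> X ` (- J) = K}"
      using XK XT active_tuple_vertex[OF XT] by (simp add: tuples_def)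
  next
    fix X assume "X \<in> {X. inj X \<and> range X = active y \<and> X ` (- J) = K}"
    then have X: "inj X" "range X = active y" "X ` (- J) = K" by auto
    have XT: "X \<in> tuples UNIV S" using X active_subset[of y] by (auto simp: tuples_def)
    have "X i \<notin> K" if "i \<in> J" for i using that X(1) by (auto simp: X(3)[symmetric] dest: injD)
    then have "\<forall>i\<in>J. tuple_coords X u $ i > 0" using y(3)[OF XT X(2)] by blast
    moreover have "S \<inter> void_ball (tuple_vertex X) = {}"
      unfolding void_iff_mem_Z vertex[OF XT X(2)] using y(1) by blast
    ultimately show "X \<in> {X \<in> top_tuples J. Z \<inter> flat (X ` (- J)) = F}"
      using XT X(3) z(2) by (simp add: K_def)
  qed
  moreover have "card (active y - K) = card J"
    using Ky y(2) cK JK finite_active by (subst card_Diff_subset) (auto simp: K_def)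
  ultimately show ?thesis
    using card_bij_betw_split[OF finite_active y(2) Ky] by simp
qed

text \<open>Tuples are grouped by the face they describe. All fibres have the same positive size, so
  every face of the right dimension occurs.\<close>

theorem num_faces_eq_card_top_tuples:
  "num_faces (card J) Z * (fact (card J) * fact (CARD('n) - card J)) = card (top_tuples J)"
proof -
  let ?g = "\<lambda>X. Z \<inter> flat (X ` (- J))" and ?F = "{F. F face_of Z \<and> aff_dim F = int (card J)}"
  have "?g ` top_tuples J = ?F"
  proof (intro equalityI subsetI)
    fix F assume "F \<in> ?g ` top_tuples J"
    then obtain X where X: "X \<in> top_tuples J" "F = ?g X" by blast
    then have XT: "X \<in> tuples UNIV S" by simp
    obtain z where z: "z \<in> Z" "active z = X ` (- J)" using interior_of_top_tuple_face[OF X(1)] .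
    have "card (X ` (- J)) = card (- J)"
      using XT by (intro card_image) (auto simp: tuples_def intro: inj_on_subset)
    then have "CARD('n) - card (X ` (- J)) = card J"
      by (simp add: Compl_eq_Diff_UNIV card_Diff_subset card_mono)
    then show "F \<in> ?F"
      using aff_dim_face[OF z(1)] face_flat[OF active_subset, of z] X(2) z(2) by simp
  next
    fix F assume F: "F \<in> ?F"
    then have "card {X \<in> top_tuples J. ?g X = F} > 0" using top_tuples_fibre[of F J] by simp
    then have "{X \<in> top_tuples J. ?g X = F} \<noteq> {}" by (metis card.empty less_irrefl)
    then show "F \<in> ?g ` top_tuples J" by auto
  qed
  moreover have "card (top_tuples J) = (\<Sum>F\<in>?g ` top_tuples J. card {X \<in> top_tuples J. ?g X = F})"
    using sum.image_gen[OF finite_top_tuples, of "\<lambda>_. 1::nat" J ?g] by simp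
  ultimately have "card (top_tuples J) = (\<Sum>F\<in>?F. card {X \<in> top_tuples J. ?g X = F})" by (simp only:)
  also have "\<dots> = (\<Sum>F\<in>?F. fact (card J) * fact (CARD('n) - card J))"
    by (rule sum.cong) (use top_tuples_fibre[of _ J] in simp_all)
  finally show ?thesis by (simp add: num_faces_def)
qed

end

section \<open>The invariant measure on hyperplanes\<close>

lemma nn_integral_hyp_intensity_lborel:
  fixes f :: "'b::euclidean_space \<Rightarrow> ennreal"
  assumes [measurable]: "f \<in> borel_measurable borel" and \<gamma>: "\<gamma> > 0"
  shows "(\<integral>\<^sup>+x. f x \<partial>hyp_intensity \<gamma>) = ennreal \<gamma> * (\<integral>\<^sup>+x. ennreal (norm x powr (1 - real DIM('b))) * f x \<partial>lborel)"
  using \<gamma> by (simp add: hyp_intensity_def nn_integral_density ennreal_mult' mult.assoc nn_integral_cmult)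

lemma sets_hyp_intensity [measurable_cong]: "sets (hyp_intensity \<gamma>) = sets borel"
  by (simp add: hyp_intensity_def)

lemma space_hyp_intensity: "space (hyp_intensity \<gamma>) = UNIV"
  by (simp add: hyp_intensity_def)

lemma null_sets_hyp_intensity:
  fixes N :: "'b::euclidean_space set"
  assumes "N \<in> null_sets lborel"
  shows "N \<in> null_sets (hyp_intensity \<gamma>)"
  using absolutely_continuousI_density[of "\<lambda>x. ennreal (\<gamma> * norm x powr (1 - real DIM('b)))" lborel] assms
  by (auto simp: hyp_intensity_def absolutely_continuous_def)

text \<open>Lebesgue measure contributes \<open>c ^ d\<close> and the density
  \<open>c powr (1 - d)\<close>: the measure is homogeneous of degree 1, like the distance of the
  hyperplane from the origin.\<close>

lemma hyp_intensity_scaleR: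
  fixes f :: "'b::euclidean_space \<Rightarrow> ennreal"
  assumes [measurable]: "f \<in> borel_measurable borel" and \<gamma>: "\<gamma> > 0" and c: "c > 0"
  shows "(\<integral>\<^sup>+x. f x \<partial>hyp_intensity \<gamma>) = ennreal c * (\<integral>\<^sup>+x. f (c *\<^sub>R x) \<partial>hyp_intensity \<gamma>)"
proof -
  have cd: "c ^ DIM('b) * c powr (1 - real DIM('b)) = c"
    using c by (simp add: powr_realpow[symmetric] powr_add[symmetric])
  have "(\<integral>\<^sup>+x. f x \<partial>hyp_intensity \<gamma>) = ennreal \<gamma> * (ennreal (c ^ DIM('b)) * (\<integral>\<^sup>+x. ennreal (norm (c *\<^sub>R x) powr (1 - real DIM('b))) * f (c *\<^sub>R x) \<partial>lborel))"
    unfolding nn_integral_hyp_intensity_lborel[OF assms(1) \<gamma>]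
    by (subst nn_integral_lborel_scaleR[OF c]) simp_all
  also have "(\<integral>\<^sup>+x. ennreal (norm (c *\<^sub>R x) powr (1 - real DIM('b))) * f (c *\<^sub>R x) \<partial>lborel)
    = ennreal (c powr (1 - real DIM('b))) * (\<integral>\<^sup>+x. ennreal (norm x powr (1 - real DIM('b))) * f (c *\<^sub>R x) \<partial>lborel)"
    using c by (subst nn_integral_cmult[symmetric]) (simp_all add: powr_mult ennreal_mult' mult.assoc)
  also have "ennreal \<gamma> * (ennreal (c ^ DIM('b)) * (ennreal (c powr (1 - real DIM('b))) * (\<integral>\<^sup>+x. ennreal (norm x powr (1 - real DIM('b))) * f (c *\<^sub>R x) \<partial>lborel)))
    = ennreal (c ^ DIM('b) * c powr (1 - real DIM('b))) * (ennreal \<gamma> * (\<integral>\<^sup>+x. ennreal (norm x powr (1 - real DIM('b))) * f (c *\<^sub>R x) \<partial>lborel))"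
    using c by (simp add: ennreal_mult ac_simps)
  also have "\<dots> = ennreal c * (\<integral>\<^sup>+x. f (c *\<^sub>R x) \<partial>hyp_intensity \<gamma>)"
    unfolding cd by (subst nn_integral_hyp_intensity_lborel[OF _ \<gamma>]) simp_all
  finally show ?thesis .
qed

lemma hyp_intensity_rotate:
  fixes f :: "real^'n::{finite,wellorder} \<Rightarrow> ennreal" and T :: "real^'n::_ \<Rightarrow> real^'n::_"
  assumes [measurable]: "f \<in> borel_measurable borel" and \<gamma>: "\<gamma> > 0" and T: "orthogonal_transformation T"
  shows "(\<integral>\<^sup>+x. f x \<partial>hyp_intensity \<gamma>) = (\<integral>\<^sup>+x. f (T x) \<partial>hyp_intensity \<gamma>)"
proof -
  have lin: "linear T" using T by (rule orthogonal_transformation_linear)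
  have [measurable]: "T \<in> borel_measurable borel"
    by (intro borel_measurable_continuous_onI linear_continuous_on) (simp add: lin linear_conv_bounded_linear[symmetric])
  have "\<bar>det (matrix T)\<bar> = 1" using T by (rule orthogonal_transformation_det)
  moreover have "matrix T *v x = T x" for x using lin by (simp add: matrix_works)
  ultimately show ?thesis
    unfolding nn_integral_hyp_intensity_lborel[OF assms(1) \<gamma>]
    by (subst nn_integral_matrix_vector_mult[of "matrix T"])
       (auto simp: orthogonal_transformation_norm[OF T] nn_integral_hyp_intensity_lborel[OF _ \<gamma>])
qed

lemma nn_integral_gauss_vec:
  "(\<integral>\<^sup>+x. ennreal (exp (- (norm x)\<^sup>2 / 2)) \<partial>(lborel :: (real^'n) measure)) = ennreal (sqrt (2 * pi) ^ CARD('n))"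
proof -
  have one: "(\<integral>\<^sup>+y. ennreal (exp (- y\<^sup>2 / 2)) \<partial>lborel) = ennreal (sqrt (2 * pi))"
  proof -
    have "(\<integral>\<^sup>+y. ennreal (exp (- y\<^sup>2 / 2)) \<partial>lborel) = (\<integral>\<^sup>+y. ennreal (sqrt (2 * pi)) * ennreal (normal_density 0 1 y) \<partial>lborel)"
      by (intro nn_integral_cong) (simp add: normal_density_def ennreal_mult[symmetric])
    also have "\<dots> = ennreal (sqrt (2 * pi)) * (\<integral>\<^sup>+y. ennreal (normal_density 0 1 y) \<partial>lborel)"
      by (rule nn_integral_cmult) simp
    also have "(\<integral>\<^sup>+y. ennreal (normal_density 0 1 y) \<partial>lborel) = 1"
      using prob_space.emeasure_space_1[OF prob_space_normal_density[of 1 0]] by (simp add: emeasure_density)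
    finally show ?thesis by simp
  qed
  have "ennreal (exp (- (norm x)\<^sup>2 / 2)) = (\<Prod>i\<in>UNIV. ennreal (exp (- (x $ i)\<^sup>2 / 2)))" for x :: "real^'n"
    by (simp add: prod_ennreal exp_sum[symmetric] norm_vec_squared sum_negf sum_divide_distrib)
  then show ?thesis
    using nn_integral_lborel_vec_prod[of "\<lambda>(i::'n) y. ennreal (exp (- y\<^sup>2 / 2))"] one
    by (simp add: ennreal_power)
qed

text \<open>The singularity of the density at 0 is harmless: in polar coordinates it cancels the
  factor \<open>r ^ (d - 1)\<close>, and the length of an interval remains.\<close>

lemma hyp_intensity_cball_finite:
  assumes \<gamma>: "\<gamma> > 0"
  shows "emeasure (hyp_intensity \<gamma>) (cball (0 :: real^'n) R) < \<infinity>"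
proof -
  let ?d = "CARD('n)"
  have "emeasure (hyp_intensity \<gamma>) (cball (0 :: real^'n) R) = (\<integral>\<^sup>+x. indicator (cball (0 :: real^'n) R) x \<partial>hyp_intensity \<gamma>)"
    by (simp add: sets_hyp_intensity)
  also have "\<dots> = ennreal \<gamma> * (\<integral>\<^sup>+x. (\<lambda>r. ennreal (r powr (1 - real ?d)) * indicator {..R} r) (norm x) * (\<lambda>_. 1) x \<partial>(lborel :: (real^'n) measure))"
    by (subst nn_integral_hyp_intensity_lborel[OF borel_measurable_indicator \<gamma>]) (auto intro!: arg_cong2[where f = "(*)"] nn_integral_cong simp: indicator_def)
  finally have *: "emeasure (hyp_intensity \<gamma>) (cball (0 :: real^'n) R)
    = ennreal \<gamma> * (\<integral>\<^sup>+x. (\<lambda>r. ennreal (r powr (1 - real ?d)) * indicator {..R} r) (norm x) * (\<lambda>_. 1) x \<partial>(lborel :: (real^'n) measure))" .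
  have "polar_const ?d 0 * (\<integral>\<^sup>+x. (\<lambda>r. ennreal (r powr (1 - real ?d)) * indicator {..R} r) (norm x) * (\<lambda>_. 1) x \<partial>(lborel :: (real^'n) measure))
    = (\<integral>\<^sup>+r. ennreal (r powr (1 - real ?d)) * indicator {..R} r * ennreal (r ^ (?d - 1)) * indicator {0<..} r \<partial>lborel) * ennreal (sqrt (2 * pi) ^ ?d)"
    using nn_integral_radial[of "\<lambda>_ :: real^'n. 1" "\<lambda>r. ennreal (r powr (1 - real ?d)) * indicator {..R} r"]
      nn_integral_gauss_vec[where 'n = 'n] by simp
  also have "(\<integral>\<^sup>+r. ennreal (r powr (1 - real ?d)) * indicator {..R} r * ennreal (r ^ (?d - 1)) * indicator {0<..} r \<partial>lborel)
    = (\<integral>\<^sup>+r. indicator {0<..R} r \<partial>lborel)"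
  proof (rule nn_integral_cong)
    fix r :: real
    have "r powr (1 - real ?d) * r ^ (?d - 1) = 1" if "r > 0"
      using that by (simp add: powr_realpow[symmetric] powr_add[symmetric] of_nat_diff Suc_leI)
    then show "ennreal (r powr (1 - real ?d)) * indicator {..R} r * ennreal (r ^ (?d - 1)) * indicator {0<..} r = indicator {0<..R} r"
      by (auto simp: indicator_def ennreal_mult[symmetric])
  qed
  also have "\<dots> = ennreal (max 0 R)" by (cases "R \<ge> 0") (auto simp: max_def)
  finally have "polar_const ?d 0 * (\<integral>\<^sup>+x. (\<lambda>r. ennreal (r powr (1 - real ?d)) * indicator {..R} r) (norm x) * (\<lambda>_. 1) x \<partial>(lborel :: (real^'n) measure)) < \<infinity>"
    by (simp add: ennreal_mult_eq_top_iff less_top[symmetric])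
  then have "(\<integral>\<^sup>+x. (\<lambda>r. ennreal (r powr (1 - real ?d)) * indicator {..R} r) (norm x) * (\<lambda>_. 1) x \<partial>(lborel :: (real^'n) measure)) < \<infinity>"
    using polar_const(1)[of ?d 0] by (auto simp: less_top[symmetric] ennreal_mult_eq_top_iff Suc_leI)
  then show ?thesis unfolding * by (simp add: ennreal_mult_less_top)
qed

lemma hyp_intensity_bounded:
  fixes B :: "(real^'n) set"
  assumes \<gamma>: "\<gamma> > 0" and B: "bounded B"
  shows "emeasure (hyp_intensity \<gamma>) B < \<infinity>"
proof -
  obtain R where "B \<subseteq> cball 0 R"
    using bounded_subset_ballD[OF B, of 0] ball_subset_cball by blast
  then have "emeasure (hyp_intensity \<gamma>) B \<le> emeasure (hyp_intensity \<gamma>) (cball (0 :: real^'n) R)"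
    by (rule emeasure_mono) (simp add: sets_hyp_intensity)
  then show ?thesis using hyp_intensity_cball_finite[OF \<gamma>] order_le_less_trans by blast
qed

lemma poisson_points_hyp_intensity:
  fixes \<Phi> :: "'w \<Rightarrow> (real^'n) set"
  assumes \<gamma>: "\<gamma> > 0" and P: "poisson_process M \<Phi> (hyp_intensity \<gamma>)"
  shows "poisson_points M \<Phi> (hyp_intensity \<gamma>)"
proof -
  interpret prob_space M using P by (simp add: poisson_process_def)
  show ?thesis
  proof
    show "emeasure (hyp_intensity \<gamma>) {x} = 0" for x :: "real^'n"
      using null_sets_hyp_intensity[of "{x}" \<gamma>] by (auto simp: null_sets_def)
  qed (use P hyp_intensity_bounded[OF \<gamma>] in \<open>auto simp: sets_hyp_intensity\<close>)
qed

text \<open>A rotation followed by a dilation by \<open>norm v\<close> carries the void ball of a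
  unit vector to that of v; the intensity ignores the rotation and is multiplied by
  \<open>norm v\<close> under the dilation.\<close>

lemma hyp_intensity_void_ball:
  assumes \<gamma>: "\<gamma> > 0"
  obtains \<kappa> where "\<And>v :: real^'n::{finite,wellorder}. measure (hyp_intensity \<gamma>) (void_ball v) = \<kappa> * norm v"
proof -
  fix k :: 'n
  define e :: "(real, 'n) vec" where "e = axis k 1"
  have ne: "norm e = 1" by (simp add: e_def norm_axis_1)
  have *: "emeasure (hyp_intensity \<gamma>) (void_ball v) = ennreal (norm v) * emeasure (hyp_intensity \<gamma>) (void_ball e)"
    for v :: "(real, 'n) vec"
  proof (cases "v = 0")
    case True
    have "void_ball (0 :: (real, 'n) vec) = {}" by (auto simp: void_ball_def not_less)
    then show ?thesis using True by simp
  next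
    case False
    then have nv: "norm v > 0" by simp
    obtain T where T: "orthogonal_transformation T" "T (norm v *\<^sub>R e) = v"
      using orthogonal_transformation_exists[of "norm v *\<^sub>R e" v] ne by auto
    have v: "v = norm v *\<^sub>R T e"
      using T(2) linear_scale[OF orthogonal_transformation_linear[OF T(1)]] by simp
    have lin: "linear T" using T(1) by (rule orthogonal_transformation_linear)
    have [measurable]: "T \<in> borel_measurable borel"
      by (intro borel_measurable_continuous_onI linear_continuous_on) (simp add: lin linear_conv_bounded_linear[symmetric])
    have Tv: "void_ball v \<in> sets borel" for v :: "(real, 'n) vec" by (rule void_ball_borel)
    have ind [measurable]: "(indicator (void_ball v) :: _ \<Rightarrow> ennreal) \<in> borel_measurable borel" for v :: "(real, 'n) vec"
      using Tv by (rule borel_measurable_indicator)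
    have eq: "indicator (void_ball v) (norm v *\<^sub>R T x) = (indicator (void_ball e) x :: ennreal)" for x
    proof -
      have "(norm v *\<^sub>R T x) \<bullet> v = (norm v)\<^sup>2 * (T x \<bullet> T e)"
        by (subst v) (simp add: power2_eq_square)
      also have "T x \<bullet> T e = x \<bullet> e" using T(1) by (simp add: orthogonal_transformation_def)
      moreover have "(norm v *\<^sub>R T x) \<bullet> (norm v *\<^sub>R T x) = (norm v)\<^sup>2 * (x \<bullet> x)"
        using T(1) by (simp add: orthogonal_transformation_def power2_eq_square)
      ultimately have "norm v *\<^sub>R T x \<in> void_ball v \<longleftrightarrow> (norm v)\<^sup>2 * (x \<bullet> x) < (norm v)\<^sup>2 * (x \<bullet> e)"
        by (simp add: void_ball_def)
      then show ?thesis using nv by (simp add: void_ball_def indicator_def)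
    qed
    have "emeasure (hyp_intensity \<gamma>) (void_ball v) = (\<integral>\<^sup>+x. indicator (void_ball v) x \<partial>hyp_intensity \<gamma>)"
      using Tv by (simp add: sets_hyp_intensity)
    also have "\<dots> = ennreal (norm v) * (\<integral>\<^sup>+x. indicator (void_ball v) (norm v *\<^sub>R x) \<partial>hyp_intensity \<gamma>)"
      by (rule hyp_intensity_scaleR[OF ind \<gamma> nv])
    also have "(\<integral>\<^sup>+x. indicator (void_ball v) (norm v *\<^sub>R x) \<partial>hyp_intensity \<gamma>) = (\<integral>\<^sup>+x. indicator (void_ball v) (norm v *\<^sub>R T x) \<partial>hyp_intensity \<gamma> :: ennreal)"
      by (rule hyp_intensity_rotate[OF _ \<gamma> T(1)]) measurable
    also have "\<dots> = emeasure (hyp_intensity \<gamma>) (void_ball e)"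
      using Tv by (simp add: eq sets_hyp_intensity)
    finally show ?thesis .
  qed
  have "measure (hyp_intensity \<gamma>) (void_ball v) = measure (hyp_intensity \<gamma>) (void_ball e) * norm v" for v :: "(real, 'n) vec"
    unfolding measure_def *[of v] by (simp add: enn2real_mult)
  then show ?thesis by (rule that)
qed

text \<open>By translation invariance it suffices that \<open>det (G + t I)\<close> is a nonzero polynomial in t.\<close>

lemma AE_det_nonzero: "AE G in (lborel :: (real^'n^'n) measure). det G \<noteq> 0"
proof -
  let ?N = "\<lambda>G :: real^'n^'n. indicator {G. det G = 0} G :: ennreal"
  have [measurable]: "{G :: real^'n^'n. det G = 0} \<in> sets borel" by measurable
  have finite_roots: "finite {t. det (G + t *\<^sub>R mat 1) = 0}" for G :: "real^'n^'n"
  proof -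
    define P where "P = (\<Sum>p | p permutes (UNIV :: 'n set). smult (of_int (sign p)) (\<Prod>i\<in>UNIV. [: G $ i $ p i, (if i = p i then 1 else 0) :]))"
    have poly: "poly P t = det (G + t *\<^sub>R mat 1)" for t
      unfolding P_def det_def by (auto simp: poly_sum poly_prod mat_def intro!: sum.cong prod.cong)
    \<comment> \<open>For t beyond the operator bound of G the matrix is injective, hence the
      polynomial P is not zero.\<close>
    obtain K where K: "\<And>x. norm (G *v x) \<le> norm x * K"
      using bounded_linear.bounded[OF matrix_vector_mul_bounded_linear[of G]] by blast
    have "x = 0" if "(G + (\<bar>K\<bar> + 1) *\<^sub>R mat 1) *v x = 0" for x
    proof (rule ccontr)
      assume "x \<noteq> 0"
      have "G *v x = - ((\<bar>K\<bar> + 1) *\<^sub>R x)"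
        using that by (simp add: matrix_vector_mult_add_rdistrib scaleR_matrix_vector_assoc[symmetric] eq_neg_iff_add_eq_0)
      then have "norm (G *v x) = (\<bar>K\<bar> + 1) * norm x" by simp
      then have "(\<bar>K\<bar> + 1) * norm x \<le> K * norm x" using K[of x] by (simp add: mult.commute)
      then have "\<bar>K\<bar> + 1 \<le> K" using \<open>x \<noteq> 0\<close> by simp
      then show False by linarith
    qed
    then have "det (G + (\<bar>K\<bar> + 1) *\<^sub>R mat 1) \<noteq> 0"
      by (metis invertible_det_nz invertible_left_inverse matrix_left_invertible_ker)
    then have "P \<noteq> 0" using poly[of "\<bar>K\<bar> + 1"] by auto
    then show ?thesis using poly_roots_finite[of P] by (simp add: poly)
  qed
  have shift: "(\<integral>\<^sup>+G. ?N G \<partial>lborel) = (\<integral>\<^sup>+G. ?N (G + t *\<^sub>R mat 1) \<partial>lborel)" for t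
  proof -
    have "(\<integral>\<^sup>+G. ?N G \<partial>lborel) = (\<integral>\<^sup>+G. ?N G \<partial>distr lborel borel ((+) (t *\<^sub>R mat 1)))"
      by (simp only: lborel_distr_plus)
    also have "\<dots> = (\<integral>\<^sup>+G. ?N (t *\<^sub>R mat 1 + G) \<partial>lborel)" by (rule nn_integral_distr) measurable
    finally show ?thesis by (simp only: add.commute)
  qed
  \<comment> \<open>Shift invariance is averaged over t in \<open>{0..1}\<close>; after Fubini the
    inner integral runs over a finite set of roots.\<close>
  have "(\<integral>\<^sup>+G. ?N G \<partial>lborel) = (\<integral>\<^sup>+t. (\<integral>\<^sup>+G. ?N G \<partial>lborel) * indicator {0..1::real} t \<partial>lborel)"
    by (subst nn_integral_cmult_indicator) auto
  also have "\<dots> = (\<integral>\<^sup>+t. (\<integral>\<^sup>+G. ?N (G + t *\<^sub>R mat 1) * indicator {0..1::real} t \<partial>lborel) \<partial>lborel)"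
    by (rule nn_integral_cong, subst shift) (rule nn_integral_multc[symmetric], measurable)
  also have "\<dots> = (\<integral>\<^sup>+G. (\<integral>\<^sup>+t. ?N (G + t *\<^sub>R mat 1) * indicator {0..1::real} t \<partial>lborel) \<partial>lborel)"
    by (rule lborel_pair.Fubini') measurable
  also have "\<dots> = (\<integral>\<^sup>+G. 0 \<partial>(lborel :: (real^'n^'n) measure))"
  proof (rule nn_integral_cong)
    fix G :: "real^'n^'n"
    have "AE t in lborel. t \<notin> {t. det (G + t *\<^sub>R mat 1) = 0}"
      using finite_imp_null_set_lborel[OF finite_roots[of G]] by (rule AE_not_in)
    then have "AE t in lborel. ?N (G + t *\<^sub>R mat 1) * indicator {0..1::real} t = 0"
      by eventually_elim (simp add: indicator_def)
    then show "(\<integral>\<^sup>+t. ?N (G + t *\<^sub>R mat 1) * indicator {0..1::real} t \<partial>lborel) = 0"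
      by (subst nn_integral_0_iff_AE) auto
  qed
  finally have "(\<integral>\<^sup>+G. ?N G \<partial>lborel) = 0" by simp
  then have "AE G in (lborel :: (real^'n^'n) measure). ?N G = 0"
    by (subst (asm) nn_integral_0_iff_AE) auto
  then show ?thesis by eventually_elim (simp add: indicator_def split: if_splits)
qed

lemma measurable_fst_snd_borel [measurable]:
  "(fst :: 'b::euclidean_space \<times> 'c::euclidean_space \<Rightarrow> 'b) \<in> borel_measurable borel"
  "(snd :: 'b::euclidean_space \<times> 'c::euclidean_space \<Rightarrow> 'c) \<in> borel_measurable borel"
  by (intro borel_measurable_continuous_onI continuous_intros)+

text \<open>The normals become the columns of a matrix and the offsets a vector; only coordinates
  are relabelled.\<close>

lemma nn_integral_lborel_matrix_vector:
  fixes H :: "(real^'n^'n) \<times> (real^'n) \<Rightarrow> ennreal"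
  assumes [measurable]: "H \<in> borel_measurable borel"
  shows "(\<integral>\<^sup>+Y. H (\<chi> r i. fst (Y $ i) $ r, \<chi> i. snd (Y $ i)) \<partial>(lborel :: (((real^'n) \<times> real)^'n) measure))
    = (\<integral>\<^sup>+a. \<integral>\<^sup>+G. H (G, a) \<partial>lborel \<partial>lborel)"
proof -
  define T where "T Y = (\<chi> r i. fst (Y $ i) $ r, \<chi> i. snd (Y $ i))" for Y :: "((real^'n) \<times> real)^'n"
  have lin: "linear T"
    by (rule linearI) (auto simp: T_def vec_eq_iff)
  have T1: "T (axis i (axis r 1, 0)) = (axis r (axis i 1), 0)" for i r
    by (auto simp: T_def axis_def vec_eq_iff zero_prod_def)
  have T2: "T (axis i (0, 1)) = (0, axis i 1)" for i
    by (auto simp: T_def axis_def vec_eq_iff zero_prod_def)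
  have B1: "(Basis :: (((real^'n) \<times> real)^'n) set) = (\<lambda>(i, r). axis i (axis r 1, 0)) ` UNIV \<union> (\<lambda>i. axis i (0, 1)) ` UNIV"
    by (auto simp: Basis_vec_def Basis_prod_def image_iff)
  have B2: "(Basis :: ((real^'n^'n) \<times> (real^'n)) set) = (\<lambda>(i, r). (axis r (axis i 1), 0)) ` UNIV \<union> (\<lambda>i. (0, axis i 1)) ` UNIV"
    by (auto simp: Basis_vec_def Basis_prod_def image_iff)
  have "bij_betw T Basis Basis"
    unfolding bij_betw_def
  proof
    show "T ` Basis = Basis"
      unfolding B1 B2 image_Un image_image by (simp add: case_prod_unfold T1 T2)
    show "inj_on T Basis"
      unfolding B1 by (auto simp: inj_on_def T1 T2 axis_eq_axis zero_prod_def)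
  qed
  then have "distr lborel borel T = lborel" using lin by (rule lborel_distr_basis_bij[rotated])
  moreover have "T \<in> borel_measurable borel"
    by (intro borel_measurable_continuous_onI linear_continuous_on) (simp add: lin linear_conv_bounded_linear[symmetric])
  ultimately have "(\<integral>\<^sup>+Y. H (T Y) \<partial>lborel) = (\<integral>\<^sup>+p. H p \<partial>lborel)"
    by (subst nn_integral_distr[symmetric, of T _ borel]) simp_all
  also have "\<dots> = (\<integral>\<^sup>+p. H p \<partial>(lborel \<Otimes>\<^sub>M lborel))" by (simp add: lborel_prod)
  also have "\<dots> = (\<integral>\<^sup>+a. \<integral>\<^sup>+G. H (G, a) \<partial>lborel \<partial>lborel)"
    by (rule lborel_pair.nn_integral_snd[symmetric]) (simp add: lborel_prod)
  finally show ?thesis by (simp add: T_def)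
qed

lemma nn_integral_PiM_hyp_intensity_vec:
  fixes F :: "('n::finite \<Rightarrow> 'b::euclidean_space) \<Rightarrow> ennreal"
  assumes \<gamma>: "\<gamma> > 0" and sf: "sigma_finite_measure (hyp_intensity \<gamma> :: 'b measure)"
    and F [measurable]: "F \<in> borel_measurable (PiM UNIV (\<lambda>_. hyp_intensity \<gamma>))"
  shows "(\<integral>\<^sup>+X. F X \<partial>PiM UNIV (\<lambda>_. hyp_intensity \<gamma>)) = (ennreal \<gamma> / (2 * polar_const DIM('b) 1)) ^ CARD('n) *
    (\<integral>\<^sup>+Y. ennreal (exp (- (\<Sum>i\<in>UNIV. (norm (fst (Y $ i)))\<^sup>2) / 2)) * F (\<lambda>i. hyp_code (Y $ i)) \<partial>lborel)"
proof -
  let ?L = "hyp_intensity \<gamma> :: 'b measure" and ?c = "ennreal \<gamma> / (2 * polar_const DIM('b) 1)"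
  interpret product_sigma_finite "\<lambda>_ :: 'n. ?L" by unfold_locales (rule sf[unfolded sigma_finite_measure_def])+
  have L: "(\<integral>\<^sup>+x. f x \<partial>?L) = ?c * (\<integral>\<^sup>+y. ennreal (exp (- (norm (fst y))\<^sup>2 / 2)) * f (hyp_code y) \<partial>lborel)"
    if "f \<in> borel_measurable borel" for f
    using polar_const[of "DIM('b)" 1]
    by (intro ennreal_eq_divide_mult nn_integral_hyp_intensity that \<gamma>)
       (auto simp: Suc_leI ennreal_mult_eq_top_iff)
  define W :: "('b \<times> real)^'n \<Rightarrow> ennreal" where "W Y = (\<Prod>i\<in>UNIV. ?c * ennreal (exp (- (norm (fst (Y $ i)))\<^sup>2 / 2)))" for Y
  have [measurable]: "(\<lambda>Y :: ('b \<times> real)^'n. fst (Y $ i)) \<in> borel_measurable borel" for i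
    by (rule measurable_compose[OF measurable_vec_nth' measurable_fst_snd_borel(1)]) simp
  have W [measurable, simp]: "W \<in> borel_measurable borel" unfolding W_def by measurable
  have code [measurable]: "(\<lambda>Y :: ('b \<times> real)^'n. \<lambda>i. hyp_code (Y $ i)) \<in> borel \<rightarrow>\<^sub>M PiM UNIV (\<lambda>_. ?L)"
    by (rule measurable_PiM_single') (auto simp: space_hyp_intensity PiE_def extensional_def measurable_cong_sets[OF refl sets_hyp_intensity])
  \<comment> \<open>The image of the Gaussian density under coding each component; it agrees with
    the product measure because the two coincide on boxes.\<close>
  define P where "P = distr (density lborel W) (PiM UNIV (\<lambda>_. ?L)) (\<lambda>Y i. hyp_code (Y $ i))"
  have "P = PiM UNIV (\<lambda>_. ?L)"
  proof (rule PiM_eqI)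
    fix A :: "'n \<Rightarrow> 'b set" assume A0: "\<And>i. i \<in> UNIV \<Longrightarrow> A i \<in> sets ?L"
    then have A: "A i \<in> sets ?L" for i by simp
    then have A' [measurable]: "A i \<in> sets borel" for i by (simp add: sets_hyp_intensity)
    have PA: "Pi\<^sub>E UNIV A \<in> sets (PiM UNIV (\<lambda>_. ?L))" using A by (intro sets_PiM_I_finite) auto
    have ind: "(\<lambda>Y. indicator (Pi\<^sub>E UNIV A) (\<lambda>i. hyp_code (Y $ i)) :: ennreal) \<in> borel_measurable lborel"
      using measurable_compose[OF code borel_measurable_indicator[OF PA]] by simp
    have "emeasure P (Pi\<^sub>E UNIV A) = (\<integral>\<^sup>+Y. W Y * indicator (Pi\<^sub>E UNIV A) (\<lambda>i. hyp_code (Y $ i)) \<partial>lborel)"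
      using PA by (simp add: P_def nn_integral_indicator[symmetric] nn_integral_distr del: nn_integral_indicator)
         (subst nn_integral_density[OF _ ind], simp_all)
    also have "\<dots> = (\<integral>\<^sup>+Y. (\<Prod>i\<in>UNIV. ?c * (ennreal (exp (- (norm (fst (Y $ i)))\<^sup>2 / 2)) * indicator (A i) (hyp_code (Y $ i)))) \<partial>lborel)"
    proof (rule nn_integral_cong)
      fix Y :: "('b \<times> real)^'n"
      have "indicator (Pi\<^sub>E UNIV A) (\<lambda>i. hyp_code (Y $ i)) = (\<Prod>i\<in>UNIV. indicator (A i) (hyp_code (Y $ i)) :: ennreal)"
        by (auto simp: indicator_def PiE_iff)
      then show "W Y * indicator (Pi\<^sub>E UNIV A) (\<lambda>i. hyp_code (Y $ i)) = (\<Prod>i\<in>UNIV. ?c * (ennreal (exp (- (norm (fst (Y $ i)))\<^sup>2 / 2)) * indicator (A i) (hyp_code (Y $ i))))"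
        by (simp add: W_def prod.distrib mult.assoc)
    qed
    also have "\<dots> = (\<Prod>i\<in>UNIV. \<integral>\<^sup>+y. ?c * (ennreal (exp (- (norm (fst y))\<^sup>2 / 2)) * indicator (A i) (hyp_code y)) \<partial>lborel)"
      by (rule nn_integral_lborel_vec_prod) measurable
    also have "\<dots> = (\<Prod>i\<in>UNIV. emeasure ?L (A i))"
    proof (rule prod.cong)
      fix i
      have "emeasure ?L (A i) = (\<integral>\<^sup>+x. indicator (A i) x \<partial>?L)" using A by simp
      also have "\<dots> = (\<integral>\<^sup>+y. ?c * (ennreal (exp (- (norm (fst y))\<^sup>2 / 2)) * indicator (A i) (hyp_code y)) \<partial>lborel)"
        by (subst L) (auto simp: nn_integral_cmult)
      finally show "(\<integral>\<^sup>+y. ?c * (ennreal (exp (- (norm (fst y))\<^sup>2 / 2)) * indicator (A i) (hyp_code y)) \<partial>lborel) = emeasure ?L (A i)" ..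
    qed simp
    finally show "emeasure P (Pi\<^sub>E UNIV A) = (\<Prod>i\<in>UNIV. emeasure ?L (A i))" .
  qed (simp_all add: P_def)
  then have "(\<integral>\<^sup>+X. F X \<partial>PiM UNIV (\<lambda>_. ?L)) = (\<integral>\<^sup>+X. F X \<partial>P)" by simp
  also have "\<dots> = (\<integral>\<^sup>+Y. F (\<lambda>i. hyp_code (Y $ i)) \<partial>density lborel W)"
    unfolding P_def using code F by (intro nn_integral_distr) (simp_all cong: measurable_cong_sets)
  also have "\<dots> = (\<integral>\<^sup>+Y. W Y * F (\<lambda>i. hyp_code (Y $ i)) \<partial>lborel)"
    using measurable_compose[OF code F] by (intro nn_integral_density) simp_all
  also have "\<dots> = (\<integral>\<^sup>+Y. ?c ^ CARD('n) * (ennreal (exp (- (\<Sum>i\<in>UNIV. (norm (fst (Y $ i)))\<^sup>2) / 2)) * F (\<lambda>i. hyp_code (Y $ i))) \<partial>lborel)"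
    by (rule nn_integral_cong)
       (simp add: W_def prod.distrib prod_ennreal exp_sum[symmetric] sum_negf sum_divide_distrib mult.assoc)
  also have "\<dots> = ?c ^ CARD('n) * (\<integral>\<^sup>+Y. ennreal (exp (- (\<Sum>i\<in>UNIV. (norm (fst (Y $ i)))\<^sup>2) / 2)) * F (\<lambda>i. hyp_code (Y $ i)) \<partial>lborel)"
    by (rule nn_integral_cmult) measurable
  finally show ?thesis .
qed

lemma nn_integral_PiM_hyp_intensity:
  fixes F :: "('n::finite \<Rightarrow> real^'n) \<Rightarrow> ennreal"
  assumes \<gamma>: "\<gamma> > 0" and sf: "sigma_finite_measure (hyp_intensity \<gamma> :: (real^'n) measure)"
    and F [measurable]: "F \<in> borel_measurable (PiM UNIV (\<lambda>_. hyp_intensity \<gamma>))"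
  shows "(\<integral>\<^sup>+X. F X \<partial>PiM UNIV (\<lambda>_. hyp_intensity \<gamma>)) = (ennreal \<gamma> / (2 * polar_const CARD('n) 1)) ^ CARD('n) *
    (\<integral>\<^sup>+a. \<integral>\<^sup>+G. ennreal (exp (- (norm G)\<^sup>2 / 2)) * F (\<lambda>i. hyp_code (column i G, a $ i)) \<partial>lborel \<partial>lborel)"
proof -
  have code [measurable]: "(\<lambda>p :: (real^'n^'n) \<times> (real^'n). \<lambda>i. hyp_code (column i (fst p), snd p $ i)) \<in> borel \<rightarrow>\<^sub>M PiM UNIV (\<lambda>_. hyp_intensity \<gamma>)"
  proof (rule measurable_PiM_single')
    fix i :: 'n
    have "(\<lambda>p :: (real^'n^'n) \<times> (real^'n). (column i (fst p), snd p $ i)) \<in> borel_measurable borel"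
      unfolding column_def borel_prod[symmetric] by measurable
    then show "(\<lambda>p :: (real^'n^'n) \<times> (real^'n). hyp_code (column i (fst p), snd p $ i)) \<in> borel \<rightarrow>\<^sub>M hyp_intensity \<gamma>"
      unfolding measurable_cong_sets[OF refl sets_hyp_intensity] by measurable
  qed (auto simp: space_hyp_intensity PiE_def extensional_def)
  let ?H = "\<lambda>p :: (real^'n^'n) \<times> (real^'n). ennreal (exp (- (norm (fst p))\<^sup>2 / 2)) * F (\<lambda>i. hyp_code (column i (fst p), snd p $ i))"
  have "(\<lambda>p :: (real^'n^'n) \<times> (real^'n). ennreal (exp (- (norm (fst p))\<^sup>2 / 2))) \<in> borel_measurable borel"
    by (intro measurable_compose[OF measurable_fst_snd_borel(1)]) measurable
  then have [measurable]: "?H \<in> borel_measurable borel"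
    using measurable_compose[OF code F] by measurable
  have norm: "(norm (\<chi> r i. fst (Y $ i) $ r :: real^'n^'n))\<^sup>2 = (\<Sum>i\<in>UNIV. (norm (fst (Y $ i)))\<^sup>2)" for Y :: "((real^'n) \<times> real)^'n"
    by (simp add: norm_vec_squared) (rule sum.swap)
  have col: "column i (\<chi> r i. fst (Y $ i) $ r) = fst (Y $ i)" for Y :: "((real^'n) \<times> real)^'n" and i
    by (simp add: column_def vec_eq_iff)
  show ?thesis
    using nn_integral_lborel_matrix_vector[of ?H] nn_integral_PiM_hyp_intensity_vec[OF \<gamma> sf F]
    by (simp add: norm col)
qed

section \<open>Generic position of the process\<close>

lemma null_sets_lborel_if_negligible: "negligible S \<Longrightarrow> S \<in> sets borel \<Longrightarrow> S \<in> null_sets lborel"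
  by (metis negligible_iff_null_sets null_sets_completion_iff sets_lborel)

lemma measurable_tuple_matrix [measurable (raw)]:
  fixes f :: "'a \<Rightarrow> 'n \<Rightarrow> real^'n"
  assumes [measurable]: "\<And>i. (\<lambda>x. f x i) \<in> borel_measurable N"
  shows "(\<lambda>x. tuple_matrix (f x)) \<in> borel_measurable N"
  unfolding tuple_matrix_def by measurable

lemma measurable_tuple_vertex [measurable (raw)]:
  fixes f :: "'a \<Rightarrow> 'n \<Rightarrow> real^'n"
  assumes [measurable]: "\<And>i. (\<lambda>x. f x i) \<in> borel_measurable N"
  shows "(\<lambda>x. tuple_vertex (f x)) \<in> borel_measurable N"
  unfolding tuple_vertex_def by measurable

lemma measurable_tuple_coords [measurable (raw)]:
  fixes f :: "'a \<Rightarrow> 'n \<Rightarrow> real^'n"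
  assumes [measurable]: "\<And>i. (\<lambda>x. f x i) \<in> borel_measurable N" "g \<in> borel_measurable N"
  shows "(\<lambda>x. tuple_coords (f x) (g x)) \<in> borel_measurable N"
  unfolding tuple_coords_def by measurable

text \<open>Column i of G and entry i of a are the normal and the offset of hyperplane i.\<close>

definition code_tuple :: "real^'n^'n \<Rightarrow> real^'n \<Rightarrow> 'n \<Rightarrow> real^'n" where
  "code_tuple G a i = hyp_code (column i G, a $ i)"

lemma det_code_tuple: "det (tuple_matrix (code_tuple G a)) = (\<Prod>i\<in>UNIV. a $ i / (norm (column i G))\<^sup>2) * det G"
proof -
  have "transpose (tuple_matrix (code_tuple G a)) = (\<chi> i. (a $ i / (norm (column i G))\<^sup>2) *s (transpose G $ i))"
    by (simp add: vec_eq_iff transpose_def tuple_matrix_def code_tuple_def hyp_code_def column_def)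
  then have "det (transpose (tuple_matrix (code_tuple G a))) = (\<Prod>i\<in>UNIV. a $ i / (norm (column i G))\<^sup>2) * det (\<chi> i. transpose G $ i)"
    by (simp only: det_rows_mul)
  then show ?thesis by (simp add: det_transpose)
qed

lemma column_nonzero: "det (G :: real^'n^'n) \<noteq> 0 \<Longrightarrow> column i G \<noteq> 0"
  using det_zero_column(1)[of i G] by auto

lemma det_code_tuple_nonzero:
  assumes "\<And>i. a $ i \<noteq> 0"
  shows "det (tuple_matrix (code_tuple G a)) \<noteq> 0 \<longleftrightarrow> det G \<noteq> 0"
  using assms column_nonzero[of G] by (auto simp: det_code_tuple)

text \<open>For nonzero normals and offsets each code describes the hyperplane it was made from, so
  the vertex solves the system of normals and offsets.\<close>

lemma tuple_vertex_code_tuple: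
  assumes a: "\<And>i. a $ i \<noteq> 0" and G: "det G \<noteq> 0"
  shows "tuple_vertex (code_tuple G a) = sol (transpose G) a"
proof -
  let ?v = "sol (transpose G) a"
  have "transpose G *v ?v = a" using G by (intro mult_sol) simp
  then have v: "column i G \<bullet> ?v = a $ i" for i
    by (simp add: vec_eq_iff matrix_vector_mult_def transpose_def column_def inner_vec_def del: transpose_matrix_vector)
  have "?v \<bullet> code_tuple G a i = code_tuple G a i \<bullet> code_tuple G a i" for i
    using column_nonzero[OF G, of i] v[of i]
    by (simp add: code_tuple_def hyp_code_def inner_commute power2_norm_eq_inner divide_simps)
  then show ?thesis using tuple_vertex_iff[of "code_tuple G a" ?v] det_code_tuple_nonzero[OF a] G by simp
qed

text \<open>Code i is column i of G times \<open>a $ i / (norm (column i G))\<^sup>2\<close>.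
  Passing to coordinates with respect to the columns multiplies by this factor, and a further factor
  \<open>a $ i\<close> restores the sign.\<close>

lemma tuple_coords_code_tuple:
  assumes a: "\<And>i. a $ i \<noteq> 0" and G: "det G \<noteq> 0"
  shows "tuple_coords (code_tuple G a) u $ i > 0 \<longleftrightarrow> sol G u $ i * a $ i > 0"
proof -
  let ?l = "tuple_coords (code_tuple G a) u" and ?c = "\<lambda>i. a $ i / (norm (column i G))\<^sup>2"
  have "(\<Sum>i\<in>UNIV. ?l $ i *\<^sub>R code_tuple G a i) = u"
    using det_code_tuple_nonzero[OF a] G by (intro sum_tuple_coords) simp
  then have "G *v (\<chi> i. ?l $ i * ?c i) = u"
    by (simp add: matrix_mult_sum code_tuple_def hyp_code_def scalar_mult_eq_scaleR)
  then have "(\<chi> i. ?l $ i * ?c i) = sol G u" using sol_iff[OF G] by blast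
  then have "sol G u $ i = ?l $ i * ?c i" by (simp only: vec_eq_iff vec_lambda_beta)
  then have "sol G u $ i * a $ i = ?l $ i * ((a $ i)\<^sup>2 / (norm (column i G))\<^sup>2)"
    by (simp add: power2_eq_square)
  moreover have "(a $ i)\<^sup>2 / (norm (column i G))\<^sup>2 > 0" using a column_nonzero[OF G] by simp
  ultimately show ?thesis by (simp only: zero_less_mult_iff) auto
qed

lemma AE_vec_nonzero: "AE a in (lborel :: (real^'n) measure). \<forall>i. a $ i \<noteq> 0"
proof -
  have "AE a in (lborel :: (real^'n) measure). a $ i \<noteq> 0" for i
  proof -
    have "{a :: real^'n. axis i 1 \<bullet> a = 0} \<in> null_sets lborel"
      by (intro null_sets_lborel_if_negligible negligible_hyperplane) auto
    then have "AE a in lborel. a \<notin> {a :: real^'n. axis i 1 \<bullet> a = 0}" by (rule AE_not_in)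
    then show ?thesis by eventually_elim (simp add: inner_axis')
  qed
  then show ?thesis by (simp add: AE_finite_all[of UNIV, simplified])
qed

locale isotropic_process = poisson_points M \<Phi> "hyp_intensity \<gamma>"
  for M :: "'w measure" and \<Phi> :: "'w \<Rightarrow> (real, 'n::{finite,wellorder}) vec set" and \<gamma> :: real +
  assumes \<gamma>: "\<gamma> > 0"
begin

abbreviation "L \<equiv> hyp_intensity \<gamma> :: (real, 'n) vec measure"

abbreviation "TupM \<equiv> PiM (UNIV :: 'n set) (\<lambda>_. L)"

lemma measurable_component [measurable (raw)]: "i \<in> I \<Longrightarrow> (\<lambda>X. X i) \<in> borel_measurable (PiM I (\<lambda>_. L))"
  using measurable_component_singleton[of i I "\<lambda>_. L"] by (simp add: measurable_cong_sets[OF refl sets_hyp_intensity])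

lemma nn_integral_tuples:
  assumes "F \<in> borel_measurable TupM"
  shows "(\<integral>\<^sup>+X. F X \<partial>TupM) = (ennreal \<gamma> / (2 * polar_const CARD('n) 1)) ^ CARD('n) *
    (\<integral>\<^sup>+a. \<integral>\<^sup>+G. ennreal (exp (- (norm G)\<^sup>2 / 2)) * F (code_tuple G a) \<partial>lborel \<partial>lborel)"
  using nn_integral_PiM_hyp_intensity[OF \<gamma> L.sigma_finite_measure_axioms assms]
  by (simp add: code_tuple_def[abs_def])

lemma singular_tuples_null: "{X \<in> space TupM. det (tuple_matrix X) = 0} \<in> null_sets TupM"
proof -
  let ?F = "\<lambda>X. indicator {X \<in> space TupM. det (tuple_matrix X) = 0} X :: ennreal"
  have sets: "{X \<in> space TupM. det (tuple_matrix X) = 0} \<in> sets TupM" by measurable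
  have "AE a in (lborel :: (real, 'n) vec measure). (\<integral>\<^sup>+G. ennreal (exp (- (norm G)\<^sup>2 / 2)) * ?F (code_tuple G a) \<partial>lborel) = 0"
    using AE_vec_nonzero
  proof eventually_elim
    case (elim a)
    have "(\<integral>\<^sup>+G. ennreal (exp (- (norm G)\<^sup>2 / 2)) * ?F (code_tuple G a) \<partial>lborel) = (\<integral>\<^sup>+G. 0 \<partial>(lborel :: ((real, 'n) vec, 'n) vec measure))"
      by (rule nn_integral_cong_AE, rule AE_mp[OF AE_det_nonzero])
         (use elim det_code_tuple_nonzero[of a] in \<open>simp add: indicator_def\<close>)
    then show ?case by simp
  qed
  then have "(\<integral>\<^sup>+a. \<integral>\<^sup>+G. ennreal (exp (- (norm G)\<^sup>2 / 2)) * ?F (code_tuple G a) \<partial>lborel \<partial>lborel) = (\<integral>\<^sup>+a. 0 \<partial>(lborel :: (real, 'n) vec measure))"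
    by (rule nn_integral_cong_AE)
  then have "(\<integral>\<^sup>+X. ?F X \<partial>TupM) = 0"
    using sets by (subst nn_integral_tuples) auto
  then show ?thesis using sets by (simp add: null_sets_def)
qed

text \<open>The index \<open>None\<close> stands for an additional point. Once the other d points
  are fixed, it would have to lie on the sphere with diameter from 0 to their vertex, which is a
  null set.\<close>

lemma degenerate_tuples_null:
  "{Y \<in> space (PiM (UNIV :: 'n option set) (\<lambda>_. L)). tuple_vertex (\<lambda>i. Y (Some i)) \<bullet> Y None = Y None \<bullet> Y None}
    \<in> null_sets (PiM UNIV (\<lambda>_. L))" (is "?A \<in> _")
proof -
  have U: "(UNIV :: 'n option set) = insert None (range Some)" by (rule UNIV_option_conv)
  have sets: "?A \<in> sets (PiM UNIV (\<lambda>_. L))" by measurable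
  have sphere: "{y. v \<bullet> y = y \<bullet> y} \<in> null_sets L" for v :: "(real, 'n) vec"
  proof -
    have "(dist (v /\<^sub>R 2) y)\<^sup>2 = (norm v / 2)\<^sup>2 \<longleftrightarrow> v \<bullet> y = y \<bullet> y" for y
      by (simp add: dist_norm power2_norm_eq_inner power_divide inner_diff_left inner_diff_right inner_commute field_simps) auto
    then have "dist (v /\<^sub>R 2) y = norm v / 2 \<longleftrightarrow> v \<bullet> y = y \<bullet> y" for y
      by (subst power2_eq_iff_nonneg[symmetric]) simp_all
    then have "{y. v \<bullet> y = y \<bullet> y} = sphere (v /\<^sub>R 2) (norm v / 2)"
      unfolding sphere_def by blast
    then show ?thesis
      by (intro null_sets_hyp_intensity null_sets_lborel_if_negligible) (auto simp: negligible_sphere)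
  qed
  have "emeasure (PiM UNIV (\<lambda>_. L)) ?A = (\<integral>\<^sup>+Y. indicator ?A Y \<partial>PiM UNIV (\<lambda>_. L))" using sets by simp
  also have "\<dots> = (\<integral>\<^sup>+X. \<integral>\<^sup>+y. indicator ?A (X(None := y)) \<partial>L \<partial>PiM (range Some) (\<lambda>_. L))"
    using sets unfolding U by (intro PL.product_nn_integral_insert) auto
  also have "\<dots> = (\<integral>\<^sup>+X. 0 \<partial>PiM (range (Some :: 'n \<Rightarrow> 'n option)) (\<lambda>_. L))"
  proof (rule nn_integral_cong)
    fix X :: "'n option \<Rightarrow> (real, 'n) vec"
    have "AE y in L. y \<notin> {y. tuple_vertex (\<lambda>i. X (Some i)) \<bullet> y = y \<bullet> y}" using sphere by (rule AE_not_in)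
    then have "AE y in L. indicator ?A (X(None := y)) = (0 :: ennreal)"
      by eventually_elim (simp add: indicator_def)
    then show "(\<integral>\<^sup>+y. indicator ?A (X(None := y)) \<partial>L) = 0" by (simp cong: nn_integral_cong_AE)
  qed
  finally show ?thesis using sets by (simp add: null_sets_def)
qed

text \<open>For a fixed regular tuple the bad u form the image of the coordinate hyperplanes under
  an invertible matrix. Fubini turns this into a statement about tuples for almost every u.\<close>

lemma non_generic_tuples_null:
  "AE u in lborel. {X \<in> space TupM. det (tuple_matrix X) \<noteq> 0 \<and> (\<exists>i. tuple_coords X u $ i = 0)} \<in> null_sets TupM"
proof -
  interpret T: sigma_finite_measure TupM by (rule PL.sigma_finite) simp
  interpret TL: pair_sigma_finite "lborel :: (real, 'n) vec measure" TupM ..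
  let ?F = "\<lambda>u X. indicator {X. det (tuple_matrix X) \<noteq> 0 \<and> (\<exists>i. tuple_coords X u $ i = 0)} X :: ennreal"
  have [measurable]: "(\<lambda>p. X_of p i) \<in> borel_measurable (lborel \<Otimes>\<^sub>M TupM)" if "X_of = snd" for X_of :: "(real, 'n) vec \<times> ('n \<Rightarrow> (real, 'n) vec) \<Rightarrow> 'n \<Rightarrow> (real, 'n) vec" and i
    unfolding that by measurable
  have meas: "(\<lambda>(u, X). ?F u X) \<in> borel_measurable (lborel \<Otimes>\<^sub>M TupM)"
    unfolding indicator_def case_prod_unfold mem_Collect_eq by measurable
  have "(\<integral>\<^sup>+u. \<integral>\<^sup>+X. ?F u X \<partial>TupM \<partial>lborel) = (\<integral>\<^sup>+X. \<integral>\<^sup>+u. ?F u X \<partial>lborel \<partial>TupM)"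
    by (rule TL.Fubini'[OF meas, symmetric])
  also have "\<dots> = (\<integral>\<^sup>+X. 0 \<partial>TupM)"
  proof (rule nn_integral_cong)
    fix X :: "'n \<Rightarrow> (real, 'n) vec"
    show "(\<integral>\<^sup>+u. ?F u X \<partial>lborel) = 0"
    proof (cases "det (tuple_matrix X) = 0")
      case False
      have [measurable]: "(\<lambda>u. ?F u X) \<in> borel_measurable borel"
        unfolding indicator_def mem_Collect_eq by measurable
      have "sol (tuple_matrix X) (tuple_matrix X *v m) = m" for m
        using sol_iff[OF False, of m "tuple_matrix X *v m"] by simp
      then have "?F (tuple_matrix X *v m) X = indicator {m. \<exists>i. m $ i = 0} m" for m
        using False by (simp add: tuple_coords_def indicator_def)
      then have "AE m in lborel. ?F (tuple_matrix X *v m) X = 0"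
        using AE_vec_nonzero by (simp add: indicator_def)
      then have "(\<integral>\<^sup>+m. ?F (tuple_matrix X *v m) X \<partial>lborel) = 0" by (simp cong: nn_integral_cong_AE)
      then show ?thesis by (subst nn_integral_matrix_vector_mult[OF False]) simp_all
    qed simp
  qed
  finally have 0: "(\<integral>\<^sup>+u. \<integral>\<^sup>+X. ?F u X \<partial>TupM \<partial>lborel) = 0" by simp
  have [measurable]: "(\<lambda>u. \<integral>\<^sup>+X. ?F u X \<partial>TupM) \<in> borel_measurable lborel"
    using T.borel_measurable_nn_integral[OF meas] by simp
  have "AE u in lborel. (\<integral>\<^sup>+X. ?F u X \<partial>TupM) = 0"
    using 0 by (subst (asm) nn_integral_0_iff_AE) auto
  then show ?thesis
  proof eventually_elim
    case (elim u)
    let ?A = "{X \<in> space TupM. det (tuple_matrix X) \<noteq> 0 \<and> (\<exists>i. tuple_coords X u $ i = 0)}"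
    have sets: "?A \<in> sets TupM" by measurable
    have "(\<integral>\<^sup>+X. ?F u X \<partial>TupM) = (\<integral>\<^sup>+X. indicator ?A X \<partial>TupM)"
      by (rule nn_integral_cong) (simp add: indicator_def)
    then show ?case using elim sets by (simp add: null_sets_def)
  qed
qed

text \<open>The part of an open orthant in the ball of radius r has intensity proportional to r,
  with a positive factor, so the probability that it contains no point tends to 0. There are only
  finitely many sign patterns.\<close>

lemma AE_orthants: "AE \<omega> in M. \<forall>e :: 'n \<Rightarrow> bool. \<exists>x\<in>\<Phi> \<omega>. \<forall>i. if e i then x $ i > 0 else x $ i < 0"
proof -
  have "AE \<omega> in M. \<exists>x\<in>\<Phi> \<omega>. \<forall>i. if e i then x $ i > 0 else x $ i < 0" for e :: "'n \<Rightarrow> bool"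
  proof -
    define O' where "O' = {x :: (real, 'n) vec. \<forall>i. if e i then x $ i > 0 else x $ i < 0}"
    have opn: "open O'"
    proof -
      have "O' = (\<Inter>i. {x. if e i then x $ i > 0 else x $ i < 0})" by (auto simp: O'_def)
      moreover have "open {x :: (real, 'n) vec. if e i then x $ i > 0 else x $ i < 0}" for i
        by (cases "e i") (auto intro!: open_Collect_less continuous_intros)
      ultimately show ?thesis by (simp add: open_INT)
    qed
    define B where "B r = O' \<inter> ball 0 r" for r :: real
    have B [measurable]: "B r \<in> sets borel" "bounded (B r)" for r
      using opn by (auto simp: B_def intro: bounded_subset[OF bounded_ball])
    have fin: "emeasure L (B r) < \<infinity>" for r using hyp_intensity_bounded[OF \<gamma> B(2)] .
    have scale: "emeasure L (B r) = ennreal r * emeasure L (B 1)" if r: "r > 0" for r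
    proof -
      have "indicator (B r) (r *\<^sub>R x) = (indicator (B 1) x :: ennreal)" for x
        using r by (auto simp: B_def O'_def indicator_def zero_less_mult_iff mult_less_0_iff split: if_splits)
      then show ?thesis
        using hyp_intensity_scaleR[OF borel_measurable_indicator[OF B(1)[of r]] \<gamma> r] B(1)
        by (simp add: sets_hyp_intensity)
    qed
    have pos: "measure L (B 1) > 0"
    proof (rule ccontr)
      assume "\<not> measure L (B 1) > 0"
      then have "enn2real (emeasure L (B 1)) = 0" by (simp add: measure_def order_antisym not_less)
      then have "emeasure L (B 1) = 0" using fin[of 1] by (auto simp: enn2real_eq_0_iff)
      then have "B 1 \<in> null_sets L" using B by (simp add: null_sets_def sets_hyp_intensity)
      then have "AE x in lborel. x \<in> B 1 \<longrightarrow> ennreal (\<gamma> * norm x powr (1 - real DIM((real, 'n) vec))) = 0"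
        unfolding hyp_intensity_def by (subst (asm) null_sets_density_iff) auto
      then have "AE x in lborel. x \<notin> B 1"
        by eventually_elim (use \<gamma> in \<open>auto simp: B_def O'_def split: if_splits\<close>)
      then have "B 1 \<in> null_sets lborel"
        using AE_iff_null_sets[of "B 1" lborel] B(1)[of 1] by simp
      moreover have "open (B 1)" using opn by (simp add: B_def open_Int)
      \<comment> \<open>A witness that \<open>B 1\<close> is not empty: its entries are so small
        that even their absolute sum is 1 / 2.\<close>
      moreover have "(\<chi> i. if e i then 1 / (2 * real CARD('n)) else - 1 / (2 * real CARD('n))) \<in> B 1" (is "?p \<in> _")
      proof -
        have "norm ?p \<le> (\<Sum>i\<in>UNIV. \<bar>?p $ i\<bar>)" by (rule norm_le_l1_cart)
        also have "\<dots> = 1 / 2" by (simp add: if_distrib cong: if_cong)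
        finally show ?thesis by (auto simp: B_def O'_def)
      qed
      ultimately show False using open_not_negligible[of "B 1"] 
        by (auto simp: negligible_iff_null_sets null_sets_completionI)
    qed
    have mscale: "measure L (B r) = r * measure L (B 1)" if "r > 0" for r
      unfolding measure_def scale[OF that] using that by (simp add: enn2real_mult)
    let ?E = "\<Inter>n. {\<omega> \<in> space M. \<Phi> \<omega> \<inter> B (real (Suc n)) = {}}"
    have E: "?E \<in> sets M" using void_measurable[OF B] by (intro sets.countable_INT) auto
    have lim: "(\<lambda>n. ennreal (exp (- (real (Suc n) * measure L (B 1))))) \<longlonglongrightarrow> ennreal 0"
      using pos by (intro tendsto_ennrealI) real_asymp
    have le: "emeasure M ?E \<le> ennreal (exp (- (real (Suc n) * measure L (B 1))))" for n
    proof -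
      have "emeasure M ?E \<le> emeasure M {\<omega> \<in> space M. \<Phi> \<omega> \<inter> B (real (Suc n)) = {}}"
        using void_measurable[OF B] by (intro emeasure_mono) auto
      then show ?thesis using void_prob[OF B, of "real (Suc n)"] by (subst mscale[symmetric]) simp_all
    qed
    have "emeasure M ?E \<le> ennreal 0"
      by (rule LIMSEQ_le_const[OF lim]) (use le in auto)
    then have "emeasure M ?E = 0" by simp
    then show ?thesis
      by (rule AE_I[rotated, OF _ E]) (auto simp: B_def O'_def)
  qed
  then show ?thesis by (simp add: AE_finite_all[of UNIV, simplified])
qed

text \<open>Each requirement on tuples fails only on a null set of the product measure, so
  \<open>AE_no_tuples\<close> applies; u enters through \<open>generic\<close> alone.\<close>

lemma AE_general_position:
  "AE u in (lborel :: (real, 'n) vec measure). AE \<omega> in M. general_position (\<Phi> \<omega>) u"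
  using non_generic_tuples_null
proof eventually_elim
  case (elim u)
  let ?N = "{Y \<in> space (PiM (UNIV :: 'n option set) (\<lambda>_. L)). tuple_vertex (\<lambda>i. Y (Some i)) \<bullet> Y None = Y None \<bullet> Y None}"
  have full: "X \<in> space (PiM UNIV (\<lambda>_. L))" for X :: "'i \<Rightarrow> (real, 'n) vec" by (simp add: space_PiM_L)
  show ?case
    using AE_no_tuples[OF finite elim] AE_no_tuples[OF finite singular_tuples_null]
      AE_no_tuples[OF finite degenerate_tuples_null] AE_orthants AE_space
  proof eventually_elim
    case (elim \<omega>)
    show ?case
    proof
      show "finite (\<Phi> \<omega> \<inter> cball 0 R)" for R using finite_points[OF elim(5)] by simp
      show "\<exists>x\<in>\<Phi> \<omega>. \<forall>i. if e i then x $ i > 0 else x $ i < 0" for e using elim(4) by blast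
      fix X :: "'n \<Rightarrow> (real, 'n) vec" assume X: "X \<in> tuples UNIV (\<Phi> \<omega>)"
      show det: "det (tuple_matrix X) \<noteq> 0" using elim(2) X full[of X] by blast
      show "tuple_coords X u $ i \<noteq> 0" for i using elim(1) X det full[of X] by blast
      fix x assume x: "x \<in> \<Phi> \<omega>" "x \<notin> range X"
      \<comment> \<open>The tuple and the additional point form one injective tuple indexed by
        \<open>'n option\<close>.\<close>
      define Y where "Y = case_option x X"
      have "Y \<in> tuples UNIV (\<Phi> \<omega>)"
        using X x unfolding tuples_def Y_def by (auto simp: inj_on_def PiE_iff split: option.splits)
      then have "Y \<notin> ?N" using elim(3) by blast
      then show "tuple_vertex X \<bullet> x \<noteq> x \<bullet> x" using full[of Y] by (simp add: Y_def)
    qed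
  qed
qed

end

section \<open>The expected number of faces\<close>

text \<open>A code equal to 0 would be linearly dependent, so no hyperplane passes through the
  origin and \<open>Z\<close> has full dimension; a face of full dimension lies on no hyperplane.
  This case fixes the unknown constant later.\<close>

lemma (in general_position) num_faces_full: "num_faces CARD('n) Z = 1"
proof -
  have Z0: "0 \<in> Z" by (simp add: mem_Z)
  have act0: "active 0 = {}"
  proof (rule ccontr)
    assume "active 0 \<noteq> {}"
    then have 0: "0 \<in> active 0" by (auto simp: active_def)
    obtain X :: "'n \<Rightarrow> real^'n" where X: "X \<in> tuples UNIV S" "active 0 \<subseteq> range X"
      using tuple_containing_active by blast
    then show False using tuple_independent[OF regular[OF X(1)]] 0 dependent_zero by blast
  qed
  have flat: "flat {} = UNIV" by (simp add: flat_def)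
  have "aff_dim Z = int CARD('n)" using aff_dim_face[OF Z0] act0 flat by simp
  moreover have "F = Z" if F: "F face_of Z" "aff_dim F = int CARD('n)" for F
  proof -
    have "F \<noteq> {}" using F(2) by force
    then obtain z where z: "z \<in> Z" "F = Z \<inter> flat (active z)" using face_eq_flat[OF F(1)] by blast
    have "card (active z) = 0"
      using aff_dim_face[OF z(1)] F(2) z(2) card_active[of z] zero_less_card_finite[where 'a = 'n] by simp
    then have "active z = {}" using finite_active by simp
    then show ?thesis using z(2) flat by simp
  qed
  ultimately have "{F. F face_of Z \<and> aff_dim F = int CARD('n)} = {Z}"
    using face_of_refl[OF convex_Z] by blast
  then show ?thesis by (simp add: num_faces_def)
qed

context isotropic_process
begin

definition positive_tuples :: "'n set \<Rightarrow> (real, 'n) vec \<Rightarrow> ('n \<Rightarrow> (real, 'n) vec) set" where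
  "positive_tuples J u = {X \<in> space TupM. det (tuple_matrix X) \<noteq> 0 \<and> (\<forall>i\<in>J. tuple_coords X u $ i > 0)}"

lemma positive_tuples_sets [measurable]: "positive_tuples J u \<in> sets TupM"
  unfolding positive_tuples_def by measurable

text \<open>\<open>mecke_void\<close> speaks about bounded sets of tuples. Tuples whose vertex has
  norm at most n are bounded, since no foot point is farther from the origin than the vertex; n then
  grows by monotone convergence.\<close>

lemma expected_positive_tuples:
  assumes \<kappa>: "\<And>v. measure L (void_ball v) = \<kappa> * norm v"
  shows "(\<lambda>\<omega>. ntuples UNIV {X \<in> positive_tuples J u. \<Phi> \<omega> \<inter> void_ball (tuple_vertex X) = {}} \<omega>) \<in> borel_measurable M" (is "?N \<in> _")
    and "(\<integral>\<^sup>+\<omega>. ntuples UNIV {X \<in> positive_tuples J u. \<Phi> \<omega> \<inter> void_ball (tuple_vertex X) = {}} \<omega> \<partial>M)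
      = (\<integral>\<^sup>+X. indicator (positive_tuples J u) X * ennreal (exp (- \<kappa> * norm (tuple_vertex X))) \<partial>TupM)"
proof -
  define A where "A n = {X \<in> space TupM. X \<in> positive_tuples J u \<and> norm (tuple_vertex X) \<le> real n}" for n
  have A_sets [measurable]: "A n \<in> sets TupM" for n unfolding A_def by measurable
  have vertex: "X i \<bullet> tuple_vertex X = X i \<bullet> X i" if "X \<in> A n" for X i n
    using that tuple_vertex_iff[of X "tuple_vertex X"] by (simp add: A_def positive_tuples_def inner_commute)
  have sub: "A n \<subseteq> (\<Pi>\<^sub>E i\<in>UNIV. cball 0 (real n))" for n
  proof
    fix X assume X: "X \<in> A n"
    have "norm (X i) \<le> real n" for i
      using norm_le_if_inner_le[of "X i" "tuple_vertex X"] vertex[OF X, of i] X by (simp add: A_def inner_commute)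
    then show "X \<in> (\<Pi>\<^sub>E i\<in>UNIV. cball 0 (real n))" by (simp add: PiE_iff)
  qed
  have out: "X i \<notin> void_ball (tuple_vertex X)" if "X \<in> A n" for X i n
    using vertex[OF that, of i] by (simp add: void_ball_def)
  have V: "tuple_vertex \<in> borel_measurable TupM" by measurable
  let ?T = "\<lambda>n \<omega>. ntuples UNIV {X \<in> A n. \<Phi> \<omega> \<inter> void_ball (tuple_vertex X) = {}} \<omega>"
  note mecke = mecke_void[OF finite A_sets sub V out \<kappa>]
  have inc: "incseq A" by (auto simp: incseq_def A_def)
  have UA: "(\<Union>n. A n) = positive_tuples J u"
    by (auto simp: A_def positive_tuples_def real_arch_simple)
  have N: "?N \<omega> = (SUP n. ?T n \<omega>)" for \<omega>
  proof -
    have "tuples UNIV (\<Phi> \<omega>) \<inter> {X \<in> positive_tuples J u. \<Phi> \<omega> \<inter> void_ball (tuple_vertex X) = {}}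
      = (\<Union>n. tuples UNIV (\<Phi> \<omega>) \<inter> {X \<in> A n. \<Phi> \<omega> \<inter> void_ball (tuple_vertex X) = {}})"
      by (subst UA[symmetric]) blast
    moreover have "incseq (\<lambda>n. tuples UNIV (\<Phi> \<omega>) \<inter> {X \<in> A n. \<Phi> \<omega> \<inter> void_ball (tuple_vertex X) = {}})"
      using inc by (fastforce simp: incseq_def)
    ultimately show ?thesis
      unfolding ntuples_def by (subst SUP_emeasure_incseq) auto
  qed
  have T_inc: "incseq (\<lambda>n. ?T n)"
    unfolding incseq_def le_fun_def ntuples_def using inc
    by (intro allI impI emeasure_mono) (auto simp: incseq_def)
  show "?N \<in> borel_measurable M" unfolding N using mecke(1) by measurable
  have "(\<integral>\<^sup>+\<omega>. ?N \<omega> \<partial>M) = (SUP n. \<integral>\<^sup>+\<omega>. ?T n \<omega> \<partial>M)"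
    unfolding N by (rule nn_integral_monotone_convergence_SUP[OF T_inc mecke(1)])
  also have "\<dots> = (SUP n. \<integral>\<^sup>+X. indicator (A n) X * ennreal (exp (- \<kappa> * norm (tuple_vertex X))) \<partial>TupM)"
    by (simp only: mecke(2))
  also have "\<dots> = (\<integral>\<^sup>+X. (SUP n. indicator (A n) X * ennreal (exp (- \<kappa> * norm (tuple_vertex X)))) \<partial>TupM)"
  proof (rule nn_integral_monotone_convergence_SUP[symmetric])
    show "incseq (\<lambda>n X. indicator (A n) X * ennreal (exp (- \<kappa> * norm (tuple_vertex X))))"
      using inc by (auto simp: incseq_def le_fun_def indicator_def)
  qed measurable
  also have "\<dots> = (\<integral>\<^sup>+X. indicator (positive_tuples J u) X * ennreal (exp (- \<kappa> * norm (tuple_vertex X))) \<partial>TupM)"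
  proof (rule nn_integral_cong)
    fix X
    have "(SUP n. indicator (A n) X) = (indicator (positive_tuples J u) X :: ennreal)"
    proof (cases "X \<in> positive_tuples J u")
      case True
      then obtain n where "X \<in> A n" using UA by blast
      then have "1 \<le> (SUP n. indicator (A n) X :: ennreal)" by (intro SUP_upper2[of n]) auto
      moreover have "(SUP n. indicator (A n) X :: ennreal) \<le> 1" by (intro SUP_least) (simp add: indicator_def)
      ultimately show ?thesis using True by simp
    next
      case False
      then have "X \<notin> A n" for n using UA by blast
      then show ?thesis using False by simp
    qed
    then show "(SUP n. indicator (A n) X * ennreal (exp (- \<kappa> * norm (tuple_vertex X)))) = indicator (positive_tuples J u) X * ennreal (exp (- \<kappa> * norm (tuple_vertex X)))"
      by (simp only: SUP_mult_right_ennreal[symmetric])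
  qed
  finally show "(\<integral>\<^sup>+\<omega>. ?N \<omega> \<partial>M) = (\<integral>\<^sup>+X. indicator (positive_tuples J u) X * ennreal (exp (- \<kappa> * norm (tuple_vertex X))) \<partial>TupM)" .
qed

definition expected_faces :: "nat \<Rightarrow> ennreal" where
  "expected_faces l = (\<integral>\<^sup>+\<omega>. ennreal (real (num_faces l (zero_cell (\<Phi> \<omega>)))) \<partial>M)"

text \<open>Almost surely the process is in general position with respect to u, so the number of
  faces may be replaced under the integral by the measurable count of tuples.\<close>

lemma expected_faces_tuples:
  assumes \<kappa>: "\<And>v. measure L (void_ball v) = \<kappa> * norm v"
    and u: "AE \<omega> in M. general_position (\<Phi> \<omega>) u"
  shows "expected_faces (card J) * ennreal (fact (card J) * fact (CARD('n) - card J))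
    = (\<integral>\<^sup>+X. indicator (positive_tuples J u) X * ennreal (exp (- \<kappa> * norm (tuple_vertex X))) \<partial>TupM)"
proof -
  let ?c = "fact (card J) * fact (CARD('n) - card J) :: real"
  let ?N = "\<lambda>\<omega>. ntuples UNIV {X \<in> positive_tuples J u. \<Phi> \<omega> \<inter> void_ball (tuple_vertex X) = {}} \<omega>"
  have c: "?c > 0" by simp
  have "AE \<omega> in M. ennreal (real (num_faces (card J) (zero_cell (\<Phi> \<omega>)))) = ?N \<omega> * ennreal (1 / ?c)"
    using u
  proof eventually_elim
    case (elim \<omega>)
    interpret general_position "\<Phi> \<omega>" u by (rule elim)
    have "tuples UNIV (\<Phi> \<omega>) \<inter> {X \<in> positive_tuples J u. \<Phi> \<omega> \<inter> void_ball (tuple_vertex X) = {}} = top_tuples J"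
      using regular by (auto simp: positive_tuples_def space_PiM_L)
    then have "?N \<omega> = of_nat (card (top_tuples J))"
      using finite_top_tuples[of J] by (simp add: ntuples_def emeasure_count_space)
    also have "\<dots> = ennreal (real (num_faces (card J) (zero_cell (\<Phi> \<omega>))) * ?c)"
      unfolding num_faces_eq_card_top_tuples[symmetric] by (simp add: ennreal_of_nat_eq_real_of_nat)
    finally show ?case using c by (simp add: ennreal_mult[symmetric])
  qed
  then have "expected_faces (card J) = (\<integral>\<^sup>+\<omega>. ?N \<omega> * ennreal (1 / ?c) \<partial>M)"
    unfolding expected_faces_def by (rule nn_integral_cong_AE)
  also have "\<dots> = (\<integral>\<^sup>+\<omega>. ?N \<omega> \<partial>M) * ennreal (1 / ?c)"
    by (rule nn_integral_multc[OF expected_positive_tuples(1)[OF \<kappa>]])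
  finally have "expected_faces (card J) * ennreal ?c = (\<integral>\<^sup>+\<omega>. ?N \<omega> \<partial>M) * (ennreal (1 / ?c) * ennreal ?c)"
    by (simp only: mult.assoc)
  also have "ennreal (1 / ?c) * ennreal ?c = 1" using c by (subst ennreal_mult[symmetric]) auto
  finally show ?thesis unfolding expected_positive_tuples(2)[OF \<kappa>] by simp
qed

text \<open>The expectation does not depend on u, so it may be averaged over a Gaussian u; this
  brings in the integral of \<open>nn_integral_random_simplex\<close>, whose constant is the same
  for every \<open>J\<close>.\<close>

lemma expected_faces_proportional:
  obtains C :: ennreal where
    "\<And>J :: 'n set. expected_faces (card J) * ennreal (fact (card J) * fact (CARD('n) - card J))
      = C * ennreal (pi ^ (CARD('n) - card J) * Re (\<integral>s. arsinh_integrand (card J) CARD('n) s \<partial>lborel))"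
proof -
  obtain \<kappa> where \<kappa>: "\<And>v :: (real, 'n) vec. measure L (void_ball v) = \<kappa> * norm v"
    using hyp_intensity_void_ball[OF \<gamma>] by blast
  obtain K :: ennreal where K: "\<And>J::'n set.
      (\<integral>\<^sup>+u. \<integral>\<^sup>+a. \<integral>\<^sup>+G. ennreal (exp (- (norm u)\<^sup>2 / 2 - (norm G)\<^sup>2 / 2 - \<kappa> * norm (sol (transpose G) a)))
         * indicator {G. det G \<noteq> 0} G * indicator (sign_set J) (sol G u, a)
       \<partial>lborel \<partial>lborel \<partial>lborel)
      = K * ennreal (pi ^ (CARD('n) - card J) * Re (\<integral>s. arsinh_integrand (card J) CARD('n) s \<partial>lborel))"
    using nn_integral_random_simplex[of \<kappa>] by blast
  define c where "c = (ennreal \<gamma> / (2 * polar_const CARD('n) 1)) ^ CARD('n)"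
  define D where "D = ennreal (sqrt (2 * pi) ^ CARD('n))"
  have D: "D \<noteq> 0" "D \<noteq> \<top>" by (simp_all add: D_def ennreal_eq_0_iff not_le)
  have "D * (expected_faces (card J) * ennreal (fact (card J) * fact (CARD('n) - card J)))
    = (c * K) * ennreal (pi ^ (CARD('n) - card J) * Re (\<integral>s. arsinh_integrand (card J) CARD('n) s \<partial>lborel))" for J :: "'n set"
  proof -
    let ?E = "expected_faces (card J) * ennreal (fact (card J) * fact (CARD('n) - card J))"
    let ?f = "\<lambda>u a G. ennreal (exp (- (norm u)\<^sup>2 / 2 - (norm G)\<^sup>2 / 2 - \<kappa> * norm (sol (transpose G) a)))
         * indicator {G. det G \<noteq> 0} G * indicator (sign_set J) (sol G u, a) :: ennreal"
    \<comment> \<open>\<open>D\<close> is the total mass of the Gaussian weight of u.\<close>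
    have "D * ?E = (\<integral>\<^sup>+u. ennreal (exp (- (norm u)\<^sup>2 / 2)) * ?E \<partial>(lborel :: (real, 'n) vec measure))"
      unfolding D_def nn_integral_gauss_vec[symmetric] by (rule nn_integral_multc[symmetric]) simp
    also have "\<dots> = (\<integral>\<^sup>+u. c * (\<integral>\<^sup>+a. \<integral>\<^sup>+G. ?f u a G \<partial>lborel \<partial>lborel) \<partial>(lborel :: (real, 'n) vec measure))"
    proof (rule nn_integral_cong_AE, rule AE_mp[OF AE_general_position], rule AE_I2, rule impI)
      fix u :: "(real, 'n) vec" assume u: "AE \<omega> in M. general_position (\<Phi> \<omega>) u"
      let ?g = "ennreal (exp (- (norm u)\<^sup>2 / 2))"
      have exp_mult: "ennreal (exp x) * ennreal (exp y) = ennreal (exp (x + y))" for x y :: real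
        by (simp add: ennreal_mult[symmetric] exp_add)
      let ?h = "\<lambda>a G. ennreal (exp (- (norm G)\<^sup>2 / 2)) * (indicator (positive_tuples J u) (code_tuple G a) * ennreal (exp (- \<kappa> * norm (tuple_vertex (code_tuple G a)))))"
      let ?h' = "\<lambda>a G. ennreal (exp (- (norm G)\<^sup>2 / 2 - \<kappa> * norm (sol (transpose G) a)))
         * indicator {G. det G \<noteq> 0} G * indicator (sign_set J) (sol G u, a) :: ennreal"
      have h: "?h a G = ?h' a G" if a: "\<forall>i. a $ i \<noteq> 0" for a G
      proof (cases "det G = 0")
        case True
        then show ?thesis using det_code_tuple_nonzero[of a G] a by (simp add: positive_tuples_def indicator_def)
      next
        case False
        have "code_tuple G a \<in> positive_tuples J u \<longleftrightarrow> (sol G u, a) \<in> sign_set J"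
          using det_code_tuple_nonzero[of a G] tuple_coords_code_tuple[of a G u] a False
          by (auto simp: positive_tuples_def sign_set_def space_PiM_L)
        then show ?thesis
          using tuple_vertex_code_tuple[of a G] a False
          by (simp add: indicator_def ennreal_mult[symmetric] exp_add[symmetric])
      qed
      have "?E = c * (\<integral>\<^sup>+a. \<integral>\<^sup>+G. ?h a G \<partial>lborel \<partial>lborel)"
        unfolding expected_faces_tuples[OF \<kappa> u] c_def by (rule nn_integral_tuples) measurable
      also have "(\<integral>\<^sup>+a. \<integral>\<^sup>+G. ?h a G \<partial>lborel \<partial>lborel) = (\<integral>\<^sup>+a. \<integral>\<^sup>+G. ?h' a G \<partial>lborel \<partial>lborel)"
        by (rule nn_integral_cong_AE, rule AE_mp[OF AE_vec_nonzero], intro AE_I2 impI, rule nn_integral_cong, rule h)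
      finally have "?g * ?E = c * (?g * (\<integral>\<^sup>+a. \<integral>\<^sup>+G. ?h' a G \<partial>lborel \<partial>lborel))" by (simp only: ac_simps)
      also have "?g * (\<integral>\<^sup>+a. \<integral>\<^sup>+G. ?h' a G \<partial>lborel \<partial>lborel) = (\<integral>\<^sup>+a. ?g * (\<integral>\<^sup>+G. ?h' a G \<partial>lborel) \<partial>lborel)"
        by (rule nn_integral_cmult[symmetric]) measurable
      also have "\<dots> = (\<integral>\<^sup>+a. \<integral>\<^sup>+G. ?g * ?h' a G \<partial>lborel \<partial>lborel)"
        by (intro nn_integral_cong, rule nn_integral_cmult[symmetric]) measurable
      also have "\<dots> = (\<integral>\<^sup>+a. \<integral>\<^sup>+G. ?f u a G \<partial>lborel \<partial>lborel)"
        by (rule nn_integral_cong, rule nn_integral_cong)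
           (simp only: mult.assoc[symmetric] exp_mult add_diff_eq minus_divide_left[symmetric] add_uminus_conv_diff)
      finally show "?g * ?E = c * (\<integral>\<^sup>+a. \<integral>\<^sup>+G. ?f u a G \<partial>lborel \<partial>lborel)" .
    qed
    also have "\<dots> = c * (\<integral>\<^sup>+u. \<integral>\<^sup>+a. \<integral>\<^sup>+G. ?f u a G \<partial>lborel \<partial>lborel \<partial>lborel)"
      by (rule nn_integral_cmult) measurable
    finally show ?thesis unfolding K by (simp only: mult.assoc)
  qed
  then have "expected_faces (card J) * ennreal (fact (card J) * fact (CARD('n) - card J))
    = (c * K) / D * ennreal (pi ^ (CARD('n) - card J) * Re (\<integral>s. arsinh_integrand (card J) CARD('n) s \<partial>lborel))" for J :: "'n set"
    using D by (rule ennreal_eq_divide_mult)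
  then show ?thesis by (rule that)
qed

text \<open>For l = d the left side is d! and the coefficient is 1, so the constant satisfies
  \<open>C * pi = d!\<close>. Dividing by the number of orderings produces the binomial
  coefficient.\<close>

theorem expected_faces_formula:
  assumes l: "l \<le> CARD('n)" "even (CARD('n) - l)"
  shows "expected_faces l = ennreal (pi ^ (CARD('n) - l) * real (CARD('n) choose l) *
    fps_nth ((fps_X / fps_sin (1::real)) ^ (CARD('n) + 1)) (CARD('n) - l))"
proof -
  let ?n = "CARD('n)" and ?q = "\<lambda>l. fps_nth ((fps_X / fps_sin (1::real)) ^ (CARD('n) + 1)) (CARD('n) - l)"
  obtain C :: ennreal where C: "\<And>J :: 'n set. expected_faces (card J) * ennreal (fact (card J) * fact (?n - card J))
      = C * ennreal (pi ^ (?n - card J) * Re (\<integral>s. arsinh_integrand (card J) ?n s \<partial>lborel))"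
    using expected_faces_proportional by blast
  have E: "expected_faces k * ennreal (fact k * fact (?n - k)) = C * ennreal (pi ^ (?n - k) * (pi * ?q k))"
    if k: "k \<le> ?n" "even (?n - k)" for k
  proof -
    obtain J :: "'n set" where "card J = k" using obtain_subset_with_card_n[of k UNIV] k(1) by auto
    then show ?thesis using C[of J] integral_arsinh_integrand[OF k] by simp
  qed
  \<comment> \<open>The claim does not mention u: the quantifier only provides some u for which the
    process is almost surely in general position.\<close>
  have "AE u in (lborel :: (real, 'n) vec measure). expected_faces ?n = 1"
    using AE_general_position
  proof eventually_elim
    case (elim u)
    have "expected_faces ?n = (\<integral>\<^sup>+\<omega>. 1 \<partial>M)"
      unfolding expected_faces_def
      by (rule nn_integral_cong_AE, rule AE_mp[OF elim]) (simp add: general_position.num_faces_full)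
    then show ?case by (simp add: emeasure_space_1)
  qed
  then have E1: "expected_faces ?n = 1" by (simp add: eventually_const_iff ae_filter_eq_bot_iff)
  have "fps_nth ((fps_X / fps_sin (1::real)) * fps_sin 1) 1 = fps_nth fps_X 1" by (simp only: fps_X_div_sin_mult)
  then have "fps_nth (fps_X / fps_sin (1::real)) 0 = 1" by (simp add: fps_mult_nth_1)
  then have q: "?q ?n = 1" by (simp add: fps_power_zeroth)
  have Cn: "ennreal (fact ?n) = C * ennreal pi" using E[of ?n] by (simp only: E1 q) simp
  have "expected_faces l * ennreal (fact l * fact (?n - l)) = C * ennreal pi * ennreal (pi ^ (?n - l) * ?q l)"
    using E[OF l] by (simp add: ennreal_mult'[symmetric] mult.assoc mult.left_commute[of _ pi])
  also have "\<dots> = ennreal (fact ?n * (pi ^ (?n - l) * ?q l))"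
    unfolding Cn[symmetric] by (simp add: ennreal_mult')
  finally have *: "expected_faces l * ennreal (fact l * fact (?n - l)) = ennreal (fact ?n * (pi ^ (?n - l) * ?q l))" .
  have pos: "(fact l * fact (?n - l) :: real) > 0" by simp
  have "expected_faces l = expected_faces l * ennreal (fact l * fact (?n - l)) * ennreal (1 / (fact l * fact (?n - l)))"
    unfolding mult.assoc by (subst ennreal_mult[symmetric]) auto
  also have "\<dots> = ennreal (1 / (fact l * fact (?n - l)) * (fact ?n * (pi ^ (?n - l) * ?q l)))"
    unfolding * by (subst mult.commute, subst ennreal_mult') auto
  also have "1 / (fact l * fact (?n - l)) * (fact ?n * (pi ^ (?n - l) * ?q l)) = pi ^ (?n - l) * real (?n choose l) * ?q l"
    using l(1) by (simp add: binomial_fact field_simps)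
  finally show ?thesis .
qed

end

section \<open>Coordinates\<close>

text \<open>The change of variables formula for matrices is only available for well-ordered index types.\<close>

typedef (overloaded) ('a::euclidean_space) basis_index = "Basis :: 'a set"
  using nonempty_Basis by blast

lemma range_Rep_basis_index: "range (Rep_basis_index :: 'a basis_index \<Rightarrow> 'a) = (Basis :: 'a::euclidean_space set)"
  by (rule type_definition.Rep_range[OF type_definition_basis_index])

lemma inj_Rep_basis_index: "inj Rep_basis_index"
  by (simp add: inj_on_def Rep_basis_index_inject)

lemma CARD_basis_index: "CARD('a::euclidean_space basis_index) = DIM('a)"
  by (rule type_definition.card[OF type_definition_basis_index])

instance basis_index :: (euclidean_space) finite
proof
  show "finite (UNIV :: 'a basis_index set)"
    by (rule finite_imageD[OF _ inj_Rep_basis_index]) (simp add: range_Rep_basis_index)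
qed

instantiation basis_index :: (euclidean_space) wellorder
begin

definition basis_rank :: "'a basis_index \<Rightarrow> nat" where
  "basis_rank i = to_nat_on Basis (Rep_basis_index i)"

definition less_eq_basis_index :: "'a basis_index \<Rightarrow> 'a basis_index \<Rightarrow> bool" where
  "i \<le> j \<longleftrightarrow> basis_rank i \<le> basis_rank j"

definition less_basis_index :: "'a basis_index \<Rightarrow> 'a basis_index \<Rightarrow> bool" where
  "i < j \<longleftrightarrow> basis_rank i < basis_rank j"

instance
proof
  fix i j k :: "'a basis_index"
  have inj: "basis_rank i = basis_rank j \<Longrightarrow> i = j" for i j :: "'a basis_index"
    unfolding basis_rank_def Rep_basis_index_inject[symmetric]
    by (rule inj_onD[OF inj_on_to_nat_on[OF countable_finite[OF finite_Basis]]]) (simp_all add: Rep_basis_index)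
  show "i < j \<longleftrightarrow> i \<le> j \<and> \<not> j \<le> i" "i \<le> i" "i \<le> j \<or> j \<le> i"
    by (auto simp: less_eq_basis_index_def less_basis_index_def)
  show "i \<le> j \<Longrightarrow> j \<le> k \<Longrightarrow> i \<le> k" "i \<le> j \<Longrightarrow> j \<le> i \<Longrightarrow> i = j"
    using inj by (auto simp: less_eq_basis_index_def)
  fix P :: "'a basis_index \<Rightarrow> bool" and a
  assume step: "\<And>x. (\<And>y. y < x \<Longrightarrow> P y) \<Longrightarrow> P x"
  show "P a"
    by (induction a rule: measure_induct_rule[of basis_rank]) (use step in \<open>simp add: less_basis_index_def\<close>)
qed

end

definition coords :: "'a::euclidean_space \<Rightarrow> real^'a basis_index" where
  "coords x = (\<chi> i. x \<bullet> Rep_basis_index i)"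

lemma linear_coords: "linear coords"
  by (rule linearI) (simp_all add: coords_def vec_eq_iff inner_add_left)

lemma inner_coords: "coords x \<bullet> coords y = x \<bullet> y"
proof -
  have "coords x \<bullet> coords y = (\<Sum>i\<in>UNIV. (x \<bullet> Rep_basis_index i) * (y \<bullet> Rep_basis_index i))"
    by (simp add: coords_def inner_vec_def)
  also have "\<dots> = (\<Sum>b\<in>range Rep_basis_index. (x \<bullet> b) * (y \<bullet> b))"
    by (simp add: sum.reindex[OF inj_Rep_basis_index])
  also have "\<dots> = x \<bullet> y" by (simp add: range_Rep_basis_index euclidean_inner[of x y])
  finally show ?thesis .
qed

lemma norm_coords: "norm (coords x) = norm x"
  by (simp add: norm_eq_sqrt_inner inner_coords)

lemma inj_coords: "inj coords"
  using linear_injective_0[OF linear_coords] norm_coords by (metis norm_eq_zero)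

lemma coords_Rep_basis_index: "coords (Rep_basis_index i) = axis i 1"
  by (auto simp: coords_def vec_eq_iff axis_def inner_Basis Rep_basis_index Rep_basis_index_inject)

lemma bij_betw_coords_Basis: "bij_betw coords (Basis :: 'a::euclidean_space set) Basis"
  unfolding bij_betw_def
proof
  show "inj_on coords (Basis :: 'a set)" using inj_coords by (rule inj_on_subset) simp
  have "coords ` (Basis :: 'a set) = range (\<lambda>i. axis i 1)"
    by (simp add: range_Rep_basis_index[symmetric] image_image coords_Rep_basis_index)
  then show "coords ` (Basis :: 'a set) = Basis" by (auto simp: Basis_vec_def)
qed

lemma surj_coords: "surj (coords :: 'a::euclidean_space \<Rightarrow> real^'a basis_index)"
proof -
  have "y \<in> range (coords :: 'a \<Rightarrow> _)" for y :: "real^'a basis_index"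
  proof -
    have "coords (\<Sum>i\<in>UNIV. (y $ i) *\<^sub>R Rep_basis_index i) = (\<Sum>i\<in>UNIV. (y $ i) *\<^sub>R axis i 1)"
      by (simp add: linear_sum[OF linear_coords] linear_scale[OF linear_coords] coords_Rep_basis_index)
    also have "\<dots> = y" by (simp add: vec_eq_iff axis_def if_distrib cong: if_cong)
    finally show ?thesis by (metis rangeI)
  qed
  then show ?thesis by blast
qed

lemma measurable_coords [measurable]: "coords \<in> borel_measurable borel"
  by (intro borel_measurable_continuous_onI linear_continuous_on) (simp add: linear_coords linear_conv_bounded_linear[symmetric])

text \<open>\<open>coords\<close> preserves both Lebesgue measure and the norm, the two ingredients
  of the intensity.\<close>

lemma hyp_intensity_coords:
  assumes \<gamma>: "\<gamma> > 0" and B [measurable]: "B \<in> sets borel"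
  shows "measure (hyp_intensity \<gamma>) (coords -` B :: 'a::euclidean_space set) = measure (hyp_intensity \<gamma>) B"
proof -
  have [measurable]: "coords -` B \<in> sets borel" using measurable_sets[OF measurable_coords B] by simp
  have "emeasure (hyp_intensity \<gamma>) B = (\<integral>\<^sup>+x. indicator B x \<partial>hyp_intensity \<gamma>)"
    by (simp add: sets_hyp_intensity)
  also have "\<dots> = ennreal \<gamma> * (\<integral>\<^sup>+x. ennreal (norm x powr (1 - real DIM('a))) * indicator B x \<partial>distr lborel borel (coords :: 'a \<Rightarrow> _))"
    using nn_integral_hyp_intensity_lborel[OF borel_measurable_indicator[OF B] \<gamma>]
    by (simp add: lborel_distr_basis_bij[OF linear_coords bij_betw_coords_Basis] CARD_basis_index)
  also have "\<dots> = ennreal \<gamma> * (\<integral>\<^sup>+x. ennreal (norm x powr (1 - real DIM('a))) * indicator (coords -` B) x \<partial>(lborel :: 'a measure))"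
    by (simp add: nn_integral_distr norm_coords indicator_def)
  also have "\<dots> = (\<integral>\<^sup>+x. indicator (coords -` B) x \<partial>(hyp_intensity \<gamma> :: 'a measure))"
    by (subst nn_integral_hyp_intensity_lborel[OF _ \<gamma>]) simp_all
  also have "\<dots> = emeasure (hyp_intensity \<gamma>) (coords -` B :: 'a set)" by (simp add: sets_hyp_intensity)
  finally show ?thesis by (simp add: measure_def)
qed

lemma poisson_process_coords:
  fixes \<Phi> :: "'w \<Rightarrow> 'a::euclidean_space set"
  assumes \<gamma>: "\<gamma> > 0" and P: "poisson_process M \<Phi> (hyp_intensity \<gamma>)"
  shows "poisson_process M (\<lambda>\<omega>. coords ` \<Phi> \<omega>) (hyp_intensity \<gamma>)"
proof -
  have card: "card (coords ` \<Phi> \<omega> \<inter> B) = card (\<Phi> \<omega> \<inter> coords -` B)" for \<omega> and B :: "(real^'a basis_index) set"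
  proof -
    have "coords ` \<Phi> \<omega> \<inter> B = coords ` (\<Phi> \<omega> \<inter> coords -` B)" by blast
    then show ?thesis by (simp only: card_image[OF inj_on_subset[OF inj_coords subset_UNIV]])
  qed
  have fin: "coords ` \<Phi> \<omega> \<inter> cball 0 R = coords ` (\<Phi> \<omega> \<inter> cball 0 R)" for \<omega> R
    by (auto simp: norm_coords)
  have B: "coords -` B \<in> sets borel" "bounded (coords -` B :: 'a set)"
    if B: "B \<in> sets borel" "bounded B" for B :: "(real^'a basis_index) set"
  proof -
    show "coords -` B \<in> sets borel" using measurable_sets[OF measurable_coords B(1)] by simp
    obtain R where R: "\<And>y. y \<in> B \<Longrightarrow> norm y \<le> R" using B(2) unfolding bounded_iff by blast
    have "norm x \<le> R" if "coords x \<in> B" for x :: 'a using R[OF that] by (simp only: norm_coords)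
    then show "bounded (coords -` B :: 'a set)" unfolding bounded_iff by blast
  qed
  show ?thesis
    unfolding poisson_process_def card fin
  proof (intro conjI allI impI ballI)
    show "prob_space M" using P by (simp add: poisson_process_def)
    show "finite (coords ` (\<Phi> \<omega> \<inter> cball 0 R))" if "\<omega> \<in> space M" for \<omega> R
      using P that by (simp add: poisson_process_def)
    fix B :: "(real^'a basis_index) set" assume BB: "B \<in> sets borel \<and> bounded B"
    then show "(\<lambda>\<omega>. card (\<Phi> \<omega> \<inter> coords -` B)) \<in> measurable M (count_space UNIV)"
      using P B[of B] by (simp add: poisson_process_def)
    show "measure M {\<omega> \<in> space M. card (\<Phi> \<omega> \<inter> coords -` B) = k}
        = measure (hyp_intensity \<gamma>) B ^ k / fact k * exp (- measure (hyp_intensity \<gamma>) B)" for k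
      using P B[of B] BB hyp_intensity_coords[OF \<gamma>, of B] by (simp add: poisson_process_def)
  next
    fix I :: "nat set" and D :: "nat \<Rightarrow> (real^'a basis_index) set"
    assume D: "finite I \<and> disjoint_family_on D I \<and> (\<forall>i\<in>I. D i \<in> sets borel \<and> bounded (D i))"
    then have "disjoint_family_on (\<lambda>i. coords -` D i :: 'a set) I"
      by (auto simp: disjoint_family_on_def)
    then show "prob_space.indep_vars M (\<lambda>_. count_space UNIV) (\<lambda>i \<omega>. card (\<Phi> \<omega> \<inter> coords -` D i)) I"
      using P B D by (auto simp: poisson_process_def)
  qed
qed

lemma zero_cell_coords: "zero_cell (coords ` S) = coords ` zero_cell S"
proof -
  have *: "coords y \<in> zero_cell (coords ` S) \<longleftrightarrow> y \<in> zero_cell S" for y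
    by (simp add: zero_cell_def halfspace0_def inner_coords)
  have "zero_cell (coords ` S) = coords ` (coords -` zero_cell (coords ` S))"
    by (simp add: surj_coords)
  also have "coords -` zero_cell (coords ` S) = zero_cell S" using * by blast
  finally show ?thesis .
qed

lemma num_faces_coords:
  fixes P :: "'a::euclidean_space set"
  shows "num_faces l (coords ` P) = num_faces l P"
proof -
  have "{F. F face_of coords ` P \<and> aff_dim F = int l} = (\<lambda>F. coords ` F) ` {F. F face_of P \<and> aff_dim F = int l}"
  proof (intro equalityI subsetI)
    fix F assume F: "F \<in> {F. F face_of coords ` P \<and> aff_dim F = int l}"
    have "F = coords ` (coords -` F)" by (simp add: surj_coords)
    moreover from F have "coords ` (coords -` F) face_of coords ` P" "aff_dim (coords ` (coords -` F)) = int l"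
      by (simp_all add: surj_coords)
    ultimately show "F \<in> (\<lambda>F. coords ` F) ` {F. F face_of P \<and> aff_dim F = int l}"
      unfolding face_of_linear_image[OF linear_coords inj_coords] aff_dim_injective_linear_image[OF linear_coords inj_coords]
      by blast
  next
    fix F assume "F \<in> (\<lambda>F. coords ` F) ` {F. F face_of P \<and> aff_dim F = int l}"
    then show "F \<in> {F. F face_of coords ` P \<and> aff_dim F = int l}"
      by (auto simp: face_of_linear_image[OF linear_coords inj_coords] aff_dim_injective_linear_image[OF linear_coords inj_coords])
  qed
  moreover have "inj_on (\<lambda>F. coords ` F) A" for A :: "'a set set" by (simp add: inj_on_def inj_image_eq_iff[OF inj_coords])
  ultimately show ?thesis
    unfolding num_faces_def by (simp add: card_image)
qed

text \<open>The linear isometry \<open>coords\<close> carries the process, its zero cell and the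
  faces to \<open>real^'a basis_index\<close>, where \<open>expected_faces_formula\<close>
  applies.\<close>

theorem theorem2p3:
  fixes M :: "'w measure" and \<Phi> :: "'w \<Rightarrow> 'a::euclidean_space set"
    and \<gamma> :: real and l :: nat
  assumes "\<gamma> > 0"
    and "poisson_process M \<Phi> (hyp_intensity \<gamma>)"
    and "l \<le> DIM('a)" and "even (DIM('a) - l)"
  shows "(\<integral>\<^sup>+ \<omega>. ennreal (real (num_faces l (zero_cell (\<Phi> \<omega>)))) \<partial>M)
         = ennreal (pi ^ (DIM('a) - l) * real (DIM('a) choose l) *
             fps_nth ((fps_X / fps_sin (1::real)) ^ (DIM('a) + 1)) (DIM('a) - l))"
proof -
  interpret poisson_points M "\<lambda>\<omega>. coords ` \<Phi> \<omega>" "hyp_intensity \<gamma>"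
    by (intro poisson_points_hyp_intensity poisson_process_coords assms)
  interpret isotropic_process M "\<lambda>\<omega>. coords ` \<Phi> \<omega>" \<gamma>
    by unfold_locales (rule assms)
  show ?thesis
    using expected_faces_formula[of l] assms(3,4)
    by (simp only: expected_faces_def zero_cell_coords num_faces_coords CARD_basis_index)
qed

end
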